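(* Let $C$ be the modular tensor category of a $2+1$D TQFT, and suppose there is a gauge in which the $F$ and $R$ symbols of $C$ belong to a CM field. Then for every $q\in\mathrm{Gal}(K_C)$, $C$ and its Galois conjugate $q(C)$ have isomorphic unitary and anti-unitary 0-form symmetries.
   Context: A modular tensor category (MTC) $C$ (simple objects $a,b,\dots$ called anyons, unit $\mathbf 1$, fusion rules $a\otimes b=\sum_c N_{ab}^c c$) is described, after choosing bases $|a,b,c;\mu\rangle$ of the fusion spaces $V_{ab}^c$ (such a choice is called a gauge), by its $F$ symbols $(F_{abc}^d)_{(e,\alpha,\beta)}^{(f,\mu,\nu)}$ ($e\in a\otimes b$, $f\in b\otimes c$), $R$ symbols $(R_{ab}^c)_{\mu\nu}$ and pivotal coefficients $\epsilon_a\in\{\pm1\}$. There is always a gauge in which all entries of $F$ and $R$ lie in a number field; $K_C$ is the normal closure over $\mathbb{Q}$ of $\mathbb{Q}(F,R)$. For $q\in\mathrm{Gal}(K_C):=\mathrm{Gal}(K_C/\mathbb{Q})$, $q(C)$ is the MTC with the same anyons, fusion rules and $\epsilon_a$, and with data $q(F),q(R)$. A CM field is a totally imaginary quadratic extension of a totally real number field. 0-form symmetries: a symmetry $g$ of $C$ is declared unitary or anti-unitary and consists of a permutation $a\mapsto g(a)$ of the anyons preserving fusion rules together with unitary matrices $U_g(a,b,c)$ acting on fusion spaces by $g|a,b,c;\mu\rangle=\sum_{\mu'}U_g(g(a),g(b),g(c))_{\mu\mu'}K^g|g(a),g(b),g(c);\mu'\rangle$, where $K^g x K^g:=x$ if $g$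 is unitary and $K^gxK^g:=\bar x$ (complex conjugate) if $g$ is anti-unitary, such that $$\sum_{\mu',\nu'}[U_g(g(b),g(a),g(c))]_{\mu\mu'}(R^{g(c)}_{g(a)g(b)})_{\mu'\nu'}[U_g(g(a),g(b),g(c))^{-1}]_{\nu'\nu}=K^g(R_{ab}^c)_{\mu\nu}K^g,$$ $$\sum_{\alpha',\beta',\mu',\nu'}[U_g(g(a),g(b),g(e))]_{\alpha\alpha'}[U_g(g(e),g(c),g(d))]_{\beta\beta'}(F^{g(d)}_{g(a)g(b)g(c)})^{(g(f),\mu',\nu')}_{(g(e),\alpha',\beta')}[U_g(g(b),g(c),g(f))^{-1}]_{\mu'\mu}[U_g(g(a),g(f),g(d))^{-1}]_{\nu'\nu}=K^g(F^d_{abc})^{(f,\mu,\nu)}_{(e,\alpha,\beta)}K^g.$$ In particular gauge-invariant data such as the modular $S$ matrix and twists are preserved up to the complex conjugation by $K^g$. A natural isomorphism is a map fixing all anyons and acting as $|a,b,c;\mu\rangle\mapsto\frac{\gamma_a\gamma_b}{\gamma_c}|a,b,c;\mu\rangle$ for some phases $\gamma_a$. The 0-form symmetry group $G$ of the theory is the group of all such (unitary and anti-unitary) maps $g$ modulo natural isomorphisms; "isomorphic 0-form symmetries" refers to these groups, including which elements are unitary or anti-unitary. *)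

theory Defs
  imports
    "HOL-Algebra.Algebraic_Closure_Type"
    "HOL-Algebra.Generated_Fields"
    "HOL-Algebra.Embedded_Algebras"
    "Jordan_Normal_Form.Schur_Decomposition"
    "Jordan_Normal_Form.Gauss_Jordan_Elimination"
begin

section \<open>Subfields of the complex numbers\<close>

abbreviation CC :: "complex ring" where
  "CC \<equiv> ring_of_type_algebra"

abbreviation CC_on :: "complex set \<Rightarrow> complex ring" where
  "CC_on K \<equiv> CC\<lparr>carrier := K\<rparr>"

definition number_field :: "complex set \<Rightarrow> bool" where
  "number_field K \<longleftrightarrow> subfield K CC \<and> (\<exists>n. ring.dimension CC n \<rat> K)"

definition embeddings :: "complex set \<Rightarrow> (complex \<Rightarrow> complex) set" where
  "embeddings K = Ring.ring_hom (CC_on K) CC"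

definition totally_real :: "complex set \<Rightarrow> bool" where
  "totally_real K \<longleftrightarrow> number_field K \<and> (\<forall>\<sigma>\<in>embeddings K. \<sigma> ` K \<subseteq> \<real>)"

definition totally_imaginary :: "complex set \<Rightarrow> bool" where
  "totally_imaginary K \<longleftrightarrow> number_field K \<and> (\<forall>\<sigma>\<in>embeddings K. \<not> \<sigma> ` K \<subseteq> \<real>)"

definition CM_field :: "complex set \<Rightarrow> bool" where
  "CM_field K \<longleftrightarrow> totally_imaginary K \<and>
     (\<exists>K\<^sub>0. totally_real K\<^sub>0 \<and> K\<^sub>0 \<subseteq> K \<and> ring.dimension CC 2 K\<^sub>0 K)"

definition normal_over_rat :: "complex set \<Rightarrow> bool" where
  "normal_over_rat K \<longleftrightarrow> subfield K CC \<and> (\<forall>x\<in>K. algebraic x) \<and>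
     (\<forall>p :: rat poly. irreducible p \<longrightarrow>
        (\<exists>x\<in>K. poly (map_poly of_rat p) x = 0) \<longrightarrow>
        {x. poly (map_poly of_rat p) x = 0} \<subseteq> K)"

definition normal_closure_rat :: "complex set \<Rightarrow> complex set" where
  "normal_closure_rat L = \<Inter> {K. normal_over_rat K \<and> L \<subseteq> K}"

text \<open>Only the values of an automorphism on \<open>K\<close> matter; it is arbitrary outside \<open>K\<close>.\<close>

definition Gal_rat :: "complex set \<Rightarrow> (complex \<Rightarrow> complex) set" where
  "Gal_rat K = {q \<in> ring_iso (CC_on K) (CC_on K). \<forall>x\<in>\<rat>. q x = x}"


section \<open>Modular tensor categories in a fixed gauge\<close>

text \<open>
  The simple objects are the elements of the finite type \<open>'a\<close>, and
  \<open>fus C a b c\<close> is \<open>N\<^sub>a\<^sub>b\<^sup>c\<close>. The basis vectors of \<open>V\<^sub>a\<^sub>b\<^sup>c\<close> (a basis of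
  \<open>Hom (a \<otimes> b) c\<close>) are numbered \<open>0, \<dots>, N\<^sub>a\<^sub>b\<^sup>c - 1\<close>.

  \<open>Fsym C a b c d (e, \<alpha>, \<beta>) (f, \<mu>, \<nu>)\<close> is the entry of \<open>F\<^sub>a\<^sub>b\<^sub>c\<^sup>d\<close> with lower index
  \<open>(e, \<alpha>, \<beta>)\<close> and upper index \<open>(f, \<mu>, \<nu>)\<close>, where \<open>\<alpha>\<close>, \<open>\<beta>\<close>, \<open>\<mu>\<close>, \<open>\<nu>\<close> number the bases of
  \<open>V\<^sub>a\<^sub>b\<^sup>e\<close>, \<open>V\<^sub>e\<^sub>c\<^sup>d\<close>, \<open>V\<^sub>b\<^sub>c\<^sup>f\<close>, \<open>V\<^sub>a\<^sub>f\<^sup>d\<close> respectively; only entries within these ranges are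
  meaningful. It expresses the basis of \<open>Hom ((a \<otimes> b) \<otimes> c) d\<close> through \<open>e\<close> in terms of
  that of \<open>Hom (a \<otimes> (b \<otimes> c)) d\<close> through \<open>f\<close>.

  \<open>Rsym C a b c\<close> is the matrix \<open>R\<^sub>a\<^sub>b\<^sup>c\<close>; its rows are indexed by the basis of \<open>V\<^sub>b\<^sub>a\<^sup>c\<close> and its
  columns by the basis of \<open>V\<^sub>a\<^sub>b\<^sup>c\<close>.
\<close>

record 'a mtc =
  unit_obj :: 'a
  fus :: "'a \<Rightarrow> 'a \<Rightarrow> 'a \<Rightarrow> nat"
  Fsym :: "'a \<Rightarrow> 'a \<Rightarrow> 'a \<Rightarrow> 'a \<Rightarrow> 'a \<times> nat \<times> nat \<Rightarrow> 'a \<times> nat \<times> nat \<Rightarrow> complex"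
  Rsym :: "'a \<Rightarrow> 'a \<Rightarrow> 'a \<Rightarrow> complex mat"
  piv :: "'a \<Rightarrow> int"

definition dual :: "'a mtc \<Rightarrow> 'a \<Rightarrow> 'a" where
  "dual C a = (THE b. fus C a b (unit_obj C) \<noteq> 0)"

definition left_ix :: "'a mtc \<Rightarrow> 'a \<Rightarrow> 'a \<Rightarrow> 'a \<Rightarrow> 'a \<Rightarrow> ('a \<times> nat \<times> nat) set" where
  "left_ix C a b c d = {(e, \<alpha>, \<beta>). \<alpha> < fus C a b e \<and> \<beta> < fus C e c d}"

definition right_ix :: "'a mtc \<Rightarrow> 'a \<Rightarrow> 'a \<Rightarrow> 'a \<Rightarrow> 'a \<Rightarrow> ('a \<times> nat \<times> nat) set" where
  "right_ix C a b c d = {(f, \<mu>, \<nu>). \<mu> < fus C b c f \<and> \<nu> < fus C a f d}"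

definition minv :: "complex mat \<Rightarrow> complex mat" where
  "minv A = the (mat_inverse A)"

definition fusion_rules :: "'a::finite mtc \<Rightarrow> bool" where
  "fusion_rules C \<longleftrightarrow>
     (\<forall>a b. fus C (unit_obj C) a b = (if a = b then 1 else 0)) \<and>
     (\<forall>a b. fus C a (unit_obj C) b = (if a = b then 1 else 0)) \<and>
     (\<forall>a b c. fus C a b c = fus C b a c) \<and>
     (\<forall>a b c d. (\<Sum>e\<in>UNIV. fus C a b e * fus C e c d) = (\<Sum>f\<in>UNIV. fus C b c f * fus C a f d)) \<and>
     (\<forall>a. \<exists>!b. fus C a b (unit_obj C) \<noteq> 0) \<and>
     (\<forall>a. fus C a (dual C a) (unit_obj C) = 1)"

definition F_invertible :: "'a::finite mtc \<Rightarrow> bool" where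
  "F_invertible C \<longleftrightarrow> (\<forall>a b c d. \<exists>G.
     (\<forall>i\<in>left_ix C a b c d. \<forall>j\<in>left_ix C a b c d.
        (\<Sum>k\<in>right_ix C a b c d. Fsym C a b c d i k * G k j) = (if i = j then 1 else 0)) \<and>
     (\<forall>k\<in>right_ix C a b c d. \<forall>l\<in>right_ix C a b c d.
        (\<Sum>i\<in>left_ix C a b c d. G k i * Fsym C a b c d i l) = (if k = l then 1 else 0)))"

definition pentagon :: "'a::finite mtc \<Rightarrow> bool" where
  "pentagon C \<longleftrightarrow> (\<forall>a b c d e f g k l \<alpha> \<beta> \<gamma> \<delta> \<tau> \<mu>.
     \<alpha> < fus C a b f \<longrightarrow> \<beta> < fus C f c g \<longrightarrow> \<gamma> < fus C g d e \<longrightarrow>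
     \<delta> < fus C c d l \<longrightarrow> \<tau> < fus C b l k \<longrightarrow> \<mu> < fus C a k e \<longrightarrow>
     (\<Sum>\<nu> < fus C f l e.
        Fsym C f c d e (g, \<beta>, \<gamma>) (l, \<delta>, \<nu>) * Fsym C a b l e (f, \<alpha>, \<nu>) (k, \<tau>, \<mu>)) =
     (\<Sum>h\<in>UNIV. \<Sum>\<sigma> < fus C b c h. \<Sum>\<psi> < fus C a h g. \<Sum>\<rho> < fus C h d k.
        Fsym C a b c g (f, \<alpha>, \<beta>) (h, \<sigma>, \<psi>) * Fsym C a h d e (g, \<psi>, \<gamma>) (k, \<rho>, \<mu>) *
        Fsym C b c d k (h, \<sigma>, \<rho>) (l, \<delta>, \<tau>)))"

text \<open>
  The spaces \<open>V\<^sub>1\<^sub>a\<^sup>a\<close> and \<open>V\<^sub>a\<^sub>1\<^sup>a\<close> are one-dimensional, so the left and right unit constraints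
  are nonzero multiples \<open>l a\<close> and \<open>r a\<close> of their basis vectors. The gauge need not be normalized
  to \<open>l = r = 1\<close>. The condition below is the triangle axiom.
\<close>

definition unit_constraints :: "'a::finite mtc \<Rightarrow> ('a \<Rightarrow> complex) \<Rightarrow> ('a \<Rightarrow> complex) \<Rightarrow> bool" where
  "unit_constraints C l r \<longleftrightarrow>
     (\<forall>a. l a \<noteq> 0 \<and> r a \<noteq> 0) \<and>
     (\<forall>a c d. \<forall>\<beta> < fus C a c d. \<forall>\<nu> < fus C a c d.
        r a * Fsym C a (unit_obj C) c d (a, 0, \<beta>) (c, 0, \<nu>) = (if \<beta> = \<nu> then l c else 0))"

text \<open>
  The composite \<open>a \<rightarrow> (a \<otimes> a*) \<otimes> a \<rightarrow> a \<otimes> (a* \<otimes> a) \<rightarrow> a\<close> (and its mirror image) of the zigzag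
  identities is, up to nonzero factors, the entry of \<open>F\<close> (of its inverse) in the unit channel.
\<close>

definition rigid :: "'a::finite mtc \<Rightarrow> bool" where
  "rigid C \<longleftrightarrow> (\<forall>a.
     Fsym C a (dual C a) a a (unit_obj C, 0, 0) (unit_obj C, 0, 0) \<noteq> 0)"

definition braided :: "'a::finite mtc \<Rightarrow> bool" where
  "braided C \<longleftrightarrow>
     (\<forall>a b c. Rsym C a b c \<in> carrier_mat (fus C b a c) (fus C a b c) \<and> invertible_mat (Rsym C a b c)) \<and>
     (\<forall>a b c d e g \<alpha> \<beta> \<mu> \<nu>.
        \<alpha> < fus C c a e \<longrightarrow> \<beta> < fus C e b d \<longrightarrow> \<mu> < fus C b c g \<longrightarrow> \<nu> < fus C a g d \<longrightarrow>
        (\<Sum>\<tau> < fus C a c e. \<Sum>\<gamma> < fus C c b g.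
           Rsym C a c e $$ (\<alpha>, \<tau>) * Fsym C a c b d (e, \<tau>, \<beta>) (g, \<gamma>, \<nu>) * Rsym C b c g $$ (\<gamma>, \<mu>)) =
        (\<Sum>f\<in>UNIV. \<Sum>\<delta> < fus C a b f. \<Sum>\<sigma> < fus C c f d. \<Sum>\<psi> < fus C f c d.
           Fsym C c a b d (e, \<alpha>, \<beta>) (f, \<delta>, \<sigma>) * Rsym C f c d $$ (\<sigma>, \<psi>) *
           Fsym C a b c d (f, \<delta>, \<psi>) (g, \<mu>, \<nu>))) \<and>
     (\<forall>a b c d e g \<alpha> \<beta> \<mu> \<nu>.
        \<alpha> < fus C c a e \<longrightarrow> \<beta> < fus C e b d \<longrightarrow> \<mu> < fus C b c g \<longrightarrow> \<nu> < fus C a g d \<longrightarrow>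
        (\<Sum>\<tau> < fus C a c e. \<Sum>\<gamma> < fus C c b g.
           minv (Rsym C c a e) $$ (\<alpha>, \<tau>) * Fsym C a c b d (e, \<tau>, \<beta>) (g, \<gamma>, \<nu>) *
           minv (Rsym C c b g) $$ (\<gamma>, \<mu>)) =
        (\<Sum>f\<in>UNIV. \<Sum>\<delta> < fus C a b f. \<Sum>\<sigma> < fus C c f d. \<Sum>\<psi> < fus C f c d.
           Fsym C c a b d (e, \<alpha>, \<beta>) (f, \<delta>, \<sigma>) * minv (Rsym C c f d) $$ (\<sigma>, \<psi>) *
           Fsym C a b c d (f, \<delta>, \<psi>) (g, \<mu>, \<nu>)))"

text \<open>
  Monoidality of the pivotal structure in terms of the pivotal coefficients: on the space of
  morphisms \<open>a \<otimes> b \<otimes> c \<rightarrow> 1\<close> the product of the three \<open>F\<close> moves that rotate the legs once around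
  is the scalar \<open>\<epsilon>\<^sub>a \<epsilon>\<^sub>b \<epsilon>\<^sub>c\<close>.
\<close>

definition pivotal :: "'a::finite mtc \<Rightarrow> bool" where
  "pivotal C \<longleftrightarrow>
     (\<forall>a. piv C a \<in> {1, -1}) \<and> piv C (unit_obj C) = 1 \<and>
     (\<forall>a b c. let u = unit_obj C; a' = dual C a; b' = dual C b; c' = dual C c in
        \<forall>\<alpha> < fus C a b c'. \<forall>\<alpha>' < fus C a b c'.
          (\<Sum>\<mu> < fus C b c a'. \<Sum>\<kappa> < fus C c a b'.
             Fsym C a b c u (c', \<alpha>, 0) (a', \<mu>, 0) * Fsym C b c a u (a', \<mu>, 0) (b', \<kappa>, 0) *
             Fsym C c a b u (b', \<kappa>, 0) (c', \<alpha>', 0)) =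
          (if \<alpha> = \<alpha>' then of_int (piv C a * piv C b * piv C c) else 0))"

text \<open>
  Let \<open>v\<close> be the basis vector of the maps \<open>a \<otimes> a* \<rightarrow> 1\<close>, and let \<open>coev : 1 \<rightarrow> a \<otimes> a*\<close> be
  normalized by \<open>v \<circ> coev = id\<close>. The evaluation \<open>a* \<otimes> a \<rightarrow> 1\<close> belonging to \<open>coev\<close> by the zigzag
  identities is \<open>s\<close> times the basis vector, with \<open>s = r (a*) / (l (a*) F)\<close> for the
  entry \<open>F\<close> used below, and the evaluation \<open>a \<otimes> a* \<rightarrow> 1\<close> given by the pivotal structure is
  \<open>\<epsilon>\<^sub>a s v\<close>. Its composite with \<open>coev\<close> is the quantum dimension of \<open>a\<close>.
\<close>

definition qdim :: "'a::finite mtc \<Rightarrow> ('a \<Rightarrow> complex) \<Rightarrow> ('a \<Rightarrow> complex) \<Rightarrow> 'a \<Rightarrow> complex" where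
  "qdim C l r a = (let u = unit_obj C; a' = dual C a in
     of_int (piv C a) * r a' / (l a' * Fsym C a' a a' a' (u, 0, 0) (u, 0, 0)))"

definition spherical :: "'a::finite mtc \<Rightarrow> ('a \<Rightarrow> complex) \<Rightarrow> ('a \<Rightarrow> complex) \<Rightarrow> bool" where
  "spherical C l r \<longleftrightarrow> (\<forall>a. qdim C l r (dual C a) = qdim C l r a)"

text \<open>The unnormalized \<open>S\<close> matrix: the quantum trace of the double braiding of \<open>a\<close> and \<open>b\<close>.\<close>

definition Smat :: "'a::finite mtc \<Rightarrow> ('a \<Rightarrow> complex) \<Rightarrow> ('a \<Rightarrow> complex) \<Rightarrow> 'a \<Rightarrow> 'a \<Rightarrow> complex" where
  "Smat C l r a b = (\<Sum>c\<in>UNIV. qdim C l r c *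
     (\<Sum>\<mu> < fus C b a c. \<Sum>\<nu> < fus C a b c. Rsym C a b c $$ (\<mu>, \<nu>) * Rsym C b a c $$ (\<nu>, \<mu>)))"

definition S_nondegenerate :: "'a::finite mtc \<Rightarrow> ('a \<Rightarrow> complex) \<Rightarrow> ('a \<Rightarrow> complex) \<Rightarrow> bool" where
  "S_nondegenerate C l r \<longleftrightarrow> (\<exists>T. \<forall>a c.
     (\<Sum>b\<in>UNIV. Smat C l r a b * T b c) = (if a = c then 1 else 0) \<and>
     (\<Sum>b\<in>UNIV. T a b * Smat C l r b c) = (if a = c then 1 else 0))"

definition modular_tensor_category :: "'a::finite mtc \<Rightarrow> bool" where
  "modular_tensor_category C \<longleftrightarrow>
     fusion_rules C \<and> F_invertible C \<and> pentagon C \<and> rigid C \<and> braided C \<and> pivotal C \<and>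
     (\<exists>l r. unit_constraints C l r \<and> spherical C l r \<and> S_nondegenerate C l r)"


section \<open>Galois conjugation\<close>

definition FR_entries :: "'a mtc \<Rightarrow> complex set" where
  "FR_entries C =
     {Fsym C a b c d i k | a b c d i k. i \<in> left_ix C a b c d \<and> k \<in> right_ix C a b c d} \<union>
     {Rsym C a b c $$ (\<mu>, \<nu>) | a b c \<mu> \<nu>. \<mu> < fus C b a c \<and> \<nu> < fus C a b c}"

definition K_of :: "'a mtc \<Rightarrow> complex set" where
  "K_of C = normal_closure_rat (generate_field CC (FR_entries C))"

definition galois_conj :: "(complex \<Rightarrow> complex) \<Rightarrow> 'a mtc \<Rightarrow> 'a mtc" where
  "galois_conj q C = C\<lparr>
     Fsym := (\<lambda>a b c d i k. q (Fsym C a b c d i k)),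
     Rsym := (\<lambda>a b c. map_mat q (Rsym C a b c))\<rparr>"


section \<open>Unitary and anti-unitary 0-form symmetries\<close>

record 'a sym =
  anti :: bool
  perm :: "'a \<Rightarrow> 'a"
  Umat :: "'a \<Rightarrow> 'a \<Rightarrow> 'a \<Rightarrow> complex mat"

definition Kconj :: "bool \<Rightarrow> complex \<Rightarrow> complex" where
  "Kconj t x = (if t then cnj x else x)"

definition unitary_mat :: "nat \<Rightarrow> complex mat \<Rightarrow> bool" where
  "unitary_mat n U \<longleftrightarrow> U \<in> carrier_mat n n \<and>
     U * mat_adjoint U = 1\<^sub>m n \<and> mat_adjoint U * U = 1\<^sub>m n"

definition is_symmetry :: "'a::finite mtc \<Rightarrow> 'a sym \<Rightarrow> bool" where
  "is_symmetry C s \<longleftrightarrow> (let g = perm s; U = Umat s; N = fus C; F = Fsym C; R = Rsym C in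
     bij g \<and>
     (\<forall>a b c. N (g a) (g b) (g c) = N a b c) \<and>
     (\<forall>a b c. unitary_mat (N a b c) (U a b c)) \<and>
     (\<forall>a b c. \<forall>\<mu> < N b a c. \<forall>\<nu> < N a b c.
        (\<Sum>\<mu>' < N b a c. \<Sum>\<nu>' < N a b c.
           U (g b) (g a) (g c) $$ (\<mu>, \<mu>') * R (g a) (g b) (g c) $$ (\<mu>', \<nu>') *
           minv (U (g a) (g b) (g c)) $$ (\<nu>', \<nu>)) =
        Kconj (anti s) (R a b c $$ (\<mu>, \<nu>))) \<and>
     (\<forall>a b c d e f \<alpha> \<beta> \<mu> \<nu>.
        \<alpha> < N a b e \<longrightarrow> \<beta> < N e c d \<longrightarrow> \<mu> < N b c f \<longrightarrow> \<nu> < N a f d \<longrightarrow>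
        (\<Sum>\<alpha>' < N a b e. \<Sum>\<beta>' < N e c d. \<Sum>\<mu>' < N b c f. \<Sum>\<nu>' < N a f d.
           U (g a) (g b) (g e) $$ (\<alpha>, \<alpha>') * U (g e) (g c) (g d) $$ (\<beta>, \<beta>') *
           F (g a) (g b) (g c) (g d) (g e, \<alpha>', \<beta>') (g f, \<mu>', \<nu>') *
           minv (U (g b) (g c) (g f)) $$ (\<mu>', \<mu>) * minv (U (g a) (g f) (g d)) $$ (\<nu>', \<nu>)) =
        Kconj (anti s) (F a b c d (e, \<alpha>, \<beta>) (f, \<mu>, \<nu>))))"

text \<open>
  The product is composition of the maps on fusion spaces. Applying first \<open>t\<close> and then \<open>s\<close> to
  \<open>|a, b, c; \<mu>\<rangle>\<close> conjugates the coefficients of \<open>t\<close> by the \<open>K\<close> of \<open>s\<close>, and coefficients act on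
  basis vectors from the left; hence the factor of \<open>t\<close> stands first and is taken at the
  preimages under \<open>perm s\<close>.
\<close>

definition sym_comp :: "'a sym \<Rightarrow> 'a sym \<Rightarrow> 'a sym" where
  "sym_comp s t = \<lparr>
     anti = (anti s \<noteq> anti t),
     perm = perm s \<circ> perm t,
     Umat = (\<lambda>x y z. let h = inv_into UNIV (perm s) in
       map_mat (Kconj (anti s)) (Umat t (h x) (h y) (h z)) * Umat s x y z)\<rparr>"

definition sym_maps :: "'a::finite mtc \<Rightarrow> 'a sym monoid" where
  "sym_maps C = \<lparr>
     carrier = {s. is_symmetry C s},
     monoid.mult = sym_comp,
     one = \<lparr>anti = False, perm = id, Umat = (\<lambda>a b c. 1\<^sub>m (fus C a b c))\<rparr>\<rparr>"

definition natural_isos :: "'a::finite mtc \<Rightarrow> 'a sym set" where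
  "natural_isos C = {\<lparr>anti = False, perm = id,
       Umat = (\<lambda>a b c. (\<gamma> a * \<gamma> b / \<gamma> c) \<cdot>\<^sub>m 1\<^sub>m (fus C a b c))\<rparr> | \<gamma>. \<forall>a. cmod (\<gamma> a) = 1}"

definition symmetry_group :: "'a::finite mtc \<Rightarrow> 'a sym set monoid" where
  "symmetry_group C = sym_maps C Mod natural_isos C"

text \<open>
  All representatives of an element of the symmetry group are unitary, or all are anti-unitary.
\<close>

definition isomorphic_symmetries :: "'a::finite mtc \<Rightarrow> 'a mtc \<Rightarrow> bool" where
  "isomorphic_symmetries C D \<longleftrightarrow> (\<exists>\<phi> \<in> iso (symmetry_group C) (symmetry_group D).
     \<forall>A \<in> carrier (symmetry_group C). \<forall>s\<in>A. \<forall>t\<in>\<phi> A. anti t = anti s)"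

end

theory Submission
  imports Defs
begin

text \<open>
  A Galois automorphism \<open>q\<close> extends to a field automorphism \<open>h\<close> of the complex numbers. As the data
  lie in a CM field, \<open>h\<close> commutes with complex conjugation on all entries of \<open>F\<close> and \<open>R\<close>. If \<open>U\<close>
  belongs to a symmetry of \<open>C\<close>, the matrices \<open>h U\<close> therefore solve the symmetry equations of \<open>q C\<close>.
  They need not be unitary, because \<open>U\<close> itself may lie outside of the CM field; but \<open>cnj \<circ> h \<circ> cnj\<close>
  acts on the entries of \<open>F\<close> and \<open>R\<close> in the same way as \<open>h\<close>, so the inverse adjoint of \<open>h U\<close>
  solves the same equations. Hence the positive matrices \<open>(h U)* (h U)\<close> define an automorphism of the
  monoidal structure of \<open>q C\<close>. The eigenvalues of such a family can be replaced by their logarithms,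
  which turns it into a derivation of \<open>F\<close>, and by Ocneanu rigidity (averaging with the quantum
  dimensions) derivations are coboundaries. So \<open>(h U)* (h U)\<close> is a positive natural isomorphism, and
  dividing \<open>h U\<close> by its square root yields a unitary symmetry of \<open>q C\<close>, well-defined up to
  natural isomorphisms.
\<close>

section \<open>Ocneanu rigidity\<close>

text \<open>Natural isomorphisms multiply \<open>U\<close> by arbitrary phases; this is why
  \<open>U\<close> may leave every number field and why \<open>q\<close> has to act on all complex
  numbers. The extended automorphism respects conjugation on the data, but in general not elsewhere.
  Rigidity is needed for \<open>q C\<close>, where positivity is lost: Galois conjugation can make
  quantum dimensions negative. Hence the locale \<open>fusion_system\<close> lists only identities
  and nonvanishing conditions that survive \<open>q\<close>, and the global dimension is shown to be
  nonzero because the dimensions form a character of the fusion ring with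
  \<open>w (dl a) = cnj (w a)\<close>. The scalars split off from \<open>h U\<close> need not be
  phases, and \<open>h\<close> does not preserve moduli; lifts are therefore compared through the
  relation \<open>conj_rel\<close>, which allows any nonzero scalars, and two unitary
  representatives then turn out to differ by phases. The relation can be turned around with the
  inverse of \<open>h\<close>, which yields surjectivity.\<close>

lemma sum_if_const: "(\<Sum>x\<in>A. if P then f x else 0) = (if P then sum f A else (0::'b::comm_monoid_add))"
  by simp

lemma sum_rotate3: "(\<Sum>a\<in>A. \<Sum>b\<in>B. \<Sum>c\<in>C. f a b c) = (\<Sum>b\<in>B. \<Sum>c\<in>C. \<Sum>a\<in>A. f a b c)"
  by (subst sum.swap, rule sum.cong[OF refl], rule sum.swap)

lemma sum_rotate4: "(\<Sum>a\<in>A. \<Sum>b\<in>B. \<Sum>c\<in>C. \<Sum>d\<in>D. f a b c d) = (\<Sum>b\<in>B. \<Sum>c\<in>C. \<Sum>d\<in>D. \<Sum>a\<in>A. f a b c d)"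
  by (subst sum.swap, rule sum.cong[OF refl], rule sum_rotate3)

lemma if_times: "(if P then x else 0) * y = (if P then x * y else (0::'b::mult_zero))"
  by simp

lemma times_if: "y * (if P then x else 0) = (if P then y * x else (0::'b::mult_zero))"
  by simp

lemma if_conj: "(if P \<and> Q then x else y) = (if P then if Q then x else y else y)"
  by simp

lemmas delta_simps = sum_if_const if_times times_if

text \<open>Padded with zeros to square size, a one-sided inverse becomes two-sided. For
  \<open>n < m\<close> this would put a 1 at position \<open>(n,n)\<close> of the product, although
  row \<open>n\<close> of \<open>A'\<close> vanishes. Equalities of fusion multiplicities are
  obtained in this way.\<close>

lemma matrix_left_inverse:
  fixes A A' :: "nat \<Rightarrow> nat \<Rightarrow> complex"
  assumes fin: "finite J" "{..<m} \<subseteq> J" "{..<n} \<subseteq> J"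
    and A: "\<And>i k. A i k \<noteq> 0 \<Longrightarrow> i < m \<and> k < n"
    and A': "\<And>k i. A' k i \<noteq> 0 \<Longrightarrow> k < n \<and> i < m"
    and inv: "\<And>i j. i < m \<Longrightarrow> j < m \<Longrightarrow> (\<Sum>k\<in>J. A i k * A' k j) = (if i = j then 1 else 0)"
  shows "m \<le> n" "m = n \<Longrightarrow> (\<Sum>i\<in>J. A' k i * A i l) = (if k = l \<and> k < n then 1 else 0)"
proof -
  define P where "P = mat m (max m n) (\<lambda>(i,j). A i j)"
  define Q where "Q = mat (max m n) m (\<lambda>(i,j). A' i j)"
  have *: "(\<Sum>i\<in>{..<m}. A' k i * A i l) = (if k = l then 1 else 0)" if "k < m" "l < m" "n \<le> m" for k l
  proof -
    have mx: "max m n = m" using that by simp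
    have c: "P \<in> carrier_mat m m" "Q \<in> carrier_mat m m" by (simp_all add: P_def Q_def mx)
    have "(\<Sum>k\<in>J. A i k * A' k j) = (\<Sum>k\<in>{0..<m}. A i k * A' k j)" for i j
    proof (rule sum.mono_neutral_right)
      show "\<forall>k\<in>J - {0..<m}. A i k * A' k j = 0" using A that by force
    qed (use fin in \<open>auto simp: atLeast0LessThan\<close>)
    then have "P * Q = 1\<^sub>m m"
      using inv by (intro eq_matI) (auto simp: P_def Q_def mx scalar_prod_def)
    from mat_mult_left_right_inverse[OF c this] have "(Q * P) $$ (k,l) = 1\<^sub>m m $$ (k,l)" by simp
    then show ?thesis using that by (simp add: P_def Q_def mx scalar_prod_def atLeast0LessThan)
  qed
  show le: "m \<le> n"
  proof (rule ccontr)
    assume "\<not> m \<le> n"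
    moreover have "(\<Sum>i\<in>{..<m}. A' n i * A i n) = 0"
      using A'[of n] by (intro sum.neutral) auto
    ultimately show False using *[of n n] by simp
  qed
  assume mn: "m = n"
  have "(\<Sum>i\<in>J. A' k i * A i l) = (\<Sum>i\<in>{..<m}. A' k i * A i l)"
    using fin A by (intro sum.mono_neutral_right) auto
  also have "\<dots> = (if k = l \<and> k < n then 1 else 0)"
  proof (cases "k < n \<and> l < n")
    case True then show ?thesis using * mn by simp
  next
    case False
    then have "A' k i * A i l = 0" for i using A[of i l] A'[of k i] by auto
    then have "(\<Sum>i\<in>{..<m}. A' k i * A i l) = 0" by (intro sum.neutral) auto
    then show ?thesis using False by auto
  qed
  finally show "(\<Sum>i\<in>J. A' k i * A i l) = (if k = l \<and> k < n then 1 else 0)" .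
qed

text \<open>
  \<open>F\<close> in a gauge with trivial unit constraints and its inverse \<open>G\<close>, both extended by \<open>0\<close>. The set
  \<open>J\<close> contains all multiplicity labels, so that sums over fusion spaces have a range
  independent of the anyons.
\<close>

locale fusion_system =
  fixes u :: "'a::finite" and dl :: "'a \<Rightarrow> 'a" and N :: "'a \<Rightarrow> 'a \<Rightarrow> 'a \<Rightarrow> nat"
    and F G :: "'a \<Rightarrow> 'a \<Rightarrow> 'a \<Rightarrow> 'a \<Rightarrow> 'a \<times> nat \<times> nat \<Rightarrow> 'a \<times> nat \<times> nat \<Rightarrow> complex"
    and J :: "nat set" and ep :: "'a \<Rightarrow> complex"
  assumes finJ: "finite J" and J_range: "\<And>a b c i. i < N a b c \<Longrightarrow> i \<in> J"
    and N_unit1: "\<And>a b. N u a b = (if a = b then 1 else 0)"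
    and N_unit2: "\<And>a b. N a u b = (if a = b then 1 else 0)"
    and N_dual: "\<And>a b. N a b u = (if b = dl a then 1 else 0)"
    and dl_dl: "\<And>a. dl (dl a) = a"
    and F_supp: "\<And>a b c d e \<alpha> \<beta> f \<mu> \<nu>. F a b c d (e,\<alpha>,\<beta>) (f,\<mu>,\<nu>) \<noteq> 0 \<Longrightarrow>
       \<alpha> < N a b e \<and> \<beta> < N e c d \<and> \<mu> < N b c f \<and> \<nu> < N a f d"
    and G_supp: "\<And>a b c d e \<alpha> \<beta> f \<mu> \<nu>. G a b c d (f,\<mu>,\<nu>) (e,\<alpha>,\<beta>) \<noteq> 0 \<Longrightarrow>
       \<alpha> < N a b e \<and> \<beta> < N e c d \<and> \<mu> < N b c f \<and> \<nu> < N a f d"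
    and FG: "\<And>a b c d e \<alpha> \<beta> e' \<alpha>' \<beta>'. (\<Sum>f\<in>UNIV. \<Sum>\<mu>\<in>J. \<Sum>\<nu>\<in>J.
       F a b c d (e,\<alpha>,\<beta>) (f,\<mu>,\<nu>) * G a b c d (f,\<mu>,\<nu>) (e',\<alpha>',\<beta>')) =
       (if (e,\<alpha>,\<beta>) = (e',\<alpha>',\<beta>') \<and> \<alpha> < N a b e \<and> \<beta> < N e c d then 1 else 0)"
    and GF: "\<And>a b c d f \<mu> \<nu> f' \<mu>' \<nu>'. (\<Sum>e\<in>UNIV. \<Sum>\<alpha>\<in>J. \<Sum>\<beta>\<in>J.
       G a b c d (f,\<mu>,\<nu>) (e,\<alpha>,\<beta>) * F a b c d (e,\<alpha>,\<beta>) (f',\<mu>',\<nu>')) =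
       (if (f,\<mu>,\<nu>) = (f',\<mu>',\<nu>') \<and> \<mu> < N b c f \<and> \<nu> < N a f d then 1 else 0)"
    and pent: "\<And>a b c d e f g k l \<alpha> \<beta> \<gamma> \<delta> \<tau> \<mu>.
       (\<Sum>\<nu>\<in>J. F f c d e (g,\<beta>,\<gamma>) (l,\<delta>,\<nu>) * F a b l e (f,\<alpha>,\<nu>) (k,\<tau>,\<mu>)) =
       (\<Sum>h\<in>UNIV. \<Sum>\<sigma>\<in>J. \<Sum>\<psi>\<in>J. \<Sum>\<rho>\<in>J. F a b c g (f,\<alpha>,\<beta>) (h,\<sigma>,\<psi>) *
          F a h d e (g,\<psi>,\<gamma>) (k,\<rho>,\<mu>) * F b c d k (h,\<sigma>,\<rho>) (l,\<delta>,\<tau>))"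
    and F_unit2: "\<And>a c d e \<alpha> \<beta> f \<mu> \<nu>. F a u c d (e,\<alpha>,\<beta>) (f,\<mu>,\<nu>) =
       (if e = a \<and> \<alpha> = 0 \<and> f = c \<and> \<mu> = 0 \<and> \<beta> = \<nu> \<and> \<beta> < N a c d then 1 else 0)"
    and rigid: "\<And>a. F a (dl a) a a (u,0,0) (u,0,0) \<noteq> 0"
    and ep_sq: "\<And>a. ep a * ep a = 1" and ep_u: "ep u = 1"
    and piv: "\<And>a b c \<alpha> \<alpha>'. (\<Sum>\<mu>\<in>J. \<Sum>\<kappa>\<in>J.
        F a b c u (dl c,\<alpha>,0) (dl a,\<mu>,0) * F b c a u (dl a,\<mu>,0) (dl b,\<kappa>,0) *
        F c a b u (dl b,\<kappa>,0) (dl c,\<alpha>',0)) =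
        (if \<alpha> = \<alpha>' \<and> \<alpha> < N a b (dl c) then ep a * ep b * ep c else 0)"
begin

section \<open>Index sets, ranges and inversion of the associator\<close>

definition II :: "('a \<times> nat \<times> nat) set" where "II = UNIV \<times> J \<times> J"

lemma fin_II: "finite II" by (simp add: II_def finJ)

lemma sum_II: "(\<Sum>i\<in>II. f i) = (\<Sum>e\<in>UNIV. \<Sum>\<alpha>\<in>J. \<Sum>\<beta>\<in>J. f (e,\<alpha>,\<beta>))"
  by (simp add: II_def sum.cartesian_product)

definition chiL where "chiL a b c d i = (case i of (e,\<alpha>,\<beta>) \<Rightarrow> \<alpha> < N a b e \<and> \<beta> < N e c d)"
definition chiR where "chiR a b c d i = (case i of (f,\<mu>,\<nu>) \<Rightarrow> \<mu> < N b c f \<and> \<nu> < N a f d)"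

lemma chiL_II: "chiL a b c d i \<Longrightarrow> i \<in> II"
  by (auto simp: chiL_def II_def J_range split: prod.splits)
lemma chiR_II: "chiR a b c d i \<Longrightarrow> i \<in> II"
  by (auto simp: chiR_def II_def J_range split: prod.splits)

lemma FG_II: "(\<Sum>k\<in>II. F a b c d i k * G a b c d k j) = (if i = j \<and> chiL a b c d i then 1 else 0)"
  by (cases i; cases j) (auto simp only: sum_II FG chiL_def prod.case)
lemma GF_II: "(\<Sum>k\<in>II. G a b c d i k * F a b c d k j) = (if i = j \<and> chiR a b c d i then 1 else 0)"
  by (cases i; cases j) (auto simp only: sum_II GF chiR_def prod.case)

lemma F_eq_0: "\<not> (\<alpha> < N a b e \<and> \<beta> < N e c d \<and> \<mu> < N b c f \<and> \<nu> < N a f d) \<Longrightarrow> F a b c d (e,\<alpha>,\<beta>) (f,\<mu>,\<nu>) = 0"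
  using F_supp by blast
lemma G_eq_0: "\<not> (\<alpha> < N a b e \<and> \<beta> < N e c d \<and> \<mu> < N b c f \<and> \<nu> < N a f d) \<Longrightarrow> G a b c d (f,\<mu>,\<nu>) (e,\<alpha>,\<beta>) = 0"
  using G_supp by blast
text \<open>Right multiplication by \<open>G\<close> solves \<open>L = C F\<close> for
  \<open>C\<close>, but only on the range \<open>chiL\<close> where \<open>F G\<close> is the
  identity. Together with the column version below, this is how an \<open>F\<close> is moved across
  a pentagon equation.\<close>

lemma F_to_G:
  assumes "\<And>j. j \<in> II \<Longrightarrow> L j = (\<Sum>i\<in>II. C i * F a b c d i j)"
  shows "(\<Sum>j\<in>II. L j * G a b c d j k) = (if chiL a b c d k then C k else 0)"
proof -
  have "(\<Sum>j\<in>II. L j * G a b c d j k) = (\<Sum>j\<in>II. \<Sum>i\<in>II. C i * (F a b c d i j * G a b c d j k))"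
    by (intro sum.cong refl) (simp add: assms sum_distrib_right mult.assoc)
  also have "\<dots> = (\<Sum>i\<in>II. C i * (\<Sum>j\<in>II. F a b c d i j * G a b c d j k))"
    by (subst sum.swap) (simp add: sum_distrib_left)
  also have "\<dots> = (\<Sum>i\<in>II. if i = k then if chiL a b c d k then C k else 0 else 0)"
    by (intro sum.cong refl) (auto simp: FG_II)
  also have "\<dots> = (if chiL a b c d k then C k else 0)"
    using chiL_II[of a b c d k] by (auto simp: fin_II)
  finally show ?thesis .
qed

lemma F_to_G':
  assumes "\<And>i. i \<in> II \<Longrightarrow> L i = (\<Sum>j\<in>II. F a b c d i j * C j)"
  shows "(\<Sum>i\<in>II. G a b c d k i * L i) = (if chiR a b c d k then C k else 0)"
proof -
  have "(\<Sum>j\<in>II. G a b c d k j * L j) = (\<Sum>j\<in>II. \<Sum>i\<in>II. (G a b c d k j * F a b c d j i) * C i)"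
    by (intro sum.cong refl) (simp add: assms sum_distrib_left mult.assoc)
  also have "\<dots> = (\<Sum>i\<in>II. (\<Sum>j\<in>II. G a b c d k j * F a b c d j i) * C i)"
    by (subst sum.swap) (simp add: sum_distrib_right)
  also have "\<dots> = (\<Sum>i\<in>II. if i = k then if chiR a b c d k then C k else 0 else 0)"
    by (intro sum.cong refl) (auto simp: GF_II)
  also have "\<dots> = (if chiR a b c d k then C k else 0)"
    using chiR_II[of a b c d k] by (auto simp: fin_II)
  finally show ?thesis .
qed

section \<open>Triviality of the associator with a unit label\<close>

lemma dl_u: "dl u = u"
  by (metis N_unit1 N_dual zero_neq_one)

lemma dl_eq: "dl a = dl b \<longleftrightarrow> a = b" by (metis dl_dl)
lemma dl_eq2: "a = dl b \<longleftrightarrow> b = dl a" by (metis dl_dl)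
lemma zJ: "0 \<in> J" using J_range[of 0 u u u] by (simp add: N_unit1)

lemma N_dual': "N a b u = (if a = dl b then 1 else 0)"
  using N_dual[of a b] by (simp only: dl_eq2[of b a])

text \<open>Cancelling the right inverse: \<open>M H = M M H = M\<close>, and \<open>M H\<close> is
  the identity block.\<close>

lemma idem_block:
  assumes M: "\<And>i j. M i j \<noteq> 0 \<Longrightarrow> i < n \<and> j < n" and nJ: "{..<n} \<subseteq> J"
    and idem: "\<And>i j. M i j = (\<Sum>k\<in>J. M i k * M k j)"
    and inv: "\<And>i j. (\<Sum>k\<in>J. M i k * H k j) = (if i = j \<and> i < n then 1 else (0::complex))"
  shows "M i j = (if i = j \<and> i < n then 1 else 0)"
proof (cases "i < n \<and> j < n")
  case True
  have "(\<Sum>k\<in>J. M i k * H k j) = (\<Sum>k\<in>J. \<Sum>l\<in>J. M i l * (M l k * H k j))"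
    by (intro sum.cong refl) (subst idem, simp add: sum_distrib_right mult.assoc)
  also have "\<dots> = (\<Sum>l\<in>J. M i l * (\<Sum>k\<in>J. M l k * H k j))"
    by (subst sum.swap) (simp add: sum_distrib_left)
  also have "\<dots> = (\<Sum>l\<in>J. if l = j then M i j else 0)"
    using True by (intro sum.cong refl) (auto simp: inv)
  also have "\<dots> = M i j" using True nJ by (auto simp: finJ)
  finally show ?thesis by (simp add: inv)
next
  case False
  then show ?thesis using M[of i j] by auto
qed

text \<open>The pentagon for \<open>u, u, b, c\<close>: the two associators with \<open>u\<close> in
  the middle drop out by \<open>F_unit2\<close>, and what remains is \<open>M = M M\<close> for the
  block \<open>M\<close>. Invertibility of \<open>F\<close> then forces \<open>M\<close> to be the
  identity.\<close>

lemma F_unit1: "F u b c d (e,\<alpha>,\<beta>) (f,\<mu>,\<nu>) =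
   (if e = b \<and> \<alpha> = 0 \<and> f = d \<and> \<nu> = 0 \<and> \<beta> = \<mu> \<and> \<beta> < N b c d then 1 else 0)"
proof -
  define M where "M \<beta> \<mu> = F u b c d (b,0,\<beta>) (d,\<mu>,0)" for \<beta> \<mu>
  define H where "H \<mu> \<beta> = G u b c d (d,\<mu>,0) (b,0,\<beta>)" for \<beta> \<mu>
  have FM: "F u b c d (e,\<alpha>,\<beta>) (f,\<mu>,\<nu>) = (if e = b then if \<alpha> = 0 then if f = d then if \<nu> = 0 then M \<beta> \<mu> else 0 else 0 else 0 else 0)" for e \<alpha> \<beta> f \<mu> \<nu>
    using F_supp[of u b c d e \<alpha> \<beta> f \<mu> \<nu>] by (cases "F u b c d (e,\<alpha>,\<beta>) (f,\<mu>,\<nu>) = 0") (auto simp: M_def N_unit1 split: if_splits)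
  have GM: "G u b c d (f,\<mu>,\<nu>) (e,\<alpha>,\<beta>) = (if e = b then if \<alpha> = 0 then if f = d then if \<nu> = 0 then H \<mu> \<beta> else 0 else 0 else 0 else 0)" for e \<alpha> \<beta> f \<mu> \<nu>
    using G_supp[of u b c d f \<mu> \<nu> e \<alpha> \<beta>] by (cases "G u b c d (f,\<mu>,\<nu>) (e,\<alpha>,\<beta>) = 0") (auto simp: H_def N_unit1 split: if_splits)
  have "M \<beta> \<mu> = (if \<beta> = \<mu> \<and> \<beta> < N b c d then 1 else 0)" for \<beta> \<mu>
  proof (rule idem_block)
    show "M i j \<noteq> 0 \<Longrightarrow> i < N b c d \<and> j < N b c d" for i j
      unfolding M_def by (drule F_supp) auto
    show "{..<N b c d} \<subseteq> J" using J_range by auto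
    show "(\<Sum>k\<in>J. M i k * H k j) = (if i = j \<and> i < N b c d then 1 else 0)" for i j
      using FG[of u b c d b 0 i b 0 j] by (simp add: FM GM delta_simps finJ zJ N_unit1)
    show "M i j = (\<Sum>k\<in>J. M i k * M k j)" for i j
      using pent[of u b c d b 0 i d j u u 0 d 0 0]
      by (simp add: F_unit2 FM delta_simps finJ zJ N_unit1 if_conj)
  qed
  then show ?thesis by (simp add: FM)
qed

text \<open>The mirror image: the pentagon for \<open>a, b, u, u\<close> again leaves an idempotent
  block.\<close>

lemma F_unit3: "F a b u d (e,\<alpha>,\<beta>) (f,\<mu>,\<nu>) =
   (if e = d \<and> \<beta> = 0 \<and> f = b \<and> \<mu> = 0 \<and> \<alpha> = \<nu> \<and> \<alpha> < N a b d then 1 else 0)"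
proof -
  define M where "M \<beta> \<mu> = F a b u d (d,\<beta>,0) (b,0,\<mu>)" for \<beta> \<mu>
  define H where "H \<mu> \<beta> = G a b u d (b,0,\<mu>) (d,\<beta>,0)" for \<beta> \<mu>
  have FM: "F a b u d (e,\<alpha>,\<beta>) (f,\<mu>,\<nu>) = (if e = d then if \<beta> = 0 then if f = b then if \<mu> = 0 then M \<alpha> \<nu> else 0 else 0 else 0 else 0)" for e \<alpha> \<beta> f \<mu> \<nu>
    using F_supp[of a b u d e \<alpha> \<beta> f \<mu> \<nu>] by (cases "F a b u d (e,\<alpha>,\<beta>) (f,\<mu>,\<nu>) = 0") (auto simp: M_def N_unit2 split: if_splits)
  have GM: "G a b u d (f,\<mu>,\<nu>) (e,\<alpha>,\<beta>) = (if e = d then if \<beta> = 0 then if f = b then if \<mu> = 0 then H \<nu> \<alpha> else 0 else 0 else 0 else 0)" for e \<alpha> \<beta> f \<mu> \<nu>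
    using G_supp[of a b u d f \<mu> \<nu> e \<alpha> \<beta>] by (cases "G a b u d (f,\<mu>,\<nu>) (e,\<alpha>,\<beta>) = 0") (auto simp: H_def N_unit2 split: if_splits)
  have "M \<beta> \<mu> = (if \<beta> = \<mu> \<and> \<beta> < N a b d then 1 else 0)" for \<beta> \<mu>
  proof (rule idem_block)
    show "M i j \<noteq> 0 \<Longrightarrow> i < N a b d \<and> j < N a b d" for i j
      unfolding M_def by (drule F_supp) auto
    show "{..<N a b d} \<subseteq> J" using J_range by auto
    show "(\<Sum>k\<in>J. M i k * H k j) = (if i = j \<and> i < N a b d then 1 else 0)" for i j
      using FG[of a b u d d i 0 d j 0] by (simp add: FM GM delta_simps finJ zJ N_unit2)
    show "M i j = (\<Sum>k\<in>J. M i k * M k j)" for i j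
      using pent[of d u u d d 0 0 u 0 a b i b 0 j]
      by (simp add: F_unit2 FM delta_simps finJ zJ N_unit2 if_conj)
  qed
  then show ?thesis by (simp add: FM)
qed

section \<open>Bending and rotating the legs of fusion vertices\<close>

definition B where "B a b c \<alpha> \<mu> = F a b c u (dl c,\<alpha>,0) (dl a,\<mu>,0)"
definition Bi where "Bi a b c \<mu> \<alpha> = G a b c u (dl a,\<mu>,0) (dl c,\<alpha>,0)"
text \<open>\<open>D\<close> is the unit-channel row of \<open>F\<close> and pairs the vertices
  \<open>a b \<rightarrow> h\<close> with the vertices \<open>dl a h \<rightarrow> b\<close>, that
  is, it bends the leg \<open>a\<close>; \<open>E\<close> does the same for the right leg with the
  inverse associator. \<open>B\<close> above rotates the three legs of a map into the unit, and
  \<open>kap\<close> is the scalar of a zigzag composite.\<close>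

definition D where "D a b h \<sigma> \<psi> = F (dl a) a b b (u,0,0) (h,\<sigma>,\<psi>)"
definition E where "E b a f \<nu> \<psi> = G a b (dl b) a (u,0,0) (f,\<nu>,\<psi>)"
definition kap where "kap a = D a (dl a) u 0 0"

lemma F_total_u: "F a b c u (e,\<alpha>,\<beta>) (f,\<mu>,\<nu>) =
   (if e = dl c then if \<beta> = 0 then if f = dl a then if \<nu> = 0 then B a b c \<alpha> \<mu> else 0 else 0 else 0 else 0)"
proof (cases "F a b c u (e,\<alpha>,\<beta>) (f,\<mu>,\<nu>) = 0")
  case True then show ?thesis by (auto simp: B_def)
next
  case False
  then show ?thesis using F_supp[OF False] N_dual'[of e c] N_dual[of a f] by (auto simp: B_def split: if_splits)
qed

lemma G_total_u: "G a b c u (f,\<mu>,\<nu>) (e,\<alpha>,\<beta>) =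
   (if e = dl c then if \<beta> = 0 then if f = dl a then if \<nu> = 0 then Bi a b c \<mu> \<alpha> else 0 else 0 else 0 else 0)"
proof (cases "G a b c u (f,\<mu>,\<nu>) (e,\<alpha>,\<beta>) = 0")
  case True then show ?thesis by (auto simp: Bi_def)
next
  case False
  then show ?thesis using G_supp[OF False] N_dual'[of e c] N_dual[of a f] by (auto simp: Bi_def split: if_splits)
qed

lemma B_Bi: "(\<Sum>\<mu>\<in>J. B a b c \<alpha> \<mu> * Bi a b c \<mu> \<alpha>') = (if \<alpha> = \<alpha>' \<and> \<alpha> < N a b (dl c) then 1 else 0)"
  using FG[of a b c u "dl c" \<alpha> 0 "dl c" \<alpha>' 0]
  by (simp add: F_total_u G_total_u delta_simps finJ zJ N_dual dl_dl)

lemma Bi_B: "(\<Sum>\<alpha>\<in>J. Bi a b c \<mu> \<alpha> * B a b c \<alpha> \<mu>') = (if \<mu> = \<mu>' \<and> \<mu> < N b c (dl a) then 1 else 0)"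
  using GF[of a b c u "dl a" \<mu> 0 "dl a" \<mu>' 0]
  by (simp add: F_total_u G_total_u delta_simps finJ zJ N_dual dl_dl)

text \<open>The pentagon for \<open>dl a, a, b, c\<close> with \<open>dl a\<close> and
  \<open>a\<close> fused to \<open>u\<close>; \<open>F_unit1\<close> leaves a single
  \<open>D\<close> on the left.\<close>

lemma D_rot: "(if l = t \<and> \<gamma> = \<delta> \<and> \<gamma> < N b c t then D a t k \<tau> \<mu> else 0) =
   (\<Sum>h\<in>UNIV. \<Sum>\<sigma>\<in>J. \<Sum>\<psi>\<in>J. \<Sum>\<rho>\<in>J. D a b h \<sigma> \<psi> * F (dl a) h c t (b,\<psi>,\<gamma>) (k,\<rho>,\<mu>) * F a b c k (h,\<sigma>,\<rho>) (l,\<delta>,\<tau>))"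
proof -
  have "(\<Sum>\<nu>\<in>J. F u b c t (b,0,\<gamma>) (l,\<delta>,\<nu>) * F (dl a) a l t (u,0,\<nu>) (k,\<tau>,\<mu>)) = (if l = t \<and> \<gamma> = \<delta> \<and> \<gamma> < N b c t then D a t k \<tau> \<mu> else 0)"
    by (simp add: F_unit1 if_times if_conj finJ zJ D_def sum_if_const cong: if_cong)
  then show ?thesis
    using pent[of u b c t b 0 \<gamma> l \<delta> "dl a" a 0 k \<tau> \<mu>] by (simp add: D_def)
qed

lemma D_eq_0: "\<not> (\<sigma> < N a b h \<and> \<psi> < N (dl a) h b) \<Longrightarrow> D a b h \<sigma> \<psi> = 0"
  unfolding D_def by (rule F_eq_0) auto

lemma E_eq_0: "\<not> (\<nu> < N a b f \<and> \<psi> < N f (dl b) a) \<Longrightarrow> E b a f \<nu> \<psi> = 0"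
  unfolding E_def by (rule G_eq_0) auto

lemma B_eq_0: "\<not> (\<alpha> < N a b (dl c) \<and> \<mu> < N b c (dl a)) \<Longrightarrow> B a b c \<alpha> \<mu> = 0"
  unfolding B_def by (rule F_eq_0) auto

lemma Bi_eq_0: "\<not> (\<alpha> < N a b (dl c) \<and> \<mu> < N b c (dl a)) \<Longrightarrow> Bi a b c \<mu> \<alpha> = 0"
  unfolding Bi_def by (rule G_eq_0) auto

lemma range_J: "{..<N a b c} \<subseteq> J" using J_range by auto

text \<open>\<open>D_rot\<close> multiplied by \<open>G\<close>. Bending the leg \<open>a\<close>
  thus exchanges the associator of \<open>dl a, h, c\<close> with the inverse associator of
  \<open>a, b, c\<close>; the averaging argument rests on this exchange.\<close>

lemma D_rot_inv: "(\<Sum>\<psi>\<in>J. D a b h \<sigma> \<psi> * F (dl a) h c t (b,\<psi>,\<gamma>) (k,\<rho>,\<mu>)) =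
   (\<Sum>\<tau>\<in>J. D a t k \<tau> \<mu> * G a b c k (t,\<gamma>,\<tau>) (h,\<sigma>,\<rho>))"
proof -
  define C where "C = (\<lambda>(h,\<sigma>,\<rho>). \<Sum>\<psi>\<in>J. D a b h \<sigma> \<psi> * F (dl a) h c t (b,\<psi>,\<gamma>) (k,\<rho>,\<mu>))"
  define L where "L = (\<lambda>(l,\<delta>,\<tau>). if l = t \<and> \<gamma> = \<delta> \<and> \<gamma> < N b c t then D a t k \<tau> \<mu> else 0)"
  have "L j = (\<Sum>i\<in>II. C i * F a b c k i j)" for j
  proof (cases j)
    case (fields l \<delta> \<tau>)
    have "L j = (\<Sum>h\<in>UNIV. \<Sum>\<sigma>\<in>J. \<Sum>\<psi>\<in>J. \<Sum>\<rho>\<in>J. D a b h \<sigma> \<psi> * F (dl a) h c t (b,\<psi>,\<gamma>) (k,\<rho>,\<mu>) * F a b c k (h,\<sigma>,\<rho>) (l,\<delta>,\<tau>))"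
      using D_rot[of l t \<gamma> \<delta> b c a k \<tau> \<mu>] by (simp only: L_def fields prod.case)
    moreover have "(\<Sum>\<psi>\<in>J. \<Sum>\<rho>\<in>J. D a b h \<sigma> \<psi> * F (dl a) h c t (b,\<psi>,\<gamma>) (k,\<rho>,\<mu>) * F a b c k (h,\<sigma>,\<rho>) (l,\<delta>,\<tau>)) =
        (\<Sum>\<rho>\<in>J. C (h,\<sigma>,\<rho>) * F a b c k (h,\<sigma>,\<rho>) j)" for h \<sigma>
      by (subst sum.swap) (simp add: C_def fields sum_distrib_right)
    ultimately show ?thesis by (simp only: sum_II)
  qed
  from F_to_G[OF this, of "(h,\<sigma>,\<rho>)"]
  have "(\<Sum>j\<in>II. L j * G a b c k j (h,\<sigma>,\<rho>)) = (if chiL a b c k (h,\<sigma>,\<rho>) then C (h,\<sigma>,\<rho>) else 0)" .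
  moreover have "(if chiL a b c k (h,\<sigma>,\<rho>) then C (h,\<sigma>,\<rho>) else 0) = C (h,\<sigma>,\<rho>)"
  proof -
    have "D a b h \<sigma> \<psi> * F (dl a) h c t (b,\<psi>,\<gamma>) (k,\<rho>,\<mu>) = 0" if "\<not> (\<sigma> < N a b h \<and> \<rho> < N h c k)" for \<psi>
      using that D_eq_0[of \<sigma> a b h \<psi>] F_eq_0[of \<psi> "dl a" h b \<gamma> c t \<rho> k \<mu>] by auto
    then have "C (h,\<sigma>,\<rho>) = 0" if "\<not> (\<sigma> < N a b h \<and> \<rho> < N h c k)"
      unfolding C_def prod.case using that by (intro sum.neutral) blast
    then show ?thesis by (auto simp: chiL_def)
  qed
  moreover have "(\<Sum>j\<in>II. L j * G a b c k j (h,\<sigma>,\<rho>)) = (\<Sum>\<tau>\<in>J. if \<gamma> < N b c t then D a t k \<tau> \<mu> * G a b c k (t,\<gamma>,\<tau>) (h,\<sigma>,\<rho>) else 0)"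
    using J_range[of \<gamma> b c t] by (auto simp: sum_II L_def if_conj if_times sum_if_const finJ)
  moreover have "\<dots> = (\<Sum>\<tau>\<in>J. D a t k \<tau> \<mu> * G a b c k (t,\<gamma>,\<tau>) (h,\<sigma>,\<rho>))"
    by (intro sum.cong refl) (auto simp: G_eq_0)
  ultimately show ?thesis by (simp add: C_def)
qed

lemma kap_nz: "kap a \<noteq> 0"
  using rigid[of "dl a"] by (simp add: kap_def D_def dl_dl)

text \<open>The inverse of \<open>D\<close>, read off from \<open>D_rot_inv\<close> at
  \<open>b = dl a\<close> and \<open>h = u\<close>: there the left side collapses to
  \<open>kap a\<close> by \<open>F_unit2\<close>.\<close>

definition Di where "Di a t c \<gamma> \<tau> = G a (dl a) c c (t,\<gamma>,\<tau>) (u,0,0) / kap a"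

lemma Di_eq_0: "\<not> (\<tau> < N a t c \<and> \<gamma> < N (dl a) c t) \<Longrightarrow> Di a t c \<gamma> \<tau> = 0"
  unfolding Di_def using G_eq_0[of 0 a "dl a" u 0 c c \<gamma> t \<tau>] by auto

lemma Di_D: "(\<Sum>\<tau>\<in>J. Di a t c \<gamma> \<tau> * D a t c \<tau> \<mu>) = (if \<gamma> = \<mu> \<and> \<gamma> < N (dl a) c t then 1 else 0)"
proof -
  have "(\<Sum>\<psi>\<in>J. D a (dl a) u 0 \<psi> * F (dl a) u c t (dl a,\<psi>,\<gamma>) (c,0,\<mu>)) = (if \<gamma> = \<mu> \<and> \<gamma> < N (dl a) c t then kap a else 0)"
    by (simp add: F_unit2 if_conj delta_simps finJ zJ kap_def)
  then show ?thesis
    using kap_nz[of a] by (simp add: D_rot_inv Di_def sum_divide_distrib[symmetric] mult.commute split: if_splits)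
qed

text \<open>Frobenius reciprocity. The left inverse \<open>Di\<close> of \<open>D\<close> gives one
  inequality, and the same argument for \<open>dl a\<close> the other.\<close>

lemma N_rot: "N (dl a) c t = N a t c"
proof -
  have *: "N (dl a) c t \<le> N a t c" for a c t
  proof (rule matrix_left_inverse(1)[OF finJ range_J range_J])
    show "Di a t c i k \<noteq> 0 \<Longrightarrow> i < N (dl a) c t \<and> k < N a t c" for i k using Di_eq_0 by blast
    show "D a t c k i \<noteq> 0 \<Longrightarrow> k < N a t c \<and> i < N (dl a) c t" for i k using D_eq_0 by blast
  qed (simp add: Di_D)
  show ?thesis using *[of a c t] *[of "dl a" t c] by (simp add: dl_dl)
qed

lemma D_Di: "(\<Sum>\<gamma>\<in>J. D a t c \<tau> \<gamma> * Di a t c \<gamma> \<tau>') = (if \<tau> = \<tau>' \<and> \<tau> < N a t c then 1 else 0)"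
proof (rule matrix_left_inverse(2)[OF finJ range_J range_J _ _ _ N_rot])
  show "Di a t c i k \<noteq> 0 \<Longrightarrow> i < N (dl a) c t \<and> k < N a t c" for i k using Di_eq_0 by blast
  show "D a t c k i \<noteq> 0 \<Longrightarrow> k < N a t c \<and> i < N (dl a) c t" for i k using D_eq_0 by blast
qed (simp add: Di_D)

lemma N_cyc: "N a b (dl c) = N b c (dl a)"
proof (rule antisym)
  show "N a b (dl c) \<le> N b c (dl a)"
  proof (rule matrix_left_inverse(1)[OF finJ range_J range_J])
    show "B a b c i k \<noteq> 0 \<Longrightarrow> i < N a b (dl c) \<and> k < N b c (dl a)" for i k using B_eq_0 by blast
    show "Bi a b c k i \<noteq> 0 \<Longrightarrow> k < N b c (dl a) \<and> i < N a b (dl c)" for i k using Bi_eq_0 by blast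
  qed (simp add: B_Bi)
  show "N b c (dl a) \<le> N a b (dl c)"
  proof (rule matrix_left_inverse(1)[OF finJ range_J range_J])
    show "Bi a b c i k \<noteq> 0 \<Longrightarrow> i < N b c (dl a) \<and> k < N a b (dl c)" for i k using Bi_eq_0 by blast
    show "B a b c k i \<noteq> 0 \<Longrightarrow> k < N a b (dl c) \<and> i < N b c (dl a)" for i k using B_eq_0 by blast
  qed (simp add: Bi_B)
qed

text \<open>The case \<open>t = u\<close> of \<open>D_rot_inv\<close>: bending on the right is
  bending on the left followed by a rotation.\<close>

lemma E_D_B: "E b a f \<sigma> \<rho> = (\<Sum>\<psi>\<in>J. D a b f \<sigma> \<psi> * B (dl a) f (dl b) \<psi> \<rho>)"
proof -
  have "D a u a \<tau> 0 = (if \<tau> = 0 then 1 else 0)" for \<tau>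
    by (simp add: D_def F_unit3 N_dual' dl_dl)
  then show ?thesis
    using D_rot_inv[of a b f \<sigma> "dl b" u 0 a \<rho> 0]
    by (simp add: F_total_u dl_dl E_def if_times finJ zJ)
qed

text \<open>The pentagon for \<open>a, b, dl b, dl a\<close> with total charge \<open>u\<close>,
  solved by \<open>G\<close> in the channel where \<open>b\<close> and \<open>dl b\<close> fuse to
  \<open>u\<close>.\<close>

lemma D_dual_E: "D (dl b) (dl a) l \<delta> \<tau> =
  (\<Sum>\<alpha>\<in>J. \<Sum>\<beta>\<in>J. E b a (dl l) \<alpha> \<beta> * (B (dl l) (dl b) (dl a) \<beta> \<delta> * B a b l \<alpha> \<tau>))"
proof -
  define L where "L = (\<lambda>(f,\<alpha>,\<beta>). if f = dl l then B f (dl b) (dl a) \<beta> \<delta> * B a b l \<alpha> \<tau> else 0)"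
  define C where "C = (\<lambda>(h,\<sigma>,\<psi>). \<Sum>\<rho>\<in>J. B a h (dl a) \<psi> \<rho> * F b (dl b) (dl a) (dl a) (h,\<sigma>,\<rho>) (l,\<delta>,\<tau>))"
  have "L i = (\<Sum>j\<in>II. F a b (dl b) a i j * C j)" for i
  proof (cases i)
    case (fields f \<alpha> \<beta>)
    have "L i = (\<Sum>\<nu>\<in>J. F f (dl b) (dl a) u (a,\<beta>,0) (l,\<delta>,\<nu>) * F a b l u (f,\<alpha>,\<nu>) (dl a,\<tau>,0))"
      by (auto simp: F_total_u dl_dl fields L_def delta_simps finJ zJ)
    also have "\<dots> = (\<Sum>j\<in>II. F a b (dl b) a i j * C j)"
      unfolding pent by (simp add: sum_II C_def fields F_total_u dl_dl sum_distrib_left mult.assoc)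
    finally show ?thesis .
  qed
  from F_to_G'[OF this, of "(u,0,0)"]
  have "(\<Sum>i\<in>II. G a b (dl b) a (u,0,0) i * L i) = (if chiR a b (dl b) a (u,0,0) then C (u,0,0) else 0)" .
  moreover have "C (u,0,0) = D (dl b) (dl a) l \<delta> \<tau>"
  proof -
    have "B a u (dl a) 0 \<rho> = (if \<rho> = 0 then 1 else 0)" for \<rho>
      by (auto simp: B_def F_unit2 dl_dl N_dual)
    then show ?thesis by (simp add: C_def D_def dl_dl if_times finJ zJ)
  qed
  moreover have "chiR a b (dl b) a (u,0,0)" by (simp add: chiR_def N_dual N_unit2)
  moreover have "(\<Sum>i\<in>II. G a b (dl b) a (u,0,0) i * L i) =
    (\<Sum>f\<in>UNIV. if f = dl l then (\<Sum>\<alpha>\<in>J. \<Sum>\<beta>\<in>J. E b a (dl l) \<alpha> \<beta> * (B (dl l) (dl b) (dl a) \<beta> \<delta> * B a b l \<alpha> \<tau>)) else 0)"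
    unfolding sum_II by (intro sum.cong refl) (auto simp: L_def E_def dl_dl)
  ultimately show ?thesis by simp
qed

text \<open>The pentagon for \<open>b, c, dl c, c\<close> with the middle pair fused to the unit; it
  exhibits a right inverse of \<open>E\<close> up to a zigzag scalar.\<close>

lemma E_inv: "(\<Sum>\<beta>\<in>J. E c b t \<mu> \<beta> * F t (dl c) c t (b,\<beta>,\<gamma>) (u,0,0)) =
  (if \<gamma> = \<mu> \<and> \<gamma> < N b c t then kap (dl c) else 0)"
proof -
  define L where "L = (\<lambda>(f,\<alpha>,\<beta>). if f = t then if \<alpha> = \<mu> then if \<mu> < N b c t then F t (dl c) c t (b,\<beta>,\<gamma>) (u,0,0) else 0 else 0 else 0)"
  define C where "C = (\<lambda>(h,\<sigma>,\<psi>). \<Sum>\<rho>\<in>J. F b h c t (b,\<psi>,\<gamma>) (c,\<rho>,\<mu>) * F c (dl c) c c (h,\<sigma>,\<rho>) (u,0,0))"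
  have "L i = (\<Sum>j\<in>II. F b c (dl c) b i j * C j)" for i
  proof (cases i)
    case (fields f \<alpha> \<beta>)
    have "L i = (\<Sum>\<nu>\<in>J. F f (dl c) c t (b,\<beta>,\<gamma>) (u,0,\<nu>) * F b c u t (f,\<alpha>,\<nu>) (c,0,\<mu>))"
      by (auto simp: F_unit3 fields L_def delta_simps if_conj finJ zJ)
    also have "\<dots> = (\<Sum>j\<in>II. F b c (dl c) b i j * C j)"
      unfolding pent by (simp add: sum_II C_def fields sum_distrib_left mult.assoc)
    finally show ?thesis .
  qed
  from F_to_G'[OF this, of "(u,0,0)"]
  have "(\<Sum>i\<in>II. G b c (dl c) b (u,0,0) i * L i) = (if chiR b c (dl c) b (u,0,0) then C (u,0,0) else 0)" .
  moreover have "C (u,0,0) = (if \<gamma> = \<mu> \<and> \<gamma> < N b c t then kap (dl c) else 0)"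
    by (simp add: C_def F_unit2 if_conj if_times finJ zJ kap_def D_def dl_dl)
  moreover have "chiR b c (dl c) b (u,0,0)" by (simp add: chiR_def N_dual N_unit2)
  moreover have "(\<Sum>i\<in>II. G b c (dl c) b (u,0,0) i * L i) = (\<Sum>\<beta>\<in>J. if \<mu> < N b c t then E c b t \<mu> \<beta> * F t (dl c) c t (b,\<beta>,\<gamma>) (u,0,0) else 0)"
    using J_range[of \<mu> b c t] by (auto simp: sum_II L_def E_def delta_simps finJ)
  moreover have "\<dots> = (\<Sum>\<beta>\<in>J. E c b t \<mu> \<beta> * F t (dl c) c t (b,\<beta>,\<gamma>) (u,0,0))"
    by (intro sum.cong refl) (auto simp: E_eq_0)
  ultimately show ?thesis by simp
qed

section \<open>Matrix calculus for multiplicity indices, with sizes encoded in supports\<close>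

definition mm :: "(nat \<Rightarrow> nat \<Rightarrow> complex) \<Rightarrow> (nat \<Rightarrow> nat \<Rightarrow> complex) \<Rightarrow> nat \<Rightarrow> nat \<Rightarrow> complex"
  where "mm A A' i k = (\<Sum>j\<in>J. A i j * A' j k)"
definition tp :: "(nat \<Rightarrow> nat \<Rightarrow> complex) \<Rightarrow> nat \<Rightarrow> nat \<Rightarrow> complex" where "tp A i j = A j i"
definition sc :: "complex \<Rightarrow> (nat \<Rightarrow> nat \<Rightarrow> complex) \<Rightarrow> nat \<Rightarrow> nat \<Rightarrow> complex" where "sc x A i j = x * A i j"
definition im :: "nat \<Rightarrow> nat \<Rightarrow> nat \<Rightarrow> complex" where "im n i j = (if i = j \<and> i < n then 1 else 0)"
definition tr :: "(nat \<Rightarrow> nat \<Rightarrow> complex) \<Rightarrow> complex" where "tr A = (\<Sum>i\<in>J. A i i)"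

lemma mm_assoc: "mm (mm A A') A'' = mm A (mm A' A'')"
proof (intro ext)
  fix i l
  have "mm (mm A A') A'' i l = (\<Sum>k\<in>J. \<Sum>j\<in>J. A i j * (A' j k * A'' k l))"
    by (simp add: mm_def sum_distrib_right mult.assoc)
  also have "\<dots> = mm A (mm A' A'') i l"
    by (subst sum.swap) (simp add: mm_def sum_distrib_left)
  finally show "mm (mm A A') A'' i l = mm A (mm A' A'') i l" .
qed

lemma mm_sc: "mm (sc x A) A' = sc x (mm A A')" "mm A (sc x A') = sc x (mm A A')"
  by (auto simp: mm_def sc_def fun_eq_iff sum_distrib_left mult_ac)
lemma tp_mm: "tp (mm A A') = mm (tp A') (tp A)"
  by (auto simp: mm_def tp_def fun_eq_iff mult_ac)
lemma tp_tp: "tp (tp A) = A" by (simp add: tp_def fun_eq_iff)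
lemma tp_im: "tp (im n) = im n" by (auto simp: tp_def im_def fun_eq_iff)
lemma sc_sc: "sc x (sc y A) = sc (x * y) A" by (simp add: sc_def fun_eq_iff)
lemma sc1: "sc 1 A = A" by (simp add: sc_def fun_eq_iff)
lemma mm_im1: assumes "{..<n} \<subseteq> J" "\<And>i j. A i j \<noteq> 0 \<Longrightarrow> i < n" shows "mm (im n) A = A"
proof (intro ext)
  fix i k
  have "mm (im n) A i k = (\<Sum>j\<in>J. if j = i then (if i < n then A i k else 0) else 0)"
    unfolding mm_def by (intro sum.cong refl) (auto simp: im_def)
  then show "mm (im n) A i k = A i k" using assms by (auto simp: finJ)
qed
lemma mm_im2: assumes "{..<n} \<subseteq> J" "\<And>i j. A i j \<noteq> 0 \<Longrightarrow> j < n" shows "mm A (im n) = A"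
  using mm_im1[of n "tp A"] assms by (metis tp_im tp_mm tp_tp tp_def)
lemma tr_mm: "tr (mm A A') = tr (mm A' A)"
  unfolding tr_def mm_def by (subst sum.swap) (simp add: mult.commute)

lemma mm_B_Bi: "mm (B a b c) (Bi a b c) = im (N a b (dl c))"
  by (simp add: mm_def im_def fun_eq_iff B_Bi)
lemma mm_Bi_B: "mm (Bi a b c) (B a b c) = im (N b c (dl a))"
  by (simp add: mm_def im_def fun_eq_iff Bi_B)
lemma mm_E: "E b a f = mm (D a b f) (B (dl a) f (dl b))"
  by (simp add: mm_def fun_eq_iff E_D_B)

text \<open>Both sides are \<open>kap a * kap (dl c)\<close> times the inverse of one block
  \<open>K\<close> of \<open>F\<close>: \<open>E_inv\<close> inverts \<open>K\<close> through
  \<open>E\<close>, while \<open>D_rot_inv\<close> shows that \<open>D K\<close> is a multiple of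
  the transposed inverse of \<open>B\<close>.\<close>

lemma BD_E: "sc (kap a) (E c b (dl a)) = sc (kap (dl c)) (mm (tp (B a b c)) (D a b (dl c)))"
proof -
  define K where "K \<psi> \<gamma> = F (dl a) (dl c) c (dl a) (b,\<psi>,\<gamma>) (u,0,0)" for \<psi> \<gamma>
  let ?n = "N b c (dl a)"
  have n: "?n = N (dl a) (dl c) b" by (simp add: N_rot N_cyc[of a b c])
  have K0: "K \<psi> \<gamma> \<noteq> 0 \<Longrightarrow> \<psi> < ?n \<and> \<gamma> < ?n" for \<psi> \<gamma>
    unfolding n by (metis K_def F_eq_0 n)
  have E0: "E c b (dl a) \<gamma> \<psi> \<noteq> 0 \<Longrightarrow> \<psi> < ?n \<and> \<gamma> < ?n" for \<psi> \<gamma>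
    by (metis E_eq_0 n)
  have EK: "mm (E c b (dl a)) K = sc (kap (dl c)) (im ?n)"
    using E_inv[of c b "dl a"] by (auto simp: mm_def K_def sc_def im_def fun_eq_iff)
  \<comment> \<open>\<open>E\<close> and \<open>K\<close> are square of the same size, so the
    one-sided inverse from \<open>EK\<close> is two-sided.\<close>
  have KE: "mm K (E c b (dl a)) = sc (kap (dl c)) (im ?n)"
  proof -
    have "(\<Sum>i\<in>J. K k i * (E c b (dl a) i l / kap (dl c))) = (if k = l \<and> k < ?n then 1 else 0)" for k l
    proof (rule matrix_left_inverse(2)[OF finJ range_J range_J _ _ _ refl])
      show "(\<Sum>k\<in>J. E c b (dl a) i k / kap (dl c) * K k j) = (if i = j then 1 else 0)" if "i < ?n" "j < ?n" for i j
        using fun_cong[OF fun_cong[OF EK], of i j] that kap_nz[of "dl c"]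
        by (simp add: mm_def sc_def im_def sum_divide_distrib[symmetric] split: if_splits)
    qed (use K0 E0 in auto)
    then show ?thesis
      using kap_nz[of "dl c"] by (simp add: mm_def sc_def im_def fun_eq_iff sum_divide_distrib[symmetric] field_simps)
  qed
  have DK: "mm (D a b (dl c)) K = sc (kap a) (tp (Bi a b c))"
  proof (intro ext)
    fix \<sigma> \<gamma>
    have "mm (D a b (dl c)) K \<sigma> \<gamma> = (\<Sum>\<tau>\<in>J. D a (dl a) u \<tau> 0 * G a b c u (dl a,\<gamma>,\<tau>) (dl c,\<sigma>,0))"
      unfolding mm_def K_def by (rule D_rot_inv)
    then show "mm (D a b (dl c)) K \<sigma> \<gamma> = sc (kap a) (tp (Bi a b c)) \<sigma> \<gamma>"
      by (simp add: G_total_u times_if finJ zJ sc_def tp_def kap_def)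
  qed
  have "sc (kap (dl c)) (mm (tp (B a b c)) (D a b (dl c))) = mm (mm (tp (B a b c)) (D a b (dl c))) (sc (kap (dl c)) (im ?n))"
  proof -
    have "mm (mm (tp (B a b c)) (D a b (dl c))) (im ?n) = mm (tp (B a b c)) (D a b (dl c))"
      unfolding mm_assoc n by (subst mm_im2) (use range_J D_eq_0 in blast)+
    then show ?thesis by (simp add: mm_sc)
  qed
  also have "\<dots> = mm (mm (tp (B a b c)) (mm (D a b (dl c)) K)) (E c b (dl a))"
    by (simp add: KE[symmetric] mm_assoc)
  also have "\<dots> = sc (kap a) (mm (tp (mm (Bi a b c) (B a b c))) (E c b (dl a)))"
    by (simp add: DK mm_sc tp_mm)
  also have "\<dots> = sc (kap a) (E c b (dl a))"
    unfolding mm_Bi_B tp_im by (subst mm_im1) (use range_J E0 in blast)+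
  finally show ?thesis by simp
qed

text \<open>The pivotal identity with third leg \<open>u\<close>: all three rotations are trivial
  there, so \<open>ep a * ep (dl a) = 1\<close>.\<close>

lemma ep_dl: "ep (dl a) = ep a"
proof -
  have "(\<Sum>\<mu>\<in>J. \<Sum>\<kappa>\<in>J. B a (dl a) u 0 \<mu> * B (dl a) u a \<mu> \<kappa> * B u a (dl a) \<kappa> 0) = ep a * ep (dl a)"
    using piv[of a "dl a" u 0 0] by (simp add: B_def dl_dl dl_u N_dual ep_u)
  moreover have "(\<Sum>\<mu>\<in>J. \<Sum>\<kappa>\<in>J. B a (dl a) u 0 \<mu> * B (dl a) u a \<mu> \<kappa> * B u a (dl a) \<kappa> 0) = 1"
    by (simp add: B_def F_unit1 F_unit2 F_unit3 dl_dl dl_u N_dual if_conj delta_simps finJ zJ)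
  ultimately show ?thesis by (metis ep_sq mult.assoc mult.right_neutral mult.left_neutral)
qed

section \<open>Quantum dimensions and weighted averages of the associator\<close>

definition th where "th d = kap (dl d) * ep d"

lemma ep_nz: "ep a \<noteq> 0" using ep_sq[of a] by auto
lemma th_nz: "th d \<noteq> 0" by (simp add: th_def kap_nz ep_nz)

text \<open>Bending \<open>a\<close> and bending \<open>dl a\<close> are transposed to each other up
  to a scalar, whose dependence on \<open>d\<close> and \<open>f\<close> is the quotient
  \<open>th d / th f\<close>. The pivotal identity enters here: \<open>D_dual_E\<close> and
  \<open>BD_E\<close> reduce the left side to \<open>D a f d\<close> followed by three rotations
  \<open>B\<close>, whose product is the scalar of \<open>piv'\<close>.\<close>

lemma D_swap: "D (dl a) d f \<kappa> \<nu> = ep a * (th d / th f) * D a f d \<nu> \<kappa>"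
proof -
  have piv': "mm (B a d (dl f)) (mm (B d (dl f) a) (B (dl f) a d)) = sc (ep a * ep d * ep f) (im (N a d f))" for a d f
  proof (intro ext)
    fix \<alpha> \<alpha>'
    have "mm (B a d (dl f)) (mm (B d (dl f) a) (B (dl f) a d)) \<alpha> \<alpha>' =
      (\<Sum>\<mu>\<in>J. \<Sum>\<kappa>\<in>J. F a d (dl f) u (dl (dl f),\<alpha>,0) (dl a,\<mu>,0) * F d (dl f) a u (dl a,\<mu>,0) (dl d,\<kappa>,0) *
        F (dl f) a d u (dl d,\<kappa>,0) (dl (dl f),\<alpha>',0))"
      by (simp add: mm_def B_def dl_dl sum_distrib_left mult.assoc)
    then show "mm (B a d (dl f)) (mm (B d (dl f) a) (B (dl f) a d)) \<alpha> \<alpha>' = sc (ep a * ep d * ep f) (im (N a d f)) \<alpha> \<alpha>'"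
      unfolding piv by (simp add: sc_def im_def dl_dl ep_dl)
  qed
  define b where "b = dl a"
  define a' where "a' = dl d"
  have ab: "dl b = a" "dl a' = d" by (simp_all add: a'_def b_def dl_dl)
  have "tp (D (dl a) d f) = mm (tp (B a' a f)) (mm (E a a' (dl f)) (B (dl f) (dl a) d))"
  proof (intro ext)
    fix \<tau> \<delta>
    show "tp (D (dl a) d f) \<tau> \<delta> = mm (tp (B a' a f)) (mm (E a a' (dl f)) (B (dl f) (dl a) d)) \<tau> \<delta>"
      using D_dual_E[of a a' f \<delta> \<tau>] by (simp add: ab tp_def mm_def sum_distrib_left mult_ac)
  qed
  also have "\<dots> = mm (mm (tp (B a' a f)) (D a' a (dl f))) (mm (B d (dl f) (dl a)) (B (dl f) (dl a) d))"
    by (simp add: mm_E mm_assoc ab)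
  also have "mm (tp (B a' a f)) (D a' a (dl f)) = sc (kap a' / kap (dl f)) (E f a d)"
  proof -
    have "sc (1 / kap (dl f)) (sc (kap a') (E f a (dl a'))) = sc (1 / kap (dl f)) (sc (kap (dl f)) (mm (tp (B a' a f)) (D a' a (dl f))))"
      by (simp only: BD_E)
    then show ?thesis by (simp add: sc_sc ab kap_nz sc1)
  qed
  also have "mm (sc (kap a' / kap (dl f)) (E f a d)) (mm (B d (dl f) (dl a)) (B (dl f) (dl a) d)) =
     sc (kap a' / kap (dl f)) (mm (D a f d) (mm (B (dl a) d (dl f)) (mm (B d (dl f) (dl a)) (B (dl f) (dl a) d))))"
    by (simp add: mm_E mm_sc mm_assoc)
  also have "\<dots> = sc (kap a' / kap (dl f) * (ep (dl a) * ep d * ep f)) (D a f d)"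
    unfolding piv' mm_sc sc_sc by (subst mm_im2) (use range_J D_eq_0 in blast)+
  finally have "tp (D (dl a) d f) \<nu> \<kappa> = sc (kap a' / kap (dl f) * (ep (dl a) * ep d * ep f)) (D a f d) \<nu> \<kappa>"
    by simp
  moreover have "kap (dl d) / kap (dl f) * (ep a * ep d * ep f) = ep a * (th d / th f)"
  proof -
    have "kap (dl d) / kap (dl f) * (ep a * ep d * ep f) * (kap (dl f) * ep f) = ep a * (kap (dl d) * ep d)"
      using ep_sq[of f] kap_nz[of "dl f"] by simp
    then show ?thesis by (simp add: th_def nonzero_eq_divide_eq kap_nz ep_nz)
  qed
  ultimately show ?thesis by (simp only: tp_def sc_def a'_def ep_dl)
qed

text \<open>\<open>w\<close> is the quantum dimension.\<close>

definition w where "w d = 1 / th d"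

lemma w_nz: "w d \<noteq> 0" by (simp add: w_def th_nz)

lemma w_u: "w u = 1"
  by (simp add: w_def th_def kap_def D_def dl_u ep_u F_unit2 N_unit1)

text \<open>Orthogonality of \<open>F\<close> for the weights \<open>w\<close>. Contracted with
  \<open>D\<close>, the factor \<open>F\<close> turns into a rotated \<open>G\<close>
  (\<open>F1\<close>) and \<open>G\<close> into a rotated \<open>F\<close> (\<open>G1\<close>); the
  scalar of \<open>D_swap\<close> supplies \<open>1 / w d\<close>, which cancels the weight. The sum
  over \<open>d\<close> then closes up to \<open>F G = 1\<close> for the associator of
  \<open>dl a, e, c\<close>.\<close>

lemma avg_total: "(\<Sum>d\<in>UNIV. \<Sum>\<beta>\<in>J. \<Sum>\<nu>\<in>J. w d * (F a b c d (e,\<alpha>,\<beta>) (f,\<mu>,\<nu>) * G a b c d (f,\<mu>',\<nu>) (e,\<alpha>',\<beta>))) =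
  (if \<alpha> = \<alpha>' \<and> \<alpha> < N a b e \<and> \<mu> = \<mu>' \<and> \<mu> < N b c f then w e * w f / w b else 0)"
proof -
  define S where "S \<alpha> = (\<Sum>d\<in>UNIV. \<Sum>\<beta>\<in>J. \<Sum>\<nu>\<in>J. w d * (F a b c d (e,\<alpha>,\<beta>) (f,\<mu>,\<nu>) * G a b c d (f,\<mu>',\<nu>) (e,\<alpha>',\<beta>)))" for \<alpha>
  define k where "k = w e * w f / w b"
  have F1: "(\<Sum>\<alpha>\<in>J. D a b e \<alpha> \<psi> * F a b c d (e,\<alpha>,\<beta>) (f,\<mu>,\<nu>)) =
     (k / w d) * (\<Sum>\<kappa>\<in>J. D a f d \<nu> \<kappa> * G (dl a) e c f (d,\<beta>,\<kappa>) (b,\<psi>,\<mu>))" for \<psi> d \<beta> \<nu>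
  proof -
    have "(\<Sum>\<alpha>\<in>J. D (dl a) e b \<psi> \<alpha> * F a b c d (e,\<alpha>,\<beta>) (f,\<mu>,\<nu>)) =
       (\<Sum>\<kappa>\<in>J. D (dl a) d f \<kappa> \<nu> * G (dl a) e c f (d,\<beta>,\<kappa>) (b,\<psi>,\<mu>))"
      using D_rot_inv[of "dl a" e b \<psi> c d \<beta> f \<mu> \<nu>] by (simp add: dl_dl)
    then have "(ep a * (th e / th b)) * (\<Sum>\<alpha>\<in>J. D a b e \<alpha> \<psi> * F a b c d (e,\<alpha>,\<beta>) (f,\<mu>,\<nu>)) =
       (ep a * (th d / th f)) * (\<Sum>\<kappa>\<in>J. D a f d \<nu> \<kappa> * G (dl a) e c f (d,\<beta>,\<kappa>) (b,\<psi>,\<mu>))"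
      by (simp add: D_swap sum_distrib_left mult.assoc)
    then show ?thesis
      using ep_nz[of a] th_nz[of e] th_nz[of b] th_nz[of d] th_nz[of f] by (simp add: k_def w_def field_simps)
  qed
  have G1: "(\<Sum>\<nu>\<in>J. D a f d \<nu> \<kappa> * G a b c d (f,\<mu>',\<nu>) (e,\<alpha>',\<beta>)) =
     (\<Sum>\<psi>\<in>J. D a b e \<alpha>' \<psi> * F (dl a) e c f (b,\<psi>,\<mu>') (d,\<beta>,\<kappa>))" for d \<kappa> \<beta>
    by (rule D_rot_inv[symmetric])
  have DS: "(\<Sum>\<alpha>\<in>J. D a b e \<alpha> \<psi> * S \<alpha>) = (if \<mu> = \<mu>' \<and> \<mu> < N b c f then k * D a b e \<alpha>' \<psi> else 0)" for \<psi>
  proof -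
    have sw: "(\<Sum>\<alpha>\<in>J. D a b e \<alpha> \<psi> * S \<alpha>) = (\<Sum>d\<in>UNIV. \<Sum>\<beta>\<in>J. \<Sum>\<nu>\<in>J. \<Sum>\<alpha>\<in>J.
       D a b e \<alpha> \<psi> * (w d * (F a b c d (e,\<alpha>,\<beta>) (f,\<mu>,\<nu>) * G a b c d (f,\<mu>',\<nu>) (e,\<alpha>',\<beta>))))"
      unfolding S_def sum_distrib_left
      by (rule sum_rotate4)
    have inner: "(\<Sum>\<nu>\<in>J. \<Sum>\<alpha>\<in>J. D a b e \<alpha> \<psi> * (w d * (F a b c d (e,\<alpha>,\<beta>) (f,\<mu>,\<nu>) * G a b c d (f,\<mu>',\<nu>) (e,\<alpha>',\<beta>)))) =
       (\<Sum>\<kappa>\<in>J. k * (G (dl a) e c f (d,\<beta>,\<kappa>) (b,\<psi>,\<mu>) * (\<Sum>\<psi>'\<in>J. D a b e \<alpha>' \<psi>' * F (dl a) e c f (b,\<psi>',\<mu>') (d,\<beta>,\<kappa>))))" for d \<beta>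
    proof -
      have "(\<Sum>\<nu>\<in>J. \<Sum>\<alpha>\<in>J. D a b e \<alpha> \<psi> * (w d * (F a b c d (e,\<alpha>,\<beta>) (f,\<mu>,\<nu>) * G a b c d (f,\<mu>',\<nu>) (e,\<alpha>',\<beta>)))) =
        (\<Sum>\<nu>\<in>J. w d * G a b c d (f,\<mu>',\<nu>) (e,\<alpha>',\<beta>) * (\<Sum>\<alpha>\<in>J. D a b e \<alpha> \<psi> * F a b c d (e,\<alpha>,\<beta>) (f,\<mu>,\<nu>)))"
        by (simp add: sum_distrib_left mult_ac)
      also have "\<dots> = (\<Sum>\<nu>\<in>J. \<Sum>\<kappa>\<in>J. k * (G (dl a) e c f (d,\<beta>,\<kappa>) (b,\<psi>,\<mu>) * (D a f d \<nu> \<kappa> * G a b c d (f,\<mu>',\<nu>) (e,\<alpha>',\<beta>))))"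
        unfolding F1 using w_nz[of d] by (simp add: sum_distrib_left mult_ac)
      also have "\<dots> = (\<Sum>\<kappa>\<in>J. k * (G (dl a) e c f (d,\<beta>,\<kappa>) (b,\<psi>,\<mu>) * (\<Sum>\<nu>\<in>J. D a f d \<nu> \<kappa> * G a b c d (f,\<mu>',\<nu>) (e,\<alpha>',\<beta>))))"
        by (subst sum.swap) (simp only: sum_distrib_left)
      finally show ?thesis unfolding G1 .
    qed
    have "(\<Sum>\<alpha>\<in>J. D a b e \<alpha> \<psi> * S \<alpha>) = (\<Sum>j\<in>II. k * (G (dl a) e c f j (b,\<psi>,\<mu>) * (\<Sum>\<psi>'\<in>J. D a b e \<alpha>' \<psi>' * F (dl a) e c f (b,\<psi>',\<mu>') j)))"
      unfolding sw inner sum_II ..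
    also have "\<dots> = (\<Sum>\<psi>'\<in>J. k * D a b e \<alpha>' \<psi>' * (\<Sum>j\<in>II. F (dl a) e c f (b,\<psi>',\<mu>') j * G (dl a) e c f j (b,\<psi>,\<mu>)))"
      unfolding sum_distrib_left by (subst sum.swap) (simp add: mult_ac)
    also have "\<dots> = (\<Sum>\<psi>'\<in>J. if \<psi>' = \<psi> then (if \<mu> = \<mu>' \<and> \<mu> < N b c f then k * D a b e \<alpha>' \<psi> else 0) else 0)"
      using D_eq_0 by (intro sum.cong refl) (auto simp: FG_II chiL_def N_rot[of a e b] N_cyc)
    also have "\<dots> = (if \<mu> = \<mu>' \<and> \<mu> < N b c f then k * D a b e \<alpha>' \<psi> else 0)"
      using D_eq_0[of \<alpha>' a b e \<psi>] J_range[of \<psi> "dl a" e b] by (auto simp: finJ)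
    finally show ?thesis .
  qed
  have S0: "S \<alpha> = 0" if "\<not> \<alpha> < N a b e" for \<alpha>
    using that by (simp add: S_def F_eq_0)
  \<comment> \<open>The contraction with \<open>D\<close> is undone by inserting
    \<open>D Di = 1\<close>.\<close>
  have "S \<alpha> = (\<Sum>\<alpha>1\<in>J. if \<alpha>1 = \<alpha> then S \<alpha> else 0)"
    using S0[of \<alpha>] J_range[of \<alpha> a b e] by (auto simp: finJ)
  also have "\<dots> = (\<Sum>\<alpha>1\<in>J. S \<alpha>1 * (\<Sum>\<psi>\<in>J. D a b e \<alpha>1 \<psi> * Di a b e \<psi> \<alpha>))"
    by (rule sum.cong[OF refl]) (auto simp: D_Di S0)
  also have "\<dots> = (\<Sum>\<psi>\<in>J. (\<Sum>\<alpha>1\<in>J. D a b e \<alpha>1 \<psi> * S \<alpha>1) * Di a b e \<psi> \<alpha>)"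
    unfolding sum_distrib_left sum_distrib_right by (subst sum.swap) (simp add: mult_ac)
  also have "\<dots> = (if \<mu> = \<mu>' \<and> \<mu> < N b c f then k * (\<Sum>\<psi>\<in>J. D a b e \<alpha>' \<psi> * Di a b e \<psi> \<alpha>) else 0)"
    unfolding DS if_times sum_if_const by (simp add: sum_distrib_left mult.assoc)
  also have "\<dots> = (if \<alpha> = \<alpha>' \<and> \<alpha> < N a b e \<and> \<mu> = \<mu>' \<and> \<mu> < N b c f then k else 0)"
    by (auto simp: D_Di)
  finally show ?thesis unfolding S_def k_def .
qed

text \<open>The pentagon for \<open>dl d, a, b, c\<close> with total charge \<open>u\<close>.
  Rotating by \<open>B\<close> trades the total charge \<open>d\<close> of the associator of
  \<open>a, b, c\<close> for the total charge \<open>dl c\<close> of the associator of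
  \<open>dl d, a, b\<close>; the next two lemmas solve this for either inverse.\<close>

lemma rot_total: "(\<Sum>j\<in>II. F (dl d) a b (dl c) (x,\<alpha>,\<beta>) j * (case j of (h,\<sigma>,\<psi>) \<Rightarrow> \<Sum>\<rho>\<in>J. B (dl d) h c \<psi> \<rho> * F a b c d (h,\<sigma>,\<rho>) (l,\<delta>,\<tau>))) =
  (if x = dl l then B x b c \<beta> \<delta> * B (dl d) a l \<alpha> \<tau> else 0)"
proof -
  have "(\<Sum>\<nu>\<in>J. F x b c u (dl c,\<beta>,0) (l,\<delta>,\<nu>) * F (dl d) a l u (x,\<alpha>,\<nu>) (d,\<tau>,0)) =
     (if x = dl l then B x b c \<beta> \<delta> * B (dl d) a l \<alpha> \<tau> else 0)"
    by (auto simp: F_total_u dl_dl delta_simps finJ zJ)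
  then show ?thesis
    unfolding pent by (simp add: sum_II F_total_u dl_dl sum_distrib_left mult.assoc)
qed

lemma rot_total_G:
  "(\<Sum>\<alpha>\<in>J. \<Sum>\<beta>\<in>J. G (dl d) a b (dl c) (e,\<sigma>,\<psi>) (dl l,\<alpha>,\<beta>) * (B (dl l) b c \<beta> \<delta> * B (dl d) a l \<alpha> \<tau>)) =
   (\<Sum>\<rho>\<in>J. B (dl d) e c \<psi> \<rho> * F a b c d (e,\<sigma>,\<rho>) (l,\<delta>,\<tau>))"
proof -
  define C where "C = (\<lambda>(h,\<sigma>,\<psi>). \<Sum>\<rho>\<in>J. B (dl d) h c \<psi> \<rho> * F a b c d (h,\<sigma>,\<rho>) (l,\<delta>,\<tau>))"
  define L where "L = (\<lambda>(x,\<alpha>,\<beta>). if x = dl l then B x b c \<beta> \<delta> * B (dl d) a l \<alpha> \<tau> else 0)"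
  have "L i = (\<Sum>j\<in>II. F (dl d) a b (dl c) i j * C j)" for i
    by (cases i) (simp add: L_def C_def rot_total)
  from F_to_G'[OF this, of "(e,\<sigma>,\<psi>)"]
  have "(\<Sum>i\<in>II. G (dl d) a b (dl c) (e,\<sigma>,\<psi>) i * L i) = (if chiR (dl d) a b (dl c) (e,\<sigma>,\<psi>) then C (e,\<sigma>,\<psi>) else 0)" .
  moreover have "C (e,\<sigma>,\<psi>) = 0" if "\<not> chiR (dl d) a b (dl c) (e,\<sigma>,\<psi>)"
  proof -
    have "B (dl d) e c \<psi> \<rho> * F a b c d (e,\<sigma>,\<rho>) (l,\<delta>,\<tau>) = 0" for \<rho>
      using that B_eq_0[of \<psi> "dl d" e c \<rho>] F_eq_0[of \<sigma> a b e \<rho> c d \<delta> l \<tau>] by (auto simp: chiR_def)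
    then show ?thesis unfolding C_def prod.case by (intro sum.neutral) blast
  qed
  moreover have "(\<Sum>i\<in>II. G (dl d) a b (dl c) (e,\<sigma>,\<psi>) i * L i) =
     (\<Sum>x\<in>UNIV. if x = dl l then (\<Sum>\<alpha>\<in>J. \<Sum>\<beta>\<in>J. G (dl d) a b (dl c) (e,\<sigma>,\<psi>) (dl l,\<alpha>,\<beta>) * (B (dl l) b c \<beta> \<delta> * B (dl d) a l \<alpha> \<tau>)) else 0)"
    unfolding sum_II by (intro sum.cong refl) (auto simp: L_def)
  ultimately show ?thesis by (auto simp: C_def)
qed

lemma rot_total_F:
  "(\<Sum>\<tau>\<in>J. \<Sum>\<delta>\<in>J. B (dl d) a f \<alpha> \<tau> * (B (dl f) b c \<beta> \<delta> * G a b c d (f,\<delta>,\<tau>) (e,\<sigma>,\<rho>))) =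
   (\<Sum>\<psi>\<in>J. F (dl d) a b (dl c) (dl f,\<alpha>,\<beta>) (e,\<sigma>,\<psi>) * B (dl d) e c \<psi> \<rho>)"
proof -
  define C where "C = (\<lambda>(h,\<sigma>,\<rho>). \<Sum>\<psi>\<in>J. F (dl d) a b (dl c) (dl f,\<alpha>,\<beta>) (h,\<sigma>,\<psi>) * B (dl d) h c \<psi> \<rho>)"
  define L where "L = (\<lambda>(l,\<delta>,\<tau>). if l = f then B (dl f) b c \<beta> \<delta> * B (dl d) a f \<alpha> \<tau> else 0)"
  have "L j = (\<Sum>i\<in>II. C i * F a b c d i j)" for j
  proof (cases j)
    case (fields l \<delta> \<tau>)
    have "L j = (if dl f = dl l then B (dl f) b c \<beta> \<delta> * B (dl d) a l \<alpha> \<tau> else 0)"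
      by (auto simp: L_def fields dl_eq)
    also have "\<dots> = (\<Sum>h\<in>UNIV. \<Sum>\<sigma>\<in>J. \<Sum>\<psi>\<in>J. F (dl d) a b (dl c) (dl f,\<alpha>,\<beta>) (h,\<sigma>,\<psi>) * (\<Sum>\<rho>\<in>J. B (dl d) h c \<psi> \<rho> * F a b c d (h,\<sigma>,\<rho>) (l,\<delta>,\<tau>)))"
      unfolding rot_total[symmetric] sum_II by simp
    moreover have "(\<Sum>\<psi>\<in>J. F (dl d) a b (dl c) (dl f,\<alpha>,\<beta>) (h,\<sigma>,\<psi>) * (\<Sum>\<rho>\<in>J. B (dl d) h c \<psi> \<rho> * F a b c d (h,\<sigma>,\<rho>) (l,\<delta>,\<tau>))) =
        (\<Sum>\<rho>\<in>J. C (h,\<sigma>,\<rho>) * F a b c d (h,\<sigma>,\<rho>) j)" for h \<sigma>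
      unfolding sum_distrib_left by (subst sum.swap) (simp add: C_def fields sum_distrib_right mult.assoc)
    ultimately show ?thesis by (simp only: sum_II)
  qed
  from F_to_G[OF this, of "(e,\<sigma>,\<rho>)"]
  have "(\<Sum>j\<in>II. L j * G a b c d j (e,\<sigma>,\<rho>)) = (if chiL a b c d (e,\<sigma>,\<rho>) then C (e,\<sigma>,\<rho>) else 0)" .
  moreover have "C (e,\<sigma>,\<rho>) = 0" if "\<not> chiL a b c d (e,\<sigma>,\<rho>)"
  proof -
    have "F (dl d) a b (dl c) (dl f,\<alpha>,\<beta>) (e,\<sigma>,\<psi>) * B (dl d) e c \<psi> \<rho> = 0" for \<psi>
      using that B_eq_0[of \<psi> "dl d" e c \<rho>] F_eq_0[of \<alpha> "dl d" a "dl f" \<beta> b "dl c" \<sigma> e \<psi>] by (auto simp: chiL_def dl_dl)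
    then show ?thesis unfolding C_def prod.case by (intro sum.neutral) blast
  qed
  moreover have "(\<Sum>j\<in>II. L j * G a b c d j (e,\<sigma>,\<rho>)) =
     (\<Sum>l\<in>UNIV. if l = f then (\<Sum>\<delta>\<in>J. \<Sum>\<tau>\<in>J. B (dl d) a f \<alpha> \<tau> * (B (dl f) b c \<beta> \<delta> * G a b c d (f,\<delta>,\<tau>) (e,\<sigma>,\<rho>))) else 0)"
    unfolding sum_II by (intro sum.cong refl) (auto simp: L_def mult_ac)
  ultimately have "(\<Sum>\<delta>\<in>J. \<Sum>\<tau>\<in>J. B (dl d) a f \<alpha> \<tau> * (B (dl f) b c \<beta> \<delta> * G a b c d (f,\<delta>,\<tau>) (e,\<sigma>,\<rho>))) = C (e,\<sigma>,\<rho>)"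
    by auto
  then show ?thesis by (subst sum.swap) (simp add: C_def)
qed

text \<open>The analogue of \<open>avg_total\<close> with \<open>c\<close> summed and
  \<open>d\<close> fixed. A rotation makes \<open>dl c\<close> a total charge, which explains the
  weight \<open>w (dl c)\<close>; the rotations \<open>B\<close> on the internal vertices cancel
  inside the trace, and the sum becomes \<open>avg_total\<close> for
  \<open>dl d, a, b\<close>.\<close>

lemma avg_third: "(\<Sum>c\<in>UNIV. \<Sum>\<beta>\<in>J. \<Sum>\<mu>\<in>J. w (dl c) * (F a b c d (e,\<alpha>,\<beta>) (f,\<mu>,\<nu>) * G a b c d (f,\<mu>,\<nu>') (e,\<alpha>',\<beta>))) =
  (if \<alpha> = \<alpha>' \<and> \<alpha> < N a b e \<and> \<nu> = \<nu>' \<and> \<nu> < N a f d then w (dl f) * w e / w a else 0)"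
proof -
  define Ph where "Ph c \<nu> = (\<lambda>\<beta> \<mu>. F a b c d (e,\<alpha>,\<beta>) (f,\<mu>,\<nu>))" for c \<nu>
  define Ga where "Ga c \<nu> = (\<lambda>\<mu> \<beta>. G a b c d (f,\<mu>,\<nu>) (e,\<alpha>',\<beta>))" for c \<nu>
  define F1 where "F1 c \<alpha>1 = (\<lambda>\<beta>1 \<psi>. F (dl d) a b (dl c) (dl f,\<alpha>1,\<beta>1) (e,\<alpha>',\<psi>))" for c \<alpha>1
  define G1 where "G1 c \<alpha>1 = (\<lambda>\<psi> \<beta>1. G (dl d) a b (dl c) (e,\<alpha>,\<psi>) (dl f,\<alpha>1,\<beta>1))" for c \<alpha>1
  define k where "k = w (dl f) * w e / w a"
  let ?b = "B (dl d) a f"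
  define S where "S \<nu>' = (\<Sum>c\<in>UNIV. w (dl c) * tr (mm (Ph c \<nu>) (Ga c \<nu>')))" for \<nu>'
  have S: "S \<nu>' = (\<Sum>c\<in>UNIV. \<Sum>\<beta>\<in>J. \<Sum>\<mu>\<in>J. w (dl c) * (F a b c d (e,\<alpha>,\<beta>) (f,\<mu>,\<nu>) * G a b c d (f,\<mu>,\<nu>') (e,\<alpha>',\<beta>)))" for \<nu>'
    by (simp add: S_def tr_def mm_def Ph_def Ga_def sum_distrib_left)
  have R1: "mm (B (dl d) e c) (Ph c \<nu>) = (\<lambda>i j. \<Sum>\<alpha>2\<in>J. ?b \<alpha>2 \<nu> * mm (G1 c \<alpha>2) (B (dl f) b c) i j)" for c \<nu>
    using rot_total_G[of d a b c e \<alpha> _ f _ \<nu>]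
    by (simp add: fun_eq_iff mm_def Ph_def G1_def sum_distrib_left mult_ac)
  have R2: "(\<lambda>i j. \<Sum>\<tau>\<in>J. ?b \<alpha>1 \<tau> * mm (B (dl f) b c) (Ga c \<tau>) i j) = mm (F1 c \<alpha>1) (B (dl d) e c)" for c \<alpha>1
    using rot_total_F[of d a f \<alpha>1 b c _ e \<alpha>']
    by (simp add: fun_eq_iff mm_def Ga_def F1_def sum_distrib_left mult_ac)
  have Ga: "Ga c \<tau> = mm (Bi (dl f) b c) (mm (B (dl f) b c) (Ga c \<tau>))" for c \<tau>
  proof -
    have "mm (im (N b c f)) (Ga c \<tau>) = Ga c \<tau>"
      by (rule mm_im1) (use range_J G_eq_0 in \<open>unfold Ga_def, blast+\<close>)
    then show ?thesis by (simp add: mm_assoc[symmetric] mm_Bi_B dl_dl)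
  qed
  have tr_lin: "tr (mm A (\<lambda>i j. \<Sum>k\<in>J. x k * M k i j)) = (\<Sum>k\<in>J. x k * tr (mm A (M k)))" for A x M
  proof -
    have "tr (mm A (\<lambda>i j. \<Sum>k\<in>J. x k * M k i j)) = (\<Sum>i\<in>J. \<Sum>j\<in>J. \<Sum>k\<in>J. x k * (A i j * M k j i))"
      by (simp add: tr_def mm_def sum_distrib_left mult_ac)
    also have "\<dots> = (\<Sum>i\<in>J. \<Sum>k\<in>J. \<Sum>j\<in>J. x k * (A i j * M k j i))"
      by (rule sum.cong[OF refl], rule sum.swap)
    also have "\<dots> = (\<Sum>k\<in>J. x k * tr (mm A (M k)))"
      by (subst sum.swap) (simp add: tr_def mm_def sum_distrib_left)
    finally show ?thesis .
  qed
  have step: "(\<Sum>\<tau>\<in>J. ?b \<alpha>1 \<tau> * tr (mm (Ph c \<nu>) (Ga c \<tau>))) = (\<Sum>\<alpha>2\<in>J. ?b \<alpha>2 \<nu> * tr (mm (F1 c \<alpha>1) (G1 c \<alpha>2)))" for c \<alpha>1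
  proof -
    have tr2: "tr (mm (mm (Bi (dl f) b c) (F1 c \<alpha>1)) (mm (G1 c \<alpha>2) (B (dl f) b c))) = tr (mm (F1 c \<alpha>1) (G1 c \<alpha>2))" for \<alpha>2
    proof -
      have "tr (mm (mm (Bi (dl f) b c) (F1 c \<alpha>1)) (mm (G1 c \<alpha>2) (B (dl f) b c))) = tr (mm (F1 c \<alpha>1) (mm (G1 c \<alpha>2) (mm (B (dl f) b c) (Bi (dl f) b c))))"
        by (metis mm_assoc tr_mm)
      also have "mm (G1 c \<alpha>2) (mm (B (dl f) b c) (Bi (dl f) b c)) = G1 c \<alpha>2"
        unfolding mm_B_Bi by (rule mm_im2) (use range_J G_eq_0 in \<open>unfold G1_def, blast+\<close>)
      finally show ?thesis .
    qed
    have "(\<Sum>\<tau>\<in>J. ?b \<alpha>1 \<tau> * tr (mm (Ph c \<nu>) (Ga c \<tau>))) = (\<Sum>\<tau>\<in>J. ?b \<alpha>1 \<tau> * tr (mm (mm (Ph c \<nu>) (Bi (dl f) b c)) (mm (B (dl f) b c) (Ga c \<tau>))))"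
      by (subst Ga) (simp only: mm_assoc)
    also have "\<dots> = tr (mm (mm (Ph c \<nu>) (Bi (dl f) b c)) (mm (F1 c \<alpha>1) (B (dl d) e c)))"
      unfolding tr_lin[symmetric] R2 ..
    also have "\<dots> = tr (mm (mm (Bi (dl f) b c) (F1 c \<alpha>1)) (mm (B (dl d) e c) (Ph c \<nu>)))"
      by (metis mm_assoc tr_mm)
    also have "\<dots> = (\<Sum>\<alpha>2\<in>J. ?b \<alpha>2 \<nu> * tr (mm (mm (Bi (dl f) b c) (F1 c \<alpha>1)) (mm (G1 c \<alpha>2) (B (dl f) b c))))"
      unfolding R1 tr_lin ..
    also have "\<dots> = (\<Sum>\<alpha>2\<in>J. ?b \<alpha>2 \<nu> * tr (mm (F1 c \<alpha>1) (G1 c \<alpha>2)))"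
      unfolding tr2 ..
    finally show ?thesis .
  qed
  have total: "(\<Sum>c\<in>UNIV. w (dl c) * tr (mm (F1 c \<alpha>1) (G1 c \<alpha>2))) =
     (if \<alpha>1 = \<alpha>2 \<and> \<alpha>1 < N (dl d) a (dl f) \<and> \<alpha> = \<alpha>' \<and> \<alpha> < N a b e then k else 0)" for \<alpha>1 \<alpha>2
  proof -
    define H where "H c = w c * (\<Sum>\<beta>\<in>J. \<Sum>\<psi>\<in>J. F (dl d) a b c (dl f,\<alpha>1,\<beta>) (e,\<alpha>',\<psi>) * G (dl d) a b c (e,\<alpha>,\<psi>) (dl f,\<alpha>2,\<beta>))" for c
    have "(\<Sum>c\<in>UNIV. w (dl c) * tr (mm (F1 c \<alpha>1) (G1 c \<alpha>2))) = (\<Sum>c\<in>UNIV. H (dl c))"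
      by (simp add: H_def tr_def mm_def F1_def G1_def)
    also have "\<dots> = (\<Sum>c\<in>UNIV. H c)"
      by (rule sum.reindex_bij_witness[of _ dl dl]) (auto simp: dl_dl)
    also have "\<dots> = (if \<alpha>1 = \<alpha>2 \<and> \<alpha>1 < N (dl d) a (dl f) \<and> \<alpha> = \<alpha>' \<and> \<alpha> < N a b e then k else 0)"
      using avg_total[of "dl d" a b "dl f" \<alpha>1 e \<alpha>' \<alpha> \<alpha>2] by (auto simp: H_def k_def sum_distrib_left)
    finally show ?thesis .
  qed
  have bS: "(\<Sum>\<tau>\<in>J. ?b \<alpha>1 \<tau> * S \<tau>) = (if \<alpha> = \<alpha>' \<and> \<alpha> < N a b e then k * ?b \<alpha>1 \<nu> else 0)" for \<alpha>1
  proof -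
    have "(\<Sum>\<tau>\<in>J. ?b \<alpha>1 \<tau> * S \<tau>) = (\<Sum>c\<in>UNIV. w (dl c) * (\<Sum>\<tau>\<in>J. ?b \<alpha>1 \<tau> * tr (mm (Ph c \<nu>) (Ga c \<tau>))))"
      unfolding S_def sum_distrib_left by (subst sum.swap) (simp add: mult_ac)
    also have "\<dots> = (\<Sum>\<alpha>2\<in>J. ?b \<alpha>2 \<nu> * (\<Sum>c\<in>UNIV. w (dl c) * tr (mm (F1 c \<alpha>1) (G1 c \<alpha>2))))"
      unfolding step sum_distrib_left by (subst sum.swap) (simp add: mult_ac)
    also have "\<dots> = (\<Sum>\<alpha>2\<in>J. if \<alpha>2 = \<alpha>1 then (if \<alpha> = \<alpha>' \<and> \<alpha> < N a b e then k * ?b \<alpha>1 \<nu> else 0) else 0)"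
      unfolding total using B_eq_0[of \<alpha>1 "dl d" a f \<nu>] by (intro sum.cong refl) auto
    also have "\<dots> = (if \<alpha> = \<alpha>' \<and> \<alpha> < N a b e then k * ?b \<alpha>1 \<nu> else 0)"
      using B_eq_0[of \<alpha>1 "dl d" a f \<nu>] J_range[of \<alpha>1 "dl d" a "dl f"] by (auto simp: finJ)
    finally show ?thesis .
  qed
  have S0: "S \<tau> = 0" if "\<not> \<tau> < N a f d" for \<tau>
    using that unfolding S by (simp add: G_eq_0)
  have "S \<nu>' = (\<Sum>\<tau>\<in>J. if \<tau> = \<nu>' then S \<nu>' else 0)"
    using S0[of \<nu>'] J_range[of \<nu>' a f d] by (auto simp: finJ)
  also have "\<dots> = (\<Sum>\<tau>\<in>J. (\<Sum>\<alpha>1\<in>J. Bi (dl d) a f \<nu>' \<alpha>1 * ?b \<alpha>1 \<tau>) * S \<tau>)"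
    by (rule sum.cong[OF refl]) (auto simp: Bi_B S0 dl_dl)
  also have "\<dots> = (\<Sum>\<alpha>1\<in>J. Bi (dl d) a f \<nu>' \<alpha>1 * (\<Sum>\<tau>\<in>J. ?b \<alpha>1 \<tau> * S \<tau>))"
    unfolding sum_distrib_left sum_distrib_right by (subst sum.swap) (simp add: mult_ac)
  also have "\<dots> = (if \<alpha> = \<alpha>' \<and> \<alpha> < N a b e then k * (\<Sum>\<alpha>1\<in>J. Bi (dl d) a f \<nu>' \<alpha>1 * ?b \<alpha>1 \<nu>) else 0)"
    unfolding bS times_if sum_if_const by (simp add: sum_distrib_left mult_ac)
  also have "\<dots> = (if \<alpha> = \<alpha>' \<and> \<alpha> < N a b e \<and> \<nu> = \<nu>' \<and> \<nu> < N a f d then k else 0)"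
    by (auto simp: Bi_B dl_dl)
  finally show ?thesis unfolding S k_def .
qed

text \<open>\<open>avg_total\<close> with \<open>b = u\<close>, where \<open>F\<close> is trivial
  and the sum merely counts the basis vectors of \<open>V\<^sub>a\<^sub>c\<^sup>d\<close>. Thus
  \<open>w\<close> is a character of the fusion ring.\<close>

lemma w_char: "w a * w c = (\<Sum>d\<in>UNIV. of_nat (N a c d) * w d)"
proof -
  have G1: "G a u c d (c,0,\<beta>) (a,0,\<beta>) = 1" if "\<beta> < N a c d" for d \<beta>
    using FG[of a u c d a 0 \<beta> a 0 \<beta>] that J_range[of \<beta> a c d]
    by (simp add: F_unit2 if_conj delta_simps finJ zJ N_unit2)
  have "w a * w c = (\<Sum>d\<in>UNIV. \<Sum>\<beta>\<in>J. \<Sum>\<nu>\<in>J. w d * (F a u c d (a,0,\<beta>) (c,0,\<nu>) * G a u c d (c,0,\<nu>) (a,0,\<beta>)))"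
    by (simp add: avg_total N_unit1 N_unit2 w_u)
  also have "(\<lambda>d. \<Sum>\<beta>\<in>J. \<Sum>\<nu>\<in>J. w d * (F a u c d (a,0,\<beta>) (c,0,\<nu>) * G a u c d (c,0,\<nu>) (a,0,\<beta>))) = (\<lambda>d. of_nat (N a c d) * w d)"
  proof
    fix d
    have "(\<Sum>\<beta>\<in>J. \<Sum>\<nu>\<in>J. w d * (F a u c d (a,0,\<beta>) (c,0,\<nu>) * G a u c d (c,0,\<nu>) (a,0,\<beta>))) = (\<Sum>\<beta>\<in>J. if \<beta> < N a c d then w d else 0)"
      by (rule sum.cong[OF refl]) (auto simp: F_unit2 if_conj delta_simps finJ zJ G1)
    also have "\<dots> = (\<Sum>\<beta>\<in>{..<N a c d}. w d)"
      using J_range[of _ a c d] by (intro sum.mono_neutral_cong_right) (auto simp: finJ)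
    finally show "(\<Sum>\<beta>\<in>J. \<Sum>\<nu>\<in>J. w d * (F a u c d (a,0,\<beta>) (c,0,\<nu>) * G a u c d (c,0,\<nu>) (a,0,\<beta>))) = of_nat (N a c d) * w d"
      by simp
  qed
  finally show ?thesis .
qed

definition Dim where "Dim = (\<Sum>c\<in>UNIV. w (dl c) * w c)"

lemma w_norm: "(\<Sum>c\<in>UNIV. w c * cnj (w c)) \<noteq> 0"
proof -
  have "(\<Sum>c\<in>UNIV. w c * cnj (w c)) = of_real (\<Sum>c\<in>UNIV. (cmod (w c))\<^sup>2)"
    by (simp add: complex_norm_square del: of_real_power)
  moreover have "(\<Sum>c\<in>UNIV. (cmod (w c))\<^sup>2) > 0"
    by (rule sum_pos) (auto simp: w_nz)
  ultimately show ?thesis by (metis of_real_eq_0_iff less_irrefl)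
qed

text \<open>The sum of \<open>w a * w c * cnj (w c)\<close> over \<open>c\<close> is expanded by the
  character property; \<open>N_rot\<close> moves \<open>a\<close> to the conjugated factor, where
  the property is used backwards. \<open>Dim\<close> is therefore a squared norm, whatever the signs
  of the dimensions.\<close>

lemma w_dl: "w (dl a) = cnj (w a)"
proof -
  define M where "M = (\<Sum>c\<in>UNIV. w c * cnj (w c))"
  have "w a * M = (\<Sum>c\<in>UNIV. (w a * w c) * cnj (w c))" by (simp add: M_def sum_distrib_left mult.assoc)
  also have "\<dots> = (\<Sum>c\<in>UNIV. \<Sum>d\<in>UNIV. of_nat (N a c d) * w d * cnj (w c))"
    by (simp add: w_char sum_distrib_right)
  also have "\<dots> = (\<Sum>d\<in>UNIV. w d * cnj (\<Sum>c\<in>UNIV. of_nat (N (dl a) d c) * w c))"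
    by (subst sum.swap) (simp add: sum_distrib_left N_rot mult_ac)
  also have "\<dots> = cnj (w (dl a)) * M"
    by (simp add: w_char[symmetric] M_def sum_distrib_left mult_ac)
  finally show ?thesis using w_norm by (simp add: M_def)
qed

lemma Dim_nz: "Dim \<noteq> 0" using w_norm by (simp add: Dim_def w_dl mult.commute)

text \<open>\<open>Xd\<close> is a 2-cocycle of the Davydov-Yetter complex, and the proof is an
  explicit contracting homotopy. The derivation law is multiplied by \<open>G\<close> and summed
  over everything except the labels of the vertex \<open>a b \<rightarrow> e\<close>, with weight
  \<open>W c d\<close>; the four terms become \<open>Xd * Dim\<close> and the multiples of
  \<open>Y e\<close>, \<open>Y b\<close> and \<open>Y a\<close>.\<close>

theorem coboundary:
  assumes Xd_supp: "\<And>a b c i j. Xd a b c i j \<noteq> 0 \<Longrightarrow> i < N a b c \<and> j < N a b c"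
    and der: "\<And>a b c d e \<alpha> \<beta> f \<mu> \<nu>.
      (\<Sum>\<alpha>'\<in>J. Xd a b e \<alpha> \<alpha>' * F a b c d (e,\<alpha>',\<beta>) (f,\<mu>,\<nu>)) + (\<Sum>\<beta>'\<in>J. Xd e c d \<beta> \<beta>' * F a b c d (e,\<alpha>,\<beta>') (f,\<mu>,\<nu>)) =
      (\<Sum>\<mu>'\<in>J. F a b c d (e,\<alpha>,\<beta>) (f,\<mu>',\<nu>) * Xd b c f \<mu>' \<mu>) + (\<Sum>\<nu>'\<in>J. F a b c d (e,\<alpha>,\<beta>) (f,\<mu>,\<nu>') * Xd a f d \<nu>' \<nu>)"
  shows "\<exists>y. \<forall>a b e \<alpha> \<alpha>'. Xd a b e \<alpha> \<alpha>' = (if \<alpha> = \<alpha>' \<and> \<alpha> < N a b e then y a + y b - y e else (0::complex))"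
proof -
  have Xd0: "Xd a b c i j = 0" if "\<not> (i < N a b c \<and> j < N a b c)" for a b c i j
    using that Xd_supp by blast
  \<comment> \<open>The homotopy: weighted traces of the derivation over all vertices with left leg
    \<open>e\<close>.\<close>
  define Y where "Y e = (\<Sum>c\<in>UNIV. \<Sum>d\<in>UNIV. w (dl c) * w d / w e * (\<Sum>\<beta>\<in>J. Xd e c d \<beta> \<beta>))" for e
  have "Xd a b e \<alpha> \<alpha>'' * Dim = (if \<alpha> = \<alpha>'' \<and> \<alpha> < N a b e then Y a + Y b - Y e else 0)" for a b e \<alpha> \<alpha>''
  proof -
    define P where "P = (if \<alpha> = \<alpha>'' \<and> \<alpha> < N a b e then 1 else 0::complex)"
    define W where "W c d = w (dl c) * w d / w e" for c d
    define g where "g c d f \<mu> \<nu> \<beta> = G a b c d (f,\<mu>,\<nu>) (e,\<alpha>'',\<beta>)" for c d f \<mu> \<nu> \<beta>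
    define h where "h c d \<alpha> \<beta> f \<mu> \<nu> = F a b c d (e,\<alpha>,\<beta>) (f,\<mu>,\<nu>)" for c d \<alpha> \<beta> f \<mu> \<nu>
    have FG': "(\<Sum>f\<in>UNIV. \<Sum>\<mu>\<in>J. \<Sum>\<nu>\<in>J. h c d \<alpha>1 \<beta>1 f \<mu> \<nu> * g c d f \<mu> \<nu> \<beta>) =
       (if \<alpha>1 = \<alpha>'' \<and> \<beta>1 = \<beta> \<and> \<alpha>1 < N a b e \<and> \<beta>1 < N e c d then 1 else 0)" for c d \<alpha>1 \<beta>1 \<beta>
      unfolding h_def g_def FG by auto
    define T1 where "T1 c d = (\<Sum>\<beta>\<in>J. \<Sum>f\<in>UNIV. \<Sum>\<mu>\<in>J. \<Sum>\<nu>\<in>J. (\<Sum>\<alpha>'\<in>J. Xd a b e \<alpha> \<alpha>' * h c d \<alpha>' \<beta> f \<mu> \<nu>) * g c d f \<mu> \<nu> \<beta>)" for c d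
    define T2 where "T2 c d = (\<Sum>\<beta>\<in>J. \<Sum>f\<in>UNIV. \<Sum>\<mu>\<in>J. \<Sum>\<nu>\<in>J. (\<Sum>\<beta>'\<in>J. Xd e c d \<beta> \<beta>' * h c d \<alpha> \<beta>' f \<mu> \<nu>) * g c d f \<mu> \<nu> \<beta>)" for c d
    define T3 where "T3 c d = (\<Sum>\<beta>\<in>J. \<Sum>f\<in>UNIV. \<Sum>\<mu>\<in>J. \<Sum>\<nu>\<in>J. (\<Sum>\<mu>'\<in>J. h c d \<alpha> \<beta> f \<mu>' \<nu> * Xd b c f \<mu>' \<mu>) * g c d f \<mu> \<nu> \<beta>)" for c d
    define T4 where "T4 c d = (\<Sum>\<beta>\<in>J. \<Sum>f\<in>UNIV. \<Sum>\<mu>\<in>J. \<Sum>\<nu>\<in>J. (\<Sum>\<nu>'\<in>J. h c d \<alpha> \<beta> f \<mu> \<nu>' * Xd a f d \<nu>' \<nu>) * g c d f \<mu> \<nu> \<beta>)" for c d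
    have T: "T1 c d + T2 c d = T3 c d + T4 c d" for c d
    proof -
      have add: "(\<Sum>\<beta>\<in>J. \<Sum>f\<in>UNIV. \<Sum>\<mu>\<in>J. \<Sum>\<nu>\<in>J. A \<beta> f \<mu> \<nu> * g c d f \<mu> \<nu> \<beta>) + (\<Sum>\<beta>\<in>J. \<Sum>f\<in>UNIV. \<Sum>\<mu>\<in>J. \<Sum>\<nu>\<in>J. A' \<beta> f \<mu> \<nu> * g c d f \<mu> \<nu> \<beta>)
        = (\<Sum>\<beta>\<in>J. \<Sum>f\<in>UNIV. \<Sum>\<mu>\<in>J. \<Sum>\<nu>\<in>J. (A \<beta> f \<mu> \<nu> + A' \<beta> f \<mu> \<nu>) * g c d f \<mu> \<nu> \<beta>)" for A A'
        by (simp only: distrib_right sum.distrib)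
      show ?thesis unfolding T1_def T2_def T3_def T4_def add h_def der ..
    qed
    have e1: "T1 c d = Xd a b e \<alpha> \<alpha>'' * of_nat (N e c d)" for c d
    proof -
      have "(\<Sum>f\<in>UNIV. \<Sum>\<mu>\<in>J. \<Sum>\<nu>\<in>J. (\<Sum>\<alpha>'\<in>J. Xd a b e \<alpha> \<alpha>' * h c d \<alpha>' \<beta> f \<mu> \<nu>) * g c d f \<mu> \<nu> \<beta>)
         = (if \<beta> < N e c d then Xd a b e \<alpha> \<alpha>'' else 0)" for \<beta>
      proof -
        have "(\<Sum>f\<in>UNIV. \<Sum>\<mu>\<in>J. \<Sum>\<nu>\<in>J. (\<Sum>\<alpha>'\<in>J. Xd a b e \<alpha> \<alpha>' * h c d \<alpha>' \<beta> f \<mu> \<nu>) * g c d f \<mu> \<nu> \<beta>)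
          = (\<Sum>\<alpha>'\<in>J. Xd a b e \<alpha> \<alpha>' * (\<Sum>f\<in>UNIV. \<Sum>\<mu>\<in>J. \<Sum>\<nu>\<in>J. h c d \<alpha>' \<beta> f \<mu> \<nu> * g c d f \<mu> \<nu> \<beta>))"
          unfolding sum_distrib_left sum_distrib_right sum_rotate4[of _ J] by (simp only: mult.assoc)
        also have "\<dots> = (\<Sum>\<alpha>'\<in>J. if \<alpha>' = \<alpha>'' then (if \<beta> < N e c d then Xd a b e \<alpha> \<alpha>'' else 0) else 0)"
          unfolding FG' using Xd_supp[of a b e \<alpha> \<alpha>''] by (intro sum.cong refl) auto
        also have "\<dots> = (if \<beta> < N e c d then Xd a b e \<alpha> \<alpha>'' else 0)"
          using Xd_supp[of a b e \<alpha> \<alpha>''] J_range[of \<alpha>'' a b e] by (auto simp: finJ)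
        finally show ?thesis .
      qed
      then have "T1 c d = (\<Sum>\<beta>\<in>J. if \<beta> < N e c d then Xd a b e \<alpha> \<alpha>'' else 0)" by (simp only: T1_def)
      also have "\<dots> = (\<Sum>\<beta>\<in>{..<N e c d}. Xd a b e \<alpha> \<alpha>'')"
        using J_range[of _ e c d] by (intro sum.mono_neutral_cong_right) (auto simp: finJ)
      finally show ?thesis by (simp add: mult.commute)
    qed
    have e2: "T2 c d = P * (\<Sum>\<beta>\<in>J. Xd e c d \<beta> \<beta>)" for c d
    proof -
      have "(\<Sum>f\<in>UNIV. \<Sum>\<mu>\<in>J. \<Sum>\<nu>\<in>J. (\<Sum>\<beta>'\<in>J. Xd e c d \<beta> \<beta>' * h c d \<alpha> \<beta>' f \<mu> \<nu>) * g c d f \<mu> \<nu> \<beta>)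
         = P * Xd e c d \<beta> \<beta>" if "\<beta> \<in> J" for \<beta>
      proof -
        have "(\<Sum>f\<in>UNIV. \<Sum>\<mu>\<in>J. \<Sum>\<nu>\<in>J. (\<Sum>\<beta>'\<in>J. Xd e c d \<beta> \<beta>' * h c d \<alpha> \<beta>' f \<mu> \<nu>) * g c d f \<mu> \<nu> \<beta>)
          = (\<Sum>\<beta>'\<in>J. Xd e c d \<beta> \<beta>' * (\<Sum>f\<in>UNIV. \<Sum>\<mu>\<in>J. \<Sum>\<nu>\<in>J. h c d \<alpha> \<beta>' f \<mu> \<nu> * g c d f \<mu> \<nu> \<beta>))"
          unfolding sum_distrib_left sum_distrib_right sum_rotate4[of _ J] by (simp only: mult.assoc)
        also have "\<dots> = (\<Sum>\<beta>'\<in>J. if \<beta>' = \<beta> then P * Xd e c d \<beta> \<beta> else 0)"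
          unfolding FG' P_def using Xd_supp[of e c d \<beta> \<beta>] by (intro sum.cong refl) auto
        also have "\<dots> = P * Xd e c d \<beta> \<beta>"
          using that by (simp add: finJ)
        finally show ?thesis .
      qed
      then show ?thesis by (simp add: T2_def sum_distrib_left)
    qed
    \<comment> \<open>At fixed \<open>c\<close> the sum over \<open>d\<close> is
      \<open>avg_total\<close>, which leaves the traces over the vertices
      \<open>b c \<rightarrow> f\<close>.\<close>
    have e3: "(\<Sum>d\<in>UNIV. W c d * T3 c d) = (\<Sum>d\<in>UNIV. P * (w (dl c) * w d / w b * (\<Sum>\<mu>\<in>J. Xd b c d \<mu> \<mu>)))" for c
    proof -
      have "(\<Sum>d\<in>UNIV. W c d * T3 c d) = (\<Sum>d\<in>UNIV. \<Sum>\<beta>\<in>J. \<Sum>f\<in>UNIV. \<Sum>\<mu>\<in>J. \<Sum>\<nu>\<in>J. \<Sum>\<mu>'\<in>J. w (dl c) / w e * (Xd b c f \<mu>' \<mu> * (w d * (h c d \<alpha> \<beta> f \<mu>' \<nu> * g c d f \<mu> \<nu> \<beta>))))"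
        unfolding T3_def W_def sum_distrib_left sum_distrib_right by (simp add: mult_ac)
      also have "\<dots> = (\<Sum>f\<in>UNIV. \<Sum>\<mu>\<in>J. \<Sum>\<mu>'\<in>J. \<Sum>d\<in>UNIV. \<Sum>\<beta>\<in>J. \<Sum>\<nu>\<in>J. w (dl c) / w e * (Xd b c f \<mu>' \<mu> * (w d * (h c d \<alpha> \<beta> f \<mu>' \<nu> * g c d f \<mu> \<nu> \<beta>))))"
        unfolding sum.cartesian_product
        by (rule sum.reindex_bij_witness[of _ "\<lambda>(f,\<mu>,\<mu>',d,\<beta>,\<nu>). (d,\<beta>,f,\<mu>,\<nu>,\<mu>')" "\<lambda>(d,\<beta>,f,\<mu>,\<nu>,\<mu>'). (f,\<mu>,\<mu>',d,\<beta>,\<nu>)"]) auto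
      also have "\<dots> = (\<Sum>f\<in>UNIV. \<Sum>\<mu>\<in>J. \<Sum>\<mu>'\<in>J. w (dl c) / w e * (Xd b c f \<mu>' \<mu> * (\<Sum>d\<in>UNIV. \<Sum>\<beta>\<in>J. \<Sum>\<nu>\<in>J. w d * (h c d \<alpha> \<beta> f \<mu>' \<nu> * g c d f \<mu> \<nu> \<beta>))))"
        by (simp only: sum_distrib_left)
      also have "\<dots> = (\<Sum>f\<in>UNIV. \<Sum>\<mu>\<in>J. \<Sum>\<mu>'\<in>J. if \<mu>' = \<mu> then P * (w (dl c) * w f / w b * Xd b c f \<mu> \<mu>) else 0)"
        unfolding h_def g_def avg_total P_def
        by (intro sum.cong refl) (use w_nz in \<open>auto simp: field_simps Xd0\<close>)
      also have "\<dots> = (\<Sum>f\<in>UNIV. \<Sum>\<mu>\<in>J. P * (w (dl c) * w f / w b * Xd b c f \<mu> \<mu>))"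
        by (simp add: finJ)
      finally show ?thesis by (simp only: sum_distrib_left)
    qed
    \<comment> \<open>At fixed \<open>d\<close> the sum over \<open>c\<close> is
      \<open>avg_third\<close>; the factor \<open>w (dl c)\<close> of \<open>W\<close> is made for
      this.\<close>
    have e4: "(\<Sum>c\<in>UNIV. W c d * T4 c d) = (\<Sum>f\<in>UNIV. P * (w (dl f) * w d / w a * (\<Sum>\<nu>\<in>J. Xd a f d \<nu> \<nu>)))" for d
    proof -
      have "(\<Sum>c\<in>UNIV. W c d * T4 c d) = (\<Sum>c\<in>UNIV. \<Sum>\<beta>\<in>J. \<Sum>f\<in>UNIV. \<Sum>\<mu>\<in>J. \<Sum>\<nu>\<in>J. \<Sum>\<nu>'\<in>J. w d / w e * (Xd a f d \<nu>' \<nu> * (w (dl c) * (h c d \<alpha> \<beta> f \<mu> \<nu>' * g c d f \<mu> \<nu> \<beta>))))"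
        unfolding T4_def W_def sum_distrib_left sum_distrib_right by (simp add: mult_ac)
      also have "\<dots> = (\<Sum>f\<in>UNIV. \<Sum>\<nu>\<in>J. \<Sum>\<nu>'\<in>J. \<Sum>c\<in>UNIV. \<Sum>\<beta>\<in>J. \<Sum>\<mu>\<in>J. w d / w e * (Xd a f d \<nu>' \<nu> * (w (dl c) * (h c d \<alpha> \<beta> f \<mu> \<nu>' * g c d f \<mu> \<nu> \<beta>))))"
        unfolding sum.cartesian_product
        by (rule sum.reindex_bij_witness[of _ "\<lambda>(f,\<nu>,\<nu>',c,\<beta>,\<mu>). (c,\<beta>,f,\<mu>,\<nu>,\<nu>')" "\<lambda>(c,\<beta>,f,\<mu>,\<nu>,\<nu>'). (f,\<nu>,\<nu>',c,\<beta>,\<mu>)"]) auto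
      also have "\<dots> = (\<Sum>f\<in>UNIV. \<Sum>\<nu>\<in>J. \<Sum>\<nu>'\<in>J. w d / w e * (Xd a f d \<nu>' \<nu> * (\<Sum>c\<in>UNIV. \<Sum>\<beta>\<in>J. \<Sum>\<mu>\<in>J. w (dl c) * (h c d \<alpha> \<beta> f \<mu> \<nu>' * g c d f \<mu> \<nu> \<beta>))))"
        by (simp only: sum_distrib_left)
      also have "\<dots> = (\<Sum>f\<in>UNIV. \<Sum>\<nu>\<in>J. \<Sum>\<nu>'\<in>J. if \<nu>' = \<nu> then P * (w (dl f) * w d / w a * Xd a f d \<nu> \<nu>) else 0)"
        unfolding h_def g_def avg_third P_def
        by (intro sum.cong refl) (use w_nz in \<open>auto simp: field_simps Xd0\<close>)
      also have "\<dots> = (\<Sum>f\<in>UNIV. \<Sum>\<nu>\<in>J. P * (w (dl f) * w d / w a * Xd a f d \<nu> \<nu>))"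
        by (simp add: finJ)
      finally show ?thesis by (simp only: sum_distrib_left)
    qed
    \<comment> \<open>The character property turns the sum over \<open>d\<close> into
      \<open>w e * w c\<close>, so that \<open>Dim\<close> remains.\<close>
    have s1: "(\<Sum>c\<in>UNIV. \<Sum>d\<in>UNIV. W c d * T1 c d) = Xd a b e \<alpha> \<alpha>'' * Dim"
    proof -
      have "(\<Sum>d\<in>UNIV. W c d * T1 c d) = Xd a b e \<alpha> \<alpha>'' * (w (dl c) * w c)" for c
      proof -
        have "(\<Sum>d\<in>UNIV. W c d * T1 c d) = Xd a b e \<alpha> \<alpha>'' * (w (dl c) / w e * (\<Sum>d\<in>UNIV. of_nat (N e c d) * w d))"
          unfolding e1 W_def sum_distrib_left by (simp add: mult_ac)
        then show ?thesis using w_nz[of e] by (simp add: w_char[symmetric])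
      qed
      then show ?thesis by (simp add: Dim_def sum_distrib_left)
    qed
    have s2: "(\<Sum>c\<in>UNIV. \<Sum>d\<in>UNIV. W c d * T2 c d) = P * Y e"
      unfolding e2 Y_def W_def sum_distrib_left by (simp add: mult_ac)
    have s3: "(\<Sum>c\<in>UNIV. \<Sum>d\<in>UNIV. W c d * T3 c d) = P * Y b"
      unfolding e3 Y_def by (simp only: sum_distrib_left)
    have s4: "(\<Sum>c\<in>UNIV. \<Sum>d\<in>UNIV. W c d * T4 c d) = P * Y a"
      by (subst sum.swap, unfold e4 Y_def, subst sum.swap, simp only: sum_distrib_left)
    have "(\<Sum>c\<in>UNIV. \<Sum>d\<in>UNIV. W c d * (T1 c d + T2 c d)) = (\<Sum>c\<in>UNIV. \<Sum>d\<in>UNIV. W c d * (T3 c d + T4 c d))"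
      by (simp only: T)
    then have "Xd a b e \<alpha> \<alpha>'' * Dim + P * Y e = P * Y b + P * Y a"
      unfolding distrib_left sum.distrib s1 s2 s3 s4 .
    then show ?thesis by (auto simp: P_def algebra_simps split: if_splits)
  qed
  then have "Xd a b e \<alpha> \<alpha>' = (if \<alpha> = \<alpha>' \<and> \<alpha> < N a b e then Y a + Y b - Y e else 0) / Dim" for a b e \<alpha> \<alpha>'
    by (simp only: nonzero_eq_divide_eq[OF Dim_nz])
  then have "Xd a b e \<alpha> \<alpha>' = (if \<alpha> = \<alpha>' \<and> \<alpha> < N a b e then Y a / Dim + Y b / Dim - Y e / Dim else 0)" for a b e \<alpha> \<alpha>'
    by (simp add: add_divide_distrib diff_divide_distrib)
  then show ?thesis by (intro exI[of _ "\<lambda>a. Y a / Dim"]) blast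
qed

end

section \<open>Extension of isomorphisms between subrings to field automorphisms\<close>

text \<open>Isomorphisms between subrings of the complex numbers are encoded by their graphs.\<close>

definition partial_iso :: "(complex \<times> complex) set \<Rightarrow> bool" where
  "partial_iso r \<longleftrightarrow> (1,1) \<in> r \<and>
     (\<forall>x y x' y'. (x,y) \<in> r \<longrightarrow> (x',y') \<in> r \<longrightarrow> (x - x', y - y') \<in> r \<and> (x * x', y * y') \<in> r) \<and>
     (\<forall>x y. (x,y) \<in> r \<longrightarrow> (x = 0 \<longleftrightarrow> y = 0))"

definition rel_poly :: "(complex \<times> complex) set \<Rightarrow> complex poly \<Rightarrow> complex poly \<Rightarrow> bool" where
  "rel_poly r p p' \<longleftrightarrow> (\<forall>i. (coeff p i, coeff p' i) \<in> r)"

lemma partial_isoD: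
  assumes "partial_iso r"
  shows "(1,1) \<in> r" "(0,0) \<in> r"
    "(x,y) \<in> r \<Longrightarrow> (x',y') \<in> r \<Longrightarrow> (x - x', y - y') \<in> r"
    "(x,y) \<in> r \<Longrightarrow> (x',y') \<in> r \<Longrightarrow> (x * x', y * y') \<in> r"
    "(x,y) \<in> r \<Longrightarrow> (x',y') \<in> r \<Longrightarrow> (x + x', y + y') \<in> r"
    "(x,y) \<in> r \<Longrightarrow> x = 0 \<longleftrightarrow> y = 0"
proof -
  show 1: "(1,1) \<in> r" and m: "\<And>x y x' y'. (x,y) \<in> r \<Longrightarrow> (x',y') \<in> r \<Longrightarrow> (x - x', y - y') \<in> r"
    and "\<And>x y x' y'. (x,y) \<in> r \<Longrightarrow> (x',y') \<in> r \<Longrightarrow> (x * x', y * y') \<in> r"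
    and "\<And>x y. (x,y) \<in> r \<Longrightarrow> x = 0 \<longleftrightarrow> y = 0"
    using assms by (auto simp: partial_iso_def)
  show z: "(0,0) \<in> r" using m[OF 1 1] by simp
  show "(x,y) \<in> r \<Longrightarrow> (x',y') \<in> r \<Longrightarrow> (x + x', y + y') \<in> r"
    using m[of x y "-x'" "-y'"] m[OF z, of x' y'] by simp
qed

lemma partial_iso_sum:
  assumes "partial_iso r" "finite A" "\<And>i. i \<in> A \<Longrightarrow> (f i, g i) \<in> r"
  shows "(sum f A, sum g A) \<in> r"
  using assms(2,3) by (induction A rule: finite_induct) (auto intro: partial_isoD[OF assms(1)])

lemma partial_iso_converse: "partial_iso r \<Longrightarrow> partial_iso (r\<inverse>)"
  unfolding partial_iso_def by auto

section \<open>Corresponding polynomials and their pseudo-division\<close>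

lemma rel_poly_converse: "rel_poly (r\<inverse>) p' p \<longleftrightarrow> rel_poly r p p'"
  by (simp add: rel_poly_def)

lemma rel_poly_closed:
  assumes r: "partial_iso r"
  shows "rel_poly r p p' \<Longrightarrow> rel_poly r s s' \<Longrightarrow> rel_poly r (p - s) (p' - s')"
    "rel_poly r p p' \<Longrightarrow> rel_poly r s s' \<Longrightarrow> rel_poly r (p + s) (p' + s')"
    "rel_poly r p p' \<Longrightarrow> rel_poly r s s' \<Longrightarrow> rel_poly r (p * s) (p' * s')"
    "rel_poly r p p' \<Longrightarrow> (c,c') \<in> r \<Longrightarrow> rel_poly r (smult c p) (smult c' p')"
    "(c,c') \<in> r \<Longrightarrow> rel_poly r (monom c n) (monom c' n)"
    "rel_poly r 0 0" "rel_poly r 1 1"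
  using partial_isoD[OF r]
  by (auto simp: rel_poly_def coeff_mult intro!: partial_iso_sum[OF r])

lemma rel_poly_degree:
  assumes r: "partial_iso r" and p: "rel_poly r p p'"
  shows "degree p = degree p'" "p = 0 \<longleftrightarrow> p' = 0" "(lead_coeff p, lead_coeff p') \<in> r"
proof -
  have *: "coeff p i = 0 \<longleftrightarrow> coeff p' i = 0" for i
    using partial_isoD(6)[OF r] p by (auto simp: rel_poly_def)
  show d: "degree p = degree p'" by (simp add: degree_def *)
  show "p = 0 \<longleftrightarrow> p' = 0" by (simp add: poly_eq_iff *)
  show "(lead_coeff p, lead_coeff p') \<in> r" using p by (simp add: d rel_poly_def)
qed

text \<open>The domain of \<open>r\<close> is only a ring, so quotients are avoided by multiplying
  with leading coefficients. Dividing on both sides at once keeps quotients and remainders in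
  correspondence.\<close>

lemma rel_poly_division:
  assumes r: "partial_iso r" and p: "rel_poly r p p'" "p \<noteq> 0" and g: "rel_poly r g g'"
  shows "\<exists>c c' s s' t t'. (c,c') \<in> r \<and> c \<noteq> 0 \<and> rel_poly r s s' \<and> rel_poly r t t' \<and>
     smult c g = p * s + t \<and> smult c' g' = p' * s' + t' \<and> (t = 0 \<or> degree t < degree p)"
  using g
\<comment> \<open>The measure separates the zero polynomial from nonzero constants, so that the
  induction also covers a constant divisor.\<close>
proof (induction "if g = 0 then 0 else Suc (degree g)" arbitrary: g g' rule: less_induct)
  case less
  note pd = rel_poly_degree[OF r p(1)]
  show ?case
  proof (cases "g = 0 \<or> degree g < degree p")
    case True
    then show ?thesis
      using less.prems partial_isoD(1)[OF r] rel_poly_closed(6)[OF r] p(2)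
      by (intro exI[of _ 1] exI[of _ 0] exI[of _ g] exI[of _ g'] conjI) simp_all
  next
    case False
    note gd = rel_poly_degree[OF r less.prems]
    define l l' where "l = lead_coeff p" and "l' = lead_coeff p'"
    define m m' where "m = monom (lead_coeff g) (degree g - degree p)" and "m' = monom (lead_coeff g') (degree g - degree p)"
    define h h' where "h = smult l g - m * p" and "h' = smult l' g' - m' * p'"
    have l: "(l,l') \<in> r" "l \<noteq> 0" using pd(3) p(2) by (simp_all add: l_def l'_def)
    have m: "rel_poly r m m'" using gd(3) by (auto simp: m_def m'_def intro: rel_poly_closed[OF r])
    have h: "rel_poly r h h'"
      unfolding h_def h'_def by (intro rel_poly_closed[OF r] l less.prems m p)
    have "h = 0 \<or> degree h < degree g"
    proof (rule disjCI)
      assume "\<not> degree h < degree g"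
      moreover have "degree h \<le> degree g"
      proof -
        have "degree (m * p) \<le> degree m + degree p" by (rule degree_mult_le)
        also have "\<dots> \<le> (degree g - degree p) + degree p" unfolding m_def by (intro add_right_mono degree_monom_le)
        also have "\<dots> = degree g" using False by simp
        finally show ?thesis unfolding h_def by (intro degree_diff_le degree_smult_le)
      qed
      moreover have "coeff h (degree g) = 0"
      proof -
        have "coeff (m * p) (degree g) = lead_coeff g * l"
          unfolding m_def l_def using False coeff_monom_mult[of "lead_coeff g" "degree g - degree p" p "degree g"] by simp
        then show ?thesis by (simp add: h_def mult.commute)
      qed
      ultimately show "h = 0" by (metis leading_coeff_0_iff le_neq_implies_less)
    qed
    then have "(if h = 0 then 0 else Suc (degree h)) < (if g = 0 then 0 else Suc (degree g))"
      using False by auto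
    from less.hyps[OF this h] obtain c c' s s' t t' where
      ih: "(c,c') \<in> r" "c \<noteq> 0" "rel_poly r s s'" "rel_poly r t t'" "smult c h = p * s + t"
      "smult c' h' = p' * s' + t'" "t = 0 \<or> degree t < degree p" by blast
    have "smult (c * l) g = p * (s + smult c m) + t"
      using ih(5) by (simp add: h_def smult_diff_right algebra_simps)
    moreover have "smult (c' * l') g' = p' * (s' + smult c' m') + t'"
      using ih(6) by (simp add: h'_def smult_diff_right algebra_simps)
    moreover have "(c * l, c' * l') \<in> r" "c * l \<noteq> 0" using ih l partial_isoD(4)[OF r] by auto
    moreover have "rel_poly r (s + smult c m) (s' + smult c' m')"
      by (intro rel_poly_closed[OF r] ih m)
    ultimately show ?thesis using ih(4,7) by blast
  qed
qed

section \<open>Adjoining a single algebraic or transcendental element\<close>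

definition adjoin :: "(complex \<times> complex) set \<Rightarrow> complex \<Rightarrow> complex \<Rightarrow> (complex \<times> complex) set" where
  "adjoin r x y = {(poly g x, poly g' y) | g g'. rel_poly r g g'}"

lemma adjoin_partial_iso:
  assumes r: "partial_iso r" and "\<And>g g'. rel_poly r g g' \<Longrightarrow> poly g x = 0 \<longleftrightarrow> poly g' y = 0"
  shows "partial_iso (adjoin r x y)"
proof -
  have "(1,1) \<in> adjoin r x y"
    unfolding adjoin_def using rel_poly_closed(7)[OF r] by (intro CollectI exI[of _ 1]) simp
  moreover have "(a - b, a' - b') \<in> adjoin r x y \<and> (a * b, a' * b') \<in> adjoin r x y"
    if "(a,a') \<in> adjoin r x y" "(b,b') \<in> adjoin r x y" for a a' b b'
  proof -
    obtain g g' h h' where gh: "rel_poly r g g'" "rel_poly r h h'" "a = poly g x" "a' = poly g' y" "b = poly h x" "b' = poly h' y"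
      using \<open>(a,a') \<in> adjoin r x y\<close> \<open>(b,b') \<in> adjoin r x y\<close> unfolding adjoin_def by blast
    then show ?thesis
      unfolding adjoin_def using rel_poly_closed(1,3)[OF r gh(1,2)] poly_diff[symmetric] poly_mult[symmetric] by blast
  qed
  moreover have "a = 0 \<longleftrightarrow> b = 0" if "(a,b) \<in> adjoin r x y" for a b
  proof -
    obtain g g' where "rel_poly r g g'" "a = poly g x" "b = poly g' y"
      using \<open>(a,b) \<in> adjoin r x y\<close> unfolding adjoin_def by blast
    then show ?thesis using assms(2) by simp
  qed
  ultimately show ?thesis unfolding partial_iso_def by blast
qed

lemma adjoin_superset:
  assumes r: "partial_iso r" shows "r \<subseteq> adjoin r x y" "(x,y) \<in> adjoin r x y"
proof -
  show "r \<subseteq> adjoin r x y"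
  proof
    fix z assume "z \<in> r"
    moreover obtain a b where z: "z = (a,b)" by (cases z)
    ultimately have "rel_poly r [:a:] [:b:]"
      using rel_poly_closed(5)[OF r, of a b 0] by (simp add: monom_0)
    then show "z \<in> adjoin r x y" unfolding adjoin_def z
      by (intro CollectI exI[of _ "[:a:]"] exI[of _ "[:b:]"]) simp
  qed
  have "rel_poly r [:0,1:] [:0,1:]"
    using rel_poly_closed(5)[OF r partial_isoD(1)[OF r], of 1] by (simp add: monom_altdef)
  then show "(x,y) \<in> adjoin r x y" unfolding adjoin_def
    by (intro CollectI exI[of _ "[:0,1:]"]) simp
qed

lemma min_poly_transfer:
  assumes r: "partial_iso r" and p: "rel_poly r p p'" "p \<noteq> 0" "poly p' y = 0"
    and min: "\<And>h h'. rel_poly r h h' \<Longrightarrow> h \<noteq> 0 \<Longrightarrow> poly h x = 0 \<Longrightarrow> degree p \<le> degree h"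
    and px: "poly p x = 0" and g: "rel_poly r g g'" "poly g x = 0"
  shows "poly g' y = 0"
proof -
  obtain c c' s s' t t' where d: "(c,c') \<in> r" "c \<noteq> 0" "rel_poly r t t'"
     "smult c g = p * s + t" "smult c' g' = p' * s' + t'" "t = 0 \<or> degree t < degree p"
    using rel_poly_division[OF r p(1,2) g(1)] by blast
  have "poly (smult c g) x = poly (p * s + t) x" using d(4) by simp
  then have "poly t x = 0" using px g by simp
  then have "t = 0" using min[OF d(3)] d(6) by (meson not_le)
  then have "t' = 0" using rel_poly_degree(2)[OF r d(3)] by simp
  then have "poly (smult c' g') y = 0" using d(5) p(3) by simp
  moreover have "c' \<noteq> 0" using d(1,2) partial_isoD(6)[OF r] by blast
  ultimately show ?thesis by simp
qed

lemma ex_min_poly: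
  assumes "rel_poly r p p'" "p \<noteq> 0" "poly p x = 0"
  obtains m m' where "rel_poly r m m'" "m \<noteq> 0" "poly m x = 0"
    "\<And>h h'. rel_poly r h h' \<Longrightarrow> h \<noteq> 0 \<Longrightarrow> poly h x = 0 \<Longrightarrow> degree m \<le> degree h"
proof -
  define P where "P = (\<lambda>(m,m'). rel_poly r m m' \<and> m \<noteq> 0 \<and> poly m x = 0)"
  have "P (p,p')" using assms by (simp add: P_def)
  from ex_has_least_nat[of P, OF this, of "\<lambda>(m,m'). degree m"] obtain m m' where
    "P (m,m')" "\<forall>z. P z \<longrightarrow> degree m \<le> degree (fst z)" by (auto simp: case_prod_beta)
  then show ?thesis using that[of m m'] by (auto simp: P_def)
qed

text \<open>A root \<open>y\<close> of the counterpart of a minimal polynomial of \<open>x\<close>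
  serves as image. Well-definedness is \<open>fwd\<close>; injectivity needs the same with the roles
  of \<open>x\<close> and \<open>y\<close> exchanged, where a degree argument on the cofactor
  \<open>s\<close> replaces irreducibility.\<close>

lemma extend_algebraic:
  assumes r: "partial_iso r" and p: "rel_poly r p p'" "p \<noteq> 0" "poly p x = 0"
  shows "\<exists>y. partial_iso (adjoin r x y)"
proof -
  obtain m m' where m: "rel_poly r m m'" "m \<noteq> 0" "poly m x = 0"
    and min: "\<And>h h'. rel_poly r h h' \<Longrightarrow> h \<noteq> 0 \<Longrightarrow> poly h x = 0 \<Longrightarrow> degree m \<le> degree h"
    using ex_min_poly[OF p] by blast
  have "degree m \<noteq> 0" using m(2,3) by (metis degree_eq_zeroE pCons_eq_0_iff poly_const_conv)
  then have "degree m' \<noteq> 0" using rel_poly_degree[OF r m(1)] by simp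
  then obtain y where y: "poly m' y = 0"
    using fundamental_theorem_of_algebra[of m'] by (auto simp: constant_degree)
  have fwd: "poly g' y = 0" if "rel_poly r g g'" "poly g x = 0" for g g'
    using min_poly_transfer[OF r m(1,2) y min m(3) that] .
  have m'0: "m' \<noteq> 0" using m rel_poly_degree[OF r m(1)] by simp
  have rc: "partial_iso (r\<inverse>)" by (rule partial_iso_converse[OF r])
  obtain n' n where n: "rel_poly (r\<inverse>) n' n" "n' \<noteq> 0" "poly n' y = 0"
    and nmin: "\<And>h' h. rel_poly (r\<inverse>) h' h \<Longrightarrow> h' \<noteq> 0 \<Longrightarrow> poly h' y = 0 \<Longrightarrow> degree n' \<le> degree h'"
    using ex_min_poly[OF _ m'0 y, of "r\<inverse>" m] m(1) by (auto simp: rel_poly_converse)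
  have n_r: "rel_poly r n n'" using n(1) by (simp add: rel_poly_converse)
  \<comment> \<open>Up to constants \<open>m\<close> is \<open>n * s\<close>, and \<open>s\<close>
    has smaller degree than \<open>m\<close>. By minimality \<open>s\<close> does not vanish at
    \<open>x\<close>, so \<open>n\<close> does.\<close>
  have "poly n x = 0"
  proof -
    obtain c c' s s' t t' where d: "(c',c) \<in> r\<inverse>" "c' \<noteq> 0" "rel_poly (r\<inverse>) s' s" "rel_poly (r\<inverse>) t' t"
       "smult c' m' = n' * s' + t'" "smult c m = n * s + t" "t' = 0 \<or> degree t' < degree n'"
      using rel_poly_division[OF rc n(1,2), of m' m] m(1) by (auto simp: rel_poly_converse)
    have "poly (smult c' m') y = poly (n' * s' + t') y" using d(5) by simp
    then have "poly t' y = 0" using y n by simp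
    then have "t' = 0" using nmin[OF d(4)] d(7) by (meson not_le)
    then have "t = 0" using rel_poly_degree(2)[OF rc d(4)] by simp
    have c: "c \<noteq> 0" using d(1,2) partial_isoD(6)[OF r, of c c'] by auto
    have cm: "smult c m = n * s" using d(6) \<open>t = 0\<close> by simp
    then have ns: "n \<noteq> 0" "s \<noteq> 0" using c m(2) by auto
    have "degree m = degree n + degree s"
      using degree_mult_eq[OF ns] cm c by (metis degree_smult_eq)
    moreover have "degree n \<noteq> 0"
      using n(2,3) rel_poly_degree(1)[OF rc n(1)] by (metis degree_eq_zeroE pCons_eq_0_iff poly_const_conv)
    ultimately have "poly s x \<noteq> 0"
      using min[of s s'] ns d(3) by (auto simp: rel_poly_converse)
    moreover have "poly (smult c m) x = poly (n * s) x" using cm by simp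
    ultimately show ?thesis using m(3) by simp
  qed
  have bwd: "poly g x = 0" if "rel_poly r g g'" "poly g' y = 0" for g g'
  proof -
    have "rel_poly (r\<inverse>) g' g" using that by (simp add: rel_poly_converse)
    show ?thesis
    proof (rule min_poly_transfer[OF rc n(1,2) \<open>poly n x = 0\<close>])
      show "rel_poly (r\<inverse>) g' g" by fact
    qed (fact nmin n(3) that(2))+
  qed
  show ?thesis using adjoin_partial_iso[OF r, of x y] fwd bwd by blast
qed

text \<open>As domain and range coincide, \<open>x\<close> is transcendental over the range as well
  and may be sent to itself; domain and range of the extension are then the same ring of polynomial
  values at \<open>x\<close>.\<close>

lemma extend_transcendental:
  assumes r: "partial_iso r" and DR: "Domain r = Range r"
    and tr: "\<And>p p'. rel_poly r p p' \<Longrightarrow> poly p x = 0 \<Longrightarrow> p = 0"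
  shows "partial_iso (adjoin r x x) \<and> Domain (adjoin r x x) = Range (adjoin r x x)"
proof -
  have ex1: "\<exists>p'. rel_poly r p p'" if p: "\<And>i. coeff p i \<in> Domain r" for p
  proof -
    obtain f where f: "\<And>i. (coeff p i, f i) \<in> r" using choice[of "\<lambda>i y. (coeff p i, y) \<in> r"] p by blast
    have "f i = 0" if "i > degree p" for i
      using partial_isoD(6)[OF r f[of i]] that by (simp add: coeff_eq_0)
    then have "coeff (Abs_poly f) i = f i" for i
      by (subst coeff_Abs_poly[of "degree p"]) auto
    then show ?thesis using f by (intro exI[of _ "Abs_poly f"]) (simp add: rel_poly_def)
  qed
  have ex2: "\<exists>p. rel_poly r p p'" if p: "\<And>i. coeff p' i \<in> Range r" for p'
  proof -
    obtain f where f: "\<And>i. (f i, coeff p' i) \<in> r" using choice[of "\<lambda>i y. (y, coeff p' i) \<in> r"] p by blast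
    have "f i = 0" if "i > degree p'" for i
      using partial_isoD(6)[OF r f[of i]] that by (simp add: coeff_eq_0)
    then have "coeff (Abs_poly f) i = f i" for i
      by (subst coeff_Abs_poly[of "degree p'"]) auto
    then show ?thesis using f by (intro exI[of _ "Abs_poly f"]) (simp add: rel_poly_def)
  qed
  have "poly g x = 0 \<longleftrightarrow> poly g' x = 0" if g: "rel_poly r g g'" for g g'
  proof
    assume "poly g x = 0"
    then show "poly g' x = 0" using tr[OF g] rel_poly_degree(2)[OF r g] by simp
  next
    assume z: "poly g' x = 0"
    have "coeff g' i \<in> Domain r" for i unfolding DR using g by (auto simp: rel_poly_def)
    then obtain h where "rel_poly r g' h" using ex1 by blast
    then have "g' = 0" using tr z by blast
    then show "poly g x = 0" using rel_poly_degree(2)[OF r g] by simp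
  qed
  then have "partial_iso (adjoin r x x)" by (rule adjoin_partial_iso[OF r])
  moreover have "Domain (adjoin r x x) = {poly p x | p. \<forall>i. coeff p i \<in> Domain r}"
  proof (intro Set.set_eqI iffI)
    fix z assume "z \<in> {poly p x | p. \<forall>i. coeff p i \<in> Domain r}"
    then obtain p where "z = poly p x" "\<And>i. coeff p i \<in> Domain r" by blast
    with ex1 show "z \<in> Domain (adjoin r x x)" unfolding adjoin_def by blast
  qed (auto simp: adjoin_def rel_poly_def)
  moreover have "Range (adjoin r x x) = {poly p x | p. \<forall>i. coeff p i \<in> Range r}"
  proof (intro Set.set_eqI iffI)
    fix z assume "z \<in> {poly p x | p. \<forall>i. coeff p i \<in> Range r}"
    then obtain p where "z = poly p x" "\<And>i. coeff p i \<in> Range r" by blast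
    with ex2 show "z \<in> Range (adjoin r x x)" unfolding adjoin_def by blast
  qed (auto simp: adjoin_def rel_poly_def)
  ultimately show ?thesis by (simp add: DR)
qed

lemma partial_iso_Union:
  assumes C: "C \<noteq> {}" "subset.chain A C" and A: "\<And>r. r \<in> A \<Longrightarrow> partial_iso r"
  shows "partial_iso (\<Union>C)"
proof -
  have CA: "\<And>r. r \<in> C \<Longrightarrow> partial_iso r" using C A by (auto simp: subset_chain_def)
  have two: "\<exists>r\<in>C. z \<in> r \<and> z' \<in> r" if "z \<in> \<Union>C" "z' \<in> \<Union>C" for z z'
    using that C(2) unfolding subset_chain_def by blast
  have "(1,1) \<in> \<Union>C" using C(1) CA partial_isoD(1) by blast
  moreover have "(x - x', y - y') \<in> \<Union>C \<and> (x * x', y * y') \<in> \<Union>C" if xy: "(x,y) \<in> \<Union>C" "(x',y') \<in> \<Union>C" for x y x' y'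
    using two[OF xy] CA partial_isoD(3,4) by blast
  moreover have "x = 0 \<longleftrightarrow> y = 0" if "(x,y) \<in> \<Union>C" for x y
    using that CA partial_isoD(6) by blast
  ultimately show ?thesis unfolding partial_iso_def by blast
qed

text \<open>
  A maximal extension \<open>s\<close> with equal domain and range has an algebraic closure covering the complex
  numbers, since a transcendental element could be mapped to itself. An extension of \<open>s\<close> that is
  maximal without the restriction on domain and range is then total and onto.
\<close>

theorem extend_automorphism:
  assumes r: "partial_iso r" and DR: "Domain r = Range r"
  obtains \<sigma> :: "complex \<Rightarrow> complex" where "bij \<sigma>" "\<And>x y. \<sigma> (x + y) = \<sigma> x + \<sigma> y" "\<And>x y. \<sigma> (x * y) = \<sigma> x * \<sigma> y"
    "\<sigma> 1 = 1" "\<And>x y. (x,y) \<in> r \<Longrightarrow> \<sigma> x = y"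
proof -
  define A where "A = {s. partial_iso s \<and> r \<subseteq> s \<and> Domain s = Range s}"
  have "\<exists>M\<in>A. \<forall>Z\<in>A. M \<subseteq> Z \<longrightarrow> Z = M"
  proof (rule subset_Zorn_nonempty)
    have "r \<in> A" using assms by (simp add: A_def)
    then show "A \<noteq> {}" by blast
    fix C assume C: "C \<noteq> {}" "subset.chain A C"
    have "partial_iso (\<Union>C)" using C by (rule partial_iso_Union) (auto simp: A_def)
    moreover have CA: "Domain s = Range s" "r \<subseteq> s" if "s \<in> C" for s
      using C(2) that unfolding A_def subset_chain_def by blast+
    then have "Domain (\<Union>C) = Range (\<Union>C)"
      unfolding Domain_Union Range_Union using CA(1) by (intro SUP_cong refl) blast
    moreover have "r \<subseteq> \<Union>C" using C(1) CA(2) by blast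
    ultimately show "\<Union>C \<in> A" by (simp add: A_def)
  qed
  then obtain s where sA: "s \<in> A" and smax: "\<And>Z. Z \<in> A \<Longrightarrow> s \<subseteq> Z \<Longrightarrow> Z = s"
    by blast
  then have s: "partial_iso s" "r \<subseteq> s" "Domain s = Range s" by (simp_all add: A_def)
  have alg: "\<exists>p p'. rel_poly s p p' \<and> p \<noteq> 0 \<and> poly p x = 0" for x
  proof (rule ccontr)
    assume c: "\<nexists>p p'. rel_poly s p p' \<and> p \<noteq> 0 \<and> poly p x = 0"
    then have "partial_iso (adjoin s x x) \<and> Domain (adjoin s x x) = Range (adjoin s x x)"
      by (intro extend_transcendental[OF s(1,3)]) blast
    then have "adjoin s x x \<in> A"
      unfolding A_def using adjoin_superset(1)[OF s(1), of x x] s(2) by simp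
    then have "(x,x) \<in> s" using smax adjoin_superset[OF s(1), of x x] by blast
    then have "x \<in> Domain s" "x \<in> Domain s" by auto
    then obtain y where "(x,y) \<in> s" by blast
    have "rel_poly s (monom 1 1 - monom x 0) (monom 1 1 - monom y 0)"
      by (intro rel_poly_closed[OF s(1)] partial_isoD(1)[OF s(1)] \<open>(x,y) \<in> s\<close>)
    moreover have "poly (monom 1 1 - monom x 0) x = 0" by (simp add: poly_monom)
    moreover have "monom 1 1 - monom x 0 \<noteq> 0"
    proof
      assume "monom 1 1 - monom x 0 = 0"
      then have "coeff (monom 1 1 - monom x 0) 1 = 0" by simp
      then show False by simp
    qed
    ultimately show False using c by blast
  qed
  define A2 where "A2 = {t. partial_iso t \<and> s \<subseteq> t}"
  have "\<exists>M\<in>A2. \<forall>Z\<in>A2. M \<subseteq> Z \<longrightarrow> Z = M"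
  proof (rule subset_Zorn_nonempty)
    show "A2 \<noteq> {}" using s by (auto simp: A2_def)
    fix C assume C: "C \<noteq> {}" "subset.chain A2 C"
    have "partial_iso (\<Union>C)" using C by (rule partial_iso_Union) (auto simp: A2_def)
    moreover have "s \<subseteq> \<Union>C" using C unfolding A2_def subset_chain_def by blast
    ultimately show "\<Union>C \<in> A2" by (simp add: A2_def)
  qed
  then obtain t where tA: "t \<in> A2" and tmax0: "\<And>Z. Z \<in> A2 \<Longrightarrow> t \<subseteq> Z \<Longrightarrow> Z = t"
    by blast
  then have t: "partial_iso t" "s \<subseteq> t" by (simp_all add: A2_def)
  have tmax: "Z = t" if "partial_iso Z" "t \<subseteq> Z" for Z
    using that t(2) by (intro tmax0) (auto simp: A2_def)
  have mono: "rel_poly t p p'" if "rel_poly s p p'" for p p' using that t(2) by (auto simp: rel_poly_def)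
  have dom: "\<exists>y. (x,y) \<in> t" for x
  proof -
    obtain p p' where "rel_poly s p p'" "p \<noteq> 0" "poly p x = 0" using alg by blast
    then obtain y where "partial_iso (adjoin t x y)" using extend_algebraic[OF t(1)] mono by blast
    then have "adjoin t x y = t" using tmax adjoin_superset[OF t(1)] by blast
    then show ?thesis using adjoin_superset(2)[OF t(1)] by blast
  qed
  \<comment> \<open>Surjectivity is totality of the converse: \<open>y\<close> is algebraic over
    \<open>Range s\<close>, which is \<open>Domain s\<close>, so the converse of \<open>t\<close>
    extends to \<open>y\<close>, and maximality of \<open>t\<close> makes this extension
    trivial.\<close>
  have ran: "\<exists>x. (x,y) \<in> t" for y
  proof -
    obtain p p' where p: "rel_poly s p p'" "p \<noteq> 0" "poly p y = 0" using alg by blast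
    have "coeff p i \<in> Range s" for i unfolding s(3)[symmetric] using p(1) by (auto simp: rel_poly_def)
    then obtain f where f: "\<And>i. (f i, coeff p i) \<in> s"
      using choice[of "\<lambda>i y. (y, coeff p i) \<in> s"] by blast
    have "f i = 0" if "i > degree p" for i
      using partial_isoD(6)[OF s(1) f[of i]] that by (simp add: coeff_eq_0)
    then have "coeff (Abs_poly f) i = f i" for i
      by (subst coeff_Abs_poly[of "degree p"]) auto
    then have "rel_poly (t\<inverse>) p (Abs_poly f)" using f t(2) by (auto simp: rel_poly_def)
    then obtain x where x: "partial_iso (adjoin (t\<inverse>) y x)"
      using extend_algebraic[OF partial_iso_converse[OF t(1)] _ p(2,3)] by blast
    have "(adjoin (t\<inverse>) y x)\<inverse> = t"
    proof (rule tmax[OF partial_iso_converse[OF x]])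
      show "t \<subseteq> (adjoin (t\<inverse>) y x)\<inverse>"
        using adjoin_superset(1)[OF partial_iso_converse[OF t(1)], of y x] by (simp only: converse_subset_swap)
    qed
    then show ?thesis using adjoin_superset(2)[OF partial_iso_converse[OF t(1)], of y x] by auto
  qed
  have inj: "y = y'" if "(x,y) \<in> t" "(x,y') \<in> t" for x y y'
    using partial_isoD(3)[OF t(1) that] partial_isoD(6)[OF t(1), of 0 "y - y'"] by simp
  have inj': "x = x'" if "(x,y) \<in> t" "(x',y) \<in> t" for x x' y
    using partial_isoD(3)[OF t(1) that] partial_isoD(6)[OF t(1), of "x - x'" 0] by simp
  define \<sigma> where "\<sigma> x = (SOME y. (x,y) \<in> t)" for x
  have \<sigma>: "(x, \<sigma> x) \<in> t" for x unfolding \<sigma>_def using dom by (rule someI_ex)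
  show ?thesis
  proof (rule that[of \<sigma>])
    show "bij \<sigma>"
    proof (rule bijI')
      show "\<sigma> x = \<sigma> y \<longleftrightarrow> x = y" for x y using inj'[OF \<sigma>[of x]] \<sigma>[of y] by auto
      show "\<exists>x. y = \<sigma> x" for y using ran[of y] inj[OF \<sigma>] by metis
    qed
    show "\<sigma> (x + y) = \<sigma> x + \<sigma> y" for x y using inj[OF \<sigma>] partial_isoD(5)[OF t(1) \<sigma> \<sigma>] .
    show "\<sigma> (x * y) = \<sigma> x * \<sigma> y" for x y using inj[OF \<sigma>] partial_isoD(4)[OF t(1) \<sigma> \<sigma>] .
    show "\<sigma> 1 = 1" using inj[OF \<sigma>] partial_isoD(1)[OF t(1)] .
    show "(x,y) \<in> r \<Longrightarrow> \<sigma> x = y" for x y using inj[OF \<sigma>] s(2) t(2) by blast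
  qed
qed

section \<open>Spectral projections of positive matrices\<close>

lemma mat_adjoint_index [simp]:
  fixes A :: "complex mat"
  shows "i < dim_col A \<Longrightarrow> j < dim_row A \<Longrightarrow> mat_adjoint A $$ (i,j) = cnj (A $$ (j,i))"
    "dim_row (mat_adjoint A) = dim_col A" "dim_col (mat_adjoint A) = dim_row A"
  by (auto simp: mat_adjoint_def mat_of_rows_def)

lemma mat_mult_index:
  "A \<in> carrier_mat n m \<Longrightarrow> A' \<in> carrier_mat m k \<Longrightarrow> i < n \<Longrightarrow> j < k \<Longrightarrow>
    (A * A') $$ (i,j) = (\<Sum>l = 0..<m. A $$ (i,l) * (A' $$ (l,j) :: 'b::semiring_0))"
  by (auto simp: scalar_prod_def)

text \<open>The product over the last \<open>k\<close> diagonal entries has its last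
  \<open>k\<close> rows equal to 0. The next factor, with \<open>m = n - Suc k\<close>, has zeros in
  row \<open>m\<close> up to and including the diagonal, so row \<open>m\<close> of the new product
  combines only rows that already vanish.\<close>

lemma triangular_annihilated:
  fixes B :: "complex mat"
  assumes B: "B \<in> carrier_mat n n" "upper_triangular B"
  shows "\<exists>es. foldr (\<lambda>e M. (B - e \<cdot>\<^sub>m 1\<^sub>m n) * M) es (1\<^sub>m n) = 0\<^sub>m n n"
proof -
  define f where "f k = foldr (\<lambda>e M. (B - e \<cdot>\<^sub>m 1\<^sub>m n) * M) (map (\<lambda>i. B $$ (i,i)) [n-k..<n]) (1\<^sub>m n)" for k
  have "k \<le> n \<Longrightarrow> f k \<in> carrier_mat n n \<and> (\<forall>i j. i < n \<longrightarrow> j < n \<longrightarrow> n - k \<le> i \<longrightarrow> f k $$ (i,j) = 0)" for k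
  proof (induction k)
    case 0
    then show ?case by (simp add: f_def)
  next
    case (Suc k)
    define m where "m = n - Suc k"
    have m: "m < n" "n - k = Suc m" "[n - Suc k..<n] = m # [n - k..<n]"
      using Suc.prems by (auto simp: m_def upt_conv_Cons Suc_diff_Suc)
    have fS: "f (Suc k) = (B - B $$ (m,m) \<cdot>\<^sub>m 1\<^sub>m n) * f k" by (simp add: f_def m(3))
    have fk: "f k \<in> carrier_mat n n" "\<And>i j. i < n \<Longrightarrow> j < n \<Longrightarrow> Suc m \<le> i \<Longrightarrow> f k $$ (i,j) = 0"
      using Suc m by auto
    have "f (Suc k) $$ (i,j) = 0" if ij: "i < n" "j < n" "m \<le> i" for i j
    proof -
      have "f (Suc k) $$ (i,j) = (\<Sum>l = 0..<n. (B - B $$ (m,m) \<cdot>\<^sub>m 1\<^sub>m n) $$ (i,l) * f k $$ (l,j))"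
        using ij B fk(1) by (simp add: fS scalar_prod_def)
      also have "\<dots> = 0"
      proof (rule sum.neutral, rule ballI)
        fix l assume l: "l \<in> {0..<n}"
        show "(B - B $$ (m,m) \<cdot>\<^sub>m 1\<^sub>m n) $$ (i,l) * f k $$ (l,j) = 0"
        proof (cases "Suc m \<le> l")
          case True then show ?thesis using fk(2) l ij by simp
        next
          case False
          then have "(B - B $$ (m,m) \<cdot>\<^sub>m 1\<^sub>m n) $$ (i,l) = 0"
          proof (cases "l = i")
            case True
            then have "i = m" using False ij by linarith
            then show ?thesis using True ij B by simp
          next
            case False
            then have "l < i" using \<open>\<not> Suc m \<le> l\<close> ij by linarith
            then show ?thesis using ij l B upper_triangularD[OF B(2), of l i] by simp
          qed
          then show ?thesis by simp
        qed
      qed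
      finally show ?thesis .
    qed
    then show ?case using fS fk B by (auto simp: m_def)
  qed
  from this[of n] have "f n = 0\<^sub>m n n" by (intro eq_matI) auto
  then show ?thesis unfolding f_def by blast
qed

lemma smult_smult_mat: "x \<cdot>\<^sub>m (y \<cdot>\<^sub>m M) = (x * y) \<cdot>\<^sub>m (M :: 'b::semigroup_mult mat)"
  by (rule eq_matI) (auto simp: mult.assoc)

lemma smult_1_mat: "1 \<cdot>\<^sub>m M = (M :: 'b::monoid_mult mat)"
  by (rule eq_matI) auto

lemma shift_mult:
  fixes A :: "complex mat"
  assumes "A \<in> carrier_mat n n" "M \<in> carrier_mat n n"
  shows "(A - e \<cdot>\<^sub>m 1\<^sub>m n) * M = A * M - e \<cdot>\<^sub>m M"
  using assms minus_mult_distrib_mat[of A n n "e \<cdot>\<^sub>m 1\<^sub>m n" M n] mult_smult_assoc_mat[of "1\<^sub>m n" n n M n e]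
  by simp

text \<open>Schur triangularization reduces this to the triangular case, since the similarity
  carries each linear factor along (\<open>shift\<close>).\<close>

lemma mat_annihilated:
  fixes A :: "complex mat"
  assumes A: "A \<in> carrier_mat n n"
  shows "\<exists>es. foldr (\<lambda>e M. (A - e \<cdot>\<^sub>m 1\<^sub>m n) * M) es (1\<^sub>m n) = 0\<^sub>m n n"
proof -
  obtain es where "char_poly A = (\<Prod>(a::complex)\<leftarrow>es. [:- a, 1:])"
    using char_poly_factorized[OF A] by blast
  then obtain B where B: "B \<in> carrier_mat n n" "upper_triangular B" "similar_mat A B"
    using schur_decomposition_exists[OF A] by blast
  then obtain P Q where PQ: "similar_mat_wit A B P Q" unfolding similar_mat_def by blast
  note w = similar_mat_witD2[OF A PQ]
  have shift: "(A - e \<cdot>\<^sub>m 1\<^sub>m n) * (P * M * Q) = P * ((B - e \<cdot>\<^sub>m 1\<^sub>m n) * M) * Q" if M: "M \<in> carrier_mat n n" for e M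
  proof -
    have c: "P \<in> carrier_mat n n" "Q \<in> carrier_mat n n" "B \<in> carrier_mat n n" "P * M * Q \<in> carrier_mat n n"
      "B * M \<in> carrier_mat n n" "P * (B * M) \<in> carrier_mat n n" "P * M \<in> carrier_mat n n"
      using w M by auto
    have "A * (P * M * Q) = P * B * (Q * (P * M * Q))"
      using w(3) assoc_mult_mat[of "P * B" n n Q n "P * M * Q" n] c by simp
    also have "Q * (P * M * Q) = M * Q"
      using w(2) c M assoc_mult_mat[of Q n n P n "M * Q" n] assoc_mult_mat[of Q n n P n M n]
        assoc_mult_mat[of Q n n "P * M" n Q n] by simp
    also have "P * B * (M * Q) = P * (B * M) * Q"
      using c M assoc_mult_mat[of "P * B" n n M n Q n] assoc_mult_mat[of P n n B n M n] by simp
    finally have 1: "A * (P * M * Q) = P * (B * M) * Q" .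
    have "P * (B * M - e \<cdot>\<^sub>m M) * Q = (P * (B * M) - e \<cdot>\<^sub>m (P * M)) * Q"
      using c M mult_minus_distrib_mat[of P n n "B * M" n "e \<cdot>\<^sub>m M"] mult_smult_distrib[of P n n M n e] by simp
    also have "\<dots> = P * (B * M) * Q - e \<cdot>\<^sub>m (P * M * Q)"
      using c M minus_mult_distrib_mat[of "P * (B * M)" n n "e \<cdot>\<^sub>m (P * M)" Q n] mult_smult_assoc_mat[of "P * M" n n Q n e] by simp
    finally show ?thesis
      using 1 shift_mult[OF A c(4)] shift_mult[OF c(3) M] by simp
  qed
  obtain es where es: "foldr (\<lambda>e M. (B - e \<cdot>\<^sub>m 1\<^sub>m n) * M) es (1\<^sub>m n) = 0\<^sub>m n n"
    using triangular_annihilated[OF B(1,2)] by blast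
  have "foldr (\<lambda>e M. (A - e \<cdot>\<^sub>m 1\<^sub>m n) * M) es (1\<^sub>m n) = P * foldr (\<lambda>e M. (B - e \<cdot>\<^sub>m 1\<^sub>m n) * M) es (1\<^sub>m n) * Q
     \<and> foldr (\<lambda>e M. (B - e \<cdot>\<^sub>m 1\<^sub>m n) * M) es (1\<^sub>m n) \<in> carrier_mat n n" for es
  proof (induction es)
    case Nil then show ?case using w by simp
  next
    case (Cons e es) then show ?case using shift B(1) by (auto intro!: carrier_matI)
  qed
  then show ?thesis using es w by (intro exI[of _ es]) simp
qed

text \<open>In each column, the squared norm of \<open>V M\<close> is \<open>e\<close> times that of
  \<open>M\<close>, and the left inverse \<open>W\<close> keeps it nonzero where \<open>M\<close>
  is. Matrices \<open>M\<close> in place of vectors allow the application to whole spectral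
  components.\<close>

lemma pos_eigen:
  fixes V :: "complex mat"
  assumes V: "V \<in> carrier_mat n n" "W \<in> carrier_mat n n" "W * V = 1\<^sub>m n"
    and M: "M \<in> carrier_mat n m" and ev: "(mat_adjoint V * V) * M = e \<cdot>\<^sub>m M" and M0: "M \<noteq> 0\<^sub>m n m"
  shows "\<exists>r>0. e = complex_of_real r"
proof -
  obtain i0 j where ij: "i0 < n" "j < m" "M $$ (i0,j) \<noteq> 0"
    using M0 M by (metis carrier_matD eq_matI index_zero_mat)
  have sq: "(mat_adjoint Z * Z) $$ (j,j) = of_real (\<Sum>i = 0..<n. (cmod (Z $$ (i,j)))\<^sup>2)" if "Z \<in> carrier_mat n m" for Z :: "complex mat"
    using that ij by (simp add: scalar_prod_def complex_norm_square mult.commute del: of_real_power)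
  define x where "x = (\<Sum>i = 0..<n. (cmod (M $$ (i,j)))\<^sup>2)"
  define y where "y = (\<Sum>i = 0..<n. (cmod ((V * M) $$ (i,j)))\<^sup>2)"
  have adjM: "mat_adjoint M \<in> carrier_mat m n" "mat_adjoint V \<in> carrier_mat n n"
    using M V by (auto intro!: carrier_matI)
  have adj: "mat_adjoint (V * M) = mat_adjoint M * mat_adjoint V"
    using V M by (intro eq_matI) (auto simp: scalar_prod_def mult.commute)
  have "of_real y = (mat_adjoint (V * M) * (V * M)) $$ (j,j)"
    unfolding y_def by (rule sq[symmetric]) (use V M in simp)
  also have "mat_adjoint (V * M) * (V * M) = mat_adjoint M * ((mat_adjoint V * V) * M)"
    unfolding adj using V M adjM assoc_mult_mat[of "mat_adjoint M" m n "mat_adjoint V" n "V * M" m]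
      assoc_mult_mat[of "mat_adjoint V" n n V n M m] by simp
  also have "\<dots> = e \<cdot>\<^sub>m (mat_adjoint M * M)" unfolding ev using M adjM by (simp add: mult_smult_distrib[of _ m n])
  also have "\<dots> $$ (j,j) = e * of_real x" using M ij sq[OF M] by (simp add: x_def)
  finally have e: "of_real y = e * of_real x" .
  have x: "x > 0" unfolding x_def using ij by (intro sum_pos2[of _ i0]) auto
  have "y \<noteq> 0"
  proof
    assume "y = 0"
    then have "(V * M) $$ (i,j) = 0" if "i < n" for i
      using that unfolding y_def by (subst (asm) sum_nonneg_eq_0_iff) auto
    then have c: "(W * (V * M)) $$ (i0,j) = 0" using V M ij by (simp add: scalar_prod_def)
    have "W * (V * M) = M" using V M assoc_mult_mat[of W n n V n M m] by simp
    then show False using c ij by simp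
  qed
  moreover have "y \<ge> 0" unfolding y_def by (intro sum_nonneg) auto
  moreover have "e = of_real (y / x)" using e x by (simp add: field_simps)
  ultimately show ?thesis using x by (intro exI[of _ "y / x"]) auto
qed

text \<open>Self-adjointness excludes Jordan blocks: for \<open>Z = A M - e M\<close>, the adjoint
  of \<open>Z\<close> times \<open>Z\<close> is the adjoint of \<open>M\<close> times
  \<open>A Z - e Z\<close>, which is 0. \<open>pos_eigen\<close> is needed first, since
  \<open>e\<close> passes through the adjoint only if it is real.\<close>

lemma no_jordan:
  fixes V :: "complex mat"
  assumes V: "V \<in> carrier_mat n n" "W \<in> carrier_mat n n" "W * V = 1\<^sub>m n" and A: "A = mat_adjoint V * V"
    and M: "M \<in> carrier_mat n n" and 2: "A * (A * M - e \<cdot>\<^sub>m M) = e \<cdot>\<^sub>m (A * M - e \<cdot>\<^sub>m M)"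
  shows "A * M = e \<cdot>\<^sub>m M"
proof (rule ccontr)
  define Z where "Z = A * M - e \<cdot>\<^sub>m M"
  have Ac: "A \<in> carrier_mat n n" using V by (auto simp: A intro!: carrier_matI)
  have Zc: "Z \<in> carrier_mat n n" using Ac M by (auto simp: Z_def intro!: carrier_matI)
  assume "A * M \<noteq> e \<cdot>\<^sub>m M"
  then have Z0: "Z \<noteq> 0\<^sub>m n n"
  proof (rule contrapos_nn)
    assume z: "Z = 0\<^sub>m n n"
    show "A * M = e \<cdot>\<^sub>m M"
    proof (rule eq_matI)
      fix i j assume "i < dim_row (e \<cdot>\<^sub>m M)" "j < dim_col (e \<cdot>\<^sub>m M)"
      then have ij: "i < n" "j < n" using M by auto
      have "Z $$ (i,j) = 0" using z ij by simp
      then show "(A * M) $$ (i,j) = (e \<cdot>\<^sub>m M) $$ (i,j)" using ij M Ac by (simp add: Z_def)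
    qed (use M Ac in auto)
  qed
  obtain r where r: "e = complex_of_real r"
    using pos_eigen[OF V Zc _ Z0, of e] 2 unfolding A Z_def by blast
  obtain i0 j where ij: "i0 < n" "j < n" "Z $$ (i0,j) \<noteq> 0"
    using Z0 Zc by (metis carrier_matD eq_matI index_zero_mat)
  have aA: "mat_adjoint A = A" unfolding A using V by (intro eq_matI) (auto simp: scalar_prod_def mult.commute)
  have aZ: "mat_adjoint Z = mat_adjoint M * A - e \<cdot>\<^sub>m mat_adjoint M"
  proof -
    have "mat_adjoint Z = mat_adjoint M * mat_adjoint A - e \<cdot>\<^sub>m mat_adjoint M"
      unfolding Z_def r using Ac M by (intro eq_matI) (auto simp: scalar_prod_def mult.commute)
    then show ?thesis by (simp add: aA)
  qed
  have aM: "mat_adjoint M \<in> carrier_mat n n" using M by (auto intro!: carrier_matI)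
  have "mat_adjoint Z * Z = mat_adjoint M * A * Z - e \<cdot>\<^sub>m (mat_adjoint M * Z)"
    unfolding aZ using aM Ac Zc minus_mult_distrib_mat[of "mat_adjoint M * A" n n "e \<cdot>\<^sub>m mat_adjoint M" Z n]
      mult_smult_assoc_mat[of "mat_adjoint M" n n Z n e] by simp
  also have "mat_adjoint M * A * Z = e \<cdot>\<^sub>m (mat_adjoint M * Z)"
    using assoc_mult_mat[of "mat_adjoint M" n n A n Z n] aM Ac Zc 2 mult_smult_distrib[of "mat_adjoint M" n n Z n e]
    unfolding Z_def by simp
  finally have "(mat_adjoint Z * Z) $$ (j,j) = 0" using aM Zc ij M by simp
  moreover have "(mat_adjoint Z * Z) $$ (j,j) = of_real (\<Sum>i = 0..<n. (cmod (Z $$ (i,j)))\<^sup>2)"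
    using Zc ij by (simp add: scalar_prod_def complex_norm_square mult.commute del: of_real_power)
  moreover have "(\<Sum>i = 0..<n. (cmod (Z $$ (i,j)))\<^sup>2) > 0"
    using ij by (intro sum_pos2[of _ i0]) auto
  ultimately show False by (metis of_real_eq_0_iff less_irrefl)
qed

text \<open>Induction over the annihilating factors, the innermost first. The components of
  \<open>A M - e M\<close> for eigenvalues \<open>x \<noteq> e\<close> are divided by
  \<open>x - e\<close> and collected in \<open>S\<close>; the rest \<open>M - S\<close> is
  annihilated by the square of \<open>A - e\<close>, hence by \<open>A - e\<close> itself
  (\<open>no_jordan\<close>), and supplies the component for \<open>e\<close>.\<close>

lemma spectral_split:
  fixes V :: "complex mat"
  assumes V: "V \<in> carrier_mat n n" "W \<in> carrier_mat n n" "W * V = 1\<^sub>m n" and A: "A = mat_adjoint V * V"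
  shows "M \<in> carrier_mat n n \<Longrightarrow> A * M = M * A \<Longrightarrow> foldr (\<lambda>e M. (A - e \<cdot>\<^sub>m 1\<^sub>m n) * M) es M = 0\<^sub>m n n \<Longrightarrow>
    \<exists>\<Lambda> E. finite \<Lambda> \<and> (\<forall>x\<in>\<Lambda>. x > 0 \<and> E x \<in> carrier_mat n n \<and> A * E x = complex_of_real x \<cdot>\<^sub>m E x \<and> E x * A = complex_of_real x \<cdot>\<^sub>m E x) \<and>
      (\<forall>i<n. \<forall>j<n. M $$ (i,j) = (\<Sum>x\<in>\<Lambda>. E x $$ (i,j)))"
proof (induction es arbitrary: M rule: rev_induct)
  case Nil
  then show ?case by (intro exI[of _ "{}"]) simp
next
  case (snoc e es)
  note M = snoc.prems(1)
  have Ac: "A \<in> carrier_mat n n" using V by (auto simp: A intro!: carrier_matI)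
  define M2 where "M2 = A * M - e \<cdot>\<^sub>m M"
  have M2: "M2 \<in> carrier_mat n n" using M Ac by (auto simp: M2_def intro!: carrier_matI)
  have M2A: "A * M2 = M2 * A"
  proof -
    have "A * M2 = A * (A * M) - e \<cdot>\<^sub>m (A * M)"
      unfolding M2_def using M Ac mult_minus_distrib_mat[of A n n "A * M" n "e \<cdot>\<^sub>m M"] mult_smult_distrib[of A n n M n e] by simp
    moreover have "M2 * A = A * M * A - e \<cdot>\<^sub>m (M * A)"
      unfolding M2_def using M Ac minus_mult_distrib_mat[of "A * M" n n "e \<cdot>\<^sub>m M" A n] mult_smult_assoc_mat[of M n n A n e] by simp
    moreover have "A * M * A = A * (A * M)"
      using M Ac snoc.prems(2) assoc_mult_mat[of A n n M n A n] by simp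
    ultimately show ?thesis by (simp add: snoc.prems(2))
  qed
  have "foldr (\<lambda>e M. (A - e \<cdot>\<^sub>m 1\<^sub>m n) * M) es M2 = 0\<^sub>m n n"
    using snoc.prems(3) by (simp add: shift_mult[OF Ac M] M2_def)
  from snoc.IH[OF M2 M2A this] obtain \<Lambda> E where fin: "finite \<Lambda>"
    and E: "\<And>x. x \<in> \<Lambda> \<Longrightarrow> x > 0 \<and> E x \<in> carrier_mat n n \<and> A * E x = complex_of_real x \<cdot>\<^sub>m E x \<and> E x * A = complex_of_real x \<cdot>\<^sub>m E x"
    and sumE: "\<And>i j. i < n \<Longrightarrow> j < n \<Longrightarrow> M2 $$ (i,j) = (\<Sum>x\<in>\<Lambda>. E x $$ (i,j))" by blast
  have AE: "(\<Sum>l\<in>{0..<n}. A $$ (i,l) * E x $$ (l,j)) = complex_of_real x * E x $$ (i,j)"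
    and EA: "(\<Sum>l\<in>{0..<n}. E x $$ (i,l) * A $$ (l,j)) = complex_of_real x * E x $$ (i,j)" if "x \<in> \<Lambda>" "i < n" "j < n" for x i j
  proof -
    have e: "E x \<in> carrier_mat n n" "A * E x = complex_of_real x \<cdot>\<^sub>m E x" "E x * A = complex_of_real x \<cdot>\<^sub>m E x"
      using E[OF that(1)] by auto
    have "(A * E x) $$ (i,j) = (\<Sum>l\<in>{0..<n}. A $$ (i,l) * E x $$ (l,j))" "(E x * A) $$ (i,j) = (\<Sum>l\<in>{0..<n}. E x $$ (i,l) * A $$ (l,j))"
      using e(1) Ac that by (simp_all add: scalar_prod_def)
    then show "(\<Sum>l\<in>{0..<n}. A $$ (i,l) * E x $$ (l,j)) = complex_of_real x * E x $$ (i,j)"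
      "(\<Sum>l\<in>{0..<n}. E x $$ (i,l) * A $$ (l,j)) = complex_of_real x * E x $$ (i,j)"
      unfolding e(2,3) using e(1) that by simp_all
  qed
  define L where "L = {x\<in>\<Lambda>. complex_of_real x \<noteq> e}"
  have L: "finite L" "L \<subseteq> \<Lambda>" using fin by (auto simp: L_def)
  define S where "S = mat n n (\<lambda>(i,j). \<Sum>x\<in>L. E x $$ (i,j) / (complex_of_real x - e))"
  have S: "S \<in> carrier_mat n n" by (simp add: S_def)
  have AS: "(A * S) $$ (i,j) = (\<Sum>x\<in>L. complex_of_real x * (E x $$ (i,j) / (complex_of_real x - e)))" if ij: "i < n" "j < n" for i j
  proof -
    have "(A * S) $$ (i,j) = (\<Sum>l\<in>{0..<n}. \<Sum>x\<in>L. (A $$ (i,l) * E x $$ (l,j)) / (complex_of_real x - e))"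
      using Ac S ij by (simp add: scalar_prod_def S_def sum_distrib_left)
    also have "\<dots> = (\<Sum>x\<in>L. complex_of_real x * (E x $$ (i,j) / (complex_of_real x - e)))"
    proof (subst sum.swap, rule sum.cong[OF refl])
      fix x assume "x \<in> L"
      then have "x \<in> \<Lambda>" using L(2) by blast
      from AE[OF this ij] show "(\<Sum>l\<in>{0..<n}. (A $$ (i,l) * E x $$ (l,j)) / (complex_of_real x - e)) = complex_of_real x * (E x $$ (i,j) / (complex_of_real x - e))"
        by (simp only: sum_divide_distrib[symmetric] times_divide_eq_right)
    qed
    finally show ?thesis .
  qed
  have SA: "(S * A) $$ (i,j) = (\<Sum>x\<in>L. complex_of_real x * (E x $$ (i,j) / (complex_of_real x - e)))" if ij: "i < n" "j < n" for i j
  proof -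
    have "(S * A) $$ (i,j) = (\<Sum>l\<in>{0..<n}. \<Sum>x\<in>L. (E x $$ (i,l) * A $$ (l,j)) / (complex_of_real x - e))"
      using Ac S ij by (simp add: scalar_prod_def S_def sum_distrib_right)
    also have "\<dots> = (\<Sum>x\<in>L. complex_of_real x * (E x $$ (i,j) / (complex_of_real x - e)))"
    proof (subst sum.swap, rule sum.cong[OF refl])
      fix x assume "x \<in> L"
      then have "x \<in> \<Lambda>" using L(2) by blast
      from EA[OF this ij] show "(\<Sum>l\<in>{0..<n}. (E x $$ (i,l) * A $$ (l,j)) / (complex_of_real x - e)) = complex_of_real x * (E x $$ (i,j) / (complex_of_real x - e))"
        by (simp only: sum_divide_distrib[symmetric] times_divide_eq_right)
    qed
    finally show ?thesis .
  qed
  define M' where "M' = M - S"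
  have M': "M' \<in> carrier_mat n n" using M S by (auto simp: M'_def intro!: carrier_matI)
  have AM': "A * M' = A * M - A * S" "M' * A = M * A - S * A"
    unfolding M'_def using Ac M S mult_minus_distrib_mat[of A n n M n S] minus_mult_distrib_mat[of M n n S A n] by auto
  \<comment> \<open>What the division by \<open>x - e\<close> cannot reach: the component for
    \<open>x = e\<close>, if there is one.\<close>
  define R where "R = mat n n (\<lambda>(i,j). \<Sum>x\<in>\<Lambda> - L. E x $$ (i,j))"
  have R: "R \<in> carrier_mat n n" by (simp add: R_def)
  have eqR: "A * M' - e \<cdot>\<^sub>m M' = R"
  proof (rule eq_matI)
    fix i j assume "i < dim_row R" "j < dim_col R"
    then have ij: "i < n" "j < n" by (simp_all add: R_def)
    have "(A * M' - e \<cdot>\<^sub>m M') $$ (i,j) = M2 $$ (i,j) - ((A * S) $$ (i,j) - e * S $$ (i,j))"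
      unfolding AM' M2_def using ij Ac M S by (simp add: M'_def algebra_simps)
    also have "(A * S) $$ (i,j) - e * S $$ (i,j) = (\<Sum>x\<in>L. E x $$ (i,j))"
    proof -
      have "(A * S) $$ (i,j) - e * S $$ (i,j) = (\<Sum>x\<in>L. complex_of_real x * (E x $$ (i,j) / (complex_of_real x - e)) - e * (E x $$ (i,j) / (complex_of_real x - e)))"
        unfolding AS[OF ij] using ij by (simp add: S_def sum_subtractf sum_distrib_left del: times_divide_eq_right)
      also have "\<dots> = (\<Sum>x\<in>L. E x $$ (i,j))"
      proof (rule sum.cong[OF refl])
        fix x assume "x \<in> L"
        then have "complex_of_real x - e \<noteq> 0" by (simp add: L_def)
        then show "complex_of_real x * (E x $$ (i,j) / (complex_of_real x - e)) - e * (E x $$ (i,j) / (complex_of_real x - e)) = E x $$ (i,j)"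
          unfolding left_diff_distrib[symmetric] by simp
      qed
      finally show ?thesis .
    qed
    also have "M2 $$ (i,j) - (\<Sum>x\<in>L. E x $$ (i,j)) = R $$ (i,j)"
      using ij L fin by (simp add: sumE R_def sum_diff)
    finally show "(A * M' - e \<cdot>\<^sub>m M') $$ (i,j) = R $$ (i,j)" .
  qed (use M' Ac in \<open>auto simp: R_def\<close>)
  have AR: "A * R = e \<cdot>\<^sub>m R"
  proof (rule eq_matI)
    fix i j assume "i < dim_row (e \<cdot>\<^sub>m R)" "j < dim_col (e \<cdot>\<^sub>m R)"
    then have ij: "i < n" "j < n" by (simp_all add: R_def)
    have "(A * R) $$ (i,j) = (\<Sum>l\<in>{0..<n}. \<Sum>x\<in>\<Lambda> - L. A $$ (i,l) * E x $$ (l,j))"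
      using Ac R ij by (simp add: scalar_prod_def R_def sum_distrib_left)
    also have "\<dots> = (\<Sum>x\<in>\<Lambda> - L. e * E x $$ (i,j))"
    proof (subst sum.swap, rule sum.cong[OF refl])
      fix x assume "x \<in> \<Lambda> - L"
      then have "x \<in> \<Lambda>" "complex_of_real x = e" by (auto simp: L_def)
      from AE[OF this(1) ij] this(2) show "(\<Sum>l\<in>{0..<n}. A $$ (i,l) * E x $$ (l,j)) = e * E x $$ (i,j)"
        by simp
    qed
    finally show "(A * R) $$ (i,j) = (e \<cdot>\<^sub>m R) $$ (i,j)" using ij by (simp add: R_def sum_distrib_left)
  qed (use Ac in \<open>auto simp: R_def\<close>)
  have ev: "A * M' = e \<cdot>\<^sub>m M'"
    using no_jordan[OF V A M', of e] AR unfolding eqR by blast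
  have comm: "M' * A = A * M'"
    unfolding AM' snoc.prems(2) by (intro eq_matI) (use AS SA M Ac S in auto)
  define E' where "E' x = (if complex_of_real x = e then M' else (1 / (complex_of_real x - e)) \<cdot>\<^sub>m E x)" for x
  \<comment> \<open>The eigenvalue \<open>e\<close> is listed only if its component is nonzero,
    because \<open>pos_eigen\<close> shows only then that it is a positive real.\<close>
  define \<Lambda>' where "\<Lambda>' = L \<union> (if M' = 0\<^sub>m n n then {} else {Re e})"
  have pos: "0 < Re e \<and> complex_of_real (Re e) = e" if nz: "M' \<noteq> 0\<^sub>m n n"
    using pos_eigen[OF V M' _ nz, of e] ev unfolding A by auto
  have "x > 0 \<and> E' x \<in> carrier_mat n n \<and> A * E' x = complex_of_real x \<cdot>\<^sub>m E' x \<and> E' x * A = complex_of_real x \<cdot>\<^sub>m E' x" if x: "x \<in> \<Lambda>'" for x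
  proof (cases "complex_of_real x = e")
    case True
    then have "x \<notin> L" by (simp add: L_def)
    then have nz: "M' \<noteq> 0\<^sub>m n n" "x = Re e" using x by (auto simp: \<Lambda>'_def split: if_splits)
    then show ?thesis using pos True M' ev comm by (simp add: E'_def)
  next
    case False
    then have "x \<in> L" using x pos by (auto simp: \<Lambda>'_def split: if_splits)
    then have *: "x > 0" "E x \<in> carrier_mat n n" "A * E x = complex_of_real x \<cdot>\<^sub>m E x" "E x * A = complex_of_real x \<cdot>\<^sub>m E x"
      using E L(2) by auto
    then show ?thesis
      using False Ac mult_smult_distrib[of A n n "E x" n] mult_smult_assoc_mat[of "E x" n n A n]
      by (simp add: E'_def smult_smult_mat smult_1_mat mult.commute)
  qed
  moreover have "M $$ (i,j) = (\<Sum>x\<in>\<Lambda>'. E' x $$ (i,j))" if ij: "i < n" "j < n" for i j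
  proof -
    have "(\<Sum>x\<in>\<Lambda>'. E' x $$ (i,j)) = (\<Sum>x\<in>L. E' x $$ (i,j)) + M' $$ (i,j)"
    proof (cases "M' = 0\<^sub>m n n")
      case True then show ?thesis using ij by (simp add: \<Lambda>'_def)
    next
      case False
      then have "Re e \<notin> L" using pos by (auto simp: L_def)
      then show ?thesis using False pos L(1) by (simp add: \<Lambda>'_def E'_def add.commute)
    qed
    also have "(\<Sum>x\<in>L. E' x $$ (i,j)) = S $$ (i,j)"
    proof -
      have "E' x $$ (i,j) = E x $$ (i,j) / (complex_of_real x - e)" if "x \<in> L" for x
      proof -
        have "complex_of_real x \<noteq> e" "E x \<in> carrier_mat n n" using that E L(2) by (auto simp: L_def)
        then show ?thesis using ij by (simp add: E'_def)
      qed
      then show ?thesis using ij by (simp add: S_def)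
    qed
    finally show ?thesis using ij M S by (simp add: M'_def)
  qed
  moreover have "finite \<Lambda>'" using L by (simp add: \<Lambda>'_def)
  ultimately show ?case by blast
qed

text \<open>The decomposition of the identity. The \<open>E x\<close> are the spectral projections,
  recorded only through their eigenvalue equations and their sum.\<close>

lemma spectral:
  fixes V :: "complex mat"
  assumes V: "V \<in> carrier_mat n n" "W \<in> carrier_mat n n" "W * V = 1\<^sub>m n" and A: "A = mat_adjoint V * V"
  shows "\<exists>\<Lambda> E. finite \<Lambda> \<and> (\<forall>x\<in>\<Lambda>. x > 0 \<and> E x \<in> carrier_mat n n \<and> A * E x = complex_of_real x \<cdot>\<^sub>m E x \<and> E x * A = complex_of_real x \<cdot>\<^sub>m E x) \<and>
      (\<forall>i<n. \<forall>j<n. 1\<^sub>m n $$ (i,j) = (\<Sum>x\<in>\<Lambda>. E x $$ (i,j)))"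
proof -
  have Ac: "A \<in> carrier_mat n n" using V by (auto simp: A intro!: carrier_matI)
  obtain es where "foldr (\<lambda>e M. (A - e \<cdot>\<^sub>m 1\<^sub>m n) * M) es (1\<^sub>m n) = 0\<^sub>m n n"
    using mat_annihilated[OF Ac] by blast
  from spectral_split[OF V A _ _ this] Ac show ?thesis by simp
qed

section \<open>Change of basis of the associator\<close>

lemma prod4:
  fixes f1 f2 f3 f4 :: "_ \<Rightarrow> complex"
  shows "sum f1 A1 * (sum f2 A2 * (sum f3 A3 * sum f4 A4)) =
    (\<Sum>(a,b,c,d)\<in>A1 \<times> A2 \<times> A3 \<times> A4. f1 a * (f2 b * (f3 c * f4 d)))"
proof -
  have "sum f1 A1 * (sum f2 A2 * (sum f3 A3 * sum f4 A4)) =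
    (\<Sum>a\<in>A1. \<Sum>b\<in>A2. \<Sum>c\<in>A3. \<Sum>d\<in>A4. f1 a * (f2 b * (f3 c * f4 d)))"
    unfolding sum_product[of f3 A3 f4 A4] sum_distrib_right[of f2 A2] sum_distrib_right[of f1 A1]
    unfolding sum_distrib_left ..
  then show ?thesis by (simp only: sum.cartesian_product)
qed

text \<open>Change of basis of an \<open>F\<close> block: \<open>A\<close> and \<open>B\<close> act
  on the lower index, \<open>C\<close> and \<open>D\<close> from the right on the upper one. The
  value 0 outside of the range makes equality of blocks an equality of functions.\<close>

definition act :: "complex mat \<Rightarrow> complex mat \<Rightarrow> complex mat \<Rightarrow> complex mat \<Rightarrow>
    (nat \<Rightarrow> nat \<Rightarrow> nat \<Rightarrow> nat \<Rightarrow> complex) \<Rightarrow> nat \<Rightarrow> nat \<Rightarrow> nat \<Rightarrow> nat \<Rightarrow> complex" where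
  "act A B C D \<Phi> \<alpha> \<beta> \<mu> \<nu> = (if \<alpha> < dim_row A \<and> \<beta> < dim_row B \<and> \<mu> < dim_col C \<and> \<nu> < dim_col D then
     (\<Sum>\<alpha>' < dim_col A. \<Sum>\<beta>' < dim_col B. \<Sum>\<mu>' < dim_row C. \<Sum>\<nu>' < dim_row D.
        A $$ (\<alpha>,\<alpha>') * B $$ (\<beta>,\<beta>') * \<Phi> \<alpha>' \<beta>' \<mu>' \<nu>' * C $$ (\<mu>',\<mu>) * D $$ (\<nu>',\<nu>)) else 0)"

abbreviation BX where "BX n1 n2 n3 n4 \<equiv> {..<n1} \<times> {..<n2} \<times> {..<n3} \<times> {..<(n4::nat)}"

lemma act_alt:
  assumes "A \<in> carrier_mat n1 n1" "B \<in> carrier_mat n2 n2" "C \<in> carrier_mat n3 n3" "D \<in> carrier_mat n4 n4"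
  shows "act A B C D \<Phi> \<alpha> \<beta> \<mu> \<nu> = (if \<alpha> < n1 \<and> \<beta> < n2 \<and> \<mu> < n3 \<and> \<nu> < n4 then
     (\<Sum>(\<alpha>',\<beta>',\<mu>',\<nu>')\<in>BX n1 n2 n3 n4. (A $$ (\<alpha>,\<alpha>') * (B $$ (\<beta>,\<beta>') * (C $$ (\<mu>',\<mu>) * D $$ (\<nu>',\<nu>)))) * \<Phi> \<alpha>' \<beta>' \<mu>' \<nu>') else 0)"
  using assms by (simp add: act_def sum.cartesian_product mult_ac)

text \<open>Right actions compose in the opposite order, whence \<open>C' * C\<close>.\<close>

lemma act_comp:
  assumes c: "A \<in> carrier_mat n1 n1" "B \<in> carrier_mat n2 n2" "C \<in> carrier_mat n3 n3" "D \<in> carrier_mat n4 n4"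
    and c': "A' \<in> carrier_mat n1 n1" "B' \<in> carrier_mat n2 n2" "C' \<in> carrier_mat n3 n3" "D' \<in> carrier_mat n4 n4"
  shows "act A B C D (act A' B' C' D' \<Phi>) = act (A * A') (B * B') (C' * C) (D' * D) \<Phi>"
proof (intro ext)
  fix \<alpha> \<beta> \<mu> \<nu>
  have m: "A * A' \<in> carrier_mat n1 n1" "B * B' \<in> carrier_mat n2 n2" "C' * C \<in> carrier_mat n3 n3" "D' * D \<in> carrier_mat n4 n4"
    using assms by auto
  show "act A B C D (act A' B' C' D' \<Phi>) \<alpha> \<beta> \<mu> \<nu> = act (A * A') (B * B') (C' * C) (D' * D) \<Phi> \<alpha> \<beta> \<mu> \<nu>"
  proof (cases "\<alpha> < n1 \<and> \<beta> < n2 \<and> \<mu> < n3 \<and> \<nu> < n4")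
    case False then show ?thesis by (simp only: act_alt[OF c] act_alt[OF m] if_False)
  next
    case True
    let ?Xm = "BX n1 n2 n3 n4"
    define k where "k = (\<lambda>(a,b,m,n). A $$ (\<alpha>,a) * (B $$ (\<beta>,b) * (C $$ (m,\<mu>) * D $$ (n,\<nu>))))"
    define k' where "k' = (\<lambda>(a,b,m,n) (a',b',m',n'). A' $$ (a,a') * (B' $$ (b,b') * (C' $$ (m',m) * D' $$ (n',n))))"
    define \<phi> where "\<phi> = (\<lambda>(a,b,m,n). \<Phi> a b m n)"
    have "act A B C D (act A' B' C' D' \<Phi>) \<alpha> \<beta> \<mu> \<nu> = (\<Sum>p\<in>?Xm. k p * (\<Sum>p'\<in>?Xm. k' p p' * \<phi> p'))"
      unfolding act_alt[OF c] using True
      by (simp, intro sum.cong refl) (auto simp: act_alt[OF c'] k_def k'_def \<phi>_def case_prod_beta)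
    also have "\<dots> = (\<Sum>p'\<in>?Xm. (\<Sum>p\<in>?Xm. k p * k' p p') * \<phi> p')"
      unfolding sum_distrib_left sum_distrib_right by (subst sum.swap) (simp only: mult.assoc)
    also have "\<dots> = act (A * A') (B * B') (C' * C) (D' * D) \<Phi> \<alpha> \<beta> \<mu> \<nu>"
      unfolding act_alt[OF m] using True
    proof (simp, intro sum.cong refl, clarsimp)
      fix a' b' m' n' assume p: "a' < n1" "b' < n2" "m' < n3" "n' < n4"
      have "(\<Sum>p\<in>?Xm. k p * k' p (a',b',m',n')) =
        (\<Sum>a<n1. A $$ (\<alpha>,a) * A' $$ (a,a')) * ((\<Sum>b<n2. B $$ (\<beta>,b) * B' $$ (b,b')) * ((\<Sum>m<n3. C' $$ (m',m) * C $$ (m,\<mu>)) * (\<Sum>n<n4. D' $$ (n',n) * D $$ (n,\<nu>))))"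
        unfolding prod4 by (intro sum.cong refl) (auto simp: k_def k'_def)
      also have "\<dots> = (A * A') $$ (\<alpha>,a') * ((B * B') $$ (\<beta>,b') * ((C' * C) $$ (m',\<mu>) * (D' * D) $$ (n',\<nu>)))"
        using p True c c' by (simp add: scalar_prod_def atLeast0LessThan)
      finally show "(\<Sum>p\<in>?Xm. k p * k' p (a',b',m',n')) * \<phi> (a',b',m',n') =
        (A * A') $$ (\<alpha>,a') * ((B * B') $$ (\<beta>,b') * ((C' * C) $$ (m',\<mu>) * (D' * D) $$ (n',\<nu>))) * \<Phi> a' b' m' n'"
        by (simp add: \<phi>_def)
    qed
    finally show ?thesis .
  qed
qed

lemma act_smult:
  assumes "A \<in> carrier_mat n1 n1" "B \<in> carrier_mat n2 n2" "C \<in> carrier_mat n3 n3" "D \<in> carrier_mat n4 n4"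
  shows "act (x1 \<cdot>\<^sub>m A) (x2 \<cdot>\<^sub>m B) (x3 \<cdot>\<^sub>m C) (x4 \<cdot>\<^sub>m D) \<Phi> \<alpha> \<beta> \<mu> \<nu> = x1 * x2 * x3 * x4 * act A B C D \<Phi> \<alpha> \<beta> \<mu> \<nu>"
  using assms by (simp add: act_def sum_distrib_left mult_ac)

text \<open>Multilinearity in the four matrices; it serves to insert spectral decompositions into
  all slots at once.\<close>

lemma act_sum:
  assumes E: "\<And>x. x \<in> L1 \<Longrightarrow> E1 x \<in> carrier_mat n1 n1" "\<And>x. x \<in> L2 \<Longrightarrow> E2 x \<in> carrier_mat n2 n2"
     "\<And>x. x \<in> L3 \<Longrightarrow> E3 x \<in> carrier_mat n3 n3" "\<And>x. x \<in> L4 \<Longrightarrow> E4 x \<in> carrier_mat n4 n4"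
    and M: "M1 \<in> carrier_mat n1 n1" "M2 \<in> carrier_mat n2 n2" "M3 \<in> carrier_mat n3 n3" "M4 \<in> carrier_mat n4 n4"
    and S: "\<And>i j. i < n1 \<Longrightarrow> j < n1 \<Longrightarrow> M1 $$ (i,j) = (\<Sum>x\<in>L1. c1 x * E1 x $$ (i,j))"
     "\<And>i j. i < n2 \<Longrightarrow> j < n2 \<Longrightarrow> M2 $$ (i,j) = (\<Sum>x\<in>L2. c2 x * E2 x $$ (i,j))"
     "\<And>i j. i < n3 \<Longrightarrow> j < n3 \<Longrightarrow> M3 $$ (i,j) = (\<Sum>x\<in>L3. c3 x * E3 x $$ (i,j))"
     "\<And>i j. i < n4 \<Longrightarrow> j < n4 \<Longrightarrow> M4 $$ (i,j) = (\<Sum>x\<in>L4. c4 x * E4 x $$ (i,j))"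
  shows "act M1 M2 M3 M4 \<Phi> \<alpha> \<beta> \<mu> \<nu> =
    (\<Sum>(x1,x2,x3,x4)\<in>L1 \<times> L2 \<times> L3 \<times> L4. c1 x1 * c2 x2 * c3 x3 * c4 x4 * act (E1 x1) (E2 x2) (E3 x3) (E4 x4) \<Phi> \<alpha> \<beta> \<mu> \<nu>)"
proof (cases "\<alpha> < n1 \<and> \<beta> < n2 \<and> \<mu> < n3 \<and> \<nu> < n4")
  case False
  have "act (E1 x1) (E2 x2) (E3 x3) (E4 x4) \<Phi> \<alpha> \<beta> \<mu> \<nu> = 0" if "x1 \<in> L1" "x2 \<in> L2" "x3 \<in> L3" "x4 \<in> L4" for x1 x2 x3 x4
    using False by (subst act_alt[OF E(1)[OF that(1)] E(2)[OF that(2)] E(3)[OF that(3)] E(4)[OF that(4)]]) auto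
  then have "(\<Sum>(x1,x2,x3,x4)\<in>L1 \<times> L2 \<times> L3 \<times> L4. c1 x1 * c2 x2 * c3 x3 * c4 x4 * act (E1 x1) (E2 x2) (E3 x3) (E4 x4) \<Phi> \<alpha> \<beta> \<mu> \<nu>) = 0"
    by (intro sum.neutral) auto
  moreover have "act M1 M2 M3 M4 \<Phi> \<alpha> \<beta> \<mu> \<nu> = 0" using False unfolding act_alt[OF M] by (simp only: if_False)
  ultimately show ?thesis by simp
next
  case True
  let ?Xm = "BX n1 n2 n3 n4" and ?L = "L1 \<times> L2 \<times> L3 \<times> L4"
  define e where "e = (\<lambda>(x1,x2,x3,x4) (a,b,m,n). E1 x1 $$ (\<alpha>,a) * (E2 x2 $$ (\<beta>,b) * (E3 x3 $$ (m,\<mu>) * E4 x4 $$ (n,\<nu>))))"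
  define c where "c = (\<lambda>(x1,x2,x3,x4). c1 x1 * c2 x2 * c3 x3 * c4 x4)"
  define \<phi> where "\<phi> = (\<lambda>(a,b,m,n). \<Phi> a b m n)"
  have "act M1 M2 M3 M4 \<Phi> \<alpha> \<beta> \<mu> \<nu> = (\<Sum>p\<in>?Xm. (\<Sum>x\<in>?L. c x * e x p) * \<phi> p)"
    unfolding act_alt[OF M] using True
  proof (simp, intro sum.cong refl, clarsimp)
    fix a b m n assume p: "a < n1" "b < n2" "m < n3" "n < n4"
    have "M1 $$ (\<alpha>,a) * (M2 $$ (\<beta>,b) * (M3 $$ (m,\<mu>) * M4 $$ (n,\<nu>))) = (\<Sum>x\<in>?L. c x * e x (a,b,m,n))"
      using p True by (simp only: S prod4) (auto simp: c_def e_def mult_ac intro!: sum.cong)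
    then show "M1 $$ (\<alpha>,a) * (M2 $$ (\<beta>,b) * (M3 $$ (m,\<mu>) * M4 $$ (n,\<nu>))) * \<Phi> a b m n = (\<Sum>x\<in>?L. c x * e x (a,b,m,n)) * \<phi> (a,b,m,n)"
      by (simp add: \<phi>_def)
  qed
  also have "\<dots> = (\<Sum>x\<in>?L. c x * (\<Sum>p\<in>?Xm. e x p * \<phi> p))"
    unfolding sum_distrib_left sum_distrib_right by (subst sum.swap) (simp only: mult.assoc)
  also have "\<dots> = (\<Sum>(x1,x2,x3,x4)\<in>?L. c1 x1 * c2 x2 * c3 x3 * c4 x4 * act (E1 x1) (E2 x2) (E3 x3) (E4 x4) \<Phi> \<alpha> \<beta> \<mu> \<nu>)"
  proof (intro sum.cong refl, clarsimp)
    fix x1 x2 x3 x4 assume x: "x1 \<in> L1" "x2 \<in> L2" "x3 \<in> L3" "x4 \<in> L4"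
    have "act (E1 x1) (E2 x2) (E3 x3) (E4 x4) \<Phi> \<alpha> \<beta> \<mu> \<nu> = (\<Sum>p\<in>?Xm. e (x1,x2,x3,x4) p * \<phi> p)"
      unfolding act_alt[OF E(1)[OF x(1)] E(2)[OF x(2)] E(3)[OF x(3)] E(4)[OF x(4)]] using True
      by (simp, intro sum.cong refl) (auto simp: e_def \<phi>_def)
    then show "c (x1,x2,x3,x4) * (\<Sum>p\<in>?Xm. e (x1,x2,x3,x4) p * \<phi> p) = c1 x1 * c2 x2 * c3 x3 * c4 x4 * act (E1 x1) (E2 x2) (E3 x3) (E4 x4) \<Phi> \<alpha> \<beta> \<mu> \<nu>"
      by (simp add: c_def)
  qed
  finally show ?thesis .
qed

section \<open>Rigidity of positive automorphisms\<close>

context fusion_system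
begin

definition Fb where "Fb a b c d e f = (\<lambda>\<alpha> \<beta> \<mu> \<nu>. F a b c d (e,\<alpha>,\<beta>) (f,\<mu>,\<nu>))"

lemma sum_J_range:
  assumes "\<And>i. \<not> i < N a b c \<Longrightarrow> g i = (0::complex)"
  shows "sum g J = sum g {..<N a b c}"
  using assms range_J finJ by (intro sum.mono_neutral_right) auto

lemma act_id1:
  assumes "Xm \<in> carrier_mat (N a b e) (N a b e)" "\<alpha> < N a b e" "\<beta> < N e c d" "\<mu> < N b c f" "\<nu> < N a f d"
  shows "act Xm (1\<^sub>m (N e c d)) (1\<^sub>m (N b c f)) (1\<^sub>m (N a f d)) (Fb a b c d e f) \<alpha> \<beta> \<mu> \<nu> =
    (\<Sum>\<alpha>'<N a b e. Xm $$ (\<alpha>,\<alpha>') * F a b c d (e,\<alpha>',\<beta>) (f,\<mu>,\<nu>))"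
  using assms by (simp add: act_def Fb_def sum_if_const if_times times_if if_distrib[of "\<lambda>x. _ * x"] if_distrib[of "\<lambda>x. x * _"] cong: if_cong)

lemma act_id2:
  assumes "Xm \<in> carrier_mat (N e c d) (N e c d)" "\<alpha> < N a b e" "\<beta> < N e c d" "\<mu> < N b c f" "\<nu> < N a f d"
  shows "act (1\<^sub>m (N a b e)) Xm (1\<^sub>m (N b c f)) (1\<^sub>m (N a f d)) (Fb a b c d e f) \<alpha> \<beta> \<mu> \<nu> =
    (\<Sum>\<beta>'<N e c d. Xm $$ (\<beta>,\<beta>') * F a b c d (e,\<alpha>,\<beta>') (f,\<mu>,\<nu>))"
  using assms by (simp add: act_def Fb_def sum_if_const if_times times_if if_distrib[of "\<lambda>x. _ * x"] if_distrib[of "\<lambda>x. x * _"] cong: if_cong)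

lemma act_id3:
  assumes "Xm \<in> carrier_mat (N b c f) (N b c f)" "\<alpha> < N a b e" "\<beta> < N e c d" "\<mu> < N b c f" "\<nu> < N a f d"
  shows "act (1\<^sub>m (N a b e)) (1\<^sub>m (N e c d)) Xm (1\<^sub>m (N a f d)) (Fb a b c d e f) \<alpha> \<beta> \<mu> \<nu> =
    (\<Sum>\<mu>'<N b c f. F a b c d (e,\<alpha>,\<beta>) (f,\<mu>',\<nu>) * Xm $$ (\<mu>',\<mu>))"
  using assms by (simp add: act_def Fb_def sum_if_const if_times times_if if_distrib[of "\<lambda>x. _ * x"] if_distrib[of "\<lambda>x. x * _"] cong: if_cong)

lemma act_id4:
  assumes "Xm \<in> carrier_mat (N a f d) (N a f d)" "\<alpha> < N a b e" "\<beta> < N e c d" "\<mu> < N b c f" "\<nu> < N a f d"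
  shows "act (1\<^sub>m (N a b e)) (1\<^sub>m (N e c d)) (1\<^sub>m (N b c f)) Xm (Fb a b c d e f) \<alpha> \<beta> \<mu> \<nu> =
    (\<Sum>\<nu>'<N a f d. F a b c d (e,\<alpha>,\<beta>) (f,\<mu>,\<nu>') * Xm $$ (\<nu>',\<nu>))"
  using assms by (simp add: act_def Fb_def sum_if_const if_times times_if if_distrib[of "\<lambda>x. _ * x"] if_distrib[of "\<lambda>x. x * _"] cong: if_cong)

text \<open>The logarithm \<open>Xm\<close> of \<open>P\<close> obeys the derivation law, so
  \<open>coboundary\<close> makes it scalar, and hence \<open>P\<close>. The law is checked on
  spectral components: a nonzero component of \<open>F\<close> requires
  \<open>x1 * x2 = x3 * x4\<close> (\<open>logs\<close>), which logarithms turn into a linear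
  relation.\<close>

theorem posdef_rigid:
  fixes V W Pi :: "'a \<Rightarrow> 'a \<Rightarrow> 'a \<Rightarrow> complex mat"
  assumes V: "\<And>a b c. V a b c \<in> carrier_mat (N a b c) (N a b c)" and W: "\<And>a b c. W a b c \<in> carrier_mat (N a b c) (N a b c)"
    and WV: "\<And>a b c. W a b c * V a b c = 1\<^sub>m (N a b c)"
    and P: "\<And>a b c. P a b c = mat_adjoint (V a b c) * V a b c"
    and Pi: "\<And>a b c. Pi a b c \<in> carrier_mat (N a b c) (N a b c)" "\<And>a b c. Pi a b c * P a b c = 1\<^sub>m (N a b c)"
    and inv: "\<And>a b c d e f. act (P a b e) (P e c d) (Pi b c f) (Pi a f d) (Fb a b c d e f) = act (1\<^sub>m (N a b e)) (1\<^sub>m (N e c d)) (1\<^sub>m (N b c f)) (1\<^sub>m (N a f d)) (Fb a b c d e f)"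
  shows "\<exists>y :: 'a \<Rightarrow> real. \<forall>a b c. P a b c = complex_of_real (exp (y a + y b - y c)) \<cdot>\<^sub>m 1\<^sub>m (N a b c)"
proof -
  have Pc: "P a b c \<in> carrier_mat (N a b c) (N a b c)" for a b c
    unfolding P using V[of a b c] by (auto intro!: carrier_matI)
  have "\<forall>t. \<exists>LE. case t of (a,b,c) \<Rightarrow> finite (fst LE) \<and> (\<forall>x\<in>fst LE. x > 0 \<and> snd LE x \<in> carrier_mat (N a b c) (N a b c) \<and> P a b c * snd LE x = complex_of_real x \<cdot>\<^sub>m snd LE x \<and> snd LE x * P a b c = complex_of_real x \<cdot>\<^sub>m snd LE x) \<and>
      (\<forall>i<N a b c. \<forall>j<N a b c. 1\<^sub>m (N a b c) $$ (i,j) = (\<Sum>x\<in>fst LE. snd LE x $$ (i,j)))"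
    using spectral[OF V W WV P] by (simp split: prod.split)
  then obtain LE where LE: "\<And>a b c. finite (fst (LE (a,b,c))) \<and> (\<forall>x\<in>fst (LE (a,b,c)). x > 0 \<and> snd (LE (a,b,c)) x \<in> carrier_mat (N a b c) (N a b c) \<and> P a b c * snd (LE (a,b,c)) x = complex_of_real x \<cdot>\<^sub>m snd (LE (a,b,c)) x \<and> snd (LE (a,b,c)) x * P a b c = complex_of_real x \<cdot>\<^sub>m snd (LE (a,b,c)) x) \<and>
      (\<forall>i<N a b c. \<forall>j<N a b c. 1\<^sub>m (N a b c) $$ (i,j) = (\<Sum>x\<in>fst (LE (a,b,c)). snd (LE (a,b,c)) x $$ (i,j)))"
    using choice[of "\<lambda>t LE. case t of (a,b,c) \<Rightarrow> finite (fst LE) \<and> (\<forall>x\<in>fst LE. x > 0 \<and> snd LE x \<in> carrier_mat (N a b c) (N a b c) \<and> P a b c * snd LE x = complex_of_real x \<cdot>\<^sub>m snd LE x \<and> snd LE x * P a b c = complex_of_real x \<cdot>\<^sub>m snd LE x) \<and>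
      (\<forall>i<N a b c. \<forall>j<N a b c. 1\<^sub>m (N a b c) $$ (i,j) = (\<Sum>x\<in>fst LE. snd LE x $$ (i,j)))"] by auto
  define L where "L a b c = fst (LE (a,b,c))" for a b c
  define E where "E a b c = snd (LE (a,b,c))" for a b c
  have L: "finite (L a b c)" "\<And>x. x \<in> L a b c \<Longrightarrow> x > 0" for a b c using LE by (simp_all add: L_def)
  have E: "E a b c x \<in> carrier_mat (N a b c) (N a b c)" "P a b c * E a b c x = complex_of_real x \<cdot>\<^sub>m E a b c x"
    "E a b c x * P a b c = complex_of_real x \<cdot>\<^sub>m E a b c x" if "x \<in> L a b c" for a b c x
    using LE[of a b c] that by (simp_all add: L_def E_def)
  have one: "1\<^sub>m (N a b c) $$ (i,j) = (\<Sum>x\<in>L a b c. 1 * E a b c x $$ (i,j))" if "i < N a b c" "j < N a b c" for a b c i j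
    using LE[of a b c] that by (simp add: L_def E_def)
  define Xm where "Xm a b c = mat (N a b c) (N a b c) (\<lambda>(i,j). \<Sum>x\<in>L a b c. complex_of_real (ln x) * E a b c x $$ (i,j))" for a b c
  have Xc: "Xm a b c \<in> carrier_mat (N a b c) (N a b c)" for a b c by (simp add: Xm_def)
  have Xe: "Xm a b c $$ (i,j) = (\<Sum>x\<in>L a b c. complex_of_real (ln x) * E a b c x $$ (i,j))" if "i < N a b c" "j < N a b c" for a b c i j
    using that by (simp add: Xm_def)
  have PiE: "Pi a b c * E a b c x = (1 / complex_of_real x) \<cdot>\<^sub>m E a b c x" if x: "x \<in> L a b c" for a b c x
  proof -
    have x0: "complex_of_real x \<noteq> 0" using L(2)[OF x] by simp
    have "E a b c x = Pi a b c * P a b c * E a b c x" using Pi E(1)[OF x] by simp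
    also have "\<dots> = complex_of_real x \<cdot>\<^sub>m (Pi a b c * E a b c x)"
      using assoc_mult_mat[OF Pi(1) Pc E(1)[OF x]] mult_smult_distrib[OF Pi(1) E(1)[OF x]] E(2)[OF x] by simp
    finally have "(1 / complex_of_real x) \<cdot>\<^sub>m E a b c x = (1 / complex_of_real x) \<cdot>\<^sub>m (complex_of_real x \<cdot>\<^sub>m (Pi a b c * E a b c x))"
      by simp
    then show ?thesis using x0 by (simp add: smult_smult_mat smult_1_mat)
  qed
  have PiE': "E a b c x = complex_of_real x \<cdot>\<^sub>m (Pi a b c * E a b c x)" if x: "x \<in> L a b c" for a b c x
    using L(2)[OF x] by (simp add: PiE[OF x] smult_smult_mat smult_1_mat)
  \<comment> \<open>Composing with \<open>P\<close> rescales the component by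
    \<open>x1 * x2 / (x3 * x4)\<close>, while the invariance \<open>inv\<close> leaves it
    unchanged.\<close>
  have logs: "act (E a b e x1) (E e c d x2) (E b c f x3) (E a f d x4) (Fb a b c d e f) \<alpha> \<beta> \<mu> \<nu> = 0 \<or> ln x1 + ln x2 = ln x3 + ln x4"
    if x: "x1 \<in> L a b e" "x2 \<in> L e c d" "x3 \<in> L b c f" "x4 \<in> L a f d" for a b c d e f x1 x2 x3 x4 \<alpha> \<beta> \<mu> \<nu>
  proof -
    note e = E(1)[OF x(1)] E(1)[OF x(2)] E(1)[OF x(3)] E(1)[OF x(4)]
    note p = L(2)[OF x(1)] L(2)[OF x(2)] L(2)[OF x(3)] L(2)[OF x(4)]
    let ?A = "act (E a b e x1) (E e c d x2) (E b c f x3) (E a f d x4)"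
    have "?A (Fb a b c d e f) = ?A (act (P a b e) (P e c d) (Pi b c f) (Pi a f d) (Fb a b c d e f))"
      unfolding inv act_comp[OF e one_carrier_mat one_carrier_mat one_carrier_mat one_carrier_mat] using e by simp
    also have "\<dots> = act (complex_of_real x1 \<cdot>\<^sub>m E a b e x1) (complex_of_real x2 \<cdot>\<^sub>m E e c d x2) ((1 / complex_of_real x3) \<cdot>\<^sub>m E b c f x3) ((1 / complex_of_real x4) \<cdot>\<^sub>m E a f d x4) (Fb a b c d e f)"
      unfolding act_comp[OF e Pc Pc Pi(1) Pi(1)] E(3)[OF x(1)] E(3)[OF x(2)] PiE[OF x(3)] PiE[OF x(4)] ..
    finally have "?A (Fb a b c d e f) \<alpha> \<beta> \<mu> \<nu> = complex_of_real x1 * complex_of_real x2 * (1 / complex_of_real x3) * (1 / complex_of_real x4) * ?A (Fb a b c d e f) \<alpha> \<beta> \<mu> \<nu>"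
      unfolding act_smult[OF e, symmetric] by simp
    then have "?A (Fb a b c d e f) \<alpha> \<beta> \<mu> \<nu> = 0 \<or> complex_of_real x1 * complex_of_real x2 * (1 / complex_of_real x3) * (1 / complex_of_real x4) = 1"
      by (metis mult_cancel_right1)
    moreover have "ln x1 + ln x2 = ln x3 + ln x4" if "complex_of_real x1 * complex_of_real x2 * (1 / complex_of_real x3) * (1 / complex_of_real x4) = 1"
    proof -
      have "complex_of_real (x1 * x2) = complex_of_real (x3 * x4)" using that p by (simp add: field_simps)
      then have "x1 * x2 = x3 * x4" using of_real_eq_iff by blast
      then show ?thesis using p by (simp add: ln_mult_pos[symmetric])
    qed
    ultimately show ?thesis by blast
  qed
  define Xf where "Xf a b c i j = (if i < N a b c \<and> j < N a b c then Xm a b c $$ (i,j) else 0)" for a b c i j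
  have "\<exists>y. \<forall>a b e \<alpha> \<alpha>'. Xf a b e \<alpha> \<alpha>' = (if \<alpha> = \<alpha>' \<and> \<alpha> < N a b e then y a + y b - y e else 0)"
  proof (rule coboundary)
    show "Xf a b c i j \<noteq> 0 \<Longrightarrow> i < N a b c \<and> j < N a b c" for a b c i j by (auto simp: Xf_def split: if_splits)
    fix a b c d e \<alpha> \<beta> f \<mu> \<nu>
    show "(\<Sum>\<alpha>'\<in>J. Xf a b e \<alpha> \<alpha>' * F a b c d (e,\<alpha>',\<beta>) (f,\<mu>,\<nu>)) + (\<Sum>\<beta>'\<in>J. Xf e c d \<beta> \<beta>' * F a b c d (e,\<alpha>,\<beta>') (f,\<mu>,\<nu>)) =
      (\<Sum>\<mu>'\<in>J. F a b c d (e,\<alpha>,\<beta>) (f,\<mu>',\<nu>) * Xf b c f \<mu>' \<mu>) + (\<Sum>\<nu>'\<in>J. F a b c d (e,\<alpha>,\<beta>) (f,\<mu>,\<nu>') * Xf a f d \<nu>' \<nu>)"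
    proof (cases "\<alpha> < N a b e \<and> \<beta> < N e c d \<and> \<mu> < N b c f \<and> \<nu> < N a f d")
      case False
      then show ?thesis by (auto simp: Xf_def F_eq_0)
    next
      case True
      then have r: "\<alpha> < N a b e" "\<beta> < N e c d" "\<mu> < N b c f" "\<nu> < N a f d" by auto
      let ?S = "L a b e \<times> L e c d \<times> L b c f \<times> L a f d"
      define \<Phi> where "\<Phi> x1 x2 x3 x4 = act (E a b e x1) (E e c d x2) (E b c f x3) (E a f d x4) (Fb a b c d e f) \<alpha> \<beta> \<mu> \<nu>" for x1 x2 x3 x4
      note as = act_sum[OF E(1) E(1) E(1) E(1)]
      have "(\<Sum>\<alpha>'\<in>J. Xf a b e \<alpha> \<alpha>' * F a b c d (e,\<alpha>',\<beta>) (f,\<mu>,\<nu>)) = act (Xm a b e) (1\<^sub>m (N e c d)) (1\<^sub>m (N b c f)) (1\<^sub>m (N a f d)) (Fb a b c d e f) \<alpha> \<beta> \<mu> \<nu>"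
        unfolding act_id1[OF Xc r] by (subst sum_J_range[of a b e]) (use r in \<open>auto simp: Xf_def F_eq_0\<close>)
      also have "\<dots> = (\<Sum>(x1,x2,x3,x4)\<in>?S. complex_of_real (ln x1) * 1 * 1 * 1 * \<Phi> x1 x2 x3 x4)"
        unfolding \<Phi>_def by (rule as[OF _ _ _ _ Xc one_carrier_mat one_carrier_mat one_carrier_mat Xe one one one])
      finally have t1: "(\<Sum>\<alpha>'\<in>J. Xf a b e \<alpha> \<alpha>' * F a b c d (e,\<alpha>',\<beta>) (f,\<mu>,\<nu>)) = (\<Sum>(x1,x2,x3,x4)\<in>?S. complex_of_real (ln x1) * \<Phi> x1 x2 x3 x4)"
        by simp
      have "(\<Sum>\<beta>'\<in>J. Xf e c d \<beta> \<beta>' * F a b c d (e,\<alpha>,\<beta>') (f,\<mu>,\<nu>)) = act (1\<^sub>m (N a b e)) (Xm e c d) (1\<^sub>m (N b c f)) (1\<^sub>m (N a f d)) (Fb a b c d e f) \<alpha> \<beta> \<mu> \<nu>"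
        unfolding act_id2[OF Xc r] by (subst sum_J_range[of e c d]) (use r in \<open>auto simp: Xf_def F_eq_0\<close>)
      also have "\<dots> = (\<Sum>(x1,x2,x3,x4)\<in>?S. 1 * complex_of_real (ln x2) * 1 * 1 * \<Phi> x1 x2 x3 x4)"
        unfolding \<Phi>_def by (rule as[OF _ _ _ _ one_carrier_mat Xc one_carrier_mat one_carrier_mat one Xe one one])
      finally have t2: "(\<Sum>\<beta>'\<in>J. Xf e c d \<beta> \<beta>' * F a b c d (e,\<alpha>,\<beta>') (f,\<mu>,\<nu>)) = (\<Sum>(x1,x2,x3,x4)\<in>?S. complex_of_real (ln x2) * \<Phi> x1 x2 x3 x4)"
        by simp
      have "(\<Sum>\<mu>'\<in>J. F a b c d (e,\<alpha>,\<beta>) (f,\<mu>',\<nu>) * Xf b c f \<mu>' \<mu>) = act (1\<^sub>m (N a b e)) (1\<^sub>m (N e c d)) (Xm b c f) (1\<^sub>m (N a f d)) (Fb a b c d e f) \<alpha> \<beta> \<mu> \<nu>"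
        unfolding act_id3[OF Xc r] by (subst sum_J_range[of b c f]) (use r in \<open>auto simp: Xf_def F_eq_0\<close>)
      also have "\<dots> = (\<Sum>(x1,x2,x3,x4)\<in>?S. 1 * 1 * complex_of_real (ln x3) * 1 * \<Phi> x1 x2 x3 x4)"
        unfolding \<Phi>_def by (rule as[OF _ _ _ _ one_carrier_mat one_carrier_mat Xc one_carrier_mat one one Xe one])
      finally have t3: "(\<Sum>\<mu>'\<in>J. F a b c d (e,\<alpha>,\<beta>) (f,\<mu>',\<nu>) * Xf b c f \<mu>' \<mu>) = (\<Sum>(x1,x2,x3,x4)\<in>?S. complex_of_real (ln x3) * \<Phi> x1 x2 x3 x4)"
        by simp
      have "(\<Sum>\<nu>'\<in>J. F a b c d (e,\<alpha>,\<beta>) (f,\<mu>,\<nu>') * Xf a f d \<nu>' \<nu>) = act (1\<^sub>m (N a b e)) (1\<^sub>m (N e c d)) (1\<^sub>m (N b c f)) (Xm a f d) (Fb a b c d e f) \<alpha> \<beta> \<mu> \<nu>"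
        unfolding act_id4[OF Xc r] by (subst sum_J_range[of a f d]) (use r in \<open>auto simp: Xf_def F_eq_0\<close>)
      also have "\<dots> = (\<Sum>(x1,x2,x3,x4)\<in>?S. 1 * 1 * 1 * complex_of_real (ln x4) * \<Phi> x1 x2 x3 x4)"
        unfolding \<Phi>_def by (rule as[OF _ _ _ _ one_carrier_mat one_carrier_mat one_carrier_mat Xc one one one Xe])
      finally have t4: "(\<Sum>\<nu>'\<in>J. F a b c d (e,\<alpha>,\<beta>) (f,\<mu>,\<nu>') * Xf a f d \<nu>' \<nu>) = (\<Sum>(x1,x2,x3,x4)\<in>?S. complex_of_real (ln x4) * \<Phi> x1 x2 x3 x4)"
        by simp
      have pw: "complex_of_real (ln x1) * \<Phi> x1 x2 x3 x4 + complex_of_real (ln x2) * \<Phi> x1 x2 x3 x4 = complex_of_real (ln x3) * \<Phi> x1 x2 x3 x4 + complex_of_real (ln x4) * \<Phi> x1 x2 x3 x4"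
        if "x1 \<in> L a b e" "x2 \<in> L e c d" "x3 \<in> L b c f" "x4 \<in> L a f d" for x1 x2 x3 x4
      proof -
        have "\<Phi> x1 x2 x3 x4 = 0 \<or> complex_of_real (ln x1 + ln x2) = complex_of_real (ln x3 + ln x4)"
          using logs[OF that, of \<alpha> \<beta> \<mu> \<nu>] by (auto simp only: \<Phi>_def)
        then show ?thesis
          unfolding distrib_right[symmetric] of_real_add[symmetric] by auto
      qed
      show ?thesis unfolding t1 t2 t3 t4 sum.distrib[symmetric]
        by (rule sum.cong[OF refl]) (use pw in auto)
    qed
  qed
  then obtain y where y: "\<And>a b c i j. Xf a b c i j = (if i = j \<and> i < N a b c then y a + y b - y c else 0)" by blast
  \<comment> \<open>\<open>coboundary\<close> yields complex \<open>y\<close>; as the eigenvalues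
    are real, their logarithms are met by the real parts.\<close>
  have "P a b c = complex_of_real (exp (Re (y a) + Re (y b) - Re (y c))) \<cdot>\<^sub>m 1\<^sub>m (N a b c)" for a b c
  proof -
    let ?n = "N a b c"
    define z where "z = y a + y b - y c"
    \<comment> \<open>\<open>E a b c x * P a b c * E a b c x'\<close> is evaluated from both sides,
      so products of components for different eigenvalues vanish.\<close>
    have orth: "complex_of_real x * (E a b c x * E a b c x') $$ (i,j) = complex_of_real x' * (E a b c x * E a b c x') $$ (i,j)"
      if x: "x \<in> L a b c" "x' \<in> L a b c" and ij: "i < ?n" "j < ?n" for x x' i j
    proof -
      note e = E[OF x(1)] and e' = E[OF x(2)]
      have "complex_of_real x \<cdot>\<^sub>m (E a b c x * E a b c x') = complex_of_real x' \<cdot>\<^sub>m (E a b c x * E a b c x')"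
        using assoc_mult_mat[OF e(1) Pc e'(1)] e(3) e'(2) mult_smult_distrib[OF e(1) e'(1)] mult_smult_assoc_mat[OF e(1) e'(1)] by simp
      then have "(complex_of_real x \<cdot>\<^sub>m (E a b c x * E a b c x')) $$ (i,j) = (complex_of_real x' \<cdot>\<^sub>m (E a b c x * E a b c x')) $$ (i,j)" by simp
      then show ?thesis using ij e(1) e'(1) by (simp del: index_mult_mat(1) add: index_mult_mat(2,3))
    qed
    \<comment> \<open>\<open>Xm\<close> acts on a component both as \<open>ln x'\<close> and as the
      scalar \<open>z\<close>, so only one eigenvalue can have a nonzero component.\<close>
    have key: "E a b c x' $$ (i,j) = 0 \<or> complex_of_real (ln x') = z" if x': "x' \<in> L a b c" and ij: "i < ?n" "j < ?n" for x' i j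
    proof -
      have expand: "(M * E a b c x') $$ (i,j) = (\<Sum>x\<in>L a b c. g x * (E a b c x * E a b c x') $$ (i,j))"
        if M: "M \<in> carrier_mat ?n ?n" "\<And>l. l < ?n \<Longrightarrow> M $$ (i,l) = (\<Sum>x\<in>L a b c. g x * E a b c x $$ (i,l))" for M g
      proof -
        have "(M * E a b c x') $$ (i,j) = (\<Sum>l = 0..<?n. \<Sum>x\<in>L a b c. g x * (E a b c x $$ (i,l) * E a b c x' $$ (l,j)))"
          using M E(1)[OF x'] ij by (simp add: scalar_prod_def sum_distrib_right mult.assoc)
        also have "\<dots> = (\<Sum>x\<in>L a b c. \<Sum>l = 0..<?n. g x * (E a b c x $$ (i,l) * E a b c x' $$ (l,j)))"
          by (rule sum.swap)
        also have "\<dots> = (\<Sum>x\<in>L a b c. g x * (E a b c x * E a b c x') $$ (i,j))"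
        proof (rule sum.cong[OF refl])
          fix x assume "x \<in> L a b c"
          from E(1)[OF this] E(1)[OF x'] ij
          have "(E a b c x * E a b c x') $$ (i,j) = (\<Sum>l = 0..<?n. E a b c x $$ (i,l) * E a b c x' $$ (l,j))"
            by (simp add: scalar_prod_def)
          then show "(\<Sum>l = 0..<?n. g x * (E a b c x $$ (i,l) * E a b c x' $$ (l,j))) = g x * (E a b c x * E a b c x') $$ (i,j)"
            by (simp only: sum_distrib_left)
        qed
        finally show ?thesis .
      qed
      have "(Xm a b c * E a b c x') $$ (i,j) = (\<Sum>x\<in>L a b c. complex_of_real (ln x) * (E a b c x * E a b c x') $$ (i,j))"
        by (rule expand[OF Xc]) (use Xe ij in auto)
      also have "\<dots> = (\<Sum>x\<in>L a b c. complex_of_real (ln x') * (1 * (E a b c x * E a b c x') $$ (i,j)))"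
      proof (rule sum.cong[OF refl])
        fix x assume x: "x \<in> L a b c"
        show "complex_of_real (ln x) * (E a b c x * E a b c x') $$ (i,j) = complex_of_real (ln x') * (1 * (E a b c x * E a b c x') $$ (i,j))"
          using orth[OF x x' ij] by (cases "x = x'") auto
      qed
      also have "\<dots> = complex_of_real (ln x') * (1\<^sub>m ?n * E a b c x') $$ (i,j)"
        unfolding sum_distrib_left[symmetric] by (subst expand[OF one_carrier_mat, of "\<lambda>_. 1"]) (use one ij in auto)
      also have "\<dots> = complex_of_real (ln x') * E a b c x' $$ (i,j)" using E(1)[OF x'] by simp
      finally have "(Xm a b c * E a b c x') $$ (i,j) = complex_of_real (ln x') * E a b c x' $$ (i,j)" .
      moreover have "Xm a b c = z \<cdot>\<^sub>m 1\<^sub>m ?n"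
      proof (rule eq_matI)
        fix i j assume "i < dim_row (z \<cdot>\<^sub>m 1\<^sub>m ?n)" "j < dim_col (z \<cdot>\<^sub>m 1\<^sub>m ?n)"
        then have "i < ?n" "j < ?n" by simp_all
        then show "Xm a b c $$ (i,j) = (z \<cdot>\<^sub>m 1\<^sub>m ?n) $$ (i,j)" using y[of a b c i j] by (simp add: Xf_def z_def)
      qed (use Xc in auto)
      then have "(Xm a b c * E a b c x') $$ (i,j) = z * E a b c x' $$ (i,j)"
        using E(1)[OF x'] ij mult_smult_assoc_mat[OF one_carrier_mat E(1)[OF x'], of z] by simp
      ultimately show ?thesis by (metis mult_cancel_right)
    qed
    show ?thesis
    proof (rule eq_matI)
      fix i j assume "i < dim_row (complex_of_real (exp (Re (y a) + Re (y b) - Re (y c))) \<cdot>\<^sub>m 1\<^sub>m ?n)"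
        "j < dim_col (complex_of_real (exp (Re (y a) + Re (y b) - Re (y c))) \<cdot>\<^sub>m 1\<^sub>m ?n)"
      then have ij: "i < ?n" "j < ?n" by simp_all
      have "P a b c $$ (i,j) = (P a b c * 1\<^sub>m ?n) $$ (i,j)" using Pc[of a b c] by simp
      also have "\<dots> = (\<Sum>l = 0..<?n. \<Sum>x\<in>L a b c. P a b c $$ (i,l) * E a b c x $$ (l,j))"
      proof -
        have "(P a b c * 1\<^sub>m ?n) $$ (i,j) = (\<Sum>l = 0..<?n. P a b c $$ (i,l) * 1\<^sub>m ?n $$ (l,j))"
          by (rule mat_mult_index[OF Pc one_carrier_mat ij])
        also have "\<dots> = (\<Sum>l = 0..<?n. \<Sum>x\<in>L a b c. P a b c $$ (i,l) * E a b c x $$ (l,j))"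
          by (rule sum.cong[OF refl]) (use ij in \<open>simp add: one sum_distrib_left del: index_one_mat\<close>)
        finally show ?thesis .
      qed
      also have "\<dots> = (\<Sum>x\<in>L a b c. \<Sum>l = 0..<?n. P a b c $$ (i,l) * E a b c x $$ (l,j))"
        by (rule sum.swap)
      also have "\<dots> = (\<Sum>x\<in>L a b c. complex_of_real (exp (Re z)) * (1 * E a b c x $$ (i,j)))"
      proof (rule sum.cong[OF refl])
        fix x assume x: "x \<in> L a b c"
        have "(\<Sum>l = 0..<?n. P a b c $$ (i,l) * E a b c x $$ (l,j)) = (P a b c * E a b c x) $$ (i,j)"
          using E(1)[OF x] Pc[of a b c] ij by (simp add: scalar_prod_def)
        also have "\<dots> = complex_of_real x * E a b c x $$ (i,j)" using E(1,2)[OF x] ij by simp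
        also have "\<dots> = complex_of_real (exp (Re z)) * (1 * E a b c x $$ (i,j))"
        proof (cases "E a b c x $$ (i,j) = 0")
          case False
          then have "ln x = Re z" using key[OF x ij] by (metis Re_complex_of_real)
          then have "x = exp (Re z)" using L(2)[OF x] by (metis exp_ln)
          then show ?thesis by simp
        qed simp
        finally show "(\<Sum>l = 0..<?n. P a b c $$ (i,l) * E a b c x $$ (l,j)) = complex_of_real (exp (Re z)) * (1 * E a b c x $$ (i,j))" .
      qed
      also have "\<dots> = complex_of_real (exp (Re z)) * 1\<^sub>m ?n $$ (i,j)"
        by (simp only: one[OF ij] sum_distrib_left)
      finally show "P a b c $$ (i,j) = (complex_of_real (exp (Re (y a) + Re (y b) - Re (y c))) \<cdot>\<^sub>m 1\<^sub>m ?n) $$ (i,j)"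
        using ij by (simp add: z_def)
    qed (use Pc[of a b c] in auto)
  qed
  then show ?thesis by (intro exI[of _ "\<lambda>a. Re (y a)"]) blast
qed

end

section \<open>Modular tensor categories as fusion systems\<close>

text \<open>The factors \<open>k\<close> come from the change of gauge that trivializes the unit constraints.\<close>

definition has_system :: "'a::finite mtc \<Rightarrow> bool" where
  "has_system C \<longleftrightarrow> (\<exists>dl F G J ep k. fusion_system (unit_obj C) dl (fus C) F G J ep \<and>
     (\<forall>a b c d e f. k a b c d e f \<noteq> 0) \<and>
     (\<forall>a b c d e \<alpha> \<beta> f \<mu> \<nu>. \<alpha> < fus C a b e \<longrightarrow> \<beta> < fus C e c d \<longrightarrow> \<mu> < fus C b c f \<longrightarrow> \<nu> < fus C a f d \<longrightarrow>
        F a b c d (e,\<alpha>,\<beta>) (f,\<mu>,\<nu>) = k a b c d e f * Fsym C a b c d (e,\<alpha>,\<beta>) (f,\<mu>,\<nu>)))"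

section \<open>Transport of fusion systems along field automorphisms\<close>

locale field_auto =
  fixes h :: "complex \<Rightarrow> complex"
  assumes bij: "bij h" and add: "h (x + y) = h x + h y" and mult: "h (x * y) = h x * h y" and one: "h 1 = 1"
begin

lemma inj: "h x = h y \<longleftrightarrow> x = y" using bij by (auto simp: bij_def inj_def)
lemma zero: "h 0 = 0" using add[of 0 0] by simp
lemma zero_iff: "h x = 0 \<longleftrightarrow> x = 0" using inj[of x 0] zero by simp
lemma uminus: "h (- x) = - h x" using add[of x "-x"] zero by (simp add: add_eq_0_iff)
lemma diff: "h (x - y) = h x - h y" using add[of x "-y"] uminus by simp
lemma sum: "h (sum g A) = (\<Sum>i\<in>A. h (g i))"
  by (induction A rule: infinite_finite_induct) (simp_all add: zero add)
lemma inverse: "h (inverse x) = inverse (h x)"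
proof (cases "x = 0")
  case False
  then have "h x * h (inverse x) = 1" using mult[of x "inverse x"] one by simp
  then show ?thesis by (metis inverse_unique)
qed (simp add: zero)
lemma divide: "h (x / y) = h x / h y" by (simp add: divide_inverse mult inverse)

text \<open>The axioms are polynomial identities with coefficients 0 and 1, or statements about
  vanishing; the only other constants are the \<open>ep a\<close>, which \<open>h\<close>
  fixes.\<close>

lemma fusion_system_image:
  assumes fs: "fusion_system u dl N F G J ep" and ep: "\<And>a. h (ep a) = ep a"
  shows "fusion_system u dl N (\<lambda>a b c d i k. h (F a b c d i k)) (\<lambda>a b c d i k. h (G a b c d i k)) J ep"
proof -
  interpret fusion_system u dl N F G J ep by fact
  show ?thesis
  proof
    show "finite J" "\<And>i a b c. i < N a b c \<Longrightarrow> i \<in> J" by (fact finJ J_range)+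
    show "\<And>a b. N u a b = (if a = b then 1 else 0)" "\<And>a b. N a u b = (if a = b then 1 else 0)"
      "\<And>a b. N a b u = (if b = dl a then 1 else 0)" "\<And>a. dl (dl a) = a" by (fact N_unit1 N_unit2 N_dual dl_dl)+
    show "\<And>a. ep a * ep a = 1" "ep u = 1" by (fact ep_sq ep_u)+
    show "h (F a b c d (e,\<alpha>,\<beta>) (f,\<mu>,\<nu>)) \<noteq> 0 \<Longrightarrow> \<alpha> < N a b e \<and> \<beta> < N e c d \<and> \<mu> < N b c f \<and> \<nu> < N a f d" for a b c d e \<alpha> \<beta> f \<mu> \<nu>
      using F_supp[of a b c d e \<alpha> \<beta> f \<mu> \<nu>] zero_iff by blast
    show "h (G a b c d (f,\<mu>,\<nu>) (e,\<alpha>,\<beta>)) \<noteq> 0 \<Longrightarrow> \<alpha> < N a b e \<and> \<beta> < N e c d \<and> \<mu> < N b c f \<and> \<nu> < N a f d" for a b c d e \<alpha> \<beta> f \<mu> \<nu>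
      using G_supp[of a b c d f \<mu> \<nu> e \<alpha> \<beta>] zero_iff by blast
    fix a b c d e f g k l e' f' :: 'a and \<alpha> \<beta> \<gamma> \<delta> \<tau> \<mu> \<nu> \<alpha>' \<beta>' \<mu>' \<nu>' :: nat
    show "(\<Sum>f\<in>UNIV. \<Sum>\<mu>\<in>J. \<Sum>\<nu>\<in>J. h (F a b c d (e,\<alpha>,\<beta>) (f,\<mu>,\<nu>)) * h (G a b c d (f,\<mu>,\<nu>) (e',\<alpha>',\<beta>'))) =
       (if (e,\<alpha>,\<beta>) = (e',\<alpha>',\<beta>') \<and> \<alpha> < N a b e \<and> \<beta> < N e c d then 1 else 0)"
      using FG[of a b c d e \<alpha> \<beta> e' \<alpha>' \<beta>'] unfolding mult[symmetric] sum[symmetric] by (auto simp: zero one)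
    show "(\<Sum>e\<in>UNIV. \<Sum>\<alpha>\<in>J. \<Sum>\<beta>\<in>J. h (G a b c d (f,\<mu>,\<nu>) (e,\<alpha>,\<beta>)) * h (F a b c d (e,\<alpha>,\<beta>) (f',\<mu>',\<nu>'))) =
       (if (f,\<mu>,\<nu>) = (f',\<mu>',\<nu>') \<and> \<mu> < N b c f \<and> \<nu> < N a f d then 1 else 0)"
      using GF[of a b c d f \<mu> \<nu> f' \<mu>' \<nu>'] unfolding mult[symmetric] sum[symmetric] by (auto simp: zero one)
    show "(\<Sum>\<nu>\<in>J. h (F f c d e (g,\<beta>,\<gamma>) (l,\<delta>,\<nu>)) * h (F a b l e (f,\<alpha>,\<nu>) (k,\<tau>,\<mu>))) =
       (\<Sum>x\<in>UNIV. \<Sum>\<sigma>\<in>J. \<Sum>\<psi>\<in>J. \<Sum>\<rho>\<in>J. h (F a b c g (f,\<alpha>,\<beta>) (x,\<sigma>,\<psi>)) *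
          h (F a x d e (g,\<psi>,\<gamma>) (k,\<rho>,\<mu>)) * h (F b c d k (x,\<sigma>,\<rho>) (l,\<delta>,\<tau>)))"
      unfolding mult[symmetric] sum[symmetric] pent ..
    show "h (F a u c d (e,\<alpha>,\<beta>) (f,\<mu>,\<nu>)) =
       (if e = a \<and> \<alpha> = 0 \<and> f = c \<and> \<mu> = 0 \<and> \<beta> = \<nu> \<and> \<beta> < N a c d then 1 else 0)"
      by (simp add: F_unit2 zero one)
    show "h (F a (dl a) a a (u,0,0) (u,0,0)) \<noteq> 0" using rigid zero_iff by blast
    show "(\<Sum>\<mu>\<in>J. \<Sum>\<kappa>\<in>J.
        h (F a b c u (dl c,\<alpha>,0) (dl a,\<mu>,0)) * h (F b c a u (dl a,\<mu>,0) (dl b,\<kappa>,0)) *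
        h (F c a b u (dl b,\<kappa>,0) (dl c,\<alpha>',0))) =
        (if \<alpha> = \<alpha>' \<and> \<alpha> < N a b (dl c) then ep a * ep b * ep c else 0)"
      unfolding mult[symmetric] sum[symmetric] piv by (auto simp: zero mult ep)
  qed
qed

lemma has_system_image:
  assumes "has_system C" and "unit_obj D = unit_obj C" "fus D = fus C"
    and FD: "\<And>a b c d e \<alpha> \<beta> f \<mu> \<nu>. \<alpha> < fus C a b e \<Longrightarrow> \<beta> < fus C e c d \<Longrightarrow> \<mu> < fus C b c f \<Longrightarrow> \<nu> < fus C a f d \<Longrightarrow>
        Fsym D a b c d (e,\<alpha>,\<beta>) (f,\<mu>,\<nu>) = h (Fsym C a b c d (e,\<alpha>,\<beta>) (f,\<mu>,\<nu>))"
  shows "has_system D"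
proof -
  obtain dl F G J ep k where fs: "fusion_system (unit_obj C) dl (fus C) F G J ep" and k: "\<And>a b c d e f. k a b c d e f \<noteq> 0"
    and F: "\<And>a b c d e \<alpha> \<beta> f \<mu> \<nu>. \<alpha> < fus C a b e \<Longrightarrow> \<beta> < fus C e c d \<Longrightarrow> \<mu> < fus C b c f \<Longrightarrow> \<nu> < fus C a f d \<Longrightarrow>
        F a b c d (e,\<alpha>,\<beta>) (f,\<mu>,\<nu>) = k a b c d e f * Fsym C a b c d (e,\<alpha>,\<beta>) (f,\<mu>,\<nu>)"
    using assms(1) unfolding has_system_def by metis
  have "h (ep a) = ep a" for a
  proof -
    have "(ep a - 1) * (ep a + 1) = 0" using fusion_system.ep_sq[OF fs, of a] by (simp add: algebra_simps)
    then have "ep a = 1 \<or> ep a = -1" by (simp add: eq_neg_iff_add_eq_0)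
    then show ?thesis using one uminus by auto
  qed
  from fusion_system_image[OF fs this] show ?thesis
    unfolding has_system_def assms(2,3)
    by (intro exI[of _ dl] exI[of _ "\<lambda>a b c d i k. h (F a b c d i k)"] exI[of _ "\<lambda>a b c d i k. h (G a b c d i k)"]
        exI[of _ J] exI[of _ ep] exI[of _ "\<lambda>a b c d e f. h (k a b c d e f)"]) (auto simp: F FD mult k zero_iff)
qed

end

section \<open>Trivializing the unit constraints by a change of gauge\<close>

lemma sum_range_J:
  fixes g :: "'a::finite \<Rightarrow> nat \<Rightarrow> nat \<Rightarrow> complex"
  assumes "finite J" "\<And>f. {..<n f} \<subseteq> J" "\<And>f. {..<m f} \<subseteq> J"
  shows "(\<Sum>(f,\<mu>,\<nu>)\<in>{(f,\<mu>,\<nu>). \<mu> < n f \<and> \<nu> < m f}. g f \<mu> \<nu>) =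
    (\<Sum>f\<in>UNIV. \<Sum>\<mu>\<in>J. \<Sum>\<nu>\<in>J. if \<mu> < n f \<and> \<nu> < m f then g f \<mu> \<nu> else 0)"
  unfolding sum.cartesian_product using assms
  by (intro sum.mono_neutral_cong_left) (auto split: if_splits)

text \<open>The factors rescale the basis vectors of \<open>V\<^sub>u\<^sub>b\<^sup>b\<close> and
  \<open>V\<^sub>a\<^sub>u\<^sup>a\<close>; for \<open>a = b = u\<close> the two prescriptions have
  to agree.\<close>

definition gauge :: "'a \<Rightarrow> ('a \<Rightarrow> complex) \<Rightarrow> ('a \<Rightarrow> complex) \<Rightarrow> 'a \<Rightarrow> 'a \<Rightarrow> 'a \<Rightarrow> complex" where
  "gauge u l r a b c = (if a = u then l b else if b = u then r a else 1)"

text \<open>Rescaling the vertices by \<open>g\<close> turns the triangle axiom into triviality of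
  \<open>F\<close> with \<open>u\<close> in the middle. The resulting factors \<open>k\<close> of
  \<open>F\<close> are quotients of vertex factors, so they match on both sides of the pentagon and
  cancel around the pivotal cycle.\<close>

theorem has_systemI:
  fixes C :: "'a::finite mtc"
  assumes fr: "fusion_rules C" and Fi: "F_invertible C" and pent: "pentagon C" and rig: "rigid C" and pv: "pivotal C"
    and uc: "unit_constraints C l r"
  shows "has_system C"
proof -
  define u where "u = unit_obj C"
  define N where "N = fus C"
  define dl where "dl = dual C"
  define J where "J = (\<Union>a. \<Union>b. \<Union>c. {..<N a b c})"
  have finJ: "finite J" by (simp add: J_def)
  have J: "i < N a b c \<Longrightarrow> i \<in> J" for i a b c by (auto simp: J_def)
  have N1: "N u a b = (if a = b then 1 else 0)" and N2: "N a u b = (if a = b then 1 else 0)" for a b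
    using fr by (simp_all add: fusion_rules_def N_def u_def)
  have Ncomm: "N a b c = N b a c" for a b c using fr unfolding fusion_rules_def N_def by blast
  have ex1: "\<exists>!b. N a b u \<noteq> 0" and Ndl: "N a (dl a) u = 1" for a
    using fr unfolding fusion_rules_def N_def u_def dl_def by blast+
  have N3: "N a b u = (if b = dl a then 1 else 0)" for a b
    using ex1[of a] Ndl[of a] by (metis zero_neq_one)
  have dd: "dl (dl a) = a" for a using N3[of "dl a" a] Ncomm[of a "dl a" u] Ndl[of a] by (metis zero_neq_one)
  have du: "dl u = u" using N3[of u u] N1[of u u] by (metis zero_neq_one)
  have lr: "l a \<noteq> 0" "r a \<noteq> 0" for a using uc by (simp_all add: unit_constraints_def)
  have tri: "r a * Fsym C a u c d (a,0,\<beta>) (c,0,\<nu>) = (if \<beta> = \<nu> then l c else 0)" if "\<beta> < N a c d" "\<nu> < N a c d" for a c d \<beta> \<nu>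
    using uc that by (simp add: unit_constraints_def u_def N_def)
  have pentC: "(\<Sum>\<nu> < N f l e. Fsym C f c d e (g,\<beta>,\<gamma>) (l,\<delta>,\<nu>) * Fsym C a b l e (f,\<alpha>,\<nu>) (k,\<tau>,\<mu>)) =
     (\<Sum>h\<in>UNIV. \<Sum>\<sigma> < N b c h. \<Sum>\<psi> < N a h g. \<Sum>\<rho> < N h d k.
        Fsym C a b c g (f,\<alpha>,\<beta>) (h,\<sigma>,\<psi>) * Fsym C a h d e (g,\<psi>,\<gamma>) (k,\<rho>,\<mu>) * Fsym C b c d k (h,\<sigma>,\<rho>) (l,\<delta>,\<tau>))"
    if "\<alpha> < N a b f" "\<beta> < N f c g" "\<gamma> < N g d e" "\<delta> < N c d l" "\<tau> < N b l k" "\<mu> < N a k e"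
    for a b c d e f g k l \<alpha> \<beta> \<gamma> \<delta> \<tau> \<mu>
    using pent that unfolding pentagon_def N_def by blast
  \<comment> \<open>By the triangle axiom \<open>x\<close> is \<open>l u / r u\<close>, and the
    pentagon with all labels \<open>u\<close> gives \<open>x * x = x * x * x\<close>.\<close>
  have lu: "l u = r u"
  proof -
    define x where "x = Fsym C u u u u (u,0,0) (u,0,0)"
    have x: "r u * x = l u" using tri[of 0 u u u 0] by (simp add: x_def N1)
    then have "x \<noteq> 0" using lr(1)[of u] by auto
    moreover have "x * x = x * x * x"
    proof -
      have "(\<Sum>\<nu> < N u u u. Fsym C u u u u (u,0,0) (u,0,\<nu>) * Fsym C u u u u (u,0,\<nu>) (u,0,0)) = x * x"
        by (simp add: N1 x_def)
      moreover have "(\<Sum>\<sigma> < N u u h. \<Sum>\<psi> < N u h u. \<Sum>\<rho> < N h u u.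
        Fsym C u u u u (u,0,0) (h,\<sigma>,\<psi>) * Fsym C u h u u (u,\<psi>,0) (u,\<rho>,0) * Fsym C u u u u (h,\<sigma>,\<rho>) (u,0,0)) =
        (if h = u then x * x * x else 0)" for h by (auto simp: N1 x_def)
      ultimately show ?thesis
        using pentC[of 0 u u u 0 u u 0 u u 0 u 0 u 0] by (simp add: N1)
    qed
    ultimately have "x = 1" by simp
    then show ?thesis using x by simp
  qed
  define g where "g = gauge u l r"
  have g0: "g a b c \<noteq> 0" for a b c by (simp add: g_def gauge_def lr)
  define k where "k a b c d e f = g a b e * g e c d / (g b c f * g a f d)" for a b c d e f
  have k0: "k a b c d e f \<noteq> 0" for a b c d e f by (simp add: k_def g0)
  define ok where "ok a b c d e \<alpha> \<beta> f \<mu> \<nu> \<longleftrightarrow> \<alpha> < N a b e \<and> \<beta> < N e c d \<and> \<mu> < N b c f \<and> \<nu> < N a f d" for a b c d e \<alpha> \<beta> f \<mu> \<nu>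
  define F where "F a b c d = (\<lambda>(e,\<alpha>,\<beta>) (f,\<mu>,\<nu>). if ok a b c d e \<alpha> \<beta> f \<mu> \<nu> then k a b c d e f * Fsym C a b c d (e,\<alpha>,\<beta>) (f,\<mu>,\<nu>) else 0)" for a b c d
  have "\<forall>t. \<exists>H. case t of (a,b,c,d) \<Rightarrow>
     (\<forall>i\<in>left_ix C a b c d. \<forall>j\<in>left_ix C a b c d.
        (\<Sum>k\<in>right_ix C a b c d. Fsym C a b c d i k * H k j) = (if i = j then 1 else 0)) \<and>
     (\<forall>k\<in>right_ix C a b c d. \<forall>l\<in>right_ix C a b c d.
        (\<Sum>i\<in>left_ix C a b c d. H k i * Fsym C a b c d i l) = (if k = l then 1 else 0))"
    using Fi unfolding F_invertible_def by (simp split: prod.split)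
  from choice[OF this] obtain H0 where H0: "\<forall>t. case t of (a,b,c,d) \<Rightarrow>
     (\<forall>i\<in>left_ix C a b c d. \<forall>j\<in>left_ix C a b c d.
        (\<Sum>k\<in>right_ix C a b c d. Fsym C a b c d i k * H0 t k j) = (if i = j then 1 else 0)) \<and>
     (\<forall>k\<in>right_ix C a b c d. \<forall>l\<in>right_ix C a b c d.
        (\<Sum>i\<in>left_ix C a b c d. H0 t k i * Fsym C a b c d i l) = (if k = l then 1 else 0))" ..
  define H where "H a b c d = H0 (a,b,c,d)" for a b c d
  have H1: "(\<Sum>k\<in>right_ix C a b c d. Fsym C a b c d i k * H a b c d k j) = (if i = j then 1 else 0)"
    if "i \<in> left_ix C a b c d" "j \<in> left_ix C a b c d" for a b c d i j
    using spec[OF H0, of "(a,b,c,d)"] that by (simp add: H_def)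
  have H2: "(\<Sum>i\<in>left_ix C a b c d. H a b c d k i * Fsym C a b c d i l) = (if k = l then 1 else 0)"
    if "k \<in> right_ix C a b c d" "l \<in> right_ix C a b c d" for a b c d k l
    using spec[OF H0, of "(a,b,c,d)"] that by (simp add: H_def)
  define G where "G a b c d = (\<lambda>(f,\<mu>,\<nu>) (e,\<alpha>,\<beta>). if ok a b c d e \<alpha> \<beta> f \<mu> \<nu> then H a b c d (f,\<mu>,\<nu>) (e,\<alpha>,\<beta>) / k a b c d e f else 0)" for a b c d
  define ep where "ep a = complex_of_int (piv C a)" for a
  have "fusion_system u dl N F G J ep"
  proof
    show "finite J" "\<And>i a b c. i < N a b c \<Longrightarrow> i \<in> J" by (fact finJ J)+
    show "\<And>a b. N u a b = (if a = b then 1 else 0)" "\<And>a b. N a u b = (if a = b then 1 else 0)"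
      "\<And>a b. N a b u = (if b = dl a then 1 else 0)" "\<And>a. dl (dl a) = a" by (fact N1 N2 N3 dd)+
    show "\<And>a. ep a * ep a = 1"
    proof -
      fix a have "piv C a \<in> {1,-1}" using pv by (simp add: pivotal_def)
      then show "ep a * ep a = 1" by (auto simp: ep_def)
    qed
    show "ep u = 1" using pv by (simp add: pivotal_def ep_def u_def)
    fix a b c d e f g' k' l' e' f' :: 'a and \<alpha> \<beta> \<gamma> \<delta> \<tau> \<mu> \<nu> \<alpha>' \<beta>' \<mu>' \<nu>' :: nat
    show "F a b c d (e,\<alpha>,\<beta>) (f,\<mu>,\<nu>) \<noteq> 0 \<Longrightarrow> \<alpha> < N a b e \<and> \<beta> < N e c d \<and> \<mu> < N b c f \<and> \<nu> < N a f d"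
      by (simp add: F_def ok_def split: if_splits)
    show "G a b c d (f,\<mu>,\<nu>) (e,\<alpha>,\<beta>) \<noteq> 0 \<Longrightarrow> \<alpha> < N a b e \<and> \<beta> < N e c d \<and> \<mu> < N b c f \<and> \<nu> < N a f d"
      by (simp add: G_def ok_def split: if_splits)
    show "(\<Sum>f\<in>UNIV. \<Sum>\<mu>\<in>J. \<Sum>\<nu>\<in>J. F a b c d (e,\<alpha>,\<beta>) (f,\<mu>,\<nu>) * G a b c d (f,\<mu>,\<nu>) (e',\<alpha>',\<beta>')) =
       (if (e,\<alpha>,\<beta>) = (e',\<alpha>',\<beta>') \<and> \<alpha> < N a b e \<and> \<beta> < N e c d then 1 else 0)"
    proof (cases "\<alpha> < N a b e \<and> \<beta> < N e c d \<and> \<alpha>' < N a b e' \<and> \<beta>' < N e' c d")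
      case False
      then have "F a b c d (e,\<alpha>,\<beta>) (f,\<mu>,\<nu>) * G a b c d (f,\<mu>,\<nu>) (e',\<alpha>',\<beta>') = 0" for f \<mu> \<nu>
        by (auto simp: F_def G_def ok_def)
      then have "(\<Sum>f\<in>UNIV. \<Sum>\<mu>\<in>J. \<Sum>\<nu>\<in>J. F a b c d (e,\<alpha>,\<beta>) (f,\<mu>,\<nu>) * G a b c d (f,\<mu>,\<nu>) (e',\<alpha>',\<beta>')) = 0"
        by (intro sum.neutral ballI)
      then show ?thesis using False by auto
    next
      case True
      let ?c = "g a b e * g e c d / (g a b e' * g e' c d)"
      have "F a b c d (e,\<alpha>,\<beta>) (f,\<mu>,\<nu>) * G a b c d (f,\<mu>,\<nu>) (e',\<alpha>',\<beta>') =
        (if \<mu> < N b c f \<and> \<nu> < N a f d then ?c * (Fsym C a b c d (e,\<alpha>,\<beta>) (f,\<mu>,\<nu>) * H a b c d (f,\<mu>,\<nu>) (e',\<alpha>',\<beta>')) else 0)" for f \<mu> \<nu>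
        using True g0 by (simp add: F_def G_def ok_def k_def)
      then have "(\<Sum>f\<in>UNIV. \<Sum>\<mu>\<in>J. \<Sum>\<nu>\<in>J. F a b c d (e,\<alpha>,\<beta>) (f,\<mu>,\<nu>) * G a b c d (f,\<mu>,\<nu>) (e',\<alpha>',\<beta>')) =
        (\<Sum>(f,\<mu>,\<nu>)\<in>{(f,\<mu>,\<nu>). \<mu> < N b c f \<and> \<nu> < N a f d}. ?c * (Fsym C a b c d (e,\<alpha>,\<beta>) (f,\<mu>,\<nu>) * H a b c d (f,\<mu>,\<nu>) (e',\<alpha>',\<beta>')))"
        by (subst sum_range_J[OF finJ]) (use J in auto)
      also have "\<dots> = ?c * (\<Sum>i\<in>right_ix C a b c d. Fsym C a b c d (e,\<alpha>,\<beta>) i * H a b c d i (e',\<alpha>',\<beta>'))"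
        by (simp add: sum_distrib_left right_ix_def N_def case_prod_beta)
      also have "\<dots> = (if (e,\<alpha>,\<beta>) = (e',\<alpha>',\<beta>') then 1 else 0)"
        using True g0 by (subst H1) (auto simp: left_ix_def N_def)
      finally show ?thesis using True by simp
    qed
    show "(\<Sum>e\<in>UNIV. \<Sum>\<alpha>\<in>J. \<Sum>\<beta>\<in>J. G a b c d (f,\<mu>,\<nu>) (e,\<alpha>,\<beta>) * F a b c d (e,\<alpha>,\<beta>) (f',\<mu>',\<nu>')) =
       (if (f,\<mu>,\<nu>) = (f',\<mu>',\<nu>') \<and> \<mu> < N b c f \<and> \<nu> < N a f d then 1 else 0)"
    proof (cases "\<mu> < N b c f \<and> \<nu> < N a f d \<and> \<mu>' < N b c f' \<and> \<nu>' < N a f' d")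
      case False
      then have "G a b c d (f,\<mu>,\<nu>) (e,\<alpha>,\<beta>) * F a b c d (e,\<alpha>,\<beta>) (f',\<mu>',\<nu>') = 0" for e \<alpha> \<beta>
        by (auto simp: F_def G_def ok_def)
      then have "(\<Sum>e\<in>UNIV. \<Sum>\<alpha>\<in>J. \<Sum>\<beta>\<in>J. G a b c d (f,\<mu>,\<nu>) (e,\<alpha>,\<beta>) * F a b c d (e,\<alpha>,\<beta>) (f',\<mu>',\<nu>')) = 0"
        by (intro sum.neutral ballI)
      then show ?thesis using False by auto
    next
      case True
      let ?c = "g b c f * g a f d / (g b c f' * g a f' d)"
      have "G a b c d (f,\<mu>,\<nu>) (e,\<alpha>,\<beta>) * F a b c d (e,\<alpha>,\<beta>) (f',\<mu>',\<nu>') =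
        (if \<alpha> < N a b e \<and> \<beta> < N e c d then ?c * (H a b c d (f,\<mu>,\<nu>) (e,\<alpha>,\<beta>) * Fsym C a b c d (e,\<alpha>,\<beta>) (f',\<mu>',\<nu>')) else 0)" for e \<alpha> \<beta>
        using True g0 by (simp add: F_def G_def ok_def k_def)
      then have "(\<Sum>e\<in>UNIV. \<Sum>\<alpha>\<in>J. \<Sum>\<beta>\<in>J. G a b c d (f,\<mu>,\<nu>) (e,\<alpha>,\<beta>) * F a b c d (e,\<alpha>,\<beta>) (f',\<mu>',\<nu>')) =
        (\<Sum>(e,\<alpha>,\<beta>)\<in>{(e,\<alpha>,\<beta>). \<alpha> < N a b e \<and> \<beta> < N e c d}. ?c * (H a b c d (f,\<mu>,\<nu>) (e,\<alpha>,\<beta>) * Fsym C a b c d (e,\<alpha>,\<beta>) (f',\<mu>',\<nu>')))"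
        by (subst sum_range_J[OF finJ]) (use J in auto)
      also have "\<dots> = ?c * (\<Sum>i\<in>left_ix C a b c d. H a b c d (f,\<mu>,\<nu>) i * Fsym C a b c d i (f',\<mu>',\<nu>'))"
        by (simp add: sum_distrib_left left_ix_def N_def case_prod_beta)
      also have "\<dots> = (if (f,\<mu>,\<nu>) = (f',\<mu>',\<nu>') then 1 else 0)"
        using True g0 by (subst H2) (auto simp: right_ix_def N_def)
      finally show ?thesis using True by simp
    qed
    show "(\<Sum>\<nu>\<in>J. F f c d e (g',\<beta>,\<gamma>) (l',\<delta>,\<nu>) * F a b l' e (f,\<alpha>,\<nu>) (k',\<tau>,\<mu>)) =
       (\<Sum>h\<in>UNIV. \<Sum>\<sigma>\<in>J. \<Sum>\<psi>\<in>J. \<Sum>\<rho>\<in>J. F a b c g' (f,\<alpha>,\<beta>) (h,\<sigma>,\<psi>) *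
          F a h d e (g',\<psi>,\<gamma>) (k',\<rho>,\<mu>) * F b c d k' (h,\<sigma>,\<rho>) (l',\<delta>,\<tau>))"
    proof (cases "\<alpha> < N a b f \<and> \<beta> < N f c g' \<and> \<gamma> < N g' d e \<and> \<delta> < N c d l' \<and> \<tau> < N b l' k' \<and> \<mu> < N a k' e")
      case False
      then have "F f c d e (g',\<beta>,\<gamma>) (l',\<delta>,\<nu>) * F a b l' e (f,\<alpha>,\<nu>) (k',\<tau>,\<mu>) = 0" for \<nu>
        by (auto simp: F_def ok_def)
      moreover have "F a b c g' (f,\<alpha>,\<beta>) (h,\<sigma>,\<psi>) * F a h d e (g',\<psi>,\<gamma>) (k',\<rho>,\<mu>) * F b c d k' (h,\<sigma>,\<rho>) (l',\<delta>,\<tau>) = 0" for h \<sigma> \<psi> \<rho>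
        using False by (auto simp: F_def ok_def)
      ultimately show ?thesis by (simp only: sum.neutral_const)
    next
      case True
      then have t: "\<alpha> < N a b f" "\<beta> < N f c g'" "\<gamma> < N g' d e" "\<delta> < N c d l'" "\<tau> < N b l' k'" "\<mu> < N a k' e" by auto
      let ?c = "g f c g' * g g' d e * g a b f / (g c d l' * g b l' k' * g a k' e)"
      have "(\<Sum>\<nu>\<in>J. F f c d e (g',\<beta>,\<gamma>) (l',\<delta>,\<nu>) * F a b l' e (f,\<alpha>,\<nu>) (k',\<tau>,\<mu>)) =
        (\<Sum>\<nu> < N f l' e. ?c * (Fsym C f c d e (g',\<beta>,\<gamma>) (l',\<delta>,\<nu>) * Fsym C a b l' e (f,\<alpha>,\<nu>) (k',\<tau>,\<mu>)))"
        using J[of _ f l' e] finJ t g0 by (intro sum.mono_neutral_cong_right) (auto simp: F_def ok_def k_def mult_ac)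
      also have "\<dots> = (\<Sum>h\<in>UNIV. \<Sum>\<sigma> < N b c h. \<Sum>\<psi> < N a h g'. \<Sum>\<rho> < N h d k'.
        ?c * (Fsym C a b c g' (f,\<alpha>,\<beta>) (h,\<sigma>,\<psi>) * Fsym C a h d e (g',\<psi>,\<gamma>) (k',\<rho>,\<mu>) * Fsym C b c d k' (h,\<sigma>,\<rho>) (l',\<delta>,\<tau>)))"
        unfolding sum_distrib_left[symmetric] pentC[OF t] ..
      also have "\<dots> = (\<Sum>h\<in>UNIV. \<Sum>\<sigma>\<in>J. \<Sum>\<psi>\<in>J. \<Sum>\<rho>\<in>J. F a b c g' (f,\<alpha>,\<beta>) (h,\<sigma>,\<psi>) *
          F a h d e (g',\<psi>,\<gamma>) (k',\<rho>,\<mu>) * F b c d k' (h,\<sigma>,\<rho>) (l',\<delta>,\<tau>))"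
      proof (rule sum.cong[OF refl])
        fix h
        have in0: "(\<Sum>\<rho> < N h d k'. ?c * (Fsym C a b c g' (f,\<alpha>,\<beta>) (h,\<sigma>,\<psi>) * Fsym C a h d e (g',\<psi>,\<gamma>) (k',\<rho>,\<mu>) * Fsym C b c d k' (h,\<sigma>,\<rho>) (l',\<delta>,\<tau>)))
          = (\<Sum>\<rho>\<in>J. F a b c g' (f,\<alpha>,\<beta>) (h,\<sigma>,\<psi>) * F a h d e (g',\<psi>,\<gamma>) (k',\<rho>,\<mu>) * F b c d k' (h,\<sigma>,\<rho>) (l',\<delta>,\<tau>))"
          if "\<sigma> < N b c h" "\<psi> < N a h g'" for \<sigma> \<psi>
          using J[of _ h d k'] finJ t that g0 by (intro sum.mono_neutral_cong_left) (auto simp: F_def ok_def k_def mult_ac)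
        have in1: "(\<Sum>\<psi> < N a h g'. \<Sum>\<rho> < N h d k'. ?c * (Fsym C a b c g' (f,\<alpha>,\<beta>) (h,\<sigma>,\<psi>) * Fsym C a h d e (g',\<psi>,\<gamma>) (k',\<rho>,\<mu>) * Fsym C b c d k' (h,\<sigma>,\<rho>) (l',\<delta>,\<tau>)))
          = (\<Sum>\<psi>\<in>J. \<Sum>\<rho>\<in>J. F a b c g' (f,\<alpha>,\<beta>) (h,\<sigma>,\<psi>) * F a h d e (g',\<psi>,\<gamma>) (k',\<rho>,\<mu>) * F b c d k' (h,\<sigma>,\<rho>) (l',\<delta>,\<tau>))"
          if "\<sigma> < N b c h" for \<sigma>
        proof (rule sum.mono_neutral_cong_left)
          show "\<forall>\<psi>\<in>J - {..<N a h g'}. (\<Sum>\<rho>\<in>J. F a b c g' (f,\<alpha>,\<beta>) (h,\<sigma>,\<psi>) * F a h d e (g',\<psi>,\<gamma>) (k',\<rho>,\<mu>) * F b c d k' (h,\<sigma>,\<rho>) (l',\<delta>,\<tau>)) = 0"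
            by (auto simp: F_def ok_def)
        qed (use J finJ in0 that in auto)
        show "(\<Sum>\<sigma> < N b c h. \<Sum>\<psi> < N a h g'. \<Sum>\<rho> < N h d k'. ?c * (Fsym C a b c g' (f,\<alpha>,\<beta>) (h,\<sigma>,\<psi>) * Fsym C a h d e (g',\<psi>,\<gamma>) (k',\<rho>,\<mu>) * Fsym C b c d k' (h,\<sigma>,\<rho>) (l',\<delta>,\<tau>)))
          = (\<Sum>\<sigma>\<in>J. \<Sum>\<psi>\<in>J. \<Sum>\<rho>\<in>J. F a b c g' (f,\<alpha>,\<beta>) (h,\<sigma>,\<psi>) * F a h d e (g',\<psi>,\<gamma>) (k',\<rho>,\<mu>) * F b c d k' (h,\<sigma>,\<rho>) (l',\<delta>,\<tau>))"
        proof (rule sum.mono_neutral_cong_left)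
          show "\<forall>\<sigma>\<in>J - {..<N b c h}. (\<Sum>\<psi>\<in>J. \<Sum>\<rho>\<in>J. F a b c g' (f,\<alpha>,\<beta>) (h,\<sigma>,\<psi>) * F a h d e (g',\<psi>,\<gamma>) (k',\<rho>,\<mu>) * F b c d k' (h,\<sigma>,\<rho>) (l',\<delta>,\<tau>)) = 0"
            by (auto simp: F_def ok_def)
        qed (use J finJ in1 in auto)
      qed
      finally show ?thesis .
    qed
    show "F a u c d (e,\<alpha>,\<beta>) (f,\<mu>,\<nu>) = (if e = a \<and> \<alpha> = 0 \<and> f = c \<and> \<mu> = 0 \<and> \<beta> = \<nu> \<and> \<beta> < N a c d then 1 else 0)"
    proof (cases "e = a \<and> \<alpha> = 0 \<and> f = c \<and> \<mu> = 0 \<and> \<beta> < N a c d \<and> \<nu> < N a c d")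
      case False
      then show ?thesis by (auto simp: F_def ok_def N1 N2)
    next
      case True
      have "k a u c d a c = r a / l c"
        using g0[of a c d] lr by (auto simp: k_def g_def gauge_def lu)
      moreover have "r a / l c * Fsym C a u c d (a,0,\<beta>) (c,0,\<nu>) = (if \<beta> = \<nu> then 1 else 0)"
        using tri[of \<beta> a c d \<nu>] True lr[of c] by (simp split: if_splits)
      ultimately show ?thesis using True by (simp add: F_def ok_def N1 N2)
    qed
    show "F a (dl a) a a (u,0,0) (u,0,0) \<noteq> 0"
      using rig k0 Ndl[of a] N3[of "dl a" a] by (simp add: rigid_def F_def ok_def N1 N2 dd dl_def[symmetric] u_def[symmetric])
    show "(\<Sum>\<mu>\<in>J. \<Sum>\<kappa>\<in>J. F a b c u (dl c,\<alpha>,0) (dl a,\<mu>,0) * F b c a u (dl a,\<mu>,0) (dl b,\<kappa>,0) * F c a b u (dl b,\<kappa>,0) (dl c,\<alpha>',0)) =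
        (if \<alpha> = \<alpha>' \<and> \<alpha> < N a b (dl c) then ep a * ep b * ep c else 0)"
    proof (cases "\<alpha> < N a b (dl c) \<and> \<alpha>' < N a b (dl c)")
      case False
      then have "F a b c u (dl c,\<alpha>,0) (dl a,\<mu>,0) * F b c a u (dl a,\<mu>,0) (dl b,\<kappa>,0) * F c a b u (dl b,\<kappa>,0) (dl c,\<alpha>',0) = 0" for \<mu> \<kappa>
        by (auto simp: F_def ok_def)
      then have "(\<Sum>\<mu>\<in>J. \<Sum>\<kappa>\<in>J. F a b c u (dl c,\<alpha>,0) (dl a,\<mu>,0) * F b c a u (dl a,\<mu>,0) (dl b,\<kappa>,0) * F c a b u (dl b,\<kappa>,0) (dl c,\<alpha>',0)) = 0"
        by (simp only: sum.neutral_const)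
      then show ?thesis using False by auto
    next
      case True
      \<comment> \<open>\<open>dl x = u\<close> holds only for \<open>x = u\<close>, where both
        sides are \<open>l u = r u\<close>; otherwise both are 1.\<close>
      have gg: "g (dl x) x u = g x (dl x) u" for x
        by (auto simp: g_def gauge_def du lu) (metis dd du)+
      have P: "(\<Sum>\<mu> < N b c (dl a). \<Sum>\<kappa> < N c a (dl b).
             Fsym C a b c u (dl c,\<alpha>,0) (dl a,\<mu>,0) * Fsym C b c a u (dl a,\<mu>,0) (dl b,\<kappa>,0) * Fsym C c a b u (dl b,\<kappa>,0) (dl c,\<alpha>',0)) =
          (if \<alpha> = \<alpha>' then ep a * ep b * ep c else 0)"
        using pv True unfolding pivotal_def Let_def N_def dl_def u_def ep_def by simp
      have kkk: "k a b c u (dl c) (dl a) * k b c a u (dl a) (dl b) * k c a b u (dl b) (dl c) = 1"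
        using g0 by (simp add: k_def gg field_simps)
      have N_dual1: "N (dl x) x u = 1" "N x (dl x) u = 1" for x using N3[of "dl x" x] N3[of x "dl x"] dd by simp_all
      have in0: "(\<Sum>\<kappa>\<in>J. F a b c u (dl c,\<alpha>,0) (dl a,\<mu>,0) * F b c a u (dl a,\<mu>,0) (dl b,\<kappa>,0) * F c a b u (dl b,\<kappa>,0) (dl c,\<alpha>',0)) =
         (\<Sum>\<kappa> < N c a (dl b). Fsym C a b c u (dl c,\<alpha>,0) (dl a,\<mu>,0) * Fsym C b c a u (dl a,\<mu>,0) (dl b,\<kappa>,0) * Fsym C c a b u (dl b,\<kappa>,0) (dl c,\<alpha>',0))"
        if \<mu>: "\<mu> < N b c (dl a)" for \<mu>
      proof (rule sum.mono_neutral_cong_right)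
        fix \<kappa> assume "\<kappa> \<in> {..<N c a (dl b)}"
        then have "F a b c u (dl c,\<alpha>,0) (dl a,\<mu>,0) * F b c a u (dl a,\<mu>,0) (dl b,\<kappa>,0) * F c a b u (dl b,\<kappa>,0) (dl c,\<alpha>',0) =
          (k a b c u (dl c) (dl a) * k b c a u (dl a) (dl b) * k c a b u (dl b) (dl c)) *
          (Fsym C a b c u (dl c,\<alpha>,0) (dl a,\<mu>,0) * Fsym C b c a u (dl a,\<mu>,0) (dl b,\<kappa>,0) * Fsym C c a b u (dl b,\<kappa>,0) (dl c,\<alpha>',0))"
          using True \<mu> by (simp add: F_def ok_def N_dual1 mult_ac)
        then show "F a b c u (dl c,\<alpha>,0) (dl a,\<mu>,0) * F b c a u (dl a,\<mu>,0) (dl b,\<kappa>,0) * F c a b u (dl b,\<kappa>,0) (dl c,\<alpha>',0) =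
          Fsym C a b c u (dl c,\<alpha>,0) (dl a,\<mu>,0) * Fsym C b c a u (dl a,\<mu>,0) (dl b,\<kappa>,0) * Fsym C c a b u (dl b,\<kappa>,0) (dl c,\<alpha>',0)"
          unfolding kkk by simp
      qed (use J finJ in \<open>auto simp: F_def ok_def\<close>)
      have "(\<Sum>\<mu>\<in>J. \<Sum>\<kappa>\<in>J. F a b c u (dl c,\<alpha>,0) (dl a,\<mu>,0) * F b c a u (dl a,\<mu>,0) (dl b,\<kappa>,0) * F c a b u (dl b,\<kappa>,0) (dl c,\<alpha>',0)) =
        (\<Sum>\<mu> < N b c (dl a). \<Sum>\<kappa> < N c a (dl b).
             Fsym C a b c u (dl c,\<alpha>,0) (dl a,\<mu>,0) * Fsym C b c a u (dl a,\<mu>,0) (dl b,\<kappa>,0) * Fsym C c a b u (dl b,\<kappa>,0) (dl c,\<alpha>',0))"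
      proof (rule sum.mono_neutral_cong_right)
        show "\<forall>\<mu>\<in>J - {..<N b c (dl a)}. (\<Sum>\<kappa>\<in>J. F a b c u (dl c,\<alpha>,0) (dl a,\<mu>,0) * F b c a u (dl a,\<mu>,0) (dl b,\<kappa>,0) * F c a b u (dl b,\<kappa>,0) (dl c,\<alpha>',0)) = 0"
          by (auto simp: F_def ok_def)
      qed (use J finJ in0 in auto)
      then show ?thesis using P True by simp
    qed
  qed
  then show ?thesis unfolding has_system_def
    by (intro exI[of _ dl] exI[of _ F] exI[of _ G] exI[of _ J] exI[of _ ep] exI[of _ k])
       (auto simp: u_def N_def k0 F_def ok_def)
qed

section \<open>Galois automorphisms\<close>

interpretation CC: Ring.ring "CC" by (rule ring_from_type_algebra)

lemma CC_simps [simp]: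
  "carrier CC = UNIV" "monoid.mult CC x y = x * y" "ring.add CC x y = x + y" "monoid.one CC = 1" "ring.zero CC = 0"
  by (simp_all add: ring_of_type_algebra_def)

lemma CC_a_inv [simp]: "a_inv CC x = - x"
  using CC.r_neg[of x] by (simp add: add_eq_0_iff)

lemma subfield_CC:
  assumes "subfield K CC"
  shows "0 \<in> K" "1 \<in> K" "x \<in> K \<Longrightarrow> y \<in> K \<Longrightarrow> x - y \<in> K" "x \<in> K \<Longrightarrow> y \<in> K \<Longrightarrow> x + y \<in> K"
    "x \<in> K \<Longrightarrow> y \<in> K \<Longrightarrow> x * y \<in> K"
proof -
  note s = subringE[OF subfieldE(1)[OF assms]]
  show "0 \<in> K" "1 \<in> K" using s(2,3) by simp_all
  show "x + y \<in> K" if "x \<in> K" "y \<in> K" for x y using s(7)[OF that] by simp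
  show "x * y \<in> K" if "x \<in> K" "y \<in> K" for x y using s(6)[OF that] by simp
  show "x - y \<in> K" if "x \<in> K" "y \<in> K" for x y using s(7)[OF that(1) s(5)[OF that(2)]] by simp
qed

text \<open>An element \<open>z\<close> outside of the totally real \<open>K\<close> is a root of a
  quadratic polynomial over \<open>K\<close>, and neither \<open>z\<close> nor \<open>h z\<close> is
  real because \<open>L\<close> is totally imaginary. Conjugation exchanges the two roots, so
  \<open>cnj z = k - z\<close> and likewise \<open>cnj (h z) = h k - h z\<close>. The definitions
  quantify over all embeddings, and \<open>h\<close> restricts to one.\<close>

lemma CM_field_cnj:
  assumes L: "CM_field L" and h: "field_auto h" and z: "z \<in> L"
  shows "h (cnj z) = cnj (h z)"
proof -
  interpret field_auto h by fact
  obtain K where ti: "totally_imaginary L" and tr: "totally_real K" and KL: "K \<subseteq> L" and dim: "CC.dimension 2 K L"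
    using L unfolding CM_field_def by blast
  have Lf: "subfield L CC" and Kf: "subfield K CC"
    using ti tr by (simp_all add: totally_imaginary_def totally_real_def number_field_def)
  have emb: "f \<in> embeddings M" if "field_auto f" for f M
    using field_auto.add[OF that] field_auto.mult[OF that] field_auto.one[OF that]
    by (simp add: embeddings_def Ring.ring_hom_def)
  have id: "field_auto (\<lambda>x. x)" by unfold_locales (auto simp: bij_def)
  have K_emb: "\<forall>f\<in>embeddings K. f ` K \<subseteq> \<real>" and L_emb: "\<forall>f\<in>embeddings L. \<not> f ` L \<subseteq> \<real>"
    using tr ti by (simp_all add: totally_real_def totally_imaginary_def)
  have Kreal: "x \<in> K \<Longrightarrow> x \<in> \<real> \<and> h x \<in> \<real>" for x
    using bspec[OF K_emb emb[OF h]] bspec[OF K_emb emb[OF id]] by (simp add: subset_iff)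
  have Limag: "\<not> L \<subseteq> \<real>" "\<not> h ` L \<subseteq> \<real>"
    using bspec[OF L_emb emb[OF h]] bspec[OF L_emb emb[OF id]] by simp_all
  show ?thesis
  proof (cases "z \<in> K")
    case True
    then show ?thesis using Kreal[OF True] by (simp add: Reals_cnj_iff)
  next
    case False
    have S1: "CC.Span K [1] = K"
      using subfield_CC[OF Kf] by (auto simp: CC.line_extension_mem_iff)
    have ind: "CC.independent K [z, 1]"
    proof (intro CC.li_Cons)
      show "z \<notin> CC.Span K [1]" using False S1 by simp
    qed (auto)
    have "CC.Span K [z, 1] = L"
      using CC.independent_length_eq_dimension[OF Kf dim ind] z subfield_CC(2)[OF Lf] by simp
    then have Lz: "y \<in> L \<Longrightarrow> \<exists>k\<in>K. \<exists>k'\<in>K. y = k * z + k'" for y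
    proof -
      assume "y \<in> L"
      then have "y \<in> CC.line_extension K z (CC.Span K [1])" using \<open>CC.Span K [z, 1] = L\<close> by simp
      then show ?thesis unfolding S1 CC.line_extension_mem_iff by simp
    qed
    have "z * z \<in> L" using subfield_CC(5)[OF Lf z z] .
    then obtain k k' where k: "k \<in> K" "k' \<in> K" "z * z = k * z + k'" using Lz by blast
    have zr: "z \<notin> \<real>"
    proof
      assume "z \<in> \<real>"
      then have "y \<in> \<real>" if "y \<in> L" for y using Lz[OF that] Kreal by auto
      then show False using Limag by blast
    qed
    have hzr: "h z \<notin> \<real>"
    proof
      assume a: "h z \<in> \<real>"
      have "h y \<in> \<real>" if y: "y \<in> L" for y
      proof -
        obtain k k' where "k \<in> K" "k' \<in> K" "y = k * z + k'" using Lz[OF y] by blast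
        then show ?thesis using Kreal a by (simp add: add mult)
      qed
      then show False using Limag by blast
    qed
    have quad: "cnj x = a - x" if "x * x = a * x + b" "a \<in> \<real>" "b \<in> \<real>" "x \<notin> \<real>" for x a b
    proof -
      have "cnj x * cnj x = a * cnj x + b"
        using arg_cong[OF that(1), of cnj] that(2,3) by (simp add: Reals_cnj_iff)
      then have "(x - cnj x) * (x + cnj x - a) = 0" using that(1) by (simp add: algebra_simps)
      moreover have "x - cnj x \<noteq> 0" using that(4) Reals_cnj_iff[of x] by auto
      ultimately have "x + cnj x - a = 0" by (metis mult_eq_0_iff)
      then show ?thesis by (simp add: algebra_simps)
    qed
    have "cnj z = k - z" using quad[OF k(3)] Kreal k(1,2) zr by blast
    moreover have "cnj (h z) = h k - h z"
    proof (rule quad)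
      show "h z * h z = h k * h z + h k'" using arg_cong[OF k(3), of h] by (simp only: add mult)
    qed (use Kreal k hzr in auto)
    ultimately show ?thesis by (simp add: diff)
  qed
qed

text \<open>The graph of \<open>q\<close> on \<open>K_of C\<close> is a partial isomorphism with
  equal domain and range, so it extends to the complex numbers. \<open>L\<close> need be neither
  normal nor contained in \<open>K_of C\<close>; conjugation is controlled on \<open>L\<close>,
  where the extension restricts to an embedding.\<close>

lemma galois_extension:
  assumes L: "CM_field L" and FR: "FR_entries C \<subseteq> L" and q: "q \<in> Gal_rat (K_of C)"
  obtains h where "field_auto h" "\<And>z. z \<in> FR_entries C \<Longrightarrow> h z = q z" "\<And>z. z \<in> FR_entries C \<Longrightarrow> h (cnj z) = cnj (h z)"
proof -
  define K where "K = K_of C"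
  have K: "FR_entries C \<subseteq> K" "0 \<in> K" "1 \<in> K" "x \<in> K \<Longrightarrow> y \<in> K \<Longrightarrow> x - y \<in> K" "x \<in> K \<Longrightarrow> y \<in> K \<Longrightarrow> x + y \<in> K"
    "x \<in> K \<Longrightarrow> y \<in> K \<Longrightarrow> x * y \<in> K" for x y
  proof -
    define S where "S = {M. normal_over_rat M \<and> generate_field CC (FR_entries C) \<subseteq> M}"
    have K': "K = \<Inter>S" by (simp only: K_def K_of_def normal_closure_rat_def S_def)
    have S: "subfield M CC" "FR_entries C \<subseteq> M" if "M \<in> S" for M
      using that generate_field.incl[of _ "FR_entries C" CC] by (auto simp: S_def normal_over_rat_def)
    show "FR_entries C \<subseteq> K" unfolding K' using S(2) by (rule Inter_greatest)
    show "0 \<in> K" "1 \<in> K" unfolding K' using subfield_CC(1,2)[OF S(1)] by simp_all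
    show "x - y \<in> K" if "x \<in> K" "y \<in> K" using that unfolding K' using subfield_CC(3)[OF S(1)] by simp
    show "x + y \<in> K" if "x \<in> K" "y \<in> K" using that unfolding K' using subfield_CC(4)[OF S(1)] by simp
    show "x * y \<in> K" if "x \<in> K" "y \<in> K" using that unfolding K' using subfield_CC(5)[OF S(1)] by simp
  qed
  have qh: "q \<in> Ring.ring_hom (CC_on K) (CC_on K)" and qb: "bij_betw q K K"
    using q by (simp_all add: Gal_rat_def K_def ring_iso_def)
  have q1: "q 1 = 1" "q (x * y) = q x * q y" "q (x + y) = q x + q y" if "x \<in> K" "y \<in> K" for x y
    using qh that by (auto simp: Ring.ring_hom_def)
  have q0: "q 0 = 0" using q1(3)[OF K(2,2)] by simp
  have qd: "q (x - y) = q x - q y" if "x \<in> K" "y \<in> K" for x y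
    using q1(3)[OF K(4)[OF that] that(2)] by simp
  define r where "r = {(x, q x) | x. x \<in> K}"
  have "partial_iso r"
    unfolding partial_iso_def
  proof (intro conjI allI impI)
    show "(1,1) \<in> r" using K(3) q1(1)[OF K(3,3)] by (auto simp: r_def)
    show "(x - x', y - y') \<in> r" "(x * x', y * y') \<in> r" if "(x,y) \<in> r" "(x',y') \<in> r" for x y x' y'
      using that K(4,6) qd q1(2) by (auto simp: r_def)
    show "x = 0 \<longleftrightarrow> y = 0" if "(x,y) \<in> r" for x y
      using that q0 K(2) qb by (auto simp: r_def bij_betw_def inj_on_def)
  qed
  moreover have "Domain r = Range r"
  proof -
    have "Domain r = K" "Range r = q ` K" by (auto simp: r_def)
    then show ?thesis using qb by (simp add: bij_betw_def)
  qed
  ultimately obtain h where h: "bij h" "\<And>x y. h (x + y) = h x + h y" "\<And>x y. h (x * y) = h x * h y" "h 1 = 1"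
    "\<And>x y. (x,y) \<in> r \<Longrightarrow> h x = y" using extend_automorphism by blast
  then have fa: "field_auto h" by unfold_locales
  show ?thesis
  proof (rule that[OF fa])
    show "h z = q z" if "z \<in> FR_entries C" for z using that K(1) by (intro h(5)) (auto simp: r_def)
    show "h (cnj z) = cnj (h z)" if "z \<in> FR_entries C" for z using that FR by (intro CM_field_cnj[OF L fa]) auto
  qed
qed

section \<open>Symmetries with invertible matrices\<close>

text \<open>Cut off at the range, since \<open>Fsym\<close> is arbitrary elsewhere and the equations
  below compare functions.\<close>

definition Fblk :: "'a mtc \<Rightarrow> 'a \<Rightarrow> 'a \<Rightarrow> 'a \<Rightarrow> 'a \<Rightarrow> 'a \<Rightarrow> 'a \<Rightarrow> nat \<Rightarrow> nat \<Rightarrow> nat \<Rightarrow> nat \<Rightarrow> complex" where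
  "Fblk C a b c d e f \<alpha> \<beta> \<mu> \<nu> =
     (if \<alpha> < fus C a b e \<and> \<beta> < fus C e c d \<and> \<mu> < fus C b c f \<and> \<nu> < fus C a f d
      then Fsym C a b c d (e,\<alpha>,\<beta>) (f,\<mu>,\<nu>) else 0)"

definition Rblk :: "'a mtc \<Rightarrow> 'a \<Rightarrow> 'a \<Rightarrow> 'a \<Rightarrow> complex mat" where
  "Rblk C a b c = mat (fus C b a c) (fus C a b c) (\<lambda>(i,j). Rsym C a b c $$ (i,j))"

lemma Rblk_carrier [simp]: "Rblk C a b c \<in> carrier_mat (fus C b a c) (fus C a b c)"
  by (simp add: Rblk_def)

text \<open>The equations of a symmetry, with invertible matrices \<open>U\<close> and inverses \<open>V\<close> in place of unitary ones.\<close>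

definition psym :: "'a::finite mtc \<Rightarrow> bool \<Rightarrow> ('a \<Rightarrow> 'a) \<Rightarrow> ('a \<Rightarrow> 'a \<Rightarrow> 'a \<Rightarrow> complex mat) \<Rightarrow> ('a \<Rightarrow> 'a \<Rightarrow> 'a \<Rightarrow> complex mat) \<Rightarrow> bool" where
  "psym C t g U V \<longleftrightarrow> bij g \<and> (\<forall>a b c. fus C (g a) (g b) (g c) = fus C a b c) \<and>
     (\<forall>a b c. U a b c \<in> carrier_mat (fus C a b c) (fus C a b c) \<and> V a b c \<in> carrier_mat (fus C a b c) (fus C a b c) \<and>
        U a b c * V a b c = 1\<^sub>m (fus C a b c) \<and> V a b c * U a b c = 1\<^sub>m (fus C a b c)) \<and>
     (\<forall>a b c. U (g b) (g a) (g c) * Rblk C (g a) (g b) (g c) * V (g a) (g b) (g c) = map_mat (Kconj t) (Rblk C a b c)) \<and>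
     (\<forall>a b c d e f. act (U (g a) (g b) (g e)) (U (g e) (g c) (g d)) (V (g b) (g c) (g f)) (V (g a) (g f) (g d)) (Fblk C (g a) (g b) (g c) (g d) (g e) (g f))
        = (\<lambda>\<alpha> \<beta> \<mu> \<nu>. Kconj t (Fblk C a b c d e f \<alpha> \<beta> \<mu> \<nu>)))"

lemma psymD:
  assumes "psym C t g U V"
  shows "bij g" "fus C (g a) (g b) (g c) = fus C a b c"
    "U a b c \<in> carrier_mat (fus C a b c) (fus C a b c)" "V a b c \<in> carrier_mat (fus C a b c) (fus C a b c)"
    "U a b c * V a b c = 1\<^sub>m (fus C a b c)" "V a b c * U a b c = 1\<^sub>m (fus C a b c)"
    "U (g b) (g a) (g c) * Rblk C (g a) (g b) (g c) * V (g a) (g b) (g c) = map_mat (Kconj t) (Rblk C a b c)"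
    "act (U (g a) (g b) (g e)) (U (g e) (g c) (g d)) (V (g b) (g c) (g f)) (V (g a) (g f) (g d)) (Fblk C (g a) (g b) (g c) (g d) (g e) (g f))
        = (\<lambda>\<alpha> \<beta> \<mu> \<nu>. Kconj t (Fblk C a b c d e f \<alpha> \<beta> \<mu> \<nu>))"
  using assms unfolding psym_def by blast+

text \<open>Conjugation is a field automorphism too; unitary and anti-unitary symmetries are
  therefore covered by the same lemmas.\<close>

lemma Kconj_field_auto: "field_auto (Kconj t)"
proof
  have "Kconj t (Kconj t x) = x" for x by (simp add: Kconj_def)
  then show "bij (Kconj t)" by (intro o_bij[of "Kconj t"]) auto
qed (auto simp: Kconj_def)

lemma Kconj_Kconj: "Kconj s (Kconj t x) = Kconj (s \<noteq> t) x"
  by (auto simp: Kconj_def)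

context field_auto
begin

lemma map_mat_mult:
  assumes "A \<in> carrier_mat n m" "A' \<in> carrier_mat m k"
  shows "map_mat h (A * A') = map_mat h A * map_mat h A'"
  using assms by (intro eq_matI) (auto simp: scalar_prod_def sum mult)

lemma map_mat_one: "map_mat h (1\<^sub>m n) = 1\<^sub>m n"
  by (intro eq_matI) (auto simp: one zero)

lemma map_mat_smult: "map_mat h (x \<cdot>\<^sub>m A) = h x \<cdot>\<^sub>m map_mat h A"
  by (intro eq_matI) (auto simp: mult)

lemma act_image:
  assumes "A \<in> carrier_mat n1 n1" "B \<in> carrier_mat n2 n2" "C \<in> carrier_mat n3 n3" "D \<in> carrier_mat n4 n4"
  shows "(\<lambda>\<alpha> \<beta> \<mu> \<nu>. h (act A B C D \<Phi> \<alpha> \<beta> \<mu> \<nu>)) =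
    act (map_mat h A) (map_mat h B) (map_mat h C) (map_mat h D) (\<lambda>\<alpha> \<beta> \<mu> \<nu>. h (\<Phi> \<alpha> \<beta> \<mu> \<nu>))"
  using assms by (intro ext) (auto simp: act_def sum mult zero)

end

lemma Fblk_range: "act (1\<^sub>m (fus C a b e)) (1\<^sub>m (fus C e c d)) (1\<^sub>m (fus C b c f)) (1\<^sub>m (fus C a f d)) (Fblk C a b c d e f) = Fblk C a b c d e f"
proof (intro ext)
  fix \<alpha> \<beta> \<mu> \<nu>
  show "act (1\<^sub>m (fus C a b e)) (1\<^sub>m (fus C e c d)) (1\<^sub>m (fus C b c f)) (1\<^sub>m (fus C a f d)) (Fblk C a b c d e f) \<alpha> \<beta> \<mu> \<nu> = Fblk C a b c d e f \<alpha> \<beta> \<mu> \<nu>"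
  proof (cases "\<alpha> < fus C a b e \<and> \<beta> < fus C e c d \<and> \<mu> < fus C b c f \<and> \<nu> < fus C a f d")
    case True
    then show ?thesis
      by (simp add: act_def sum_if_const if_times times_if if_distrib[of "\<lambda>x. _ * x"] if_distrib[of "\<lambda>x. x * _"] cong: if_cong)
  next
    case False
    then show ?thesis by (auto simp: act_def Fblk_def)
  qed
qed

lemma unitary_minv:
  assumes "unitary_mat n A"
  shows "minv A = mat_adjoint A"
proof -
  have A: "A \<in> carrier_mat n n" "A * mat_adjoint A = 1\<^sub>m n" "mat_adjoint A * A = 1\<^sub>m n"
    using assms by (simp_all add: unitary_mat_def)
  have Ad: "mat_adjoint A \<in> carrier_mat n n" using A(1) by (auto intro!: carrier_matI)
  have "A \<in> Units (ring_mat TYPE(complex) n ())"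
    using A Ad by (auto simp: Units_def ring_mat_def)
  then obtain M where M: "mat_inverse A = Some M"
    using mat_inverse(1)[OF A(1), where b = "()"] by (cases "mat_inverse A") auto
  note m = mat_inverse(2)[OF A(1) M]
  have mc: "M \<in> carrier_mat n n" and ma: "M * A = 1\<^sub>m n" using m by simp_all
  have "M = M * 1\<^sub>m n" by (rule right_mult_one_mat[OF mc, symmetric])
  also have "\<dots> = M * (A * mat_adjoint A)" by (simp only: A(2))
  also have "\<dots> = (M * A) * mat_adjoint A" by (rule assoc_mult_mat[OF mc A(1) Ad, symmetric])
  also have "\<dots> = 1\<^sub>m n * mat_adjoint A" by (simp only: ma)
  also have "\<dots> = mat_adjoint A" by (rule left_mult_one_mat[OF Ad])
  finally show ?thesis by (simp add: minv_def M)
qed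

lemma all4_if:
  "(\<forall>a b c d. P1 a \<longrightarrow> P2 b \<longrightarrow> P3 c \<longrightarrow> P4 d \<longrightarrow> S a b c d = K a b c d) \<longleftrightarrow>
   (\<forall>a b c d. (if P1 a \<and> P2 b \<and> P3 c \<and> P4 d then S a b c d else z) = (if P1 a \<and> P2 b \<and> P3 c \<and> P4 d then K a b c d else z))"
  by auto

text \<open>For unitary matrices \<open>minv\<close> is the adjoint, and the index sums of the
  definition are matrix products for \<open>R\<close> and \<open>act\<close> on blocks for
  \<open>F\<close>.\<close>

lemma is_symmetry_iff:
  "is_symmetry C s \<longleftrightarrow> (\<forall>a b c. unitary_mat (fus C a b c) (Umat s a b c)) \<and>
     psym C (anti s) (perm s) (Umat s) (\<lambda>a b c. mat_adjoint (Umat s a b c))"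
proof -
  define g U N where "g = perm s" and "U = Umat s" and "N = fus C"
  define V where "V a b c = mat_adjoint (U a b c)" for a b c
  have V': "V = (\<lambda>a b c. mat_adjoint (Umat s a b c))" by (intro ext) (simp add: V_def U_def)
  have *: "is_symmetry C s \<longleftrightarrow> psym C (anti s) g U V"
    if un: "\<And>a b c. unitary_mat (N a b c) (U a b c)" and bij: "bij g" and fus: "\<And>a b c. N (g a) (g b) (g c) = N a b c"
  proof -
    have U: "U a b c \<in> carrier_mat (N a b c) (N a b c)" for a b c using un by (simp add: unitary_mat_def)
    have V: "V a b c \<in> carrier_mat (N a b c) (N a b c)" for a b c unfolding V_def using U[of a b c] by (auto intro!: carrier_matI)
    have UV: "U a b c * V a b c = 1\<^sub>m (N a b c)" "V a b c * U a b c = 1\<^sub>m (N a b c)" for a b c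
      using un by (simp_all add: V_def unitary_mat_def)
    have mi: "minv (U a b c) = V a b c" for a b c using unitary_minv[OF un] by (simp add: V_def)
    have R: "(\<forall>\<mu> < N b a c. \<forall>\<nu> < N a b c.
        (\<Sum>\<mu>' < N b a c. \<Sum>\<nu>' < N a b c. U (g b) (g a) (g c) $$ (\<mu>, \<mu>') * Rsym C (g a) (g b) (g c) $$ (\<mu>', \<nu>') * V (g a) (g b) (g c) $$ (\<nu>', \<nu>)) =
        Kconj (anti s) (Rsym C a b c $$ (\<mu>, \<nu>)))
      \<longleftrightarrow> U (g b) (g a) (g c) * Rblk C (g a) (g b) (g c) * V (g a) (g b) (g c) = map_mat (Kconj (anti s)) (Rblk C a b c)" (is "?L = ?R") for a b c
    proof -
      have c: "U (g b) (g a) (g c) \<in> carrier_mat (N b a c) (N b a c)" "Rblk C (g a) (g b) (g c) \<in> carrier_mat (N b a c) (N a b c)"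
        "V (g a) (g b) (g c) \<in> carrier_mat (N a b c) (N a b c)"
        using U[of "g b" "g a" "g c"] V[of "g a" "g b" "g c"] Rblk_carrier[of C "g a" "g b" "g c"] fus unfolding N_def by simp_all
      have e: "(U (g b) (g a) (g c) * Rblk C (g a) (g b) (g c) * V (g a) (g b) (g c)) $$ (\<mu>,\<nu>) =
        (\<Sum>\<mu>' < N b a c. \<Sum>\<nu>' < N a b c. U (g b) (g a) (g c) $$ (\<mu>, \<mu>') * Rsym C (g a) (g b) (g c) $$ (\<mu>', \<nu>') * V (g a) (g b) (g c) $$ (\<nu>', \<nu>))"
        if mn: "\<mu> < N b a c" "\<nu> < N a b c" for \<mu> \<nu>
      proof -
        have "(U (g b) (g a) (g c) * Rblk C (g a) (g b) (g c) * V (g a) (g b) (g c)) $$ (\<mu>,\<nu>) =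
          (\<Sum>\<nu>'=0..<N a b c. (\<Sum>\<mu>'=0..<N b a c. U (g b) (g a) (g c) $$ (\<mu>,\<mu>') * Rblk C (g a) (g b) (g c) $$ (\<mu>',\<nu>')) * V (g a) (g b) (g c) $$ (\<nu>',\<nu>))"
          by (subst mat_mult_index[OF mult_carrier_mat[OF c(1,2)] c(3) mn], rule sum.cong[OF refl], subst mat_mult_index[OF c(1,2) mn(1)]) auto
        also have "\<dots> = (\<Sum>\<nu>'=0..<N a b c. \<Sum>\<mu>'=0..<N b a c. U (g b) (g a) (g c) $$ (\<mu>, \<mu>') * Rsym C (g a) (g b) (g c) $$ (\<mu>', \<nu>') * V (g a) (g b) (g c) $$ (\<nu>', \<nu>))"
          unfolding sum_distrib_right
          by (intro sum.cong refl) (use fus in \<open>auto simp: Rblk_def N_def\<close>)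
        finally show ?thesis by (subst sum.swap) (simp add: atLeast0LessThan)
      qed
      have m: "map_mat (Kconj (anti s)) (Rblk C a b c) $$ (\<mu>,\<nu>) = Kconj (anti s) (Rsym C a b c $$ (\<mu>, \<nu>))" if "\<mu> < N b a c" "\<nu> < N a b c" for \<mu> \<nu>
        using that by (simp add: Rblk_def N_def)
      show ?thesis
      proof
        assume ?L
        show ?R
        proof (rule eq_matI)
          fix i j assume "i < dim_row (map_mat (Kconj (anti s)) (Rblk C a b c))" "j < dim_col (map_mat (Kconj (anti s)) (Rblk C a b c))"
          then have "i < N b a c" "j < N a b c" by (simp_all add: Rblk_def N_def)
          then show "(U (g b) (g a) (g c) * Rblk C (g a) (g b) (g c) * V (g a) (g b) (g c)) $$ (i,j) = map_mat (Kconj (anti s)) (Rblk C a b c) $$ (i,j)"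
            using \<open>?L\<close> by (simp only: e m)
        qed (use c in \<open>auto simp: Rblk_def N_def\<close>)
      next
        assume r: ?R
        show ?L
        proof (intro allI impI)
          fix \<mu> \<nu> assume mn: "\<mu> < N b a c" "\<nu> < N a b c"
          show "(\<Sum>\<mu>' < N b a c. \<Sum>\<nu>' < N a b c. U (g b) (g a) (g c) $$ (\<mu>, \<mu>') * Rsym C (g a) (g b) (g c) $$ (\<mu>', \<nu>') * V (g a) (g b) (g c) $$ (\<nu>', \<nu>)) =
            Kconj (anti s) (Rsym C a b c $$ (\<mu>, \<nu>))"
            unfolding e[OF mn, symmetric] m[OF mn, symmetric] r ..
        qed
      qed
    qed
    have F: "(\<forall>\<alpha> \<beta> \<mu> \<nu>. \<alpha> < N a b e \<longrightarrow> \<beta> < N e c d \<longrightarrow> \<mu> < N b c f \<longrightarrow> \<nu> < N a f d \<longrightarrow>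
        (\<Sum>\<alpha>' < N a b e. \<Sum>\<beta>' < N e c d. \<Sum>\<mu>' < N b c f. \<Sum>\<nu>' < N a f d.
           U (g a) (g b) (g e) $$ (\<alpha>, \<alpha>') * U (g e) (g c) (g d) $$ (\<beta>, \<beta>') *
           Fsym C (g a) (g b) (g c) (g d) (g e, \<alpha>', \<beta>') (g f, \<mu>', \<nu>') *
           V (g b) (g c) (g f) $$ (\<mu>', \<mu>) * V (g a) (g f) (g d) $$ (\<nu>', \<nu>)) =
        Kconj (anti s) (Fsym C a b c d (e, \<alpha>, \<beta>) (f, \<mu>, \<nu>))) \<longleftrightarrow>
      act (U (g a) (g b) (g e)) (U (g e) (g c) (g d)) (V (g b) (g c) (g f)) (V (g a) (g f) (g d)) (Fblk C (g a) (g b) (g c) (g d) (g e) (g f))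
        = (\<lambda>\<alpha> \<beta> \<mu> \<nu>. Kconj (anti s) (Fblk C a b c d e f \<alpha> \<beta> \<mu> \<nu>))" (is "?L = ?R") for a b c d e f
    proof -
      have dims: "dim_row (U (g x) (g y) (g z)) = N x y z" "dim_col (U (g x) (g y) (g z)) = N x y z"
        "dim_row (V (g x) (g y) (g z)) = N x y z" "dim_col (V (g x) (g y) (g z)) = N x y z" for x y z
        using U[of "g x" "g y" "g z"] V[of "g x" "g y" "g z"] fus by auto
      have A: "act (U (g a) (g b) (g e)) (U (g e) (g c) (g d)) (V (g b) (g c) (g f)) (V (g a) (g f) (g d)) (Fblk C (g a) (g b) (g c) (g d) (g e) (g f)) \<alpha> \<beta> \<mu> \<nu>
        = (if \<alpha> < N a b e \<and> \<beta> < N e c d \<and> \<mu> < N b c f \<and> \<nu> < N a f d then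
          (\<Sum>\<alpha>' < N a b e. \<Sum>\<beta>' < N e c d. \<Sum>\<mu>' < N b c f. \<Sum>\<nu>' < N a f d.
           U (g a) (g b) (g e) $$ (\<alpha>, \<alpha>') * U (g e) (g c) (g d) $$ (\<beta>, \<beta>') *
           Fsym C (g a) (g b) (g c) (g d) (g e, \<alpha>', \<beta>') (g f, \<mu>', \<nu>') *
           V (g b) (g c) (g f) $$ (\<mu>', \<mu>) * V (g a) (g f) (g d) $$ (\<nu>', \<nu>)) else 0)" for \<alpha> \<beta> \<mu> \<nu>
        unfolding act_def dims using fus by (intro if_cong refl sum.cong) (auto simp: Fblk_def N_def)
      have B: "Kconj (anti s) (Fblk C a b c d e f \<alpha> \<beta> \<mu> \<nu>) = (if \<alpha> < N a b e \<and> \<beta> < N e c d \<and> \<mu> < N b c f \<and> \<nu> < N a f d then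
        Kconj (anti s) (Fsym C a b c d (e, \<alpha>, \<beta>) (f, \<mu>, \<nu>)) else 0)" for \<alpha> \<beta> \<mu> \<nu>
        by (auto simp: Fblk_def N_def Kconj_def)
      show ?thesis unfolding fun_eq_iff A B by (rule all4_if)
    qed
    have "is_symmetry C s \<longleftrightarrow>
     (\<forall>a b c. \<forall>\<mu> < N b a c. \<forall>\<nu> < N a b c.
        (\<Sum>\<mu>' < N b a c. \<Sum>\<nu>' < N a b c. U (g b) (g a) (g c) $$ (\<mu>, \<mu>') * Rsym C (g a) (g b) (g c) $$ (\<mu>', \<nu>') * V (g a) (g b) (g c) $$ (\<nu>', \<nu>)) =
        Kconj (anti s) (Rsym C a b c $$ (\<mu>, \<nu>))) \<and>
     (\<forall>a b c d e f. (\<forall>\<alpha> \<beta> \<mu> \<nu>. \<alpha> < N a b e \<longrightarrow> \<beta> < N e c d \<longrightarrow> \<mu> < N b c f \<longrightarrow> \<nu> < N a f d \<longrightarrow>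
        (\<Sum>\<alpha>' < N a b e. \<Sum>\<beta>' < N e c d. \<Sum>\<mu>' < N b c f. \<Sum>\<nu>' < N a f d.
           U (g a) (g b) (g e) $$ (\<alpha>, \<alpha>') * U (g e) (g c) (g d) $$ (\<beta>, \<beta>') *
           Fsym C (g a) (g b) (g c) (g d) (g e, \<alpha>', \<beta>') (g f, \<mu>', \<nu>') *
           V (g b) (g c) (g f) $$ (\<mu>', \<mu>) * V (g a) (g f) (g d) $$ (\<nu>', \<nu>)) =
        Kconj (anti s) (Fsym C a b c d (e, \<alpha>, \<beta>) (f, \<mu>, \<nu>))))"
      unfolding is_symmetry_def Let_def g_def[symmetric] U_def[symmetric] N_def[symmetric] mi
      by (simp only: bij fus un simp_thms)
    also have "\<dots> \<longleftrightarrow> psym C (anti s) g U V"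
      unfolding R F psym_def N_def[symmetric] by (simp only: bij fus U V UV simp_thms)
    finally show ?thesis .
  qed
  show ?thesis
  proof
    assume s: "is_symmetry C s"
    note s1 = s[unfolded is_symmetry_def Let_def]
    have 1: "bij g" unfolding g_def by (rule conjunct1[OF s1])
    have 2: "N (g a) (g b) (g c) = N a b c" for a b c
      unfolding g_def N_def using conjunct1[OF conjunct2[OF s1]] by blast
    have 3: "unitary_mat (N a b c) (U a b c)" for a b c
      unfolding U_def N_def using conjunct1[OF conjunct2[OF conjunct2[OF s1]]] by blast
    have "psym C (anti s) g U V" using *[OF 3 1 2] s by blast
    then show "(\<forall>a b c. unitary_mat (fus C a b c) (Umat s a b c)) \<and> psym C (anti s) (perm s) (Umat s) (\<lambda>a b c. mat_adjoint (Umat s a b c))"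
      using 3 unfolding V' g_def U_def N_def by blast
  next
    assume s: "(\<forall>a b c. unitary_mat (fus C a b c) (Umat s a b c)) \<and> psym C (anti s) (perm s) (Umat s) (\<lambda>a b c. mat_adjoint (Umat s a b c))"
    have 3: "unitary_mat (N a b c) (U a b c)" for a b c using conjunct1[OF s] unfolding U_def N_def by blast
    note p = conjunct2[OF s]
    have "psym C (anti s) g U V" using p unfolding V' g_def U_def .
    with *[OF 3] psymD(1,2)[OF p] show "is_symmetry C s" unfolding g_def N_def by blast
  qed
qed

section \<open>Composition, inversion, transport and scaling of symmetries\<close>

lemma mat_sandwich:
  assumes "(A::complex mat) \<in> carrier_mat n n" "A' \<in> carrier_mat n n" "R \<in> carrier_mat n m" "B' \<in> carrier_mat m m" "B \<in> carrier_mat m m"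
  shows "A * (A' * R * B') * B = (A * A') * R * (B' * B)"
proof -
  have c: "A' * R \<in> carrier_mat n m" "A * A' \<in> carrier_mat n n" "A * A' * R \<in> carrier_mat n m" "A * (A' * R) \<in> carrier_mat n m"
    "A' * R * B' \<in> carrier_mat n m" "B' * B \<in> carrier_mat m m"
    using assms by auto
  have "A * (A' * R * B') * B = A * (A' * R) * B' * B" using assoc_mult_mat[OF assms(1) c(1) assms(4)] by simp
  also have "\<dots> = A * (A' * R) * (B' * B)" using assoc_mult_mat[OF c(4) assms(4,5)] by simp
  also have "\<dots> = (A * A') * R * (B' * B)" using assoc_mult_mat[OF assms(1-3)] by simp
  finally show ?thesis .
qed

lemma mat_cancel4:
  assumes "(A::complex mat) \<in> carrier_mat n n" "A' \<in> carrier_mat n n" "B' \<in> carrier_mat n n" "B \<in> carrier_mat n n"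
    "A' * B' = 1\<^sub>m n" "A * B = 1\<^sub>m n"
  shows "(A * A') * (B' * B) = 1\<^sub>m n"
proof -
  have "(A * A') * (B' * B) = A * (A' * (B' * B))" using assms assoc_mult_mat[of A n n A' n "B' * B" n] by simp
  also have "A' * (B' * B) = (A' * B') * B" using assms assoc_mult_mat[of A' n n B' n B n] by simp
  finally show ?thesis using assms by simp
qed

text \<open>The equations of the outer map leave the data at the labels \<open>gt a\<close>,
  \<open>gt b\<close>, ... with \<open>Kconj ts\<close> applied. As this is a field automorphism,
  what remains is its image of the equations of the inner map.\<close>

lemma psym_comp:
  assumes s: "psym C ts gs Us Vs" and t: "psym C tt gt Ut Vt"
  defines "h \<equiv> inv_into UNIV gs"
  shows "psym C (ts \<noteq> tt) (gs \<circ> gt)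
    (\<lambda>x y z. map_mat (Kconj ts) (Ut (h x) (h y) (h z)) * Us x y z)
    (\<lambda>x y z. Vs x y z * map_mat (Kconj ts) (Vt (h x) (h y) (h z)))"
proof -
  interpret K: field_auto "Kconj ts" by (rule Kconj_field_auto)
  note S = psymD[OF s] and T = psymD[OF t]
  have h: "h (gs x) = x" "gs (h x) = x" for x
    using S(1) by (simp_all add: h_def bij_is_inj bij_is_surj surj_f_inv_f)
  have Nh: "fus C (h x) (h y) (h z) = fus C x y z" for x y z using S(2)[of "h x" "h y" "h z"] by (simp add: h)
  have c: "map_mat (Kconj ts) (Ut (h x) (h y) (h z)) \<in> carrier_mat (fus C x y z) (fus C x y z)"
    "map_mat (Kconj ts) (Vt (h x) (h y) (h z)) \<in> carrier_mat (fus C x y z) (fus C x y z)" for x y z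
    using T(3,4)[of "h x" "h y" "h z"] by (simp_all add: Nh)
  have TT: "map_mat (Kconj ts) (Ut (h x) (h y) (h z)) * map_mat (Kconj ts) (Vt (h x) (h y) (h z)) = 1\<^sub>m (fus C x y z)"
    "map_mat (Kconj ts) (Vt (h x) (h y) (h z)) * map_mat (Kconj ts) (Ut (h x) (h y) (h z)) = 1\<^sub>m (fus C x y z)" for x y z
    unfolding K.map_mat_mult[OF T(3,4)[of "h x" "h y" "h z"], symmetric] K.map_mat_mult[OF T(4,3)[of "h x" "h y" "h z"], symmetric] T(5,6) Nh
    by (rule K.map_mat_one)+
  show ?thesis unfolding psym_def
  proof (intro conjI allI)
    show "bij (gs \<circ> gt)" using S(1) T(1) by (rule bij_comp[rotated])
    fix a b c d e f
    show "fus C ((gs \<circ> gt) a) ((gs \<circ> gt) b) ((gs \<circ> gt) c) = fus C a b c" by (simp add: S(2) T(2))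
    show "map_mat (Kconj ts) (Ut (h a) (h b) (h c)) * Us a b c \<in> carrier_mat (fus C a b c) (fus C a b c)"
      "Vs a b c * map_mat (Kconj ts) (Vt (h a) (h b) (h c)) \<in> carrier_mat (fus C a b c) (fus C a b c)"
      using c[of a b c] S(3,4)[of a b c] by auto
    show "map_mat (Kconj ts) (Ut (h a) (h b) (h c)) * Us a b c * (Vs a b c * map_mat (Kconj ts) (Vt (h a) (h b) (h c))) = 1\<^sub>m (fus C a b c)"
      by (rule mat_cancel4[OF c(1) S(3) S(4) c(2) S(5) TT(1)])
    show "Vs a b c * map_mat (Kconj ts) (Vt (h a) (h b) (h c)) * (map_mat (Kconj ts) (Ut (h a) (h b) (h c)) * Us a b c) = 1\<^sub>m (fus C a b c)"
      by (rule mat_cancel4[OF S(4) c(2) c(1) S(3) TT(2) S(6)])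
    let ?a = "gt a" and ?b = "gt b" and ?c = "gt c" and ?d = "gt d" and ?e = "gt e" and ?f = "gt f"
    have kU: "Ut (gt a) (gt b) (gt c) \<in> carrier_mat (fus C a b c) (fus C a b c)" "Vt (gt a) (gt b) (gt c) \<in> carrier_mat (fus C a b c) (fus C a b c)" for a b c
      using T(3,4)[of "gt a" "gt b" "gt c"] by (simp_all add: T(2))
    have sU: "Us (gs (gt a)) (gs (gt b)) (gs (gt c)) \<in> carrier_mat (fus C a b c) (fus C a b c)"
      "Vs (gs (gt a)) (gs (gt b)) (gs (gt c)) \<in> carrier_mat (fus C a b c) (fus C a b c)" for a b c
      using S(3,4)[of "gs (gt a)" "gs (gt b)" "gs (gt c)"] by (simp_all add: T(2) S(2))
    have Rc: "Rblk C (gs (gt a)) (gs (gt b)) (gs (gt c)) \<in> carrier_mat (fus C b a c) (fus C a b c)"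
      "Rblk C (gt a) (gt b) (gt c) \<in> carrier_mat (fus C b a c) (fus C a b c)"
      using Rblk_carrier[of C "gs (gt a)" "gs (gt b)" "gs (gt c)"] Rblk_carrier[of C "gt a" "gt b" "gt c"] by (simp_all add: T(2) S(2))
    have mk: "M \<in> carrier_mat n m \<Longrightarrow> map_mat (Kconj ts) M \<in> carrier_mat n m" for M n m by simp
    have "map_mat (Kconj ts) (Ut ?b ?a ?c) * Us (gs ?b) (gs ?a) (gs ?c) * Rblk C (gs ?a) (gs ?b) (gs ?c) * (Vs (gs ?a) (gs ?b) (gs ?c) * map_mat (Kconj ts) (Vt ?a ?b ?c))
      = map_mat (Kconj ts) (Ut ?b ?a ?c) * (Us (gs ?b) (gs ?a) (gs ?c) * Rblk C (gs ?a) (gs ?b) (gs ?c) * Vs (gs ?a) (gs ?b) (gs ?c)) * map_mat (Kconj ts) (Vt ?a ?b ?c)"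
      by (rule mat_sandwich[symmetric, OF mk[OF kU(1)] sU(1) Rc(1) sU(2) mk[OF kU(2)]])
    also have "\<dots> = map_mat (Kconj ts) (Ut ?b ?a ?c * Rblk C ?a ?b ?c * Vt ?a ?b ?c)"
      unfolding S(7) K.map_mat_mult[OF mult_carrier_mat[OF kU(1) Rc(2)] kU(2)] K.map_mat_mult[OF kU(1) Rc(2)] ..
    also have "\<dots> = map_mat (Kconj (ts \<noteq> tt)) (Rblk C a b c)"
      unfolding T(7) by (intro eq_matI) (auto simp: Kconj_Kconj)
    finally show "map_mat (Kconj ts) (Ut (h ((gs \<circ> gt) b)) (h ((gs \<circ> gt) a)) (h ((gs \<circ> gt) c))) * Us ((gs \<circ> gt) b) ((gs \<circ> gt) a) ((gs \<circ> gt) c) *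
      Rblk C ((gs \<circ> gt) a) ((gs \<circ> gt) b) ((gs \<circ> gt) c) * (Vs ((gs \<circ> gt) a) ((gs \<circ> gt) b) ((gs \<circ> gt) c) *
      map_mat (Kconj ts) (Vt (h ((gs \<circ> gt) a)) (h ((gs \<circ> gt) b)) (h ((gs \<circ> gt) c)))) = map_mat (Kconj (ts \<noteq> tt)) (Rblk C a b c)"
      by (simp add: h)
    have "act (map_mat (Kconj ts) (Ut ?a ?b ?e) * Us (gs ?a) (gs ?b) (gs ?e)) (map_mat (Kconj ts) (Ut ?e ?c ?d) * Us (gs ?e) (gs ?c) (gs ?d))
       (Vs (gs ?b) (gs ?c) (gs ?f) * map_mat (Kconj ts) (Vt ?b ?c ?f)) (Vs (gs ?a) (gs ?f) (gs ?d) * map_mat (Kconj ts) (Vt ?a ?f ?d)) (Fblk C (gs ?a) (gs ?b) (gs ?c) (gs ?d) (gs ?e) (gs ?f)) =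
       act (map_mat (Kconj ts) (Ut ?a ?b ?e)) (map_mat (Kconj ts) (Ut ?e ?c ?d)) (map_mat (Kconj ts) (Vt ?b ?c ?f)) (map_mat (Kconj ts) (Vt ?a ?f ?d))
         (act (Us (gs ?a) (gs ?b) (gs ?e)) (Us (gs ?e) (gs ?c) (gs ?d)) (Vs (gs ?b) (gs ?c) (gs ?f)) (Vs (gs ?a) (gs ?f) (gs ?d)) (Fblk C (gs ?a) (gs ?b) (gs ?c) (gs ?d) (gs ?e) (gs ?f)))"
      by (rule act_comp[symmetric, OF mk[OF kU(1)] mk[OF kU(1)] mk[OF kU(2)] mk[OF kU(2)] sU(1) sU(1) sU(2) sU(2)])
    also have "\<dots> = (\<lambda>\<alpha> \<beta> \<mu> \<nu>. Kconj ts (act (Ut ?a ?b ?e) (Ut ?e ?c ?d) (Vt ?b ?c ?f) (Vt ?a ?f ?d) (Fblk C ?a ?b ?c ?d ?e ?f) \<alpha> \<beta> \<mu> \<nu>))"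
      unfolding S(8) K.act_image[OF kU(1) kU(1) kU(2) kU(2)] ..
    also have "\<dots> = (\<lambda>\<alpha> \<beta> \<mu> \<nu>. Kconj (ts \<noteq> tt) (Fblk C a b c d e f \<alpha> \<beta> \<mu> \<nu>))"
      unfolding T(8) Kconj_Kconj ..
    finally show "act (map_mat (Kconj ts) (Ut (h ((gs \<circ> gt) a)) (h ((gs \<circ> gt) b)) (h ((gs \<circ> gt) e))) * Us ((gs \<circ> gt) a) ((gs \<circ> gt) b) ((gs \<circ> gt) e))
      (map_mat (Kconj ts) (Ut (h ((gs \<circ> gt) e)) (h ((gs \<circ> gt) c)) (h ((gs \<circ> gt) d))) * Us ((gs \<circ> gt) e) ((gs \<circ> gt) c) ((gs \<circ> gt) d))
      (Vs ((gs \<circ> gt) b) ((gs \<circ> gt) c) ((gs \<circ> gt) f) * map_mat (Kconj ts) (Vt (h ((gs \<circ> gt) b)) (h ((gs \<circ> gt) c)) (h ((gs \<circ> gt) f))))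
      (Vs ((gs \<circ> gt) a) ((gs \<circ> gt) f) ((gs \<circ> gt) d) * map_mat (Kconj ts) (Vt (h ((gs \<circ> gt) a)) (h ((gs \<circ> gt) f)) (h ((gs \<circ> gt) d))))
      (Fblk C ((gs \<circ> gt) a) ((gs \<circ> gt) b) ((gs \<circ> gt) c) ((gs \<circ> gt) d) ((gs \<circ> gt) e) ((gs \<circ> gt) f)) =
      (\<lambda>\<alpha> \<beta> \<mu> \<nu>. Kconj (ts \<noteq> tt) (Fblk C a b c d e f \<alpha> \<beta> \<mu> \<nu>))"
      by (simp add: h)
  qed
qed

text \<open>The given equations are solved for the untransformed data, and \<open>Kconj t\<close>,
  which is its own inverse, is applied once more.\<close>

lemma psym_inverse:
  assumes s: "psym C t g U V"
  defines "h \<equiv> inv_into UNIV g"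
  shows "psym C t h (\<lambda>x y z. map_mat (Kconj t) (V (g x) (g y) (g z))) (\<lambda>x y z. map_mat (Kconj t) (U (g x) (g y) (g z)))"
proof -
  interpret K: field_auto "Kconj t" by (rule Kconj_field_auto)
  note S = psymD[OF s]
  have h: "h (g x) = x" "g (h x) = x" for x
    using S(1) by (simp_all add: h_def bij_is_inj bij_is_surj surj_f_inv_f)
  have Nh: "fus C (h x) (h y) (h z) = fus C x y z" for x y z using S(2)[of "h x" "h y" "h z"] by (simp add: h)
  have KK: "map_mat (Kconj t) (map_mat (Kconj t) M) = M" for M by (intro eq_matI) (auto simp: Kconj_def)
  have mk: "M \<in> carrier_mat n m \<Longrightarrow> map_mat (Kconj t) M \<in> carrier_mat n m" for M n m by simp
  show ?thesis unfolding psym_def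
  proof (intro conjI allI)
    show "bij h" using S(1) by (simp add: h_def bij_imp_bij_inv)
    fix a b c d e f
    show "fus C (h a) (h b) (h c) = fus C a b c" by (rule Nh)
    note gc = S(3,4)[of "g a" "g b" "g c", unfolded S(2)]
    show "map_mat (Kconj t) (V (g a) (g b) (g c)) \<in> carrier_mat (fus C a b c) (fus C a b c)"
      "map_mat (Kconj t) (U (g a) (g b) (g c)) \<in> carrier_mat (fus C a b c) (fus C a b c)"
      using gc by simp_all
    show "map_mat (Kconj t) (V (g a) (g b) (g c)) * map_mat (Kconj t) (U (g a) (g b) (g c)) = 1\<^sub>m (fus C a b c)"
      "map_mat (Kconj t) (U (g a) (g b) (g c)) * map_mat (Kconj t) (V (g a) (g b) (g c)) = 1\<^sub>m (fus C a b c)"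
      unfolding K.map_mat_mult[OF gc(2,1), symmetric] K.map_mat_mult[OF gc, symmetric] S(5,6) S(2) by (rule K.map_mat_one)+
    have Rh: "Rblk C (h a) (h b) (h c) \<in> carrier_mat (fus C b a c) (fus C a b c)"
      using Rblk_carrier[of C "h a" "h b" "h c"] by (simp add: Nh)
    have R1: "U b a c * Rblk C a b c * V a b c = map_mat (Kconj t) (Rblk C (h a) (h b) (h c))"
      using S(7)[of "h b" "h a" "h c"] by (simp add: h)
    have "V b a c * (U b a c * Rblk C a b c * V a b c) * U a b c = Rblk C a b c"
      unfolding mat_sandwich[OF S(4) S(3) Rblk_carrier S(4) S(3)] S(6)
      by (simp add: left_mult_one_mat[OF Rblk_carrier] right_mult_one_mat[OF Rblk_carrier])
    then have "map_mat (Kconj t) (V b a c * map_mat (Kconj t) (Rblk C (h a) (h b) (h c)) * U a b c) = map_mat (Kconj t) (Rblk C a b c)"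
      unfolding R1 by simp
    then show "map_mat (Kconj t) (V (g (h b)) (g (h a)) (g (h c))) * Rblk C (h a) (h b) (h c) * map_mat (Kconj t) (U (g (h a)) (g (h b)) (g (h c))) = map_mat (Kconj t) (Rblk C a b c)"
      unfolding K.map_mat_mult[OF mult_carrier_mat[OF S(4) mk[OF Rh]] S(3)] K.map_mat_mult[OF S(4) mk[OF Rh]] KK h .
    have F1: "act (U a b e) (U e c d) (V b c f) (V a f d) (Fblk C a b c d e f) = (\<lambda>\<alpha> \<beta> \<mu> \<nu>. Kconj t (Fblk C (h a) (h b) (h c) (h d) (h e) (h f) \<alpha> \<beta> \<mu> \<nu>))"
      using S(8)[of "h a" "h b" "h e" "h c" "h d" "h f"] by (simp add: h)
    have "act (V a b e) (V e c d) (U b c f) (U a f d) (act (U a b e) (U e c d) (V b c f) (V a f d) (Fblk C a b c d e f)) = Fblk C a b c d e f"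
      unfolding act_comp[OF S(4) S(4) S(3) S(3) S(3) S(3) S(4) S(4)] S(6) by (rule Fblk_range)
    then have "(\<lambda>\<alpha> \<beta> \<mu> \<nu>. Kconj t (act (V a b e) (V e c d) (U b c f) (U a f d) (\<lambda>\<alpha> \<beta> \<mu> \<nu>. Kconj t (Fblk C (h a) (h b) (h c) (h d) (h e) (h f) \<alpha> \<beta> \<mu> \<nu>)) \<alpha> \<beta> \<mu> \<nu>))
        = (\<lambda>\<alpha> \<beta> \<mu> \<nu>. Kconj t (Fblk C a b c d e f \<alpha> \<beta> \<mu> \<nu>))"
      unfolding F1 by simp
    then show "act (map_mat (Kconj t) (V (g (h a)) (g (h b)) (g (h e)))) (map_mat (Kconj t) (V (g (h e)) (g (h c)) (g (h d))))
        (map_mat (Kconj t) (U (g (h b)) (g (h c)) (g (h f)))) (map_mat (Kconj t) (U (g (h a)) (g (h f)) (g (h d)))) (Fblk C (h a) (h b) (h c) (h d) (h e) (h f)) =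
        (\<lambda>\<alpha> \<beta> \<mu> \<nu>. Kconj t (Fblk C a b c d e f \<alpha> \<beta> \<mu> \<nu>))"
      unfolding K.act_image[OF S(4) S(4) S(3) S(3)] h Kconj_Kconj by (simp add: Kconj_def)
  qed
qed

lemma psym_image:
  assumes s: "psym C t g U V" and \<sigma>: "field_auto \<sigma>" and N: "fus D = fus C"
    and F: "\<And>a b c d e f \<alpha> \<beta> \<mu> \<nu>. Fblk D a b c d e f \<alpha> \<beta> \<mu> \<nu> = \<sigma> (Fblk C a b c d e f \<alpha> \<beta> \<mu> \<nu>)"
    and R: "\<And>a b c. Rblk D a b c = map_mat \<sigma> (Rblk C a b c)"
    and Fc: "\<And>a b c d e f \<alpha> \<beta> \<mu> \<nu>. \<sigma> (Kconj t (Fblk C a b c d e f \<alpha> \<beta> \<mu> \<nu>)) = Kconj t (\<sigma> (Fblk C a b c d e f \<alpha> \<beta> \<mu> \<nu>))"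
    and Rc: "\<And>a b c. map_mat \<sigma> (map_mat (Kconj t) (Rblk C a b c)) = map_mat (Kconj t) (map_mat \<sigma> (Rblk C a b c))"
  shows "psym D t g (\<lambda>x y z. map_mat \<sigma> (U x y z)) (\<lambda>x y z. map_mat \<sigma> (V x y z))"
proof -
  interpret field_auto \<sigma> by fact
  note S = psymD[OF s]
  have Fd: "Fblk D a b c d e f = (\<lambda>\<alpha> \<beta> \<mu> \<nu>. \<sigma> (Fblk C a b c d e f \<alpha> \<beta> \<mu> \<nu>))" for a b c d e f
    using F by (intro ext)
  have gcar: "U (g a) (g b) (g c) \<in> carrier_mat (fus C a b c) (fus C a b c)" "V (g a) (g b) (g c) \<in> carrier_mat (fus C a b c) (fus C a b c)"
    "Rblk C (g a) (g b) (g c) \<in> carrier_mat (fus C b a c) (fus C a b c)" for a b c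
    using S(3,4)[of "g a" "g b" "g c"] Rblk_carrier[of C "g a" "g b" "g c"] by (simp_all add: S(2))
  show ?thesis unfolding psym_def N
  proof (intro conjI allI)
    fix a b c d e f
    show "bij g" "fus C (g a) (g b) (g c) = fus C a b c" by (fact S(1) S(2))+
    show "map_mat \<sigma> (U a b c) \<in> carrier_mat (fus C a b c) (fus C a b c)" "map_mat \<sigma> (V a b c) \<in> carrier_mat (fus C a b c) (fus C a b c)"
      using S(3,4)[of a b c] by simp_all
    show "map_mat \<sigma> (U a b c) * map_mat \<sigma> (V a b c) = 1\<^sub>m (fus C a b c)" "map_mat \<sigma> (V a b c) * map_mat \<sigma> (U a b c) = 1\<^sub>m (fus C a b c)"
      unfolding map_mat_mult[OF S(3,4), symmetric] map_mat_mult[OF S(4,3), symmetric] S(5,6) by (rule map_mat_one)+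
    show "map_mat \<sigma> (U (g b) (g a) (g c)) * Rblk D (g a) (g b) (g c) * map_mat \<sigma> (V (g a) (g b) (g c)) = map_mat (Kconj t) (Rblk D a b c)"
      unfolding R Rc[symmetric] S(7)[symmetric] map_mat_mult[OF mult_carrier_mat[OF gcar(1,3)] gcar(2)] map_mat_mult[OF gcar(1,3)] ..
    show "act (map_mat \<sigma> (U (g a) (g b) (g e))) (map_mat \<sigma> (U (g e) (g c) (g d))) (map_mat \<sigma> (V (g b) (g c) (g f))) (map_mat \<sigma> (V (g a) (g f) (g d)))
        (Fblk D (g a) (g b) (g c) (g d) (g e) (g f)) = (\<lambda>\<alpha> \<beta> \<mu> \<nu>. Kconj t (Fblk D a b c d e f \<alpha> \<beta> \<mu> \<nu>))"
      unfolding Fd act_image[OF gcar(1) gcar(1) gcar(2) gcar(2), symmetric] S(8) Fc ..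
  qed
qed

lemma act_smult_fun: "act A B C D (\<lambda>\<alpha> \<beta> \<mu> \<nu>. x * \<Phi> \<alpha> \<beta> \<mu> \<nu>) = (\<lambda>\<alpha> \<beta> \<mu> \<nu>. x * act A B C D \<Phi> \<alpha> \<beta> \<mu> \<nu>)"
  by (intro ext) (simp add: act_def sum_distrib_left mult_ac)

text \<open>The scalars form a coboundary and cancel in both equations. \<open>psym_polar\<close>
  uses positive ones, natural isomorphisms use phases.\<close>

lemma psym_scale:
  assumes s: "psym C t g U V" and \<gamma>: "\<And>a. \<gamma> a \<noteq> 0"
  shows "psym C t g (\<lambda>x y z. (\<gamma> x * \<gamma> y / \<gamma> z) \<cdot>\<^sub>m U x y z) (\<lambda>x y z. (\<gamma> z / (\<gamma> x * \<gamma> y)) \<cdot>\<^sub>m V x y z)"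
proof -
  note S = psymD[OF s]
  have prod: "(x \<cdot>\<^sub>m A) * (y \<cdot>\<^sub>m A') = (x * y) \<cdot>\<^sub>m (A * A')" if "A \<in> carrier_mat n m" "A' \<in> carrier_mat m k" for A A' :: "complex mat" and x y n m k
    using that mult_smult_assoc_mat[of A n m "y \<cdot>\<^sub>m A'" k x] mult_smult_distrib[of A n m A' k y] by (simp add: smult_smult_mat)
  have gcar: "U (g a) (g b) (g c) \<in> carrier_mat (fus C a b c) (fus C a b c)" "V (g a) (g b) (g c) \<in> carrier_mat (fus C a b c) (fus C a b c)"
    "Rblk C (g a) (g b) (g c) \<in> carrier_mat (fus C b a c) (fus C a b c)" for a b c
    using S(3,4)[of "g a" "g b" "g c"] Rblk_carrier[of C "g a" "g b" "g c"] by (simp_all add: S(2))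
  show ?thesis unfolding psym_def
  proof (intro conjI allI)
    fix a b c d e f
    show "bij g" "fus C (g a) (g b) (g c) = fus C a b c" by (fact S(1) S(2))+
    show "(\<gamma> a * \<gamma> b / \<gamma> c) \<cdot>\<^sub>m U a b c \<in> carrier_mat (fus C a b c) (fus C a b c)" "(\<gamma> c / (\<gamma> a * \<gamma> b)) \<cdot>\<^sub>m V a b c \<in> carrier_mat (fus C a b c) (fus C a b c)"
      using S(3,4)[of a b c] by simp_all
    show "(\<gamma> a * \<gamma> b / \<gamma> c) \<cdot>\<^sub>m U a b c * ((\<gamma> c / (\<gamma> a * \<gamma> b)) \<cdot>\<^sub>m V a b c) = 1\<^sub>m (fus C a b c)"
      "(\<gamma> c / (\<gamma> a * \<gamma> b)) \<cdot>\<^sub>m V a b c * ((\<gamma> a * \<gamma> b / \<gamma> c) \<cdot>\<^sub>m U a b c) = 1\<^sub>m (fus C a b c)"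
      unfolding prod[OF S(3,4)] prod[OF S(4,3)] S(5,6) using \<gamma> by (simp_all add: smult_1_mat)
    show "(\<gamma> (g b) * \<gamma> (g a) / \<gamma> (g c)) \<cdot>\<^sub>m U (g b) (g a) (g c) * Rblk C (g a) (g b) (g c) * ((\<gamma> (g c) / (\<gamma> (g a) * \<gamma> (g b))) \<cdot>\<^sub>m V (g a) (g b) (g c)) = map_mat (Kconj t) (Rblk C a b c)"
      unfolding mult_smult_assoc_mat[OF gcar(1,3)] prod[OF mult_carrier_mat[OF gcar(1,3)] gcar(2)] S(7)
      using \<gamma> by (simp add: smult_1_mat mult.commute)
    have "(\<gamma> (g a) * \<gamma> (g b) / \<gamma> (g e)) * (\<gamma> (g e) * \<gamma> (g c) / \<gamma> (g d)) * (\<gamma> (g f) / (\<gamma> (g b) * \<gamma> (g c))) * (\<gamma> (g d) / (\<gamma> (g a) * \<gamma> (g f))) = 1"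
      using \<gamma> by (simp add: field_simps)
    then show "act ((\<gamma> (g a) * \<gamma> (g b) / \<gamma> (g e)) \<cdot>\<^sub>m U (g a) (g b) (g e)) ((\<gamma> (g e) * \<gamma> (g c) / \<gamma> (g d)) \<cdot>\<^sub>m U (g e) (g c) (g d))
        ((\<gamma> (g f) / (\<gamma> (g b) * \<gamma> (g c))) \<cdot>\<^sub>m V (g b) (g c) (g f)) ((\<gamma> (g d) / (\<gamma> (g a) * \<gamma> (g f))) \<cdot>\<^sub>m V (g a) (g f) (g d)) (Fblk C (g a) (g b) (g c) (g d) (g e) (g f)) =
        (\<lambda>\<alpha> \<beta> \<mu> \<nu>. Kconj t (Fblk C a b c d e f \<alpha> \<beta> \<mu> \<nu>))"
      unfolding S(8)[symmetric] by (intro ext) (subst act_smult[OF gcar(1) gcar(1) gcar(2) gcar(2)], simp)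
  qed
qed

section \<open>The group of symmetries\<close>

lemma adj_carrier: "A \<in> carrier_mat n m \<Longrightarrow> mat_adjoint (A :: complex mat) \<in> carrier_mat m n"
  by (auto intro!: carrier_matI)

lemma adj_adj: "mat_adjoint (mat_adjoint (A :: complex mat)) = A"
  by (intro eq_matI) auto

lemma adj_mult:
  "A \<in> carrier_mat n m \<Longrightarrow> A' \<in> carrier_mat m k \<Longrightarrow> mat_adjoint ((A :: complex mat) * A') = mat_adjoint A' * mat_adjoint A"
  by (intro eq_matI) (auto simp: scalar_prod_def mult.commute)

lemma adj_one: "mat_adjoint (1\<^sub>m n :: complex mat) = 1\<^sub>m n"
  by (intro eq_matI) auto

lemma adj_smult: "mat_adjoint (x \<cdot>\<^sub>m (A :: complex mat)) = cnj x \<cdot>\<^sub>m mat_adjoint A"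
  by (intro eq_matI) auto

lemma adj_Kconj: "mat_adjoint (map_mat (Kconj t) A) = map_mat (Kconj t) (mat_adjoint A)"
  by (intro eq_matI) (auto simp: Kconj_def)

lemma norm_Kconj: "cmod (Kconj t x) = cmod x"
  by (simp add: Kconj_def)

text \<open>That the inverse in \<open>psym\<close> is the adjoint already expresses
  unitarity.\<close>

lemma is_symmetry_psym:
  "is_symmetry C s \<longleftrightarrow> psym C (anti s) (perm s) (Umat s) (\<lambda>a b c. mat_adjoint (Umat s a b c))"
  unfolding is_symmetry_iff using psymD(3,5,6) by (fastforce simp: unitary_mat_def)

lemma symD:
  assumes "is_symmetry C s"
  shows "Umat s a b c \<in> carrier_mat (fus C a b c) (fus C a b c)"
    "Umat s a b c * mat_adjoint (Umat s a b c) = 1\<^sub>m (fus C a b c)"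
    "mat_adjoint (Umat s a b c) * Umat s a b c = 1\<^sub>m (fus C a b c)"
    "bij (perm s)" "fus C (perm s a) (perm s b) (perm s c) = fus C a b c"
  using psymD[OF assms[unfolded is_symmetry_psym]] by blast+

lemma sym_comp_closed:
  assumes "is_symmetry C s" "is_symmetry C t"
  shows "is_symmetry C (sym_comp s t)"
proof -
  let ?h = "inv_into UNIV (perm s)"
  have N: "fus C (?h a) (?h b) (?h c) = fus C a b c" for a b c
    using symD(5)[OF assms(1), of "?h a" "?h b" "?h c"] symD(4)[OF assms(1)] by (simp add: bij_is_surj surj_f_inv_f)
  have adj: "mat_adjoint (map_mat (Kconj (anti s)) (Umat t (?h a) (?h b) (?h c)) * Umat s a b c) =
     mat_adjoint (Umat s a b c) * map_mat (Kconj (anti s)) (mat_adjoint (Umat t (?h a) (?h b) (?h c)))" for a b c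
  proof -
    have "map_mat (Kconj (anti s)) (Umat t (?h a) (?h b) (?h c)) \<in> carrier_mat (fus C a b c) (fus C a b c)"
      using symD(1)[OF assms(2), of "?h a" "?h b" "?h c"] by (simp add: N)
    from adj_mult[OF this symD(1)[OF assms(1)]] show ?thesis by (simp add: adj_Kconj)
  qed
  show ?thesis
    using psym_comp[OF assms[unfolded is_symmetry_psym]] unfolding is_symmetry_psym sym_comp_def by (simp add: adj Let_def)
qed

definition nat_iso :: "'a mtc \<Rightarrow> ('a \<Rightarrow> complex) \<Rightarrow> 'a sym" where
  "nat_iso C \<gamma> = \<lparr>anti = False, perm = id, Umat = (\<lambda>a b c. (\<gamma> a * \<gamma> b / \<gamma> c) \<cdot>\<^sub>m 1\<^sub>m (fus C a b c))\<rparr>"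

lemma natural_isos_eq: "natural_isos C = {nat_iso C \<gamma> | \<gamma>. \<forall>a. cmod (\<gamma> a) = 1}"
  by (simp add: natural_isos_def nat_iso_def)

lemma psym_one: "psym C False id (\<lambda>a b c. 1\<^sub>m (fus C a b c)) (\<lambda>a b c. 1\<^sub>m (fus C a b c))"
  unfolding psym_def using Fblk_range
  by (auto simp: Kconj_def left_mult_one_mat[OF Rblk_carrier] right_mult_one_mat[OF Rblk_carrier])

lemma cnj_unit: "cmod x = 1 \<Longrightarrow> cnj x = 1 / x"
  by (metis complex_div_cnj complex_norm_square mult_1 nonzero_mult_div_cancel_left norm_eq_zero of_real_1 one_power2 power2_eq_square zero_neq_one divide_self_if times_divide_eq_right)

lemma is_symmetry_nat_iso:
  assumes "\<And>a. cmod (\<gamma> a) = 1"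
  shows "is_symmetry C (nat_iso C \<gamma>)"
proof -
  have 0: "\<gamma> a \<noteq> 0" for a using assms[of a] by auto
  have "mat_adjoint ((\<gamma> a * \<gamma> b / \<gamma> c) \<cdot>\<^sub>m 1\<^sub>m (fus C a b c)) = (\<gamma> c / (\<gamma> a * \<gamma> b)) \<cdot>\<^sub>m 1\<^sub>m (fus C a b c)" for a b c
    using 0 by (simp add: adj_smult adj_one cnj_unit[OF assms])
  then show ?thesis
    using psym_scale[OF psym_one 0] unfolding is_symmetry_psym nat_iso_def by simp
qed

text \<open>For phases \<open>\<gamma>\<close> this is the product with a natural isomorphism, so
  the cosets of \<open>natural_isos\<close> are orbits under \<open>scal\<close>.\<close>

definition scal :: "('a \<Rightarrow> complex) \<Rightarrow> 'a sym \<Rightarrow> 'a sym" where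
  "scal \<gamma> s = \<lparr>anti = anti s, perm = perm s, Umat = (\<lambda>a b c. (\<gamma> a * \<gamma> b / \<gamma> c) \<cdot>\<^sub>m Umat s a b c)\<rparr>"

lemma scal_simps [simp]: "anti (scal \<gamma> s) = anti s" "perm (scal \<gamma> s) = perm s"
  "Umat (scal \<gamma> s) a b c = (\<gamma> a * \<gamma> b / \<gamma> c) \<cdot>\<^sub>m Umat s a b c"
  by (simp_all add: scal_def)

lemma sym_eqI:
  assumes "anti s = anti t" "perm s = perm t" "\<And>a b c. Umat s a b c = Umat t a b c"
  shows "(s :: 'a sym) = t"
  using assms by (intro sym.equality) (auto simp: fun_eq_iff)

lemma nat_iso_comp:
  assumes "is_symmetry C s" shows "sym_comp (nat_iso C \<gamma>) s = scal \<gamma> s"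
proof (rule sym_eqI)
  fix a b c
  note U = symD(1)[OF assms, of a b c]
  have "map_mat (Kconj False) (Umat s a b c) = Umat s a b c" by (intro eq_matI) (auto simp: Kconj_def)
  then show "Umat (sym_comp (nat_iso C \<gamma>) s) a b c = Umat (scal \<gamma> s) a b c"
    using mult_smult_distrib[OF U one_carrier_mat] U by (simp add: sym_comp_def nat_iso_def right_mult_one_mat[OF U])
qed (auto simp: sym_comp_def nat_iso_def)

text \<open>Passing to the left of \<open>s\<close>, the phases are moved along
  \<open>perm s\<close> and, for anti-unitary \<open>s\<close>, conjugated.\<close>

lemma comp_nat_iso:
  assumes "is_symmetry C s"
  shows "sym_comp s (nat_iso C \<gamma>) = scal (\<lambda>x. Kconj (anti s) (\<gamma> (inv_into UNIV (perm s) x))) s"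
proof (rule sym_eqI)
  interpret K: field_auto "Kconj (anti s)" by (rule Kconj_field_auto)
  let ?h = "inv_into UNIV (perm s)"
  fix a b c
  note U = symD(1)[OF assms, of a b c]
  have N: "fus C (?h a) (?h b) (?h c) = fus C a b c"
    using symD(5)[OF assms, of "?h a" "?h b" "?h c"] symD(4)[OF assms] by (simp add: bij_is_surj surj_f_inv_f)
  show "Umat (sym_comp s (nat_iso C \<gamma>)) a b c = Umat (scal (\<lambda>x. Kconj (anti s) (\<gamma> (?h x))) s) a b c"
    using mult_smult_assoc_mat[OF one_carrier_mat U]
    by (simp add: Let_def sym_comp_def nat_iso_def N K.map_mat_smult K.map_mat_one K.mult K.divide left_mult_one_mat[OF U])
qed (auto simp: sym_comp_def nat_iso_def)

lemma sym_maps_simps [simp]: "carrier (sym_maps C) = {s. is_symmetry C s}" "monoid.mult (sym_maps C) = sym_comp"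
  "monoid.one (sym_maps C) = nat_iso C (\<lambda>_. 1)"
  by (simp_all add: sym_maps_def nat_iso_def smult_1_mat)

lemma group_sym_maps: "Group.group (sym_maps C)"
proof (rule groupI)
  show "x \<otimes>\<^bsub>sym_maps C\<^esub> y \<in> carrier (sym_maps C)" if "x \<in> carrier (sym_maps C)" "y \<in> carrier (sym_maps C)" for x y
    using that sym_comp_closed by simp
  show "\<one>\<^bsub>sym_maps C\<^esub> \<in> carrier (sym_maps C)" using is_symmetry_nat_iso[of "\<lambda>_. 1"] by simp
  show "\<one>\<^bsub>sym_maps C\<^esub> \<otimes>\<^bsub>sym_maps C\<^esub> x = x" if "x \<in> carrier (sym_maps C)" for x
    using that nat_iso_comp[of C x "\<lambda>_. 1"] by (auto simp: smult_1_mat intro!: sym_eqI)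
  show "x \<otimes>\<^bsub>sym_maps C\<^esub> y \<otimes>\<^bsub>sym_maps C\<^esub> z = x \<otimes>\<^bsub>sym_maps C\<^esub> (y \<otimes>\<^bsub>sym_maps C\<^esub> z)"
    if xyz: "x \<in> carrier (sym_maps C)" "y \<in> carrier (sym_maps C)" "z \<in> carrier (sym_maps C)" for x y z
  proof -
    have s: "is_symmetry C x" "is_symmetry C y" "is_symmetry C z" using xyz by simp_all
    interpret K: field_auto "Kconj (anti x)" by (rule Kconj_field_auto)
    define p where "p = inv_into UNIV (perm x)"
    define q where "q = inv_into UNIV (perm y)"
    have pq: "inv_into UNIV (perm x \<circ> perm y) = q \<circ> p"
      unfolding p_def q_def using symD(4)[OF s(1)] symD(4)[OF s(2)] by (rule o_inv_distrib)
    have Np: "fus C (p a) (p b) (p c) = fus C a b c" for a b c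
      using symD(5)[OF s(1), of "p a" "p b" "p c"] symD(4)[OF s(1)] by (simp add: p_def bij_is_surj surj_f_inv_f)
    have Nq: "fus C (q a) (q b) (q c) = fus C a b c" for a b c
      using symD(5)[OF s(2), of "q a" "q b" "q c"] symD(4)[OF s(2)] by (simp add: q_def bij_is_surj surj_f_inv_f)
    show ?thesis
    proof (simp, rule sym_eqI)
      fix a b c
      let ?X = "Umat x a b c" and ?Y = "Umat y (p a) (p b) (p c)" and ?Z = "Umat z (q (p a)) (q (p b)) (q (p c))"
      have X: "?X \<in> carrier_mat (fus C a b c) (fus C a b c)" by (rule symD(1)[OF s(1)])
      have Y: "?Y \<in> carrier_mat (fus C a b c) (fus C a b c)" using symD(1)[OF s(2), of "p a" "p b" "p c"] by (simp add: Np)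
      have Z: "map_mat (Kconj t) ?Z \<in> carrier_mat (fus C a b c) (fus C a b c)" for t
        using symD(1)[OF s(3), of "q (p a)" "q (p b)" "q (p c)"] by (simp add: Np Nq)
      have KY: "map_mat (Kconj (anti x)) ?Y \<in> carrier_mat (fus C a b c) (fus C a b c)" using Y by simp
      have KZ: "map_mat (Kconj (anti x)) (map_mat (Kconj (anti y)) ?Z) = map_mat (Kconj (anti x \<noteq> anti y)) ?Z"
        by (intro eq_matI) (auto simp: Kconj_Kconj)
      have "Umat (sym_comp (sym_comp x y) z) a b c = map_mat (Kconj (anti x \<noteq> anti y)) ?Z * (map_mat (Kconj (anti x)) ?Y * ?X)"
        by (simp add: sym_comp_def pq p_def[symmetric] q_def[symmetric])
      also have "\<dots> = map_mat (Kconj (anti x \<noteq> anti y)) ?Z * map_mat (Kconj (anti x)) ?Y * ?X"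
        by (rule assoc_mult_mat[OF Z KY X, symmetric])
      also have "\<dots> = map_mat (Kconj (anti x)) (map_mat (Kconj (anti y)) ?Z * ?Y) * ?X"
        unfolding K.map_mat_mult[OF Z Y] KZ ..
      also have "\<dots> = Umat (sym_comp x (sym_comp y z)) a b c"
        by (simp add: sym_comp_def p_def[symmetric] q_def[symmetric])
      finally show "Umat (sym_comp (sym_comp x y) z) a b c = Umat (sym_comp x (sym_comp y z)) a b c" .
    qed (auto simp: sym_comp_def)
  qed
  show "\<exists>y\<in>carrier (sym_maps C). y \<otimes>\<^bsub>sym_maps C\<^esub> x = \<one>\<^bsub>sym_maps C\<^esub>" if x: "x \<in> carrier (sym_maps C)" for x
  proof -
    have s: "is_symmetry C x" using x by simp
    interpret K: field_auto "Kconj (anti x)" by (rule Kconj_field_auto)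
    define g where "g = perm x"
    define h where "h = inv_into UNIV g"
    have g: "bij g" using symD(4)[OF s] by (simp add: g_def)
    \<comment> \<open>The matrices of the inverse are adjoints, taken at the images under
      \<open>perm x\<close> and conjugated if \<open>x\<close> is anti-unitary; this is dictated by
      the order of factors in \<open>sym_comp\<close>.\<close>
    define y where "y = \<lparr>anti = anti x, perm = h, Umat = (\<lambda>a b c. map_mat (Kconj (anti x)) (mat_adjoint (Umat x (g a) (g b) (g c))))\<rparr>"
    have "is_symmetry C y"
      using psym_inverse[OF s[unfolded is_symmetry_psym]]
      unfolding is_symmetry_psym y_def h_def g_def by (simp add: adj_Kconj adj_adj)
    moreover have "sym_comp y x = nat_iso C (\<lambda>_. 1)"
    proof (rule sym_eqI)
      have hg: "inv_into UNIV h = g" unfolding h_def using g by (rule inv_inv_eq)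
      show "perm (sym_comp y x) = perm (nat_iso C (\<lambda>_. 1))"
        using g by (auto simp: sym_comp_def nat_iso_def y_def h_def g_def[symmetric] bij_is_inj fun_eq_iff)
      fix a b c
      let ?U = "Umat x (g a) (g b) (g c)"
      have U: "?U \<in> carrier_mat (fus C a b c) (fus C a b c)" "?U * mat_adjoint ?U = 1\<^sub>m (fus C a b c)"
        using symD(1,2)[OF s, of "g a" "g b" "g c"] symD(5)[OF s, of a b c] by (simp_all add: g_def)
      have "Umat (sym_comp y x) a b c = map_mat (Kconj (anti x)) ?U * map_mat (Kconj (anti x)) (mat_adjoint ?U)"
        by (simp add: sym_comp_def y_def hg)
      also have "\<dots> = 1\<^sub>m (fus C a b c)"
        unfolding K.map_mat_mult[OF U(1) adj_carrier[OF U(1)], symmetric] U(2) by (rule K.map_mat_one)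
      finally show "Umat (sym_comp y x) a b c = Umat (nat_iso C (\<lambda>_. 1)) a b c"
        by (simp add: nat_iso_def smult_1_mat)
    qed (simp add: sym_comp_def y_def nat_iso_def)
    ultimately show ?thesis by auto
  qed
qed

lemma scal_nat_iso: "scal \<gamma> (nat_iso C \<delta>) = nat_iso C (\<lambda>a. \<gamma> a * \<delta> a)"
  by (rule sym_eqI) (auto simp: nat_iso_def smult_smult_mat mult_ac)

lemma natural_isos_coset:
  assumes "is_symmetry C s"
  shows "natural_isos C #>\<^bsub>sym_maps C\<^esub> s = {scal \<gamma> s | \<gamma>. \<forall>a. cmod (\<gamma> a) = 1}"
proof (intro Set.set_eqI iffI)
  fix x assume "x \<in> natural_isos C #>\<^bsub>sym_maps C\<^esub> s"
  then obtain \<gamma> where "\<forall>a. cmod (\<gamma> a) = 1" "x = sym_comp (nat_iso C \<gamma>) s"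
    by (auto simp: r_coset_def natural_isos_eq)
  then show "x \<in> {scal \<gamma> s | \<gamma>. \<forall>a. cmod (\<gamma> a) = 1}" by (auto simp: nat_iso_comp[OF assms])
next
  fix x assume "x \<in> {scal \<gamma> s | \<gamma>. \<forall>a. cmod (\<gamma> a) = 1}"
  then obtain \<gamma> where g: "\<forall>a. cmod (\<gamma> a) = 1" "x = sym_comp (nat_iso C \<gamma>) s"
    by (auto simp: nat_iso_comp[OF assms])
  have "nat_iso C \<gamma> \<in> natural_isos C" using g(1) by (auto simp: natural_isos_eq)
  then show "x \<in> natural_isos C #>\<^bsub>sym_maps C\<^esub> s" using g(2) by (auto simp: r_coset_def)
qed

text \<open>Moving \<open>s\<close> past a natural isomorphism replaces \<open>\<gamma>\<close> by
  \<open>\<lambda>x. Kconj (anti s) (\<gamma> (h x))\<close>, a bijection on families of phases, so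
  left and right cosets agree.\<close>

lemma normal_natural_isos: "natural_isos C \<lhd> sym_maps C"
proof -
  interpret Group.group "sym_maps C" by (rule group_sym_maps)
  have sub: "subgroup (natural_isos C) (sym_maps C)"
  proof (rule subgroupI)
    show "natural_isos C \<subseteq> carrier (sym_maps C)" using is_symmetry_nat_iso by (auto simp: natural_isos_eq)
    show "natural_isos C \<noteq> {}" unfolding natural_isos_eq by (auto intro!: exI[of _ "\<lambda>_. 1"])
    show "a \<otimes>\<^bsub>sym_maps C\<^esub> b \<in> natural_isos C" if ab: "a \<in> natural_isos C" "b \<in> natural_isos C" for a b
    proof -
      obtain \<gamma> \<delta> where g: "a = nat_iso C \<gamma>" "b = nat_iso C \<delta>" "\<forall>x. cmod (\<gamma> x) = 1" "\<forall>x. cmod (\<delta> x) = 1"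
        using ab by (auto simp: natural_isos_eq)
      then have "a \<otimes>\<^bsub>sym_maps C\<^esub> b = nat_iso C (\<lambda>x. \<gamma> x * \<delta> x)"
        using nat_iso_comp[OF is_symmetry_nat_iso[of \<delta> C], of \<gamma>] by (simp add: scal_nat_iso)
      then show ?thesis using g by (auto simp: natural_isos_eq norm_mult)
    qed
    show "inv\<^bsub>sym_maps C\<^esub> a \<in> natural_isos C" if a: "a \<in> natural_isos C" for a
    proof -
      obtain \<gamma> where g: "a = nat_iso C \<gamma>" "\<forall>x. cmod (\<gamma> x) = 1"
        using a by (auto simp: natural_isos_eq)
      define b where "b = nat_iso C (\<lambda>x. 1 / \<gamma> x)"
      have b: "is_symmetry C b" unfolding b_def using g by (intro is_symmetry_nat_iso) (simp add: norm_divide)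
      have "\<gamma> x \<noteq> 0" for x using g(2) by (metis norm_zero zero_neq_one)
      then have "b \<otimes>\<^bsub>sym_maps C\<^esub> a = \<one>\<^bsub>sym_maps C\<^esub>"
        using nat_iso_comp[OF is_symmetry_nat_iso[of \<gamma> C], of "\<lambda>x. 1 / \<gamma> x"] g by (simp add: b_def scal_nat_iso)
      then have "inv\<^bsub>sym_maps C\<^esub> a = b"
        using b is_symmetry_nat_iso[of \<gamma> C] g by (intro inv_equality) auto
      then show ?thesis using g by (auto simp: natural_isos_eq b_def norm_divide)
    qed
  qed
  show ?thesis
  proof (rule normalI[OF sub], rule ballI)
    fix s assume "s \<in> carrier (sym_maps C)"
    then have s: "is_symmetry C s" by simp
    define h where "h = inv_into UNIV (perm s)"
    have h: "h (perm s x) = x" "perm s (h x) = x" for x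
      using symD(4)[OF s] by (simp_all add: h_def bij_is_inj bij_is_surj surj_f_inv_f)
    have "s <#\<^bsub>sym_maps C\<^esub> natural_isos C = {scal (\<lambda>x. Kconj (anti s) (\<gamma> (h x))) s | \<gamma>. \<forall>a. cmod (\<gamma> a) = 1}"
      unfolding l_coset_def natural_isos_eq h_def comp_nat_iso[OF s, symmetric] by auto
    also have "\<dots> = {scal \<gamma> s | \<gamma>. \<forall>a. cmod (\<gamma> a) = 1}"
    proof (intro Set.set_eqI iffI)
      fix z assume "z \<in> {scal (\<lambda>x. Kconj (anti s) (\<gamma> (h x))) s | \<gamma>. \<forall>a. cmod (\<gamma> a) = 1}"
      then obtain \<gamma> where "z = scal (\<lambda>x. Kconj (anti s) (\<gamma> (h x))) s" "\<forall>a. cmod (\<gamma> a) = 1" by blast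
      then show "z \<in> {scal \<gamma> s | \<gamma>. \<forall>a. cmod (\<gamma> a) = 1}"
        by (intro CollectI exI[of _ "\<lambda>x. Kconj (anti s) (\<gamma> (h x))"]) (auto simp: Kconj_def)
    next
      fix z assume "z \<in> {scal \<gamma> s | \<gamma>. \<forall>a. cmod (\<gamma> a) = 1}"
      then obtain \<gamma> where "z = scal \<gamma> s" "\<forall>a. cmod (\<gamma> a) = 1" by blast
      then show "z \<in> {scal (\<lambda>x. Kconj (anti s) (\<gamma> (h x))) s | \<gamma>. \<forall>a. cmod (\<gamma> a) = 1}"
        by (intro CollectI exI[of _ "\<lambda>x. Kconj (anti s) (\<gamma> (perm s x))"]) (simp add: Kconj_Kconj h Kconj_def[of False] norm_Kconj)
    qed
    finally show "natural_isos C #>\<^bsub>sym_maps C\<^esub> s = s <#\<^bsub>sym_maps C\<^esub> natural_isos C"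
      by (simp add: natural_isos_coset[OF s])
  qed
qed

text \<open>If also the inverse adjoints of \<open>A\<close> satisfy the equations, then \<open>A* A\<close> is an automorphism, to which rigidity applies.\<close>

lemma psym_polar:
  assumes sys: "has_system D" and p: "psym D t g A A'" and p': "psym D t g (\<lambda>a b c. mat_adjoint (A' a b c)) (\<lambda>a b c. mat_adjoint (A a b c))"
  shows "\<exists>\<gamma> W. is_symmetry D \<lparr>anti = t, perm = g, Umat = W\<rparr> \<and> (\<forall>a. \<gamma> a \<noteq> 0) \<and> (\<forall>a b c. A a b c = (\<gamma> a * \<gamma> b / \<gamma> c) \<cdot>\<^sub>m W a b c)"
proof -
  obtain dl F G J ep k where fs: "fusion_system (unit_obj D) dl (fus D) F G J ep" and k: "\<And>a b c d e f. k a b c d e f \<noteq> 0"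
    and F: "\<And>a b c d e \<alpha> \<beta> f \<mu> \<nu>. \<alpha> < fus D a b e \<Longrightarrow> \<beta> < fus D e c d \<Longrightarrow> \<mu> < fus D b c f \<Longrightarrow> \<nu> < fus D a f d \<Longrightarrow>
        F a b c d (e,\<alpha>,\<beta>) (f,\<mu>,\<nu>) = k a b c d e f * Fsym D a b c d (e,\<alpha>,\<beta>) (f,\<mu>,\<nu>)"
    using sys unfolding has_system_def by metis
  interpret S: fusion_system "unit_obj D" dl "fus D" F G J ep by fact
  have Fb: "S.Fb a b c d e f = (\<lambda>\<alpha> \<beta> \<mu> \<nu>. k a b c d e f * Fblk D a b c d e f \<alpha> \<beta> \<mu> \<nu>)" for a b c d e f
    by (intro ext) (auto simp: S.Fb_def Fblk_def F S.F_eq_0)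
  note P = psymD[OF p] and P' = psymD[OF p']
  have adjA: "mat_adjoint (A a b c) \<in> carrier_mat (fus D a b c) (fus D a b c)" "mat_adjoint (A' a b c) \<in> carrier_mat (fus D a b c) (fus D a b c)" for a b c
    using P(3,4) by (auto intro: adj_carrier)
  \<comment> \<open>\<open>A\<close> and its inverse adjoint transform \<open>F\<close> in the same
    way; undoing the second transformation after the first gives the automorphism. The labels are
    written as images under \<open>g\<close>, since the equations speak only of those.\<close>
  have inv: "act (mat_adjoint (A a b e) * A a b e) (mat_adjoint (A e c d) * A e c d) (A' b c f * mat_adjoint (A' b c f)) (A' a f d * mat_adjoint (A' a f d)) (Fblk D a b c d e f)
     = Fblk D a b c d e f" for a b c d e f
  proof -
    have surj: "\<exists>y. x = g y" for x using P(1) by (auto simp: bij_def surj_def)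
    obtain a0 b0 c0 d0 e0 f0 where l: "a = g a0" "b = g b0" "c = g c0" "d = g d0" "e = g e0" "f = g f0"
      using surj by metis
    have "act (A a b e) (A e c d) (A' b c f) (A' a f d) (Fblk D a b c d e f) =
       act (mat_adjoint (A' a b e)) (mat_adjoint (A' e c d)) (mat_adjoint (A b c f)) (mat_adjoint (A a f d)) (Fblk D a b c d e f)"
      unfolding l P(8) P'(8) ..
    then have "act (mat_adjoint (A a b e)) (mat_adjoint (A e c d)) (mat_adjoint (A' b c f)) (mat_adjoint (A' a f d)) (act (A a b e) (A e c d) (A' b c f) (A' a f d) (Fblk D a b c d e f)) =
       act (mat_adjoint (A a b e)) (mat_adjoint (A e c d)) (mat_adjoint (A' b c f)) (mat_adjoint (A' a f d)) (act (mat_adjoint (A' a b e)) (mat_adjoint (A' e c d)) (mat_adjoint (A b c f)) (mat_adjoint (A a f d)) (Fblk D a b c d e f))"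
      by simp
    then show ?thesis
      unfolding act_comp[OF adjA(1) adjA(1) adjA(2) adjA(2) P(3) P(3) P(4) P(4)] act_comp[OF adjA(1) adjA(1) adjA(2) adjA(2) adjA(2) adjA(2) adjA(1) adjA(1)] P'(6) Fblk_range .
  qed
  have "\<exists>y. \<forall>a b c. mat_adjoint (A a b c) * A a b c = complex_of_real (exp (y a + y b - y c)) \<cdot>\<^sub>m 1\<^sub>m (fus D a b c)"
  proof (rule S.posdef_rigid[where V = A and W = A' and Pi = "\<lambda>a b c. A' a b c * mat_adjoint (A' a b c)"])
    fix a b c d e f
    show "A a b c \<in> carrier_mat (fus D a b c) (fus D a b c)" "A' a b c \<in> carrier_mat (fus D a b c) (fus D a b c)" "A' a b c * A a b c = 1\<^sub>m (fus D a b c)"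
      by (fact P(3) P(4) P(6))+
    show "mat_adjoint (A a b c) * A a b c = mat_adjoint (A a b c) * A a b c" ..
    show "A' a b c * mat_adjoint (A' a b c) \<in> carrier_mat (fus D a b c) (fus D a b c)" using P(4)[of a b c] adjA(2)[of a b c] by simp
    show "A' a b c * mat_adjoint (A' a b c) * (mat_adjoint (A a b c) * A a b c) = 1\<^sub>m (fus D a b c)"
      by (rule mat_cancel4[OF P(4) adjA(2) adjA(1) P(3) P'(5) P(6)])
    show "act (mat_adjoint (A a b e) * A a b e) (mat_adjoint (A e c d) * A e c d) (A' b c f * mat_adjoint (A' b c f)) (A' a f d * mat_adjoint (A' a f d)) (S.Fb a b c d e f) =
      act (1\<^sub>m (fus D a b e)) (1\<^sub>m (fus D e c d)) (1\<^sub>m (fus D b c f)) (1\<^sub>m (fus D a f d)) (S.Fb a b c d e f)"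
      unfolding Fb act_smult_fun inv Fblk_range ..
  qed
  then obtain y where y: "\<And>a b c. mat_adjoint (A a b c) * A a b c = complex_of_real (exp (y a + y b - y c)) \<cdot>\<^sub>m 1\<^sub>m (fus D a b c)" by blast
  \<comment> \<open>The square root of the positive natural isomorphism with factors
    \<open>exp (y a)\<close>.\<close>
  define \<gamma> where "\<gamma> a = complex_of_real (exp (y a / 2))" for a
  have \<gamma>0: "\<gamma> a \<noteq> 0" for a by (simp add: \<gamma>_def)
  have \<gamma>2: "\<gamma> a * \<gamma> a = complex_of_real (exp (y a))" for a
    by (simp add: \<gamma>_def of_real_mult[symmetric] exp_add[symmetric] del: of_real_mult)
  define W where "W a b c = ((1 / \<gamma> a) * (1 / \<gamma> b) / (1 / \<gamma> c)) \<cdot>\<^sub>m A a b c" for a b c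
  have sc: "psym D t g W (\<lambda>a b c. ((1 / \<gamma> c) / ((1 / \<gamma> a) * (1 / \<gamma> b))) \<cdot>\<^sub>m A' a b c)"
    unfolding W_def by (rule psym_scale[OF p]) (simp add: \<gamma>0)
  have WA: "A a b c = (\<gamma> a * \<gamma> b / \<gamma> c) \<cdot>\<^sub>m W a b c" for a b c
    using \<gamma>0 by (simp add: W_def smult_smult_mat smult_1_mat)
  have "((1 / \<gamma> c) / ((1 / \<gamma> a) * (1 / \<gamma> b))) \<cdot>\<^sub>m A' a b c = mat_adjoint (W a b c)" for a b c
  proof -
    have c: "W a b c \<in> carrier_mat (fus D a b c) (fus D a b c)" by (rule psymD(3)[OF sc])
    have "mat_adjoint (W a b c) * W a b c = 1\<^sub>m (fus D a b c)"
    proof -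
      define x where "x = (1 / \<gamma> a) * (1 / \<gamma> b) / (1 / \<gamma> c)"
      have cx: "cnj x = x" by (simp add: x_def \<gamma>_def)
      have "mat_adjoint (W a b c) * W a b c = (x * x) \<cdot>\<^sub>m (mat_adjoint (A a b c) * A a b c)"
        unfolding W_def x_def[symmetric] adj_smult cx mult_smult_assoc_mat[OF adjA(1) smult_carrier_mat[OF P(3)]] mult_smult_distrib[OF adjA(1) P(3)] smult_smult_mat ..
      also have "\<dots> = (x * x * complex_of_real (exp (y a + y b - y c))) \<cdot>\<^sub>m 1\<^sub>m (fus D a b c)"
        unfolding y smult_smult_mat ..
      also have "x * x * complex_of_real (exp (y a + y b - y c)) = 1"
      proof -
        have "x * x = (\<gamma> c * \<gamma> c) / ((\<gamma> a * \<gamma> a) * (\<gamma> b * \<gamma> b))" by (simp add: x_def field_simps)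
        then have "x * x = complex_of_real (exp (y c) / (exp (y a) * exp (y b)))" by (simp add: \<gamma>2)
        then show ?thesis by (simp add: exp_add exp_diff)
      qed
      finally show ?thesis by (simp add: smult_1_mat)
    qed
    note inv1 = this
    let ?V = "((1 / \<gamma> c) / ((1 / \<gamma> a) * (1 / \<gamma> b))) \<cdot>\<^sub>m A' a b c"
    have V: "?V \<in> carrier_mat (fus D a b c) (fus D a b c)" "W a b c * ?V = 1\<^sub>m (fus D a b c)" by (rule psymD(4)[OF sc], rule psymD(5)[OF sc])
    have "?V = 1\<^sub>m (fus D a b c) * ?V" by (rule left_mult_one_mat[OF V(1), symmetric])
    also have "\<dots> = mat_adjoint (W a b c) * (W a b c * ?V)"
      unfolding inv1[symmetric] by (rule assoc_mult_mat[OF adj_carrier[OF c] c V(1)])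
    also have "\<dots> = mat_adjoint (W a b c)" unfolding V(2) by (rule right_mult_one_mat[OF adj_carrier[OF c]])
    finally show ?thesis .
  qed
  then have "is_symmetry D \<lparr>anti = t, perm = g, Umat = W\<rparr>"
    using sc by (simp add: is_symmetry_psym)
  then show ?thesis using \<gamma>0 WA by blast
qed

section \<open>The isomorphism of symmetry groups\<close>

text \<open>On a nonzero fusion space, unitarity of both maps forces
  \<open>\<rho> a * \<rho> b / \<rho> c\<close> to have modulus 1, so dividing every
  \<open>\<rho> a\<close> by its modulus does not change this factor. On zero spaces there is
  nothing to compare.\<close>

lemma phase_normalise:
  assumes w: "is_symmetry D w" and w': "is_symmetry D w'" and ap: "anti w' = anti w" "perm w' = perm w"
    and \<rho>: "\<And>a. \<rho> a \<noteq> 0" and U: "\<And>a b c. Umat w' a b c = (\<rho> a * \<rho> b / \<rho> c) \<cdot>\<^sub>m Umat w a b c"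
  shows "\<exists>\<delta>. (\<forall>a. cmod (\<delta> a) = 1) \<and> w' = scal \<delta> w"
proof (intro exI conjI allI)
  let ?\<delta> = "\<lambda>a. \<rho> a / complex_of_real (cmod (\<rho> a))"
  show "cmod (?\<delta> a) = 1" for a using \<rho> by (simp add: norm_divide)
  show "w' = scal ?\<delta> w"
  proof (rule sym_eqI)
    fix a b c
    define x where "x = \<rho> a * \<rho> b / \<rho> c"
    have \<delta>: "?\<delta> a * ?\<delta> b / ?\<delta> c = x / complex_of_real (cmod x)"
      by (simp add: x_def norm_divide norm_mult)
    note W = symD(1,2)[OF w, of a b c] and W' = symD(2)[OF w', of a b c]
    show "Umat w' a b c = Umat (scal ?\<delta> w) a b c"
    proof (cases "fus D a b c = 0")
      case True
      then show ?thesis using symD(1)[OF w, of a b c] symD(1)[OF w', of a b c] by (intro eq_matI) auto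
    next
      case False
      have "1\<^sub>m (fus D a b c) = (x * cnj x) \<cdot>\<^sub>m (Umat w a b c * mat_adjoint (Umat w a b c))"
        unfolding W'[symmetric] U x_def[symmetric] adj_smult
          mult_smult_assoc_mat[OF W(1) smult_carrier_mat[OF adj_carrier[OF W(1)]]]
          mult_smult_distrib[OF W(1) adj_carrier[OF W(1)]] smult_smult_mat ..
      then have "(1\<^sub>m (fus D a b c) :: complex mat) $$ (0,0) = ((x * cnj x) \<cdot>\<^sub>m 1\<^sub>m (fus D a b c)) $$ (0,0)"
        unfolding W(2) by simp
      then have "x * cnj x = 1" using False by simp
      then have "(cmod x)\<^sup>2 = 1" by (metis complex_norm_square of_real_eq_1_iff)
      then have "cmod x = 1" by (simp add: power2_eq_1_iff) (metis norm_ge_zero not_one_le_zero neg_0_le_iff_le)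
      then show ?thesis unfolding scal_simps \<delta> by (simp add: U x_def)
    qed
  qed (use ap in simp_all)
qed

text \<open>\<open>w\<close> represents the image of \<open>s\<close> under \<open>h\<close>. The
  scalars are only required to be nonzero, a condition that survives the field automorphisms applied
  to them later, unlike positivity or modulus 1.\<close>

definition conj_rel :: "(complex \<Rightarrow> complex) \<Rightarrow> 'a sym \<Rightarrow> 'a sym \<Rightarrow> bool" where
  "conj_rel h s w \<longleftrightarrow> anti w = anti s \<and> perm w = perm s \<and>
     (\<exists>\<gamma>. (\<forall>a. \<gamma> a \<noteq> 0) \<and> (\<forall>a b c. map_mat h (Umat s a b c) = (\<gamma> a * \<gamma> b / \<gamma> c) \<cdot>\<^sub>m Umat w a b c))"

lemma conj_relI:
  assumes "anti w = anti s" "perm w = perm s" "\<And>a. \<gamma> a \<noteq> 0"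
    "\<And>a b c. map_mat h (Umat s a b c) = (\<gamma> a * \<gamma> b / \<gamma> c) \<cdot>\<^sub>m Umat w a b c"
  shows "conj_rel h s w"
  using assms unfolding conj_rel_def by blast

text \<open>Eliminating the image of \<open>U\<close> leaves two unitary symmetries that differ by
  the factors \<open>\<gamma> a / \<gamma>' a\<close>; \<open>phase_normalise\<close> turns these
  into phases.\<close>

lemma conj_rel_unique:
  assumes w: "is_symmetry D w" "conj_rel h s w" and w': "is_symmetry D w'" "conj_rel h s w'"
  shows "\<exists>\<delta>. (\<forall>a. cmod (\<delta> a) = 1) \<and> w' = scal \<delta> w"
proof -
  obtain \<gamma> where g: "anti w = anti s" "perm w = perm s" "\<And>a. \<gamma> a \<noteq> 0"
    "\<And>a b c. map_mat h (Umat s a b c) = (\<gamma> a * \<gamma> b / \<gamma> c) \<cdot>\<^sub>m Umat w a b c"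
    using w(2) unfolding conj_rel_def by blast
  obtain \<gamma>' where g': "anti w' = anti s" "perm w' = perm s" "\<And>a. \<gamma>' a \<noteq> 0"
    "\<And>a b c. map_mat h (Umat s a b c) = (\<gamma>' a * \<gamma>' b / \<gamma>' c) \<cdot>\<^sub>m Umat w' a b c"
    using w'(2) unfolding conj_rel_def by blast
  show ?thesis
  proof (rule phase_normalise[OF w(1) w'(1), where \<rho> = "\<lambda>a. \<gamma> a / \<gamma>' a"])
    show "\<gamma> a / \<gamma>' a \<noteq> 0" for a using g(3) g'(3) by simp
    fix a b c
    let ?x = "\<gamma> a * \<gamma> b / \<gamma> c" and ?x' = "\<gamma>' a * \<gamma>' b / \<gamma>' c"
    have "Umat w' a b c = (1 / ?x') \<cdot>\<^sub>m (?x' \<cdot>\<^sub>m Umat w' a b c)"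
      using g'(3) by (simp add: smult_smult_mat smult_1_mat)
    also have "\<dots> = (1 / ?x') \<cdot>\<^sub>m (?x \<cdot>\<^sub>m Umat w a b c)" using g(4)[of a b c] g'(4)[of a b c] by simp
    also have "\<dots> = (1 / ?x' * ?x) \<cdot>\<^sub>m Umat w a b c" by (rule smult_smult_mat)
    also have "1 / ?x' * ?x = \<gamma> a / \<gamma>' a * (\<gamma> b / \<gamma>' b) / (\<gamma> c / \<gamma>' c)" by simp
    finally show "Umat w' a b c = (\<gamma> a / \<gamma>' a * (\<gamma> b / \<gamma>' b) / (\<gamma> c / \<gamma>' c)) \<cdot>\<^sub>m Umat w a b c" .
  qed (simp_all add: g g')
qed

context field_auto
begin

text \<open>Even if \<open>h\<close> does not commute with complex conjugation, it commutes with inversion of matrices.\<close>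

lemma image_cnj_unitary:
  assumes U: "U \<in> carrier_mat n n" "mat_adjoint U * U = 1\<^sub>m n"
    and V: "V \<in> carrier_mat n n" "V * mat_adjoint V = 1\<^sub>m n"
    and \<kappa>: "\<kappa> \<noteq> 0" and UV: "map_mat h U = \<kappa> \<cdot>\<^sub>m V"
  shows "map_mat h (map_mat cnj U) = (1 / \<kappa>) \<cdot>\<^sub>m map_mat cnj V"
proof -
  define M where "M = map_mat h (mat_adjoint U)"
  have M: "M \<in> carrier_mat n n" using adj_carrier[OF U(1)] by (simp add: M_def)
  have "\<kappa> \<cdot>\<^sub>m (M * V) = 1\<^sub>m n"
    unfolding mult_smult_distrib[OF M V(1), symmetric] UV[symmetric]
    unfolding M_def map_mat_mult[OF adj_carrier[OF U(1)] U(1), symmetric] U(2) by (rule map_mat_one)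
  then have "(1 / \<kappa>) \<cdot>\<^sub>m (\<kappa> \<cdot>\<^sub>m (M * V)) = (1 / \<kappa>) \<cdot>\<^sub>m 1\<^sub>m n" by (rule arg_cong)
  then have MV: "M * V = (1 / \<kappa>) \<cdot>\<^sub>m 1\<^sub>m n" using \<kappa> by (simp add: smult_smult_mat smult_1_mat)
  have "M = M * (V * mat_adjoint V)" unfolding V(2) by (rule right_mult_one_mat[OF M, symmetric])
  also have "\<dots> = M * V * mat_adjoint V" by (rule assoc_mult_mat[OF M V(1) adj_carrier[OF V(1)], symmetric])
  also have "\<dots> = (1 / \<kappa>) \<cdot>\<^sub>m (1\<^sub>m n * mat_adjoint V)"
    unfolding MV by (rule mult_smult_assoc_mat[OF one_carrier_mat adj_carrier[OF V(1)]])
  also have "1\<^sub>m n * mat_adjoint V = mat_adjoint V" by (rule left_mult_one_mat[OF adj_carrier[OF V(1)]])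
  finally have M': "M = (1 / \<kappa>) \<cdot>\<^sub>m mat_adjoint V" .
  show ?thesis
  proof (rule eq_matI)
    fix i j assume "i < dim_row ((1 / \<kappa>) \<cdot>\<^sub>m map_mat cnj V)" "j < dim_col ((1 / \<kappa>) \<cdot>\<^sub>m map_mat cnj V)"
    then have ij: "i < n" "j < n" using V(1) by simp_all
    have "M $$ (j,i) = ((1 / \<kappa>) \<cdot>\<^sub>m mat_adjoint V) $$ (j,i)" by (simp only: M')
    then show "map_mat h (map_mat cnj U) $$ (i,j) = ((1 / \<kappa>) \<cdot>\<^sub>m map_mat cnj V) $$ (i,j)"
      using ij U(1) V(1) by (simp add: M_def)
  qed (use U V in simp_all)
qed

text \<open>For anti-unitary \<open>s\<close> the product conjugates the matrices of
  \<open>t\<close>, and \<open>h\<close> need not commute with that. By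
  \<open>image_cnj_unitary\<close> the scalar is then inverted instead of conjugated, which is the
  case distinction in \<open>\<epsilon>\<close>.\<close>

lemma conj_rel_comp:
  assumes N: "fus D = fus C" and s: "is_symmetry C s" "is_symmetry D w" "conj_rel h s w"
    and t: "is_symmetry C t" "is_symmetry D v" "conj_rel h t v"
  shows "conj_rel h (sym_comp s t) (sym_comp w v)"
proof -
  obtain \<gamma> where g: "anti w = anti s" "perm w = perm s" "\<And>a. \<gamma> a \<noteq> 0"
    "\<And>a b c. map_mat h (Umat s a b c) = (\<gamma> a * \<gamma> b / \<gamma> c) \<cdot>\<^sub>m Umat w a b c"
    using s(3) unfolding conj_rel_def by blast
  obtain \<delta> where d: "anti v = anti t" "perm v = perm t" "\<And>a. \<delta> a \<noteq> 0"
    "\<And>a b c. map_mat h (Umat t a b c) = (\<delta> a * \<delta> b / \<delta> c) \<cdot>\<^sub>m Umat v a b c"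
    using t(3) unfolding conj_rel_def by blast
  define p where "p = inv_into UNIV (perm s)"
  define \<epsilon> where "\<epsilon> x = (if anti s then 1 / \<delta> (p x) else \<delta> (p x))" for x
  have \<epsilon>: "\<epsilon> x \<noteq> 0" for x using d(3) by (simp add: \<epsilon>_def)
  have Np: "fus C (p a) (p b) (p c) = fus C a b c" for a b c
    using symD(5)[OF s(1), of "p a" "p b" "p c"] symD(4)[OF s(1)] by (simp add: p_def bij_is_surj surj_f_inv_f)
  show ?thesis
  proof (rule conj_relI[where \<gamma> = "\<lambda>x. \<epsilon> x * \<gamma> x"])
    fix a b c
    let ?n = "fus C a b c"
    let ?T = "Umat t (p a) (p b) (p c)" and ?V = "Umat v (p a) (p b) (p c)"
    have T: "?T \<in> carrier_mat ?n ?n" "mat_adjoint ?T * ?T = 1\<^sub>m ?n"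
      using symD(1,3)[OF t(1), of "p a" "p b" "p c"] by (simp_all add: Np)
    have V: "?V \<in> carrier_mat ?n ?n" "?V * mat_adjoint ?V = 1\<^sub>m ?n"
      using symD(1,2)[OF t(2), of "p a" "p b" "p c"] by (simp_all add: Np N)
    have S: "Umat s a b c \<in> carrier_mat ?n ?n" and W: "Umat w a b c \<in> carrier_mat ?n ?n"
      using symD(1)[OF s(1), of a b c] symD(1)[OF s(2), of a b c] by (simp_all add: N)
    have KT: "map_mat (Kconj (anti s)) ?T \<in> carrier_mat ?n ?n" and KV: "map_mat (Kconj (anti s)) ?V \<in> carrier_mat ?n ?n"
      using T(1) V(1) by simp_all
    have KcT: "map_mat (Kconj True) A = map_mat cnj A" and KcF: "map_mat (Kconj False) A = A" for A
      by (auto simp: Kconj_def)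
    have tv: "map_mat h (map_mat (Kconj (anti s)) ?T) = (\<epsilon> a * \<epsilon> b / \<epsilon> c) \<cdot>\<^sub>m map_mat (Kconj (anti s)) ?V"
    proof (cases "anti s")
      case True
      have "\<delta> (p a) * \<delta> (p b) / \<delta> (p c) \<noteq> 0" using d(3) by simp
      from image_cnj_unitary[OF T V this d(4)] show ?thesis using True by (simp add: KcT \<epsilon>_def)
    next
      case False
      then show ?thesis by (simp add: KcF \<epsilon>_def d(4))
    qed
    have "map_mat h (Umat (sym_comp s t) a b c) = map_mat h (map_mat (Kconj (anti s)) ?T) * map_mat h (Umat s a b c)"
      unfolding map_mat_mult[OF KT S, symmetric] by (simp add: sym_comp_def Let_def p_def)
    also have "\<dots> = ((\<epsilon> a * \<epsilon> b / \<epsilon> c) * (\<gamma> a * \<gamma> b / \<gamma> c)) \<cdot>\<^sub>m (map_mat (Kconj (anti s)) ?V * Umat w a b c)"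
      unfolding tv g(4) mult_smult_assoc_mat[OF KV smult_carrier_mat[OF W]] mult_smult_distrib[OF KV W] by (rule smult_smult_mat)
    also have "map_mat (Kconj (anti s)) ?V * Umat w a b c = Umat (sym_comp w v) a b c"
      by (simp add: sym_comp_def Let_def p_def g)
    also have "(\<epsilon> a * \<epsilon> b / \<epsilon> c) * (\<gamma> a * \<gamma> b / \<gamma> c) = \<epsilon> a * \<gamma> a * (\<epsilon> b * \<gamma> b) / (\<epsilon> c * \<gamma> c)" by simp
    finally show "map_mat h (Umat (sym_comp s t) a b c) = (\<epsilon> a * \<gamma> a * (\<epsilon> b * \<gamma> b) / (\<epsilon> c * \<gamma> c)) \<cdot>\<^sub>m Umat (sym_comp w v) a b c" .
  qed (use \<epsilon> g d in \<open>simp_all add: sym_comp_def\<close>)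
qed

lemma h_inv: "h (inv_into UNIV h x) = x" "inv_into UNIV h (h x) = x"
  using bij by (simp_all add: bij_is_surj surj_f_inv_f bij_is_inj)

lemma inverse_auto: "field_auto (inv_into UNIV h)"
proof
  fix x y
  show "bij (inv_into UNIV h)" by (rule bij_imp_bij_inv[OF bij])
  have "h (inv_into UNIV h (x + y)) = h (inv_into UNIV h x + inv_into UNIV h y)" by (simp only: h_inv add)
  then show "inv_into UNIV h (x + y) = inv_into UNIV h x + inv_into UNIV h y" by (simp only: inj)
  have "h (inv_into UNIV h (x * y)) = h (inv_into UNIV h x * inv_into UNIV h y)" by (simp only: h_inv mult)
  then show "inv_into UNIV h (x * y) = inv_into UNIV h x * inv_into UNIV h y" by (simp only: inj)
  have "h (inv_into UNIV h 1) = h 1" by (simp only: h_inv one)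
  then show "inv_into UNIV h 1 = 1" by (simp only: inj)
qed

lemma map_mat_inv: "map_mat h (map_mat (inv_into UNIV h) A) = A" "map_mat (inv_into UNIV h) (map_mat h A) = A"
  by (intro eq_matI; simp add: h_inv)+

lemma conj_rel_flip:
  assumes "conj_rel (inv_into UNIV h) w s"
  shows "conj_rel h s w"
proof -
  obtain \<gamma> where g: "anti s = anti w" "perm s = perm w" "\<And>a. \<gamma> a \<noteq> 0"
    "\<And>a b c. map_mat (inv_into UNIV h) (Umat w a b c) = (\<gamma> a * \<gamma> b / \<gamma> c) \<cdot>\<^sub>m Umat s a b c"
    using assms unfolding conj_rel_def by blast
  show ?thesis
  proof (rule conj_relI[where \<gamma> = "\<lambda>a. 1 / h (\<gamma> a)"])
    show "1 / h (\<gamma> a) \<noteq> 0" for a using g(3) by (simp add: zero_iff)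
    fix a b c
    let ?x = "\<gamma> a * \<gamma> b / \<gamma> c"
    have "?x \<noteq> 0" using g(3) by simp
    then have x: "h ?x \<noteq> 0" by (simp only: zero_iff not_False_eq_True)
    have "Umat w a b c = map_mat h (?x \<cdot>\<^sub>m Umat s a b c)"
      by (simp only: map_mat_inv g(4)[symmetric])
    then have "(1 / h ?x) \<cdot>\<^sub>m Umat w a b c = (1 / h ?x) \<cdot>\<^sub>m (h ?x \<cdot>\<^sub>m map_mat h (Umat s a b c))"
      by (simp only: map_mat_smult)
    also have "\<dots> = map_mat h (Umat s a b c)" using x by (simp add: smult_smult_mat smult_1_mat)
    finally show "map_mat h (Umat s a b c) = (1 / h (\<gamma> a) * (1 / h (\<gamma> b)) / (1 / h (\<gamma> c))) \<cdot>\<^sub>m Umat w a b c"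
      by (simp add: mult divide)
  qed (use g in simp_all)
qed

end

text \<open>The hypotheses are symmetric under inversion of \<open>h\<close> (\<open>flip\<close>),
  so lifting from \<open>C\<close> to \<open>D\<close> also works in the other direction. Blocks in
  place of \<open>Fsym\<close> and \<open>Rsym\<close> restrict the equations to the meaningful
  entries.\<close>

locale conjugate_pair = field_auto +
  fixes C D :: "'a::finite mtc"
  assumes fus_eq: "fus D = fus C"
    and Fblk_eq: "Fblk D a b c d e f \<alpha> \<beta> \<mu> \<nu> = h (Fblk C a b c d e f \<alpha> \<beta> \<mu> \<nu>)"
    and Rblk_eq: "Rblk D a b c = map_mat h (Rblk C a b c)"
    and Fblk_cnj: "h (cnj (Fblk C a b c d e f \<alpha> \<beta> \<mu> \<nu>)) = cnj (h (Fblk C a b c d e f \<alpha> \<beta> \<mu> \<nu>))"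
    and Rblk_cnj: "map_mat h (map_mat cnj (Rblk C a b c)) = map_mat cnj (map_mat h (Rblk C a b c))"
    and sysC: "has_system C" and sysD: "has_system D"
begin

lemma flip: "conjugate_pair (inv_into UNIV h) D C"
proof -
  interpret I: field_auto "inv_into UNIV h" by (rule inverse_auto)
  show ?thesis
  proof
    fix a b c d e f \<alpha> \<beta> \<mu> \<nu>
    show "fus C = fus D" by (simp add: fus_eq)
    show "Fblk C a b c d e f \<alpha> \<beta> \<mu> \<nu> = inv_into UNIV h (Fblk D a b c d e f \<alpha> \<beta> \<mu> \<nu>)" by (simp add: Fblk_eq h_inv)
    show "Rblk C a b c = map_mat (inv_into UNIV h) (Rblk D a b c)" by (simp only: Rblk_eq map_mat_inv)
    show "inv_into UNIV h (cnj (Fblk D a b c d e f \<alpha> \<beta> \<mu> \<nu>)) = cnj (inv_into UNIV h (Fblk D a b c d e f \<alpha> \<beta> \<mu> \<nu>))"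
      by (simp only: Fblk_eq Fblk_cnj[symmetric] h_inv)
    show "map_mat (inv_into UNIV h) (map_mat cnj (Rblk D a b c)) = map_mat cnj (map_mat (inv_into UNIV h) (Rblk D a b c))"
      by (simp only: Rblk_eq Rblk_cnj[symmetric] map_mat_inv)
  qed (fact sysC sysD)+
qed

lemma lift:
  assumes s: "is_symmetry C s"
  shows "\<exists>w. is_symmetry D w \<and> conj_rel h s w"
proof -
  \<comment> \<open>\<open>\<sigma>\<close> agrees with \<open>h\<close> on the data, but maps
    \<open>U\<close> to the inverse adjoint of its image under \<open>h\<close>, because the inverse
    of \<open>U\<close> is its adjoint.\<close>
  define \<sigma> where "\<sigma> x = cnj (h (cnj x))" for x
  have \<sigma>: "field_auto \<sigma>"
  proof
    have "bij cnj" by (intro o_bij[of cnj]) auto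
    then have "bij (cnj \<circ> (h \<circ> cnj))" using bij by (intro bij_comp)
    then show "bij \<sigma>" by (simp add: \<sigma>_def[abs_def] comp_def)
  qed (simp_all add: \<sigma>_def add mult one)
  note p = s[unfolded is_symmetry_psym]
  have Kt: "Kconj t = (if t then cnj else (\<lambda>x. x))" for t by (auto simp: Kconj_def)
  have "psym D (anti s) (perm s) (\<lambda>a b c. map_mat h (Umat s a b c)) (\<lambda>a b c. map_mat h (mat_adjoint (Umat s a b c)))"
  proof (rule psym_image[OF p field_auto_axioms fus_eq])
    fix a b c d e f \<alpha> \<beta> \<mu> \<nu>
    show "Fblk D a b c d e f \<alpha> \<beta> \<mu> \<nu> = h (Fblk C a b c d e f \<alpha> \<beta> \<mu> \<nu>)" "Rblk D a b c = map_mat h (Rblk C a b c)"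
      by (fact Fblk_eq Rblk_eq)+
    show "h (Kconj (anti s) (Fblk C a b c d e f \<alpha> \<beta> \<mu> \<nu>)) = Kconj (anti s) (h (Fblk C a b c d e f \<alpha> \<beta> \<mu> \<nu>))"
      by (simp add: Kt Fblk_cnj)
    show "map_mat h (map_mat (Kconj (anti s)) (Rblk C a b c)) = map_mat (Kconj (anti s)) (map_mat h (Rblk C a b c))"
      by (cases "anti s") (auto simp: Kt Rblk_cnj)
  qed
  moreover have "psym D (anti s) (perm s) (\<lambda>a b c. map_mat \<sigma> (Umat s a b c)) (\<lambda>a b c. map_mat \<sigma> (mat_adjoint (Umat s a b c)))"
  proof (rule psym_image[OF p \<sigma> fus_eq])
    fix a b c d e f \<alpha> \<beta> \<mu> \<nu>
    have F: "\<sigma> (Fblk C a b c d e f \<alpha> \<beta> \<mu> \<nu>) = h (Fblk C a b c d e f \<alpha> \<beta> \<mu> \<nu>)"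
      by (simp add: \<sigma>_def Fblk_cnj)
    then show "Fblk D a b c d e f \<alpha> \<beta> \<mu> \<nu> = \<sigma> (Fblk C a b c d e f \<alpha> \<beta> \<mu> \<nu>)" by (simp add: Fblk_eq)
    have \<sigma>m: "map_mat \<sigma> A = map_mat cnj (map_mat h (map_mat cnj A))" for A
      by (intro eq_matI) (simp_all add: \<sigma>_def)
    have cc: "map_mat cnj (map_mat cnj A) = A" for A by (intro eq_matI) simp_all
    have R: "map_mat \<sigma> (Rblk C a b c) = map_mat h (Rblk C a b c)" by (simp only: \<sigma>m Rblk_cnj cc)
    then show "Rblk D a b c = map_mat \<sigma> (Rblk C a b c)" by (simp only: Rblk_eq)
    show "\<sigma> (Kconj (anti s) (Fblk C a b c d e f \<alpha> \<beta> \<mu> \<nu>)) = Kconj (anti s) (\<sigma> (Fblk C a b c d e f \<alpha> \<beta> \<mu> \<nu>))"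
      unfolding F by (auto simp: Kconj_def F) (simp add: \<sigma>_def)
    show "map_mat \<sigma> (map_mat (Kconj (anti s)) (Rblk C a b c)) = map_mat (Kconj (anti s)) (map_mat \<sigma> (Rblk C a b c))"
    proof (cases "anti s")
      case True
      then show ?thesis unfolding R by (simp only: Kt if_True \<sigma>m cc)
    next
      case False
      have "map_mat (\<lambda>x. x) A = A" for A :: "complex mat" by (intro eq_matI) simp_all
      then show ?thesis using False by (simp only: Kt if_False)
    qed
  qed
  then have "psym D (anti s) (perm s) (\<lambda>a b c. mat_adjoint (map_mat h (mat_adjoint (Umat s a b c)))) (\<lambda>a b c. mat_adjoint (map_mat h (Umat s a b c)))"
  proof -
    have "map_mat \<sigma> A = mat_adjoint (map_mat h (mat_adjoint A))" "map_mat \<sigma> (mat_adjoint A) = mat_adjoint (map_mat h A)" for A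
      by (auto intro!: eq_matI simp: \<sigma>_def)
    then show "psym D (anti s) (perm s) (\<lambda>a b c. map_mat \<sigma> (Umat s a b c)) (\<lambda>a b c. map_mat \<sigma> (mat_adjoint (Umat s a b c))) \<Longrightarrow> ?thesis"
      by simp
  qed
  ultimately obtain \<gamma> W where W: "is_symmetry D \<lparr>anti = anti s, perm = perm s, Umat = W\<rparr>" "\<And>a. \<gamma> a \<noteq> 0"
    "\<And>a b c. map_mat h (Umat s a b c) = (\<gamma> a * \<gamma> b / \<gamma> c) \<cdot>\<^sub>m W a b c"
    using psym_polar[OF sysD] by blast
  have "conj_rel h s \<lparr>anti = anti s, perm = perm s, Umat = W\<rparr>"
    by (rule conj_relI[where \<gamma> = \<gamma>]) (simp_all add: W)
  then show ?thesis using W(1) by blast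
qed

definition lft :: "'a sym \<Rightarrow> 'a sym" where
  "lft s = (SOME w. is_symmetry D w \<and> conj_rel h s w)"

lemma lft: "is_symmetry C s \<Longrightarrow> is_symmetry D (lft s)" "is_symmetry C s \<Longrightarrow> conj_rel h s (lft s)"
  unfolding lft_def using someI_ex[OF lift] by blast+

text \<open>The lift is an arbitrary choice, its coset is not: every other lift gives the same one
  by \<open>hm_eq\<close>.\<close>

definition hm :: "'a sym \<Rightarrow> 'a sym set" where
  "hm s = natural_isos D #>\<^bsub>sym_maps D\<^esub> lft s"

lemma hm_eq:
  assumes s: "is_symmetry C s" and w: "is_symmetry D w" "conj_rel h s w"
  shows "hm s = natural_isos D #>\<^bsub>sym_maps D\<^esub> w"
proof -
  interpret Group.group "sym_maps D" by (rule group_sym_maps)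
  obtain \<delta> where d: "\<forall>a. cmod (\<delta> a) = 1" "lft s = scal \<delta> w"
    using conj_rel_unique[OF w lft[OF s]] by blast
  then have "lft s \<in> natural_isos D #>\<^bsub>sym_maps D\<^esub> w" unfolding natural_isos_coset[OF w(1)] by blast
  then show ?thesis unfolding hm_def
    using repr_independence[of "lft s" "natural_isos D" w] w normal_imp_subgroup[OF normal_natural_isos[of D]] by simp
qed

lemma hom_hm: "group_hom (sym_maps C) (symmetry_group D) hm"
proof -
  interpret GC: Group.group "sym_maps C" by (rule group_sym_maps)
  interpret GD: Group.group "sym_maps D" by (rule group_sym_maps)
  interpret normal "natural_isos D" "sym_maps D" by (rule normal_natural_isos)
  interpret Q: Group.group "symmetry_group D" unfolding symmetry_group_def by (rule factorgroup_is_group)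
  show ?thesis
  proof (intro group_hom.intro group_hom_axioms.intro GC.group_axioms Q.group_axioms homI)
    show "hm s \<in> carrier (symmetry_group D)" if "s \<in> carrier (sym_maps C)" for s
      using that lft(1)[of s] by (auto simp: symmetry_group_def FactGroup_def hm_def RCOSETS_def)
    fix s t assume "s \<in> carrier (sym_maps C)" "t \<in> carrier (sym_maps C)"
    then have st: "is_symmetry C s" "is_symmetry C t" by simp_all
    have "hm (sym_comp s t) = natural_isos D #>\<^bsub>sym_maps D\<^esub> sym_comp (lft s) (lft t)"
      using st lft by (intro hm_eq sym_comp_closed conj_rel_comp[OF fus_eq])
    also have "\<dots> = hm s <#>\<^bsub>sym_maps D\<^esub> hm t"
      unfolding hm_def using rcos_sum[of "lft s" "lft t"] lft(1) st by simp
    finally show "hm (s \<otimes>\<^bsub>sym_maps C\<^esub> t) = hm s \<otimes>\<^bsub>symmetry_group D\<^esub> hm t"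
      by (simp add: symmetry_group_def FactGroup_def)
  qed
qed

text \<open>If the lift of \<open>s\<close> is scalar, so is the image of \<open>U\<close> under
  \<open>h\<close>; undoing \<open>h\<close> shows that \<open>U\<close> itself is scalar with
  factors of coboundary form, and unitarity of \<open>s\<close> turns these into phases.\<close>

lemma kernel_hm: "kernel (sym_maps C) (symmetry_group D) hm = natural_isos C"
proof -
  interpret GD: Group.group "sym_maps D" by (rule group_sym_maps)
  have sub: "subgroup (natural_isos D) (sym_maps D)" by (rule normal_imp_subgroup[OF normal_natural_isos])
  have one: "\<one>\<^bsub>symmetry_group D\<^esub> = natural_isos D" by (simp add: symmetry_group_def FactGroup_def)
  show ?thesis
  proof (intro Set.set_eqI iffI)
    fix s assume "s \<in> kernel (sym_maps C) (symmetry_group D) hm"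
    then have s: "is_symmetry C s" and "hm s = natural_isos D" by (simp_all add: kernel_def one)
    moreover have "lft s \<in> hm s" unfolding hm_def using lft(1)[OF s] GD.rcos_self[OF _ sub] by simp
    ultimately obtain \<delta> where d: "lft s = nat_iso D \<delta>" "\<forall>a. cmod (\<delta> a) = 1" by (auto simp: natural_isos_eq)
    obtain \<gamma> where g: "anti (lft s) = anti s" "perm (lft s) = perm s" "\<And>a. \<gamma> a \<noteq> 0"
      "\<And>a b c. map_mat h (Umat s a b c) = (\<gamma> a * \<gamma> b / \<gamma> c) \<cdot>\<^sub>m Umat (lft s) a b c"
      using lft(2)[OF s] unfolding conj_rel_def by blast
    have d0: "\<delta> a \<noteq> 0" for a using d(2) by (metis norm_zero zero_neq_one)
    interpret I: field_auto "inv_into UNIV h" by (rule inverse_auto)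
    have "\<exists>\<epsilon>. (\<forall>a. cmod (\<epsilon> a) = 1) \<and> s = scal \<epsilon> (nat_iso C (\<lambda>_. 1))"
    proof (rule phase_normalise[OF is_symmetry_nat_iso s, where \<rho> = "\<lambda>a. inv_into UNIV h (\<gamma> a * \<delta> a)"])
      show "anti s = anti (nat_iso C (\<lambda>_. 1))" "perm s = perm (nat_iso C (\<lambda>_. 1))"
        using g(1,2) by (simp_all add: d(1) nat_iso_def)
      show "inv_into UNIV h (\<gamma> a * \<delta> a) \<noteq> 0" for a using g(3) d0 by (simp add: I.zero_iff)
      fix a b c
      have "map_mat h (Umat s a b c) = ((\<gamma> a * \<delta> a) * (\<gamma> b * \<delta> b) / (\<gamma> c * \<delta> c)) \<cdot>\<^sub>m 1\<^sub>m (fus C a b c)"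
        unfolding g(4) d(1) by (simp add: nat_iso_def smult_smult_mat fus_eq mult_ac)
      then have "map_mat (inv_into UNIV h) (map_mat h (Umat s a b c)) = map_mat (inv_into UNIV h) (((\<gamma> a * \<delta> a) * (\<gamma> b * \<delta> b) / (\<gamma> c * \<delta> c)) \<cdot>\<^sub>m 1\<^sub>m (fus C a b c))"
        by (rule arg_cong)
      then have "Umat s a b c = inv_into UNIV h ((\<gamma> a * \<delta> a) * (\<gamma> b * \<delta> b) / (\<gamma> c * \<delta> c)) \<cdot>\<^sub>m 1\<^sub>m (fus C a b c)"
        unfolding map_mat_inv I.map_mat_smult I.map_mat_one .
      then show "Umat s a b c = (inv_into UNIV h (\<gamma> a * \<delta> a) * inv_into UNIV h (\<gamma> b * \<delta> b) / inv_into UNIV h (\<gamma> c * \<delta> c)) \<cdot>\<^sub>m Umat (nat_iso C (\<lambda>_. 1)) a b c"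
        by (simp add: nat_iso_def smult_1_mat I.divide I.mult)
    qed simp
    then obtain \<epsilon> where "\<forall>a. cmod (\<epsilon> a) = 1" "s = nat_iso C \<epsilon>" by (auto simp: scal_nat_iso)
    then show "s \<in> natural_isos C" by (auto simp: natural_isos_eq)
  next
    fix s assume "s \<in> natural_isos C"
    then obtain \<gamma> where g: "s = nat_iso C \<gamma>" "\<forall>a. cmod (\<gamma> a) = 1" by (auto simp: natural_isos_eq)
    then have s: "is_symmetry C s" using is_symmetry_nat_iso by blast
    have g0: "\<gamma> a \<noteq> 0" for a using g(2) by (metis norm_zero zero_neq_one)
    have 1: "is_symmetry D (nat_iso D (\<lambda>_. 1))" by (rule is_symmetry_nat_iso) simp
    have "conj_rel h s (nat_iso D (\<lambda>_. 1))"
      by (rule conj_relI[where \<gamma> = "\<lambda>a. h (\<gamma> a)"])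
        (simp_all add: g(1) nat_iso_def g0 zero_iff map_mat_smult map_mat_one mult divide fus_eq smult_1_mat)
    note hm_eq[OF s 1 this]
    moreover have "nat_iso D (\<lambda>_. 1) \<in> natural_isos D" unfolding natural_isos_eq by fastforce
    ultimately have "hm s = natural_isos D"
      using 1 GD.coset_join2[OF _ sub, of "nat_iso D (\<lambda>_. 1)"] by simp
    then show "s \<in> kernel (sym_maps C) (symmetry_group D) hm" using s by (simp add: kernel_def one)
  qed
qed

text \<open>Lifting along the inverse of \<open>h\<close> from \<open>D\<close> to \<open>C\<close>
  produces a preimage, because \<open>conj_rel\<close> can be turned around.\<close>

lemma surj_hm: "hm ` carrier (sym_maps C) = carrier (symmetry_group D)"
proof
  interpret group_hom "sym_maps C" "symmetry_group D" hm by (rule hom_hm)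
  show "hm ` carrier (sym_maps C) \<subseteq> carrier (symmetry_group D)" by auto
  show "carrier (symmetry_group D) \<subseteq> hm ` carrier (sym_maps C)"
  proof
    fix A assume "A \<in> carrier (symmetry_group D)"
    then obtain w where w: "is_symmetry D w" "A = natural_isos D #>\<^bsub>sym_maps D\<^esub> w"
      by (auto simp: symmetry_group_def FactGroup_def RCOSETS_def)
    obtain s where s: "is_symmetry C s" "conj_rel (inv_into UNIV h) w s"
      using conjugate_pair.lift[OF flip w(1)] by blast
    then have "A = hm s" using hm_eq[OF s(1) w(1) conj_rel_flip[OF s(2)]] w(2) by simp
    then show "A \<in> hm ` carrier (sym_maps C)" using s(1) by simp
  qed
qed

text \<open>The first isomorphism theorem for \<open>hm\<close>. Lifts keep \<open>anti\<close>, and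
  natural isomorphisms have \<open>anti = False\<close>, so the type is constant on cosets on both
  sides.\<close>

theorem isomorphic_symmetries: "isomorphic_symmetries C D"
proof -
  interpret group_hom "sym_maps C" "symmetry_group D" hm by (rule hom_hm)
  let ?\<phi> = "\<lambda>A. the_elem (hm ` A)"
  have "?\<phi> \<in> iso (symmetry_group C) (symmetry_group D)"
    using FactGroup_iso_set[OF surj_hm] unfolding kernel_hm unfolding symmetry_group_def .
  moreover have "anti t = anti s" if A: "A \<in> carrier (symmetry_group C)" and s: "s \<in> A" and t: "t \<in> ?\<phi> A" for A s t
  proof -
    obtain s0 where s0: "is_symmetry C s0" "A = natural_isos C #>\<^bsub>sym_maps C\<^esub> s0"
      using A by (auto simp: symmetry_group_def FactGroup_def RCOSETS_def)
    have hs0: "hm x = hm s0" "anti x = anti s0" if x: "x \<in> A" for x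
    proof -
      obtain n where n: "n \<in> natural_isos C" "x = n \<otimes>\<^bsub>sym_maps C\<^esub> s0"
        using x[unfolded s0(2) r_coset_def] by blast
      have "n \<in> kernel (sym_maps C) (symmetry_group D) hm" unfolding kernel_hm by (rule n(1))
      then have n': "n \<in> carrier (sym_maps C)" "hm n = \<one>\<^bsub>symmetry_group D\<^esub>"
        unfolding kernel_def by blast+
      have s0': "s0 \<in> carrier (sym_maps C)" using s0(1) by simp
      show "hm x = hm s0"
        unfolding n(2) hom_mult[OF n'(1) s0'] n'(2) by (rule H.l_one[OF hom_closed[OF s0']])
      show "anti x = anti s0" using n by (auto simp: natural_isos_eq sym_comp_def nat_iso_def)
    qed
    have "hm ` A = {hm s0}" using s hs0(1) by blast
    then have "t \<in> hm s0" using t by simp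
    then have "anti t = anti (lft s0)" unfolding hm_def natural_isos_coset[OF lft(1)[OF s0(1)]] by auto
    also have "\<dots> = anti s0" by (rule conjunct1[OF lft(2)[OF s0(1), unfolded conj_rel_def]])
    also have "\<dots> = anti s" by (rule hs0(2)[OF s, symmetric])
    finally show ?thesis .
  qed
  ultimately show ?thesis unfolding isomorphic_symmetries_def by (intro bexI[of _ ?\<phi>] ballI)
qed

end

theorem theorem4p2:
  fixes C :: "'a::finite mtc"
    and L :: "complex set"
    and q :: "complex \<Rightarrow> complex"
  assumes "modular_tensor_category C"
    and "CM_field L"
    and "FR_entries C \<subseteq> L"
    and "q \<in> Gal_rat (K_of C)"
  shows "isomorphic_symmetries C (galois_conj q C)"
proof -
  define D where "D = galois_conj q C"
  obtain h where h: "field_auto h" and hq: "\<And>z. z \<in> FR_entries C \<Longrightarrow> h z = q z"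
    and hc: "\<And>z. z \<in> FR_entries C \<Longrightarrow> h (cnj z) = cnj (h z)"
    by (rule galois_extension[OF assms(2-4)]) blast
  interpret field_auto h by fact
  have F_FR: "Fsym C a b c d (e,\<alpha>,\<beta>) (f,\<mu>,\<nu>) \<in> FR_entries C"
    if "\<alpha> < fus C a b e" "\<beta> < fus C e c d" "\<mu> < fus C b c f" "\<nu> < fus C a f d" for a b c d e \<alpha> \<beta> f \<mu> \<nu>
    unfolding FR_entries_def left_ix_def right_ix_def using that by blast
  have R_FR: "Rsym C a b c $$ (\<mu>,\<nu>) \<in> FR_entries C" if "\<mu> < fus C b a c" "\<nu> < fus C a b c" for a b c \<mu> \<nu>
    unfolding FR_entries_def using that by blast
  have fus: "fus D = fus C" and unit: "unit_obj D = unit_obj C" and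
    FD: "Fsym D a b c d i k = q (Fsym C a b c d i k)" and RD: "Rsym D a b c = map_mat q (Rsym C a b c)" for a b c d i k
    by (simp_all add: D_def galois_conj_def)
  have Rc: "Rsym C a b c \<in> carrier_mat (fus C b a c) (fus C a b c)" for a b c
    using assms(1) by (simp add: modular_tensor_category_def braided_def)
  have sys: "has_system C"
    using assms(1) has_systemI unfolding modular_tensor_category_def by blast
  have "conjugate_pair h C D"
  proof
    fix a b c d e f \<alpha> \<beta> \<mu> \<nu>
    show "fus D = fus C" by (fact fus)
    show "has_system C" by (fact sys)
    \<comment> \<open>Rigidity is applied to \<open>D\<close>. Its axioms are inherited from
      \<open>C\<close> through \<open>h\<close>, which agrees with \<open>q\<close> on all
      meaningful entries.\<close>
    show "has_system D" by (rule has_system_image[OF sys unit fus]) (simp add: FD hq[OF F_FR])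
    show "Fblk D a b c d e f \<alpha> \<beta> \<mu> \<nu> = h (Fblk C a b c d e f \<alpha> \<beta> \<mu> \<nu>)"
      by (simp add: Fblk_def fus FD hq[OF F_FR] zero)
    show "h (cnj (Fblk C a b c d e f \<alpha> \<beta> \<mu> \<nu>)) = cnj (h (Fblk C a b c d e f \<alpha> \<beta> \<mu> \<nu>))"
      by (simp add: Fblk_def hc[OF F_FR] zero)
    show "Rblk D a b c = map_mat h (Rblk C a b c)"
      using Rc[of a b c] by (intro eq_matI) (simp_all add: Rblk_def fus RD hq[OF R_FR])
    show "map_mat h (map_mat cnj (Rblk C a b c)) = map_mat cnj (map_mat h (Rblk C a b c))"
      by (intro eq_matI) (simp_all add: Rblk_def hc[OF R_FR])
  qed
  then show ?thesis unfolding D_def by (rule conjugate_pair.isomorphic_symmetries)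
qed

end
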